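(* Let $d\ge1$, $T>0$ and $(z_0,s_0)\in\mathbb{H}^d$. For each $n\ge1$ let $(Y_n(m))_{m\in\mathbb{N}}$ be a discrete-time Markov chain on $\mathbb{H}^d$ with $Y_n(0)=(z_0,s_0)$ and transition function $$P_n((z,s),B)=\frac{1}{(2\pi)^d}\int_{\mathbb{R}^{2d}}e^{-|\zeta|^2/2}\,\chi_B\Big(z+\tfrac{1}{\sqrt n}\zeta,\;s+\tfrac{1}{\sqrt n}\,z\cdot_\sigma\zeta\Big)\,\mathrm{d}^{2d}\zeta,\qquad B\in\mathcal{B}(\mathbb{H}^d),$$ and let $X_n(t):=Y_n(\lfloor nt\rfloor)$, $t\ge0$. Let $Z_n$ be the process with continuous sample paths obtained from $X_n$ by interpolation with geodesic arcs: $Z_n(0)=(z_0,s_0)$, $Z_n(m/n)=X_n(m/n)$ for $m\in\mathbb{N}$, and $$Z_n(t)=\gamma_{X_n(m/n),X_n((m+1)/n)}(t-m/n),\qquad t\in[m/n,(m+1)/n],$$ where $\gamma_{x,y}$ denotes an arbitrary shortest geodesic in $\mathbb{H}^d$ with $\gamma_{x,y}(0)=x$ and $\gamma_{x,y}(1/n)=y$. Let $X$ be the Feller process (with continuous sample paths) started at $(z_0,s_0)$ associated with the Feller semigroup $(V(t))_{t\ge0}$, $V(t)=e^{\frac{t}{2}L}$, on $C_0(\mathbb{H}^d)$, i.e. the Brownian motion on $\mathbb{H}^d$. Then $Z_n$ converges in distribution to $X$ on $C_{\mathbb{H}^d}[0,T]$; equivalently, the laws $\mu_{Z_n}$ of $Z_n$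 on the Borel sets of $C_{\mathbb{H}^d}[0,T]$ converge weakly to the law $\mu_X$ of $X$.
   Context: The Heisenberg group is $\mathbb{H}^d=\mathbb{R}^{2d}\times\mathbb{R}$ with points $(z,s)=(x,y,s)$, $x,y\in\mathbb{R}^d$, $s\in\mathbb{R}$, and group law $(x,y,s)\cdot(x',y',s')=(x+x',y+y',s+s'+x'y-xy')$. For $z=(x,y)$ and $z'=(x',y')$ in $\mathbb{R}^{2d}$, $z\cdot_\sigma z':=x'y-xy'$ (Euclidean scalar products in $\mathbb{R}^d$). $\chi_B$ is the indicator function of $B$, $\mathcal{B}(\mathbb{H}^d)$ the Borel $\sigma$-algebra, and a transition function $P$ of a chain $Y$ means $\mathbb{P}(Y(m+1)\in B\mid\mathcal{F}_m^Y)=P(Y(m),B)$ with $\mathcal{F}^Y$ the filtration generated by $Y$. Let $X_i=\partial_{x^i}+y^i\partial_s$, $Y_i=\partial_{y^i}-x^i\partial_s$, $i=1,\dots,d$ (vector fields, not to be confused with the processes). An absolutely continuous curve $\gamma:[a,b]\to\mathbb{H}^d$ is horizontal if there are $u_1,\dots,u_{2d}\in L^1[a,b]$ with $\gamma'(t)=\sum_{i=1}^d(u_i(t)X_i(\gamma(t))+u_{i+d}(t)Y_i(\gamma(t)))$ for a.e. $t$; its length is $\int_a^b|u(t)|\,\mathrm{d}t$ with $|\cdot|$ Euclidean. The Carnot–Carathéodory distance $d_{\mathbb{H}}(x,y)$ is the infimum of lengths of horizontal curves joining $x$ to $y$; it is a distance inducing the Euclidean topology. Shortest geodesics are length-minimizing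 horizontal curves for $d_{\mathbb{H}}$. The $Z_n$ are understood to be stochastic processes (i.e. random variables with values in the path space). $C_0(\mathbb{H}^d)$ is the space of continuous functions vanishing at infinity. $\frac{L}{2}$ denotes the generator of the Feller semigroup of horizontal Brownian motion: $(V(t)f)(\xi)=\mathbb{E}[f(\xi\cdot W(t))]$, where $W(t)=(B^1(t),B^2(t),A(t))$, $B^1=(B^1_1,\dots,B^1_d)$ and $B^2=(B^2_1,\dots,B^2_d)$ are independent standard Brownian motions in $\mathbb{R}^d$ started at $0$ (giving the $x$- and $y$-components), $A(t)=\sum_{j=1}^d\int_0^tB^2_j(r)\,\mathrm{d}B^1_j(r)-B^1_j(r)\,\mathrm{d}B^2_j(r)$ (Itô integrals). $L$ coincides with $\sum_{i=1}^d(X_i^2+Y_i^2)$ on $C_c^\infty(\mathbb{H}^d)$, which is a core for $L$. The process $X$ started at $\xi$ has the law of $\xi\cdot W(t)$. $C_{\mathbb{H}^d}[0,T]$ is the space of continuous paths $[0,T]\to\mathbb{H}^d$ with the topology of uniform convergence with respect to $d_{\mathbb{H}}$. *)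

theory Defs
  imports "HOL-Probability.Probability"
begin

text \<open>Points are written \<open>(z, s)\<close> with \<open>z = (x, y)\<close>; the dimension \<open>d \<ge> 1\<close> is \<open>CARD('d)\<close>.\<close>

type_synonym 'd plane = "(real ^ 'd) \<times> (real ^ 'd)"
type_synonym 'd heis = "'d plane \<times> real"

definition symp :: "'d::finite plane \<Rightarrow> 'd plane \<Rightarrow> real" where
  "symp z z' = fst z' \<bullet> snd z - fst z \<bullet> snd z'"

definition heis_mult :: "'d::finite heis \<Rightarrow> 'd heis \<Rightarrow> 'd heis" where
  "heis_mult p q = (fst p + fst q, snd p + snd q + symp (fst p) (fst q))"

definition heis_X :: "'d::finite \<Rightarrow> 'd heis \<Rightarrow> 'd heis" where
  "heis_X i = (\<lambda>((x, y), s). ((axis i 1, 0), y $ i))"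

definition heis_Y :: "'d::finite \<Rightarrow> 'd heis \<Rightarrow> 'd heis" where
  "heis_Y i = (\<lambda>((x, y), s). ((0, axis i 1), - (x $ i)))"

definition abs_continuous_curve :: "real \<Rightarrow> real \<Rightarrow> (real \<Rightarrow> 'a::real_normed_vector) \<Rightarrow> bool" where
  "abs_continuous_curve a b \<gamma> \<longleftrightarrow>
    (\<forall>\<epsilon>>0. \<exists>\<delta>>0. \<forall>D :: (real \<times> real) set.
       finite D \<and> (\<forall>(p, q)\<in>D. a \<le> p \<and> p \<le> q \<and> q \<le> b) \<and>
       disjoint_family_on (\<lambda>(p, q). {p<..<q}) D \<and> (\<Sum>(p, q)\<in>D. q - p) < \<delta>
       \<longrightarrow> (\<Sum>(p, q)\<in>D. norm (\<gamma> q - \<gamma> p)) < \<epsilon>)"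

text \<open>The control \<open>u\<close> collects \<open>u\<^sub>1, \<dots>, u\<^sub>d\<close> in its first and
  \<open>u\<^bsub>d+1\<^esub>, \<dots>, u\<^bsub>2d\<^esub>\<close> in its second component. It is determined by \<open>\<gamma>\<close> up to a null set,
  so the length of \<open>\<gamma>\<close> can be computed from any admissible \<open>u\<close>.\<close>

definition horizontal_curve ::
  "real \<Rightarrow> real \<Rightarrow> (real \<Rightarrow> 'd::finite heis) \<Rightarrow> (real \<Rightarrow> 'd plane) \<Rightarrow> bool" where
  "horizontal_curve a b \<gamma> u \<longleftrightarrow>
    abs_continuous_curve a b \<gamma> \<and> u absolutely_integrable_on {a..b} \<and>
    (AE t in lebesgue. t \<in> {a..b} \<longrightarrow>
      (\<gamma> has_vector_derivative
        (\<Sum>i\<in>UNIV. (fst (u t) $ i) *\<^sub>R heis_X i (\<gamma> t) + (snd (u t) $ i) *\<^sub>R heis_Y i (\<gamma> t)))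
        (at t within {a..b}))"

definition control_length :: "real \<Rightarrow> real \<Rightarrow> (real \<Rightarrow> 'd::finite plane) \<Rightarrow> real" where
  "control_length a b u = integral {a..b} (\<lambda>t. norm (u t))"

definition cc_dist :: "'d::finite heis \<Rightarrow> 'd heis \<Rightarrow> real" where
  "cc_dist p q =
    Inf {control_length a b u | a b \<gamma> u. a < b \<and> horizontal_curve a b \<gamma> u \<and> \<gamma> a = p \<and> \<gamma> b = q}"

text \<open>No constant-speed parametrization is required.\<close>

definition shortest_geodesic ::
  "real \<Rightarrow> real \<Rightarrow> 'd::finite heis \<Rightarrow> 'd heis \<Rightarrow> (real \<Rightarrow> 'd heis) \<Rightarrow> bool" where
  "shortest_geodesic a b p q \<gamma> \<longleftrightarrow> \<gamma> a = p \<and> \<gamma> b = q \<and>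
    (\<exists>u. horizontal_curve a b \<gamma> u \<and> control_length a b u = cc_dist p q)"

text \<open>\<open>metric\<close> is the abstraction function of a type, meaningful here because \<open>cc_dist\<close> is a
  distance (any two points are joined by a horizontal curve).\<close>

definition heis_metric :: "'d::finite heis metric" where
  "heis_metric = metric (UNIV, cc_dist)"

text \<open>Continuous paths on \<open>[0,T]\<close> with the supremum distance; paths are \<open>extensional\<close>,
  so a process is turned into a random path by restricting its time parameter.\<close>

definition heis_paths :: "real \<Rightarrow> (real \<Rightarrow> 'd::finite heis) metric" where
  "heis_paths T = cfunspace (top_of_set {0..T}) heis_metric"

definition borel_of_topology :: "'a topology \<Rightarrow> 'a measure" where
  "borel_of_topology S = sigma (topspace S) {U. openin S U}"

definition path_borel :: "real \<Rightarrow> (real \<Rightarrow> 'd::finite heis) measure" where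
  "path_borel T = borel_of_topology (mtopology_of (heis_paths T))"

definition path_of :: "real \<Rightarrow> (real \<Rightarrow> 'w \<Rightarrow> 'a) \<Rightarrow> 'w \<Rightarrow> real \<Rightarrow> 'a" where
  "path_of T Z \<omega> = (\<lambda>t\<in>{0..T}. Z t \<omega>)"

definition weakly_convergent_to :: "'a topology \<Rightarrow> (nat \<Rightarrow> 'a measure) \<Rightarrow> 'a measure \<Rightarrow> bool" where
  "weakly_convergent_to S \<mu> \<nu> \<longleftrightarrow>
    (\<forall>f :: 'a \<Rightarrow> real. continuous_map S euclidean f \<and> bounded (f ` topspace S) \<longrightarrow>
      (\<lambda>n. \<integral>x. f x \<partial>\<mu> n) \<longlonglongrightarrow> (\<integral>x. f x \<partial>\<nu>))"

definition natural_filtration ::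
  "'w measure \<Rightarrow> ('t::{linorder, zero} \<Rightarrow> 'w \<Rightarrow> 'a::topological_space) \<Rightarrow> 't \<Rightarrow> 'w measure" where
  "natural_filtration M X t =
    sigma (space M) {X r -` A \<inter> space M | r A. r \<in> {0..t} \<and> A \<in> sets borel}"

definition markov_chain ::
  "'w measure \<Rightarrow> (nat \<Rightarrow> 'w \<Rightarrow> 'a::topological_space) \<Rightarrow> ('a \<Rightarrow> 'a set \<Rightarrow> real) \<Rightarrow> bool" where
  "markov_chain M Y P \<longleftrightarrow> prob_space M \<and> (\<forall>m. Y m \<in> borel_measurable M) \<and>
    (\<forall>m. \<forall>B\<in>sets borel. AE \<omega> in M.
       real_cond_exp M (natural_filtration M Y m) (\<lambda>\<omega>. indicator B (Y (Suc m) \<omega>)) \<omega> = P (Y m \<omega>) B)"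

definition heis_kernel :: "nat \<Rightarrow> 'd::finite heis \<Rightarrow> 'd heis set \<Rightarrow> real" where
  "heis_kernel n p B = 1 / (2 * pi) ^ CARD('d) *
    (\<integral>\<zeta>. exp (- (norm \<zeta>)\<^sup>2 / 2) *
       indicator B (fst p + (1 / sqrt (real n)) *\<^sub>R \<zeta>,
                    snd p + 1 / sqrt (real n) * symp (fst p) \<zeta>) \<partial>lborel)"

definition rescaled_chain :: "nat \<Rightarrow> (nat \<Rightarrow> 'w \<Rightarrow> 'a) \<Rightarrow> real \<Rightarrow> 'w \<Rightarrow> 'a" where
  "rescaled_chain n Y t = Y (nat \<lfloor>real n * t\<rfloor>)"

definition geodesic_interpolation ::
  "nat \<Rightarrow> (real \<Rightarrow> 'd::finite heis) \<Rightarrow> (real \<Rightarrow> 'd heis) \<Rightarrow> bool" where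
  "geodesic_interpolation n x z \<longleftrightarrow>
    (\<forall>m::nat. z (real m / real n) = x (real m / real n) \<and>
      (\<exists>\<gamma>. shortest_geodesic 0 (1 / real n)
               (x (real m / real n)) (x (real (Suc m) / real n)) \<gamma> \<and>
           (\<forall>t\<in>{real m / real n..real (Suc m) / real n}. z t = \<gamma> (t - real m / real n))))"

definition brownian_motion ::
  "'w measure \<Rightarrow> (real \<Rightarrow> 'w \<Rightarrow> 'a::euclidean_space) \<Rightarrow> bool" where
  "brownian_motion M B \<longleftrightarrow> prob_space M \<and>
    (\<forall>t\<ge>0. B t \<in> borel_measurable M) \<and>
    (AE \<omega> in M. B 0 \<omega> = 0) \<and>
    (AE \<omega> in M. continuous_on {0..} (\<lambda>t. B t \<omega>)) \<and>
    (\<forall>s t. 0 \<le> s \<and> s < t \<longrightarrow>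
      distributed M lborel (\<lambda>\<omega>. B t \<omega> - B s \<omega>)
        (\<lambda>x. ennreal (exp (- (norm x)\<^sup>2 / (2 * (t - s))) / sqrt (2 * pi * (t - s)) ^ DIM('a)))) \<and>
    (\<forall>(\<tau> :: nat \<Rightarrow> real) n. 0 \<le> \<tau> 0 \<and> mono \<tau> \<longrightarrow>
      prob_space.indep_vars M (\<lambda>_. borel) (\<lambda>i \<omega>. B (\<tau> (Suc i)) \<omega> - B (\<tau> i) \<omega>) {..<n})"

text \<open>A simple integrand on \<open>[0,t]\<close> is \<open>\<Sum>i<N. h i \<cdot> 1\<^bsub>(\<tau> i, \<tau> (i+1)]\<^esub>\<close> with
  \<open>h i\<close> square integrable and measurable at time \<open>\<tau> i\<close>.\<close>

definition simple_integrand ::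
  "'w measure \<Rightarrow> (real \<Rightarrow> 'w measure) \<Rightarrow> real \<Rightarrow> nat \<Rightarrow> (nat \<Rightarrow> real) \<Rightarrow> (nat \<Rightarrow> 'w \<Rightarrow> real) \<Rightarrow> bool" where
  "simple_integrand M F t N \<tau> h \<longleftrightarrow> 0 \<le> \<tau> 0 \<and> \<tau> N \<le> t \<and>
    (\<forall>i<N. \<tau> i \<le> \<tau> (Suc i) \<and> h i \<in> borel_measurable (F (\<tau> i)) \<and>
       integrable M (\<lambda>\<omega>. (h i \<omega>)\<^sup>2))"

definition simple_value :: "nat \<Rightarrow> (nat \<Rightarrow> real) \<Rightarrow> (nat \<Rightarrow> 'w \<Rightarrow> real) \<Rightarrow> real \<Rightarrow> 'w \<Rightarrow> real" where
  "simple_value N \<tau> h r \<omega> = (\<Sum>i<N. h i \<omega> * indicator {\<tau> i<..\<tau> (Suc i)} r)"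

definition simple_integral ::
  "(real \<Rightarrow> 'w \<Rightarrow> real) \<Rightarrow> nat \<Rightarrow> (nat \<Rightarrow> real) \<Rightarrow> (nat \<Rightarrow> 'w \<Rightarrow> real) \<Rightarrow> 'w \<Rightarrow> real" where
  "simple_integral B N \<tau> h \<omega> = (\<Sum>i<N. h i \<omega> * (B (\<tau> (Suc i)) \<omega> - B (\<tau> i) \<omega>))"

text \<open>\<open>I\<close> is a version of the Ito integral of \<open>H\<close> against the Brownian motion \<open>B\<close> over \<open>[0,t]\<close>,
  for the filtration \<open>F\<close>: the mean-square limit of the integrals of simple integrands that
  converge to \<open>H\<close> in mean square over \<open>[0,t]\<close> times the probability space.\<close>

definition has_ito_integral ::
  "'w measure \<Rightarrow> (real \<Rightarrow> 'w measure) \<Rightarrow> (real \<Rightarrow> 'w \<Rightarrow> real) \<Rightarrow> real \<Rightarrow>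
   (real \<Rightarrow> 'w \<Rightarrow> real) \<Rightarrow> ('w \<Rightarrow> real) \<Rightarrow> bool" where
  "has_ito_integral M F B t H I \<longleftrightarrow> I \<in> borel_measurable M \<and>
    (\<exists>N \<tau> h. (\<forall>k. simple_integrand M F t (N k) (\<tau> k) (h k)) \<and>
      (\<lambda>k. \<integral>\<^sup>+\<omega>. (\<integral>\<^sup>+r\<in>{0..t}.
          ennreal ((H r \<omega> - simple_value (N k) (\<tau> k) (h k) r \<omega>)\<^sup>2) \<partial>lborel) \<partial>M) \<longlonglongrightarrow> 0 \<and>
      (\<lambda>k. \<integral>\<^sup>+\<omega>. ennreal ((I \<omega> - simple_integral B (N k) (\<tau> k) (h k) \<omega>)\<^sup>2) \<partial>M) \<longlonglongrightarrow> 0)"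

definition horizontal_brownian_motion ::
  "'w measure \<Rightarrow> (real \<Rightarrow> 'w \<Rightarrow> 'd::finite heis) \<Rightarrow> bool" where
  "horizontal_brownian_motion M W \<longleftrightarrow>
    (\<exists>B1 B2 A. W = (\<lambda>t \<omega>. ((B1 t \<omega>, B2 t \<omega>), A t \<omega>)) \<and>
      brownian_motion M B1 \<and> brownian_motion M B2 \<and>
      prob_space.indep_var M
        (PiM {0..} (\<lambda>_. borel)) (\<lambda>\<omega>. \<lambda>t\<in>{0..}. B1 t \<omega>)
        (PiM {0..} (\<lambda>_. borel)) (\<lambda>\<omega>. \<lambda>t\<in>{0..}. B2 t \<omega>) \<and>
      (\<forall>t\<ge>0. A t \<in> borel_measurable M \<and>
        (\<exists>I J. (\<forall>j.
            has_ito_integral M (natural_filtration M (\<lambda>r \<omega>. (B1 r \<omega>, B2 r \<omega>)))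
              (\<lambda>r \<omega>. B1 r \<omega> $ j) t (\<lambda>r \<omega>. B2 r \<omega> $ j) (I j) \<and>
            has_ito_integral M (natural_filtration M (\<lambda>r \<omega>. (B1 r \<omega>, B2 r \<omega>)))
              (\<lambda>r \<omega>. B2 r \<omega> $ j) t (\<lambda>r \<omega>. B1 r \<omega> $ j) (J j)) \<and>
          (AE \<omega> in M. A t \<omega> = (\<Sum>j\<in>UNIV. I j \<omega> - J j \<omega>)))))"

text \<open>The semigroup with generator \<open>L/2\<close>, \<open>L = \<Sum>i. X\<^sub>i\<^sup>2 + Y\<^sub>i\<^sup>2\<close>, when \<open>W\<close> is a horizontal
  Brownian motion; it depends only on the law of \<open>W\<close>.\<close>

definition heis_semigroup ::
  "'w measure \<Rightarrow> (real \<Rightarrow> 'w \<Rightarrow> 'd::finite heis) \<Rightarrow> real \<Rightarrow> ('d heis \<Rightarrow> real) \<Rightarrow> 'd heis \<Rightarrow> real" where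
  "heis_semigroup M W t f \<xi> = (\<integral>\<omega>. f (heis_mult \<xi> (W t \<omega>)) \<partial>M)"

definition C0_functions :: "('a::real_normed_vector \<Rightarrow> real) set" where
  "C0_functions = {f. continuous_on UNIV f \<and> (f \<longlongrightarrow> 0) at_infinity}"

definition feller_process ::
  "'w measure \<Rightarrow> (real \<Rightarrow> 'w \<Rightarrow> 'a::real_normed_vector) \<Rightarrow>
   (real \<Rightarrow> ('a \<Rightarrow> real) \<Rightarrow> 'a \<Rightarrow> real) \<Rightarrow> bool" where
  "feller_process M X V \<longleftrightarrow> prob_space M \<and> (\<forall>t\<ge>0. X t \<in> borel_measurable M) \<and>
    (\<forall>f\<in>C0_functions. \<forall>s\<ge>0. \<forall>t\<ge>0. AE \<omega> in M.
       real_cond_exp M (natural_filtration M X s) (\<lambda>\<omega>. f (X (s + t) \<omega>)) \<omega> = V t f (X s \<omega>))"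

end

theory Submission
  imports Defs
begin

text \<open>The transition function of the chain is right multiplication by the horizontal Gaussian step
  \<open>(\<zeta> / sqrt n, 0)\<close>, since \<open>(z, s) (\<zeta> / sqrt n, 0) = (z + \<zeta> / sqrt n, s + symp z \<zeta> / sqrt n)\<close>.
  So the chain is a random walk on the group: its left increments \<open>(- Y m) (Y (m + j))\<close> are independent
  of the past, with the law of a product of \<open>j\<close> independent steps (\<open>markov_chain_increments\<close>). In the
  same way the left increment of the Feller process over a time \<open>t\<close> is independent of the past and has the
  law of \<open>W t\<close> (\<open>feller_increment\<close>). The distance is invariant under left translations, so everything
  is decided by the laws of increments.

  These laws are compared on the probability space of the horizontal Brownian motion \<open>W = (B, A)\<close>. The
  walk built there from the increments of \<open>B\<close> over the grid of mesh \<open>1 / n\<close> has the law of the chain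
  started at the origin. Its planar part is \<open>B\<close> on the grid, and its height is the difference of the
  Riemann sums of the two Ito integrals that make up the area \<open>A\<close>. By the Ito isometry these sums converge
  in mean square (\<open>ito_integral_riemann_sum\<close>), so the walk at step \<open>m\<close> tends to \<open>W t\<close> in mean when
  \<open>m / n\<close> tends to \<open>t\<close>. Taking independent copies for the successive blocks of time gives the
  convergence of the finite-dimensional distributions (\<open>grid_positions_converge\<close>).

  What replaces tightness is a bound of order \<open>(m / n)\<^sup>2\<close> for the fourth moment of the distance that the
  walk covers in \<open>m\<close> steps (\<open>bm_walk_tail\<close>). It rests on the comparison of the distance with the
  homogeneous gauge: \<open>\<bar>z\<bar> \<le> d(0, (z, s))\<close> and \<open>\<bar>s\<bar> \<le> d(0, (z, s))\<^sup>2\<close>, and conversely the distance is at most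
  \<open>\<bar>z\<bar> + 4 sqrt (\<bar>s\<bar> / 2)\<close>. Ottaviani's inequality (\<open>markov_chain_maximal\<close>) turns the moment bound into
  a bound for the probability that the chain moves far within a given block of length \<open>T / k\<close>. Summed over
  the \<open>k\<close> blocks it is of order \<open>1 / k\<close>, uniformly in large \<open>n\<close>.

  Weak convergence is tested on bounded Lipschitz functions of the path (\<open>weakly_convergent_to_lipschitzI\<close>).
  Outside the exceptional event, the geodesic interpolation is uniformly close to the piecewise linear
  path through the positions of the chain at the times \<open>i T / k\<close> (\<open>path_distance\<close>): a geodesic arc does
  not leave the ball around its starting point that has its end on the boundary, and a linear segment stays within
  a fixed multiple of the distance of its ends. The piecewise linear path is a continuous function of
  finitely many positions, so its law converges; and the piecewise linear paths through the positions of \<open>X\<close>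
  converge uniformly to \<open>X\<close> as \<open>k\<close> grows, because the paths of \<open>X\<close> are continuous.\<close>

section \<open>Algebra of the Heisenberg group\<close>

lemma symp_add_left: "symp (z + z') w = symp z w + symp z' w"
  and symp_add_right: "symp w (z + z') = symp w z + symp w z'"
  and symp_diff_left: "symp (z - z') w = symp z w - symp z' w"
  and symp_diff_right: "symp w (z - z') = symp w z - symp w z'"
  and symp_minus_left: "symp (- z) w = - symp z w"
  and symp_minus_right: "symp w (- z) = - symp w z"
  and symp_scaleR_left: "symp (c *\<^sub>R z) w = c * symp z w"
  and symp_scaleR_right: "symp w (c *\<^sub>R z) = c * symp w z"
  and symp_zero_left [simp]: "symp 0 w = 0"
  and symp_zero_right [simp]: "symp w 0 = 0"
  and symp_self [simp]: "symp z z = 0"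
  by (auto simp: symp_def inner_simps algebra_simps inner_commute)

lemmas symp_simps = symp_add_left symp_add_right symp_diff_left symp_diff_right
  symp_minus_left symp_minus_right symp_scaleR_left symp_scaleR_right

lemma symp_flip: "symp z w = - symp w z"
  by (simp add: symp_def inner_commute)

lemma abs_symp_le: "\<bar>symp z w\<bar> \<le> norm z * norm w"
proof -
  have "symp z w = z \<bullet> (- snd w, fst w)"
    by (cases z; cases w) (simp add: symp_def inner_prod_def inner_commute)
  then have "\<bar>symp z w\<bar> \<le> norm z * norm (- snd w, fst w)"
    by (simp add: Cauchy_Schwarz_ineq2)
  also have "norm (- snd w, fst w) = norm w"
    by (cases w) (simp add: norm_Pair add.commute)
  finally show ?thesis .
qed

lemma bounded_linear_symp_right: "bounded_linear (symp z)"
  by (rule bounded_linear_intro[where K = "norm z"])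
     (auto simp: symp_simps mult.commute intro: order_trans[OF abs_symp_le])

lemma continuous_on_symp [continuous_intros]:
  "continuous_on S f \<Longrightarrow> continuous_on S g \<Longrightarrow> continuous_on S (\<lambda>x. symp (f x) (g x))"
  unfolding symp_def by (intro continuous_intros)

lemma heis_mult_assoc: "heis_mult (heis_mult p q) r = heis_mult p (heis_mult q r)"
  by (simp add: heis_mult_def symp_simps algebra_simps)

text \<open>Since \<open>symp z z = 0\<close>, the group inverse is the negative.\<close>

lemma heis_mult_zero_left [simp]: "heis_mult 0 q = q"
  and heis_mult_zero_right [simp]: "heis_mult q 0 = q"
  and heis_mult_uminus_left [simp]: "heis_mult (- q) q = 0"
  and heis_mult_uminus_right [simp]: "heis_mult q (- q) = 0"
  by (simp_all add: heis_mult_def symp_simps prod_eq_iff)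

lemma heis_mult_uminus_cancel [simp]:
  "heis_mult (- p) (heis_mult p q) = q" "heis_mult p (heis_mult (- p) q) = q"
  by (simp_all flip: heis_mult_assoc)

lemma continuous_on_heis_mult [continuous_intros]:
  "continuous_on S f \<Longrightarrow> continuous_on S g \<Longrightarrow> continuous_on S (\<lambda>x. heis_mult (f x) (g x))"
  unfolding heis_mult_def by (intro continuous_intros)

section \<open>Absolutely continuous curves\<close>

text \<open>Absolute continuity is stated for finite sets of intervals; families indexed by an
  arbitrary finite set may repeat a degenerate interval, which contributes nothing.\<close>

lemma abs_continuous_curve_indexed:
  assumes "abs_continuous_curve a b \<gamma>" "0 < \<epsilon>"
  obtains \<delta> where "0 < \<delta>"
    "\<And>(I :: 'i set) p q. finite I \<Longrightarrow> (\<And>i. i \<in> I \<Longrightarrow> a \<le> p i \<and> p i \<le> q i \<and> q i \<le> b) \<Longrightarrow>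
       disjoint_family_on (\<lambda>i. {p i<..<q i}) I \<Longrightarrow> (\<Sum>i\<in>I. q i - p i) < \<delta> \<Longrightarrow>
       (\<Sum>i\<in>I. norm (\<gamma> (q i) - \<gamma> (p i))) < \<epsilon>"
proof -
  obtain \<delta> where "0 < \<delta>" and \<delta>: "\<And>D :: (real \<times> real) set. finite D \<Longrightarrow>
      (\<forall>(p, q)\<in>D. a \<le> p \<and> p \<le> q \<and> q \<le> b) \<Longrightarrow>
      disjoint_family_on (\<lambda>(p, q). {p<..<q}) D \<Longrightarrow> (\<Sum>(p, q)\<in>D. q - p) < \<delta> \<Longrightarrow>
      (\<Sum>(p, q)\<in>D. norm (\<gamma> q - \<gamma> p)) < \<epsilon>"
    using assms(1)[unfolded abs_continuous_curve_def, rule_format, OF assms(2)] by blast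
  show ?thesis
  proof (rule that[OF \<open>0 < \<delta>\<close>])
    fix I :: "'i set" and p q
    assume fin: "finite I" and bd: "\<And>i. i \<in> I \<Longrightarrow> a \<le> p i \<and> p i \<le> q i \<and> q i \<le> b"
      and disj: "disjoint_family_on (\<lambda>i. {p i<..<q i}) I" and len: "(\<Sum>i\<in>I. q i - p i) < \<delta>"
    define J where "J = {i \<in> I. p i < q i}"
    have J: "finite J" "J \<subseteq> I" using fin by (auto simp: J_def)
    have disjJ: "{p i<..<q i} \<inter> {p j<..<q j} = {}" if "i \<in> J" "j \<in> J" "i \<noteq> j" for i j
      using disj that J unfolding disjoint_family_on_def by blast
    have ne: "{p i<..<q i} \<noteq> {}" if "i \<in> J" for i
      using that by (auto simp: J_def)
    have inj: "inj_on (\<lambda>i. (p i, q i)) J"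
    proof (rule inj_onI)
      fix i j assume "i \<in> J" "j \<in> J" "(p i, q i) = (p j, q j)"
      then show "i = j" using disjJ[of i j] ne[of i] by auto
    qed
    have "(\<Sum>(p, q)\<in>(\<lambda>i. (p i, q i)) ` J. norm (\<gamma> q - \<gamma> p)) < \<epsilon>"
    proof (rule \<delta>)
      show "disjoint_family_on (\<lambda>(p, q). {p<..<q}) ((\<lambda>i. (p i, q i)) ` J)"
        unfolding disjoint_family_on_def using disjJ by auto
      have "(\<Sum>(p, q)\<in>(\<lambda>i. (p i, q i)) ` J. q - p) = (\<Sum>i\<in>J. q i - p i)"
        by (subst sum.reindex[OF inj]) simp
      also have "\<dots> \<le> (\<Sum>i\<in>I. q i - p i)"
        using bd J fin by (intro sum_mono2) auto
      finally show "(\<Sum>(p, q)\<in>(\<lambda>i. (p i, q i)) ` J. q - p) < \<delta>" using len by simp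
    qed (use J bd in auto)
    also have "(\<Sum>(p, q)\<in>(\<lambda>i. (p i, q i)) ` J. norm (\<gamma> q - \<gamma> p)) = (\<Sum>i\<in>J. norm (\<gamma> (q i) - \<gamma> (p i)))"
      by (subst sum.reindex[OF inj]) simp
    also have "\<dots> = (\<Sum>i\<in>I. norm (\<gamma> (q i) - \<gamma> (p i)))"
    proof (rule sum.mono_neutral_left[OF fin \<open>J \<subseteq> I\<close>], rule ballI)
      fix i assume "i \<in> I - J"
      then have "p i = q i" using bd[of i] by (auto simp: J_def)
      then show "norm (\<gamma> (q i) - \<gamma> (p i)) = 0" by simp
    qed
    finally show "(\<Sum>i\<in>I. norm (\<gamma> (q i) - \<gamma> (p i))) < \<epsilon>" .
  qed
qed

text \<open>The fundamental theorem of calculus for absolutely continuous curves. In the gauge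
  integral it is a direct estimate: around the points of differentiability the Riemann
  sum is controlled by the derivative; the remaining tags lie in a null set, so a second
  gauge makes the total length of their intervals so small that absolute continuity applies.\<close>

lemma abs_continuous_curve_has_integral:
  fixes \<gamma> :: "real \<Rightarrow> 'a::banach"
  assumes ac: "abs_continuous_curve a b \<gamma>" and "a < b" and neg: "negligible E"
    and deriv: "\<And>t. t \<in> {a..b} - E \<Longrightarrow> (\<gamma> has_vector_derivative g t) (at t within {a..b})"
  shows "(g has_integral (\<gamma> b - \<gamma> a)) {a..b}"
proof -
  define g0 where "g0 t = (if t \<in> E then 0 else g t)" for t
  have "(g0 has_integral (\<gamma> b - \<gamma> a)) {a..b}"
    unfolding has_integral_factor_content_real
  proof (intro allI impI)
    fix e :: real assume "0 < e"
    define e1 where "e1 = e / 2"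
    have "0 < e1" using \<open>0 < e\<close> by (simp add: e1_def)
    have "\<forall>x. \<exists>d>0. x \<in> {a..b} - E \<longrightarrow>
         (\<forall>y\<in>{a..b}. norm (y-x) < d \<longrightarrow> norm (\<gamma> y - \<gamma> x - (y-x) *\<^sub>R g x) \<le> e1 * norm (y-x))"
      using deriv[unfolded has_vector_derivative_def has_derivative_within_alt] \<open>0 < e1\<close>
      by (meson zero_less_one)
    then obtain d where d: "\<And>x. 0 < d x"
      "\<And>x y. \<lbrakk>x \<in> {a..b} - E; y \<in> {a..b}; norm (y-x) < d x\<rbrakk>
                        \<Longrightarrow> norm (\<gamma> y - \<gamma> x - (y-x) *\<^sub>R g x) \<le> e1 * norm (y-x)"
      by metis
    have "0 < e1 * (b - a)" using \<open>0 < e1\<close> \<open>a < b\<close> by simp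
    from abs_continuous_curve_indexed[OF ac this, where ?'i = "real \<times> real set"]
    obtain \<delta> where "0 < \<delta>" and \<delta>: "\<And>(I :: (real \<times> real set) set) p q. finite I \<Longrightarrow>
       (\<And>i. i \<in> I \<Longrightarrow> a \<le> p i \<and> p i \<le> q i \<and> q i \<le> b) \<Longrightarrow>
       disjoint_family_on (\<lambda>i. {p i<..<q i}) I \<Longrightarrow> (\<Sum>i\<in>I. q i - p i) < \<delta> \<Longrightarrow>
       (\<Sum>i\<in>I. norm (\<gamma> (q i) - \<gamma> (p i))) < e1 * (b - a)" by blast
    have "(indicat_real E has_integral 0) {a..b}"
      using neg by (metis box_real(2) negligible_def)
    then obtain G where G: "gauge G" "\<And>p. p tagged_division_of {a..b} \<Longrightarrow> G fine p \<Longrightarrow>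
        norm ((\<Sum>(x,k)\<in>p. measure lborel k *\<^sub>R indicat_real E x) - 0) < \<delta>"
      using \<open>0 < \<delta>\<close> unfolding has_integral_real by metis
    show "\<exists>d. gauge d \<and> (\<forall>p. p tagged_division_of {a..b} \<and> d fine p \<longrightarrow>
        norm ((\<Sum>(x, k)\<in>p. measure lborel k *\<^sub>R g0 x) - (\<gamma> b - \<gamma> a)) \<le> e * measure lborel {a..b})"
    proof (intro exI conjI allI impI)
      show "gauge (\<lambda>x. ball x (d x) \<inter> G x)"
        using gauge_ball_dependent[of d] d(1) G(1) by (auto intro: gauge_Int)
    next
      fix p assume p: "p tagged_division_of {a..b} \<and> (\<lambda>x. ball x (d x) \<inter> G x) fine p"
      then have ptag: "p tagged_division_of {a..b}" and fin1: "(\<lambda>x. ball x (d x)) fine p"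
        and fin2: "G fine p" by (auto simp: fine_Int)
      have finp: "finite p" using ptag by auto
      have cell: "\<exists>u v. K = {u..v} \<and> u \<le> v \<and> x \<in> {u..v} \<and> a \<le> u \<and> v \<le> b \<and> Inf K = u \<and> Sup K = v
          \<and> measure lborel K = v - u" if "(x, K) \<in> p" for x K
      proof -
        obtain u v where K: "K = cbox u v" using ptag \<open>(x, K) \<in> p\<close> by (meson tagged_division_ofD(4))
        moreover have "x \<in> K" "K \<subseteq> {a..b}" using ptag that by blast+
        ultimately have "u \<le> v" "a \<le> u" "v \<le> b" by auto
        with K \<open>x \<in> K\<close> show ?thesis by (intro exI[of _ u] exI[of _ v]) auto
      qed
      define P1 where "P1 = {z \<in> p. fst z \<in> E}"
      define P2 where "P2 = {z \<in> p. fst z \<notin> E}"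
      have split: "p = P1 \<union> P2" "P1 \<inter> P2 = {}" "finite P1" "finite P2"
        using finp by (auto simp: P1_def P2_def)
      let ?h = "\<lambda>(x, K). measure lborel K *\<^sub>R g0 x - (\<gamma> (Sup K) - \<gamma> (Inf K))"
      have small1: "norm (\<Sum>z\<in>P1. ?h z) \<le> e1 * (b - a)"
      proof -
        have "(\<Sum>z\<in>P1. norm (\<gamma> (Sup (snd z)) - \<gamma> (Inf (snd z)))) < e1 * (b - a)"
        proof (rule \<delta>)
          show "finite P1" by fact
          show "a \<le> Inf (snd z) \<and> Inf (snd z) \<le> Sup (snd z) \<and> Sup (snd z) \<le> b" if "z \<in> P1" for z
            using cell[of "fst z" "snd z"] that by (auto simp: P1_def)
          show "disjoint_family_on (\<lambda>z. {Inf (snd z)<..<Sup (snd z)}) P1"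
            unfolding disjoint_family_on_def
          proof (intro ballI impI)
            fix z w assume zw: "z \<in> P1" "w \<in> P1" "z \<noteq> w"
            have "interior (snd z) \<inter> interior (snd w) = {}"
              using ptag zw unfolding P1_def
              by (intro tagged_division_ofD(5)[OF ptag, of "fst z" _ "fst w"]) auto
            moreover have "{Inf (snd y)<..<Sup (snd y)} \<subseteq> interior (snd y)" if y: "y \<in> P1" for y
            proof -
              obtain u v where "snd y = {u..v}" "Inf (snd y) = u" "Sup (snd y) = v"
                using cell[of "fst y" "snd y"] y unfolding P1_def by (metis (mono_tags, lifting) mem_Collect_eq prod.collapse)
              then show ?thesis by simp
            qed
            ultimately show "{Inf (snd z)<..<Sup (snd z)} \<inter> {Inf (snd w)<..<Sup (snd w)} = {}"
              using zw by blast
          qed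
          have "(\<Sum>z\<in>P1. Sup (snd z) - Inf (snd z)) = (\<Sum>(x,k)\<in>P1. measure lborel k *\<^sub>R indicat_real E x)"
          proof (rule sum.cong[OF refl])
            fix z assume "z \<in> P1"
            then have "(fst z, snd z) \<in> p" "fst z \<in> E" by (auto simp: P1_def)
            with cell[OF this(1)]
            show "Sup (snd z) - Inf (snd z) = (case z of (x, k) \<Rightarrow> measure lborel k *\<^sub>R indicat_real E x)"
              unfolding split_beta by fastforce
          qed
          also have "\<dots> = (\<Sum>(x,k)\<in>p. measure lborel k *\<^sub>R indicat_real E x)"
            using finp by (intro sum.mono_neutral_left) (auto simp: P1_def indicator_def split: if_splits)
          also have "\<dots> < \<delta>" using G(2)[OF ptag fin2] by simp
          finally show "(\<Sum>z\<in>P1. Sup (snd z) - Inf (snd z)) < \<delta>" .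
        qed
        moreover have "norm (?h z) = norm (\<gamma> (Sup (snd z)) - \<gamma> (Inf (snd z)))" if "z \<in> P1" for z
          using that by (auto simp: P1_def g0_def split_beta norm_minus_commute)
        ultimately show ?thesis
          by (intro order_trans[OF norm_sum]) simp
      qed
      have small2: "norm (\<Sum>z\<in>P2. ?h z) \<le> e1 * (b - a)"
      proof -
        have "norm (?h z) \<le> e1 * (Sup (snd z) - Inf (snd z))" if "z \<in> P2" for z
        proof -
          obtain x K where z: "z = (x, K)" by (cases z)
          with that have xK: "(x, K) \<in> p" "x \<notin> E" by (auto simp: P2_def)
          obtain u v where uv: "K = {u..v}" "u \<le> v" "x \<in> {u..v}" "a \<le> u" "v \<le> b" "Inf K = u"
            "Sup K = v" "measure lborel K = v - u" using cell[OF xK(1)] by blast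
          have "K \<subseteq> ball x (d x)" using fin1 xK by blast
          moreover have "u \<in> K" "v \<in> K" using uv by auto
          ultimately have "u \<in> ball x (d x)" "v \<in> ball x (d x)" by blast+
          then have near: "norm (u - x) < d x" "norm (v - x) < d x"
            by (auto simp: dist_norm norm_minus_commute)
          have "x \<in> {a..b} - E" "u \<in> {a..b}" "v \<in> {a..b}" using uv xK by auto
          then have 1: "norm (\<gamma> u - \<gamma> x - (u-x) *\<^sub>R g x) \<le> e1 * norm (u-x)"
            "norm (\<gamma> v - \<gamma> x - (v-x) *\<^sub>R g x) \<le> e1 * norm (v-x)"
            using near by (blast intro: d(2))+
          have "norm ((v - u) *\<^sub>R g x - (\<gamma> v - \<gamma> u)) =
              norm (\<gamma> u - \<gamma> x - (u - x) *\<^sub>R g x - (\<gamma> v - \<gamma> x - (v - x) *\<^sub>R g x))"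
            by (auto simp: algebra_simps)
          also have "\<dots> \<le> norm (\<gamma> u - \<gamma> x - (u - x) *\<^sub>R g x) + norm (\<gamma> v - \<gamma> x - (v - x) *\<^sub>R g x)"
            by (rule norm_triangle_ineq4)
          also have "\<dots> \<le> e1 * norm (u-x) + e1 * norm (v-x)" using 1 by simp
          also have "\<dots> = e1 * (v - u)" using uv by (simp flip: distrib_left)
          finally show ?thesis using uv xK z by (simp add: g0_def)
        qed
        then have "norm (\<Sum>z\<in>P2. ?h z) \<le> (\<Sum>z\<in>P2. e1 * (Sup (snd z) - Inf (snd z)))"
          by (intro sum_norm_le) auto
        also have "\<dots> \<le> (\<Sum>z\<in>p. e1 * (Sup (snd z) - Inf (snd z)))"
          using \<open>0 < e1\<close> finp
        proof (intro sum_mono2)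
          fix z assume "z \<in> p - P2"
          then show "0 \<le> e1 * (Sup (snd z) - Inf (snd z))"
            using cell[of "fst z" "snd z"] \<open>0 < e1\<close> by auto
        qed (auto simp: P2_def)
        also have "\<dots> = e1 * (b - a)"
          using additive_tagged_division_1[where f = "\<lambda>x. x", OF _ ptag] \<open>a < b\<close>
          by (simp add: split_beta flip: sum_distrib_left)
        finally show ?thesis .
      qed
      have "(\<Sum>(x, k)\<in>p. measure lborel k *\<^sub>R g0 x) - (\<gamma> b - \<gamma> a) = (\<Sum>z\<in>p. ?h z)"
        using additive_tagged_division_1[OF _ ptag, where f = \<gamma>] \<open>a < b\<close>
        by (simp add: split_beta sum_subtractf)
      also have "\<dots> = (\<Sum>z\<in>P1. ?h z) + (\<Sum>z\<in>P2. ?h z)"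
        using split sum.union_disjoint[of P1 P2 ?h] by simp
      finally have "norm ((\<Sum>(x, k)\<in>p. measure lborel k *\<^sub>R g0 x) - (\<gamma> b - \<gamma> a)) \<le> e1 * (b - a) + e1 * (b - a)"
        using small1 small2 by (metis (no_types, lifting) add_mono norm_triangle_ineq order_trans)
      then show "norm ((\<Sum>(x, k)\<in>p. measure lborel k *\<^sub>R g0 x) - (\<gamma> b - \<gamma> a)) \<le> e * measure lborel {a..b}"
        using \<open>a < b\<close> by (simp add: e1_def)
    qed
  qed
  then show ?thesis
    by (rule has_integral_spike[OF neg, rotated]) (simp add: g0_def)
qed

lemma abs_continuous_curve_lipschitz:
  assumes "\<And>s t. a \<le> s \<Longrightarrow> s \<le> t \<Longrightarrow> t \<le> b \<Longrightarrow> norm (\<gamma> t - \<gamma> s) \<le> C * (t - s)"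
  shows "abs_continuous_curve a b \<gamma>"
  unfolding abs_continuous_curve_def
proof (intro allI impI)
  fix e :: real assume "0 < e"
  define K where "K = \<bar>C\<bar> + 1"
  show "\<exists>\<delta>>0. \<forall>D. finite D \<and> (\<forall>(p, q)\<in>D. a \<le> p \<and> p \<le> q \<and> q \<le> b) \<and>
       disjoint_family_on (\<lambda>(p, q). {p<..<q}) D \<and> (\<Sum>(p, q)\<in>D. q - p) < \<delta>
       \<longrightarrow> (\<Sum>(p, q)\<in>D. norm (\<gamma> q - \<gamma> p)) < e"
  proof (intro exI[of _ "e / K"] conjI allI impI)
    show "0 < e / K" using \<open>0 < e\<close> by (simp add: K_def)
    fix D assume D: "finite D \<and> (\<forall>(p, q)\<in>D. a \<le> p \<and> p \<le> q \<and> q \<le> b) \<and>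
       disjoint_family_on (\<lambda>(p, q). {p<..<q}) D \<and> (\<Sum>(p, q)\<in>D. q - p) < e / K"
    have "(\<Sum>(p, q)\<in>D. norm (\<gamma> q - \<gamma> p)) \<le> (\<Sum>(p, q)\<in>D. K * (q - p))"
    proof (rule sum_mono, clarify)
      fix p q assume "(p, q) \<in> D"
      then have "norm (\<gamma> q - \<gamma> p) \<le> C * (q - p)" "p \<le> q" using D assms by auto
      moreover have "C * (q - p) \<le> K * (q - p)"
        using \<open>p \<le> q\<close> by (intro mult_right_mono) (auto simp: K_def)
      ultimately show "norm (\<gamma> q - \<gamma> p) \<le> K * (q - p)" by simp
    qed
    also have "\<dots> = K * (\<Sum>(p, q)\<in>D. q - p)" by (simp add: sum_distrib_left split_beta)
    also have "\<dots> < e" using D by (simp add: K_def field_simps)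
    finally show "(\<Sum>(p, q)\<in>D. norm (\<gamma> q - \<gamma> p)) < e" .
  qed
qed

text \<open>An interval that contains the junction \<open>b\<close> is cut there: taking minima and maxima of the end
  points with \<open>b\<close> produces admissible families for the two pieces.\<close>

lemma abs_continuous_curve_join:
  assumes g1: "abs_continuous_curve a b \<gamma>" and g2: "abs_continuous_curve b c \<eta>"
    and eq: "\<gamma> b = \<eta> b" and ab: "a \<le> b" "b \<le> c"
  shows "abs_continuous_curve a c (\<lambda>t. if t \<le> b then \<gamma> t else \<eta> t)"
  unfolding abs_continuous_curve_def
proof (intro allI impI)
  fix e :: real assume "0 < e"
  let ?h = "\<lambda>t. if t \<le> b then \<gamma> t else \<eta> t"
  from abs_continuous_curve_indexed[OF g1, of "e/2", where ?'i = "real \<times> real"] \<open>0 < e\<close>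
  obtain \<delta>1 where "0 < \<delta>1" and \<delta>1: "\<And>(I :: (real \<times> real) set) p q. finite I \<Longrightarrow>
       (\<And>i. i \<in> I \<Longrightarrow> a \<le> p i \<and> p i \<le> q i \<and> q i \<le> b) \<Longrightarrow>
       disjoint_family_on (\<lambda>i. {p i<..<q i}) I \<Longrightarrow> (\<Sum>i\<in>I. q i - p i) < \<delta>1 \<Longrightarrow>
       (\<Sum>i\<in>I. norm (\<gamma> (q i) - \<gamma> (p i))) < e / 2" by (auto simp: half_gt_zero)
  from abs_continuous_curve_indexed[OF g2, of "e/2", where ?'i = "real \<times> real"] \<open>0 < e\<close>
  obtain \<delta>2 where "0 < \<delta>2" and \<delta>2: "\<And>(I :: (real \<times> real) set) p q. finite I \<Longrightarrow>
       (\<And>i. i \<in> I \<Longrightarrow> b \<le> p i \<and> p i \<le> q i \<and> q i \<le> c) \<Longrightarrow>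
       disjoint_family_on (\<lambda>i. {p i<..<q i}) I \<Longrightarrow> (\<Sum>i\<in>I. q i - p i) < \<delta>2 \<Longrightarrow>
       (\<Sum>i\<in>I. norm (\<eta> (q i) - \<eta> (p i))) < e / 2" by (auto simp: half_gt_zero)
  show "\<exists>\<delta>>0. \<forall>D. finite D \<and> (\<forall>(p, q)\<in>D. a \<le> p \<and> p \<le> q \<and> q \<le> c) \<and>
       disjoint_family_on (\<lambda>(p, q). {p<..<q}) D \<and> (\<Sum>(p, q)\<in>D. q - p) < \<delta>
       \<longrightarrow> (\<Sum>(p, q)\<in>D. norm (?h q - ?h p)) < e"
  proof (intro exI[of _ "min \<delta>1 \<delta>2"] conjI allI impI)
    show "0 < min \<delta>1 \<delta>2" using \<open>0 < \<delta>1\<close> \<open>0 < \<delta>2\<close> by simp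
    fix D assume D: "finite D \<and> (\<forall>(p, q)\<in>D. a \<le> p \<and> p \<le> q \<and> q \<le> c) \<and>
       disjoint_family_on (\<lambda>(p, q). {p<..<q}) D \<and> (\<Sum>(p, q)\<in>D. q - p) < min \<delta>1 \<delta>2"
    have fin: "finite D" and bd: "\<And>z. z \<in> D \<Longrightarrow> a \<le> fst z \<and> fst z \<le> snd z \<and> snd z \<le> c"
      and disj: "\<And>z w. z \<in> D \<Longrightarrow> w \<in> D \<Longrightarrow> z \<noteq> w \<Longrightarrow> {fst z<..<snd z} \<inter> {fst w<..<snd w} = {}"
      and len: "(\<Sum>z\<in>D. snd z - fst z) < min \<delta>1 \<delta>2"
      using D by (auto simp: disjoint_family_on_def split_beta)
    have "(\<Sum>z\<in>D. norm (\<gamma> (min (snd z) b) - \<gamma> (min (fst z) b))) < e / 2"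
    proof (rule \<delta>1[OF fin])
      show "disjoint_family_on (\<lambda>z. {min (fst z) b<..<min (snd z) b}) D"
        unfolding disjoint_family_on_def
      proof (intro ballI impI)
        fix z w assume "z \<in> D" "w \<in> D" "z \<noteq> w"
        moreover have "{min (fst z) b<..<min (snd z) b} \<subseteq> {fst z<..<snd z}" for z by auto
        ultimately show "{min (fst z) b<..<min (snd z) b} \<inter> {min (fst w) b<..<min (snd w) b} = {}"
          using disj by blast
      qed
      have "(\<Sum>z\<in>D. min (snd z) b - min (fst z) b) \<le> (\<Sum>z\<in>D. snd z - fst z)"
        using bd by (intro sum_mono) fastforce
      then show "(\<Sum>z\<in>D. min (snd z) b - min (fst z) b) < \<delta>1" using len by simp
    qed (use bd ab in fastforce)
    moreover have "(\<Sum>z\<in>D. norm (\<eta> (max (snd z) b) - \<eta> (max (fst z) b))) < e / 2"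
    proof (rule \<delta>2[OF fin])
      show "disjoint_family_on (\<lambda>z. {max (fst z) b<..<max (snd z) b}) D"
        unfolding disjoint_family_on_def
      proof (intro ballI impI)
        fix z w assume "z \<in> D" "w \<in> D" "z \<noteq> w"
        moreover have "{max (fst z) b<..<max (snd z) b} \<subseteq> {fst z<..<snd z}" for z by auto
        ultimately show "{max (fst z) b<..<max (snd z) b} \<inter> {max (fst w) b<..<max (snd w) b} = {}"
          using disj by blast
      qed
      have "(\<Sum>z\<in>D. max (snd z) b - max (fst z) b) \<le> (\<Sum>z\<in>D. snd z - fst z)"
        using bd by (intro sum_mono) fastforce
      then show "(\<Sum>z\<in>D. max (snd z) b - max (fst z) b) < \<delta>2" using len by simp
    qed (use bd ab in fastforce)
    moreover have "norm (?h (snd z) - ?h (fst z)) \<le> norm (\<gamma> (min (snd z) b) - \<gamma> (min (fst z) b))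
        + norm (\<eta> (max (snd z) b) - \<eta> (max (fst z) b))" if "z \<in> D" for z
    proof -
      have "?h (snd z) - ?h (fst z) = (\<gamma> (min (snd z) b) - \<gamma> (min (fst z) b))
        + (\<eta> (max (snd z) b) - \<eta> (max (fst z) b))"
        using eq bd[OF that] by (auto simp: min_def max_def)
      then show ?thesis using norm_triangle_ineq by metis
    qed
    then have "(\<Sum>z\<in>D. norm (?h (snd z) - ?h (fst z))) \<le>
        (\<Sum>z\<in>D. norm (\<gamma> (min (snd z) b) - \<gamma> (min (fst z) b))) +
        (\<Sum>z\<in>D. norm (\<eta> (max (snd z) b) - \<eta> (max (fst z) b)))"
      by (simp add: sum_mono flip: sum.distrib)
    ultimately show "(\<Sum>(p, q)\<in>D. norm (?h q - ?h p)) < e"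
      by (simp add: split_beta)
  qed
qed

section \<open>Horizontal curves and the Carnot-Caratheodory distance\<close>

lemma sum_axis: "(\<Sum>i\<in>UNIV. (v $ i) *\<^sub>R axis i (1::real)) = (v :: real ^ 'n::finite)"
  by (simp add: vec_eq_iff axis_def if_distrib cong: if_cong)

text \<open>Horizontal velocities have a free planar part, which determines the vertical part.\<close>

lemma horizontal_field:
  "(\<Sum>i\<in>UNIV. (fst w $ i) *\<^sub>R heis_X i p + (snd w $ i) *\<^sub>R heis_Y i p) = (w, symp (fst p) w)"
proof -
  obtain x y s a b where [simp]: "p = ((x, y), s)" "w = (a, b)" by (metis prod.exhaust)
  have "(\<Sum>i\<in>UNIV. (fst w $ i) *\<^sub>R heis_X i p + (snd w $ i) *\<^sub>R heis_Y i p)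
      = (\<Sum>i\<in>UNIV. (((a $ i) *\<^sub>R axis i 1, (b $ i) *\<^sub>R axis i 1), a $ i * y $ i - b $ i * x $ i))"
    by (intro sum.cong) (auto simp: heis_X_def heis_Y_def)
  also have "\<dots> = ((\<Sum>i\<in>UNIV. (a $ i) *\<^sub>R axis i 1, \<Sum>i\<in>UNIV. (b $ i) *\<^sub>R axis i 1),
      \<Sum>i\<in>UNIV. a $ i * y $ i - b $ i * x $ i)"
    by (simp add: sum_prod)
  also have "\<dots> = (w, symp (fst p) w)"
    by (simp add: sum_axis symp_def inner_vec_def sum_subtractf mult.commute)
  finally show ?thesis .
qed

lemma horizontal_curve_iff:
  "horizontal_curve a b \<gamma> u \<longleftrightarrow>
    abs_continuous_curve a b \<gamma> \<and> u absolutely_integrable_on {a..b} \<and>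
    (\<exists>E. negligible E \<and> (\<forall>t\<in>{a..b} - E.
      (\<gamma> has_vector_derivative (u t, symp (fst (\<gamma> t)) (u t))) (at t within {a..b})))"
proof -
  have "(AE t in lebesgue. t \<in> {a..b} \<longrightarrow> P t) \<longleftrightarrow> (\<exists>E. negligible E \<and> (\<forall>t\<in>{a..b} - E. P t))" for P :: "real \<Rightarrow> bool"
  proof
    assume "AE t in lebesgue. t \<in> {a..b} \<longrightarrow> P t"
    then obtain E where "E \<in> null_sets lebesgue" "{t \<in> space lebesgue. \<not> (t \<in> {a..b} \<longrightarrow> P t)} \<subseteq> E"
      unfolding eventually_ae_filter by blast
    then show "\<exists>E. negligible E \<and> (\<forall>t\<in>{a..b} - E. P t)"
      unfolding negligible_iff_null_sets by (intro exI[of _ E]) auto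
  next
    assume "\<exists>E. negligible E \<and> (\<forall>t\<in>{a..b} - E. P t)"
    then obtain E where "E \<in> null_sets lebesgue" "\<forall>t\<in>{a..b} - E. P t"
      unfolding negligible_iff_null_sets by blast
    then show "AE t in lebesgue. t \<in> {a..b} \<longrightarrow> P t"
      unfolding eventually_ae_filter by (intro bexI[of _ E]) auto
  qed
  then show ?thesis unfolding horizontal_curve_def horizontal_field by simp
qed

text \<open>Left translation is affine, and its linear part maps the horizontal velocities at a point to those
  at the translated point with the same planar part; so the control does not change.\<close>

lemma horizontal_curve_left_mult:
  assumes "horizontal_curve a b \<gamma> u"
  shows "horizontal_curve a b (\<lambda>t. heis_mult p (\<gamma> t)) u"
proof -
  define L where "L q = (fst q, snd q + symp (fst p) (fst q))" for q :: "'a heis"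
  have L: "bounded_linear L"
    unfolding L_def
    by (intro bounded_linear_Pair bounded_linear_fst bounded_linear_add bounded_linear_snd
        bounded_linear_compose[OF bounded_linear_symp_right])
  then obtain K where K: "K > 0" "\<And>x. norm (L x) \<le> norm x * K" using bounded_linear.pos_bounded by blast
  have mult: "heis_mult p q = p + L q" for q by (simp add: heis_mult_def L_def prod_eq_iff)
  have diff: "heis_mult p q - heis_mult p q' = L (q - q')" for q q'
    by (simp add: mult linear_diff[OF bounded_linear.linear[OF L]])
  obtain E where ac: "abs_continuous_curve a b \<gamma>" and u: "u absolutely_integrable_on {a..b}"
    and E: "negligible E" "\<And>t. t \<in> {a..b} - E \<Longrightarrow>
      (\<gamma> has_vector_derivative (u t, symp (fst (\<gamma> t)) (u t))) (at t within {a..b})"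
    using assms by (auto simp: horizontal_curve_iff)
  have "abs_continuous_curve a b (\<lambda>t. heis_mult p (\<gamma> t))"
    unfolding abs_continuous_curve_def
  proof (intro allI impI)
    fix e :: real assume "0 < e"
    then have "0 < e / K" using K by simp
    from ac[unfolded abs_continuous_curve_def, rule_format, OF this] obtain \<delta> where "0 < \<delta>"
      and \<delta>: "\<And>D :: (real \<times> real) set. finite D \<and> (\<forall>(p, q)\<in>D. a \<le> p \<and> p \<le> q \<and> q \<le> b) \<and>
       disjoint_family_on (\<lambda>(p, q). {p<..<q}) D \<and> (\<Sum>(p, q)\<in>D. q - p) < \<delta> \<Longrightarrow>
        (\<Sum>(p, q)\<in>D. norm (\<gamma> q - \<gamma> p)) < e / K" by blast
    have "(\<Sum>(r, q)\<in>D. norm (heis_mult p (\<gamma> q) - heis_mult p (\<gamma> r))) < e"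
      if D: "finite D \<and> (\<forall>(p, q)\<in>D. a \<le> p \<and> p \<le> q \<and> q \<le> b) \<and>
       disjoint_family_on (\<lambda>(p, q). {p<..<q}) D \<and> (\<Sum>(p, q)\<in>D. q - p) < \<delta>" for D
    proof -
      have "(\<Sum>(r, q)\<in>D. norm (heis_mult p (\<gamma> q) - heis_mult p (\<gamma> r)))
          \<le> (\<Sum>(r, q)\<in>D. norm (\<gamma> q - \<gamma> r) * K)"
        unfolding split_beta diff by (intro sum_mono K(2))
      also have "\<dots> = (\<Sum>(r, q)\<in>D. norm (\<gamma> q - \<gamma> r)) * K"
        by (simp add: sum_distrib_right split_beta)
      also have "\<dots> < e" using \<delta>[OF D] K by (simp add: field_simps)
      finally show ?thesis .
    qed
    then show "\<exists>\<delta>>0. \<forall>D. finite D \<and> (\<forall>(p, q)\<in>D. a \<le> p \<and> p \<le> q \<and> q \<le> b) \<and>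
       disjoint_family_on (\<lambda>(p, q). {p<..<q}) D \<and> (\<Sum>(p, q)\<in>D. q - p) < \<delta> \<longrightarrow>
       (\<Sum>(r, q)\<in>D. norm (heis_mult p (\<gamma> q) - heis_mult p (\<gamma> r))) < e"
      using \<open>0 < \<delta>\<close> by blast
  qed
  moreover have "((\<lambda>t. heis_mult p (\<gamma> t)) has_vector_derivative
        (u t, symp (fst (heis_mult p (\<gamma> t))) (u t))) (at t within {a..b})" if "t \<in> {a..b} - E" for t
  proof -
    have "((\<lambda>t. p + L (\<gamma> t)) has_vector_derivative L (u t, symp (fst (\<gamma> t)) (u t))) (at t within {a..b})"
      using has_vector_derivative_add[OF has_vector_derivative_const[of p]
          bounded_linear.has_vector_derivative[OF L E(2)[OF that]]] by simp
    then show ?thesis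
      by (simp add: mult L_def symp_simps add.commute)
  qed
  ultimately show ?thesis using u E(1) unfolding horizontal_curve_iff by blast
qed

lemma horizontal_curve_subinterval:
  assumes "horizontal_curve a b \<gamma> u" "a \<le> a'" "b' \<le> b"
  shows "horizontal_curve a' b' \<gamma> u"
proof -
  obtain E where ac: "abs_continuous_curve a b \<gamma>" and u: "u absolutely_integrable_on {a..b}"
    and E: "negligible E" "\<And>t. t \<in> {a..b} - E \<Longrightarrow>
      (\<gamma> has_vector_derivative (u t, symp (fst (\<gamma> t)) (u t))) (at t within {a..b})"
    using assms by (auto simp: horizontal_curve_iff)
  have "abs_continuous_curve a' b' \<gamma>"
    unfolding abs_continuous_curve_def
  proof (intro allI impI)
    fix e :: real assume "0 < e"
    from ac[unfolded abs_continuous_curve_def, rule_format, OF this] obtain \<delta> where "0 < \<delta>"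
      and \<delta>: "\<And>D :: (real \<times> real) set. finite D \<and> (\<forall>(p, q)\<in>D. a \<le> p \<and> p \<le> q \<and> q \<le> b) \<and>
       disjoint_family_on (\<lambda>(p, q). {p<..<q}) D \<and> (\<Sum>(p, q)\<in>D. q - p) < \<delta> \<Longrightarrow>
        (\<Sum>(p, q)\<in>D. norm (\<gamma> q - \<gamma> p)) < e" by blast
    have "(\<Sum>(r, q)\<in>D. norm (\<gamma> q - \<gamma> r)) < e"
      if D: "finite D \<and> (\<forall>(p, q)\<in>D. a' \<le> p \<and> p \<le> q \<and> q \<le> b') \<and>
       disjoint_family_on (\<lambda>(p, q). {p<..<q}) D \<and> (\<Sum>(p, q)\<in>D. q - p) < \<delta>" for D
    proof (rule \<delta>, intro conjI)
      show "\<forall>(p, q)\<in>D. a \<le> p \<and> p \<le> q \<and> q \<le> b" using D assms(2,3) by fastforce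
    qed (use D in blast)+
    then show "\<exists>\<delta>>0. \<forall>D. finite D \<and> (\<forall>(p, q)\<in>D. a' \<le> p \<and> p \<le> q \<and> q \<le> b') \<and>
       disjoint_family_on (\<lambda>(p, q). {p<..<q}) D \<and> (\<Sum>(p, q)\<in>D. q - p) < \<delta> \<longrightarrow>
       (\<Sum>(r, q)\<in>D. norm (\<gamma> q - \<gamma> r)) < e"
      using \<open>0 < \<delta>\<close> by blast
  qed
  moreover have "u absolutely_integrable_on {a'..b'}"
    using u assms by (auto intro: absolutely_integrable_on_subinterval)
  moreover have "(\<gamma> has_vector_derivative (u t, symp (fst (\<gamma> t)) (u t))) (at t within {a'..b'})"
    if "t \<in> {a'..b'} - E" for t
    using that assms by (intro has_vector_derivative_within_subset[OF E(2)]) auto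
  ultimately show ?thesis using E(1) unfolding horizontal_curve_iff by blast
qed

lemma control_length_subinterval:
  assumes "horizontal_curve a b \<gamma> u" "a \<le> a'" "b' \<le> b"
  shows "control_length a' b' u \<le> control_length a b u"
  using assms horizontal_curve_subinterval[OF assms] unfolding control_length_def
  by (intro integral_subset_le) (auto simp: horizontal_curve_iff absolutely_integrable_on_def)

lemma control_length_nonneg: "0 \<le> control_length a b u"
  unfolding control_length_def by (cases "(\<lambda>t. norm (u t)) integrable_on {a..b}")
    (auto intro: integral_nonneg simp: not_integrable_integral)

lemma horizontal_curve_shift:
  assumes "horizontal_curve a b \<gamma> u"
  shows "horizontal_curve (a + c) (b + c) (\<lambda>t. \<gamma> (t - c)) (\<lambda>t. u (t - c))"
    and "control_length (a + c) (b + c) (\<lambda>t. u (t - c)) = control_length a b u"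
proof -
  obtain E where ac: "abs_continuous_curve a b \<gamma>" and u: "u absolutely_integrable_on {a..b}"
    and E: "negligible E" "\<And>t. t \<in> {a..b} - E \<Longrightarrow>
      (\<gamma> has_vector_derivative (u t, symp (fst (\<gamma> t)) (u t))) (at t within {a..b})"
    using assms by (auto simp: horizontal_curve_iff)
  have "abs_continuous_curve (a + c) (b + c) (\<lambda>t. \<gamma> (t - c))"
    unfolding abs_continuous_curve_def
  proof (intro allI impI)
    fix e :: real assume "0 < e"
    from abs_continuous_curve_indexed[OF ac this, where ?'i = "real \<times> real"]
    obtain \<delta> where "0 < \<delta>" and \<delta>: "\<And>(I :: (real \<times> real) set) p q. finite I \<Longrightarrow>
       (\<And>i. i \<in> I \<Longrightarrow> a \<le> p i \<and> p i \<le> q i \<and> q i \<le> b) \<Longrightarrow>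
       disjoint_family_on (\<lambda>i. {p i<..<q i}) I \<Longrightarrow> (\<Sum>i\<in>I. q i - p i) < \<delta> \<Longrightarrow>
       (\<Sum>i\<in>I. norm (\<gamma> (q i) - \<gamma> (p i))) < e" by blast
    have "(\<Sum>(p, q)\<in>D. norm (\<gamma> (q - c) - \<gamma> (p - c))) < e"
      if D: "finite D \<and> (\<forall>(p, q)\<in>D. a + c \<le> p \<and> p \<le> q \<and> q \<le> b + c) \<and>
       disjoint_family_on (\<lambda>(p, q). {p<..<q}) D \<and> (\<Sum>(p, q)\<in>D. q - p) < \<delta>" for D
    proof -
      have "(\<Sum>i\<in>D. norm (\<gamma> (snd i - c) - \<gamma> (fst i - c))) < e"
      proof (rule \<delta>)
        show "disjoint_family_on (\<lambda>i. {fst i - c<..<snd i - c}) D"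
          unfolding disjoint_family_on_def
        proof (intro ballI impI)
          fix i j assume ij: "i \<in> D" "j \<in> D" "i \<noteq> j"
          then have "{fst i<..<snd i} \<inter> {fst j<..<snd j} = {}"
            using D by (auto simp: disjoint_family_on_def split_beta)
          moreover have "x + c \<in> {fst k<..<snd k}" if "x \<in> {fst k - c<..<snd k - c}" for x k
            using that by auto
          ultimately show "{fst i - c<..<snd i - c} \<inter> {fst j - c<..<snd j - c} = {}"
            by blast
        qed
      qed (use D in \<open>auto simp: split_beta\<close>)
      then show ?thesis by (simp add: split_beta)
    qed
    then show "\<exists>\<delta>>0. \<forall>D. finite D \<and> (\<forall>(p, q)\<in>D. a + c \<le> p \<and> p \<le> q \<and> q \<le> b + c) \<and>
       disjoint_family_on (\<lambda>(p, q). {p<..<q}) D \<and> (\<Sum>(p, q)\<in>D. q - p) < \<delta> \<longrightarrow>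
       (\<Sum>(p, q)\<in>D. norm (\<gamma> (q - c) - \<gamma> (p - c))) < e"
      using \<open>0 < \<delta>\<close> by blast
  qed
  moreover have int: "(\<lambda>t. f (t - c)) integrable_on {a + c..b + c} \<longleftrightarrow> f integrable_on {a..b}"
    "integral {a + c..b + c} (\<lambda>t. f (t - c)) = integral {a..b} f"
    for f :: "real \<Rightarrow> 'z::banach"
    using has_integral_shift_Icc_real[of "\<lambda>t. f (t - c)" c _ a b]
      integral_shift_Icc_real[of a b "\<lambda>t. f (t - c)" c]
    unfolding integrable_on_def by (auto simp: o_def)
  have "(\<lambda>t. u (t - c)) absolutely_integrable_on {a + c..b + c}"
    using u int(1)[of u] int(1)[of "\<lambda>t. norm (u t)"] unfolding absolutely_integrable_on_def by simp
  moreover have "negligible ((+) c ` E)" by (rule negligible_translation[OF E(1)])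
  moreover have "((\<lambda>t. \<gamma> (t - c)) has_vector_derivative (u (t - c), symp (fst (\<gamma> (t - c))) (u (t - c))))
      (at t within {a + c..b + c})" if "t \<in> {a + c..b + c} - (+) c ` E" for t
  proof -
    have t: "t - c \<in> {a..b} - E" using that by (auto simp: image_iff algebra_simps)
    have "(\<lambda>t. t - c) ` {a + c..b + c} = {a..b}"
      using image_add_atLeastAtMost[of "-c" "a + c" "b + c"] by (simp add: image_def algebra_simps)
    with E(2)[OF t] have "(\<gamma> has_vector_derivative (u (t - c), symp (fst (\<gamma> (t - c))) (u (t - c))))
       (at (t - c) within (\<lambda>t. t - c) ` {a + c..b + c})" by simp
    moreover have "((\<lambda>t. t - c) has_vector_derivative 1) (at t within {a + c..b + c})"
      by (auto intro!: derivative_eq_intros simp flip: has_real_derivative_iff_has_vector_derivative)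
    ultimately show ?thesis
      using vector_diff_chain_within[of "\<lambda>t. t - c" 1 t "{a + c..b + c}" \<gamma>] by (simp add: o_def)
  qed
  ultimately show "horizontal_curve (a + c) (b + c) (\<lambda>t. \<gamma> (t - c)) (\<lambda>t. u (t - c))"
    unfolding horizontal_curve_iff by blast
  show "control_length (a + c) (b + c) (\<lambda>t. u (t - c)) = control_length a b u"
    using int(2)[of "\<lambda>t. norm (u t)"] by (simp add: control_length_def)
qed

lemma horizontal_curve_reverse:
  assumes "horizontal_curve a b \<gamma> u"
  shows "horizontal_curve (- b) (- a) (\<lambda>t. \<gamma> (- t)) (\<lambda>t. - u (- t))"
    and "control_length (- b) (- a) (\<lambda>t. - u (- t)) = control_length a b u"
proof -
  obtain E where ac: "abs_continuous_curve a b \<gamma>" and u: "u absolutely_integrable_on {a..b}"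
    and E: "negligible E" "\<And>t. t \<in> {a..b} - E \<Longrightarrow>
      (\<gamma> has_vector_derivative (u t, symp (fst (\<gamma> t)) (u t))) (at t within {a..b})"
    using assms by (auto simp: horizontal_curve_iff)
  have "abs_continuous_curve (- b) (- a) (\<lambda>t. \<gamma> (- t))"
    unfolding abs_continuous_curve_def
  proof (intro allI impI)
    fix e :: real assume "0 < e"
    from abs_continuous_curve_indexed[OF ac this, where ?'i = "real \<times> real"]
    obtain \<delta> where "0 < \<delta>" and \<delta>: "\<And>(I :: (real \<times> real) set) p q. finite I \<Longrightarrow>
       (\<And>i. i \<in> I \<Longrightarrow> a \<le> p i \<and> p i \<le> q i \<and> q i \<le> b) \<Longrightarrow>
       disjoint_family_on (\<lambda>i. {p i<..<q i}) I \<Longrightarrow> (\<Sum>i\<in>I. q i - p i) < \<delta> \<Longrightarrow>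
       (\<Sum>i\<in>I. norm (\<gamma> (q i) - \<gamma> (p i))) < e" by blast
    have "(\<Sum>(p, q)\<in>D. norm (\<gamma> (- q) - \<gamma> (- p))) < e"
      if D: "finite D \<and> (\<forall>(p, q)\<in>D. - b \<le> p \<and> p \<le> q \<and> q \<le> - a) \<and>
       disjoint_family_on (\<lambda>(p, q). {p<..<q}) D \<and> (\<Sum>(p, q)\<in>D. q - p) < \<delta>" for D
    proof -
      have "(\<Sum>i\<in>D. norm (\<gamma> (- fst i) - \<gamma> (- snd i))) < e"
      proof (rule \<delta>)
        show "disjoint_family_on (\<lambda>i. {- snd i<..<- fst i}) D"
          unfolding disjoint_family_on_def
        proof (intro ballI impI)
          fix i j assume ij: "i \<in> D" "j \<in> D" "i \<noteq> j"
          then have "{fst i<..<snd i} \<inter> {fst j<..<snd j} = {}"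
            using D by (auto simp: disjoint_family_on_def split_beta)
          moreover have "- x \<in> {fst k<..<snd k}" if "x \<in> {- snd k<..<- fst k}" for x :: real and k
            using that by auto
          ultimately show "{- snd i<..<- fst i} \<inter> {- snd j<..<- fst j} = {}"
            by blast
        qed
      qed (use D in \<open>auto simp: split_beta\<close>)
      then show ?thesis by (simp add: split_beta norm_minus_commute)
    qed
    then show "\<exists>\<delta>>0. \<forall>D. finite D \<and> (\<forall>(p, q)\<in>D. - b \<le> p \<and> p \<le> q \<and> q \<le> - a) \<and>
       disjoint_family_on (\<lambda>(p, q). {p<..<q}) D \<and> (\<Sum>(p, q)\<in>D. q - p) < \<delta> \<longrightarrow>
       (\<Sum>(p, q)\<in>D. norm (\<gamma> (- q) - \<gamma> (- p))) < e"
      using \<open>0 < \<delta>\<close> by blast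
  qed
  moreover have "(\<lambda>t. - u (- t)) absolutely_integrable_on {- b..- a}"
    using u absolutely_integrable_reflect_real[where f = u and a = a and b = b]
    unfolding absolutely_integrable_on_def by (simp add: integrable_neg)
  moreover have "negligible (uminus ` E)"
  proof (rule negligible_locally_Lipschitz_image[OF _ E(1)])
    show "\<exists>T B. open T \<and> x \<in> T \<and> (\<forall>y\<in>E \<inter> T. norm (- y - - x) \<le> B * norm (y - x))" if "x \<in> E" for x
      by (intro exI[of _ UNIV] exI[of _ 1]) (auto simp: abs_minus_commute)
  qed simp
  moreover have "((\<lambda>t. \<gamma> (- t)) has_vector_derivative (- u (- t), symp (fst (\<gamma> (- t))) (- u (- t))))
      (at t within {- b..- a})" if "t \<in> {- b..- a} - uminus ` E" for t
  proof -
    have t: "- t \<in> {a..b} - E" using that by (auto simp: image_iff)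
    have "uminus ` {- b..- a} = {a..b}" by simp
    with E(2)[OF t] have d1: "(\<gamma> has_vector_derivative (u (- t), symp (fst (\<gamma> (- t))) (u (- t))))
       (at (- t) within uminus ` {- b..- a})" by simp
    have d2: "((\<lambda>t. - t) has_vector_derivative - 1) (at t within {- b..- a})"
      by (auto intro!: derivative_eq_intros simp flip: has_real_derivative_iff_has_vector_derivative)
    show ?thesis
      using vector_diff_chain_within[OF d2 d1] by (simp add: o_def symp_simps)
  qed
  ultimately show "horizontal_curve (- b) (- a) (\<lambda>t. \<gamma> (- t)) (\<lambda>t. - u (- t))"
    unfolding horizontal_curve_iff by blast
  show "control_length (- b) (- a) (\<lambda>t. - u (- t)) = control_length a b u"
    using Henstock_Kurzweil_Integration.integral_reflect_real[of b a "\<lambda>t. norm (u t)"] by (simp add: control_length_def)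
qed

lemma horizontal_curve_join:
  assumes g1: "horizontal_curve a b \<gamma> u" and g2: "horizontal_curve b c \<eta> w"
    and eq: "\<gamma> b = \<eta> b" and ab: "a < b" "b < c"
  defines "\<theta> \<equiv> \<lambda>t. if t \<le> b then \<gamma> t else \<eta> t" and "v \<equiv> \<lambda>t. if t \<le> b then u t else w t"
  shows "horizontal_curve a c \<theta> v" "control_length a c v = control_length a b u + control_length b c w"
proof -
  obtain E where ac: "abs_continuous_curve a b \<gamma>" and u: "u absolutely_integrable_on {a..b}"
    and E: "negligible E" "\<And>t. t \<in> {a..b} - E \<Longrightarrow>
      (\<gamma> has_vector_derivative (u t, symp (fst (\<gamma> t)) (u t))) (at t within {a..b})"
    using g1 by (auto simp: horizontal_curve_iff)
  obtain F where bc: "abs_continuous_curve b c \<eta>" and w: "w absolutely_integrable_on {b..c}"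
    and F: "negligible F" "\<And>t. t \<in> {b..c} - F \<Longrightarrow>
      (\<eta> has_vector_derivative (w t, symp (fst (\<eta> t)) (w t))) (at t within {b..c})"
    using g2 by (auto simp: horizontal_curve_iff)
  have "abs_continuous_curve a c \<theta>"
    unfolding \<theta>_def using ab by (intro abs_continuous_curve_join[OF ac bc eq]) auto
  moreover have v1: "v absolutely_integrable_on {a..b}"
    by (rule absolutely_integrable_spike[OF u negligible_empty]) (simp add: v_def)
  have v2: "v absolutely_integrable_on {b..c}"
  proof (rule absolutely_integrable_spike[OF w])
    show "negligible {b}" by simp
    show "v x = w x" if "x \<in> {b..c} - {b}" for x using that by (simp add: v_def)
  qed
  have v: "v absolutely_integrable_on {a..c}"
    using v1 v2 ab by (intro absolutely_integrable_on_combine[OF v1 v2]) auto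
  moreover have "negligible (E \<union> F \<union> {b})" using E(1) F(1) by simp
  moreover have "(\<theta> has_vector_derivative (v t, symp (fst (\<theta> t)) (v t))) (at t within {a..c})"
    if t: "t \<in> {a..c} - (E \<union> F \<union> {b})" for t
  proof (cases "t < b")
    case True
    have at: "at t within {a..c} = at t within {a..b}"
      using True ab by (intro at_within_nhd[of t "{..<b}"]) auto
    show ?thesis
    proof (rule has_vector_derivative_transform_within[of \<gamma> _ t _ "b - t"])
      show "(\<gamma> has_vector_derivative (v t, symp (fst (\<theta> t)) (v t))) (at t within {a..c})"
        unfolding at using E(2)[of t] t True by (simp add: v_def \<theta>_def)
    qed (use t True in \<open>auto simp: \<theta>_def dist_real_def\<close>)
  next
    case False
    then have "b < t" using t by auto
    have at: "at t within {a..c} = at t within {b..c}"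
      using \<open>b < t\<close> ab by (intro at_within_nhd[of t "{b<..}"]) auto
    show ?thesis
    proof (rule has_vector_derivative_transform_within[of \<eta> _ t _ "t - b"])
      show "(\<eta> has_vector_derivative (v t, symp (fst (\<theta> t)) (v t))) (at t within {a..c})"
        unfolding at using F(2)[of t] t \<open>b < t\<close> by (simp add: v_def \<theta>_def)
    qed (use t \<open>b < t\<close> in \<open>auto simp: \<theta>_def dist_real_def\<close>)
  qed
  ultimately show "horizontal_curve a c \<theta> v" unfolding horizontal_curve_iff by blast
  have "integral {a..c} (\<lambda>t. norm (v t)) = integral {a..b} (\<lambda>t. norm (v t)) + integral {b..c} (\<lambda>t. norm (v t))"
    using v ab by (intro Henstock_Kurzweil_Integration.integral_combine[symmetric]) (auto simp: absolutely_integrable_on_def)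
  also have "integral {a..b} (\<lambda>t. norm (v t)) = integral {a..b} (\<lambda>t. norm (u t))"
    by (rule integral_cong) (simp add: v_def)
  also have "integral {b..c} (\<lambda>t. norm (v t)) = integral {b..c} (\<lambda>t. norm (w t))"
  proof (rule integral_spike[of "{b}"])
    show "norm (w x) = norm (v x)" if "x \<in> {b..c} - {b}" for x using that by (simp add: v_def)
  qed simp
  finally show "control_length a c v = control_length a b u + control_length b c w"
    by (simp add: control_length_def)
qed

text \<open>The lengths whose infimum is \<open>cc_dist p q\<close>. Translation, reversal and concatenation of curves
  act on them directly, which gives the invariance, the symmetry and the triangle inequality of the distance.\<close>

definition reaches :: "'d::finite heis \<Rightarrow> 'd heis \<Rightarrow> real \<Rightarrow> bool" where
  "reaches p q l \<longleftrightarrow>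
    (\<exists>a b \<gamma> u. a < b \<and> horizontal_curve a b \<gamma> u \<and> \<gamma> a = p \<and> \<gamma> b = q \<and> l = control_length a b u)"

lemma cc_dist_eq: "cc_dist p q = Inf {l. reaches p q l}"
  unfolding cc_dist_def reaches_def by (rule arg_cong[of _ _ Inf]) auto

lemma reaches_left_mult: "reaches p q l \<Longrightarrow> reaches (heis_mult g p) (heis_mult g q) l"
  unfolding reaches_def using horizontal_curve_left_mult by blast

lemma reaches_sym:
  assumes "reaches p q l" shows "reaches q p l"
proof -
  obtain a b \<gamma> u where *: "a < b" "horizontal_curve a b \<gamma> u" "\<gamma> a = p" "\<gamma> b = q" "l = control_length a b u"
    using assms by (auto simp: reaches_def)
  show ?thesis unfolding reaches_def
    using horizontal_curve_reverse[OF *(2)] *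
    by (intro exI[of _ "-b"] exI[of _ "-a"] exI[of _ "\<lambda>t. \<gamma> (- t)"] exI[of _ "\<lambda>t. - u (- t)"]) auto
qed

lemma reaches_trans:
  assumes "reaches p q l" "reaches q r k" shows "reaches p r (l + k)"
proof -
  obtain a b \<gamma> u where 1: "a < b" "horizontal_curve a b \<gamma> u" "\<gamma> a = p" "\<gamma> b = q" "l = control_length a b u"
    using assms by (auto simp: reaches_def)
  obtain c d \<eta> w where 2: "c < d" "horizontal_curve c d \<eta> w" "\<eta> c = q" "\<eta> d = r" "k = control_length c d w"
    using assms by (auto simp: reaches_def)
  define s where "s = b - c"
  have cs: "c + s = b" by (simp add: s_def)
  have sh: "horizontal_curve b (d + s) (\<lambda>t. \<eta> (t - s)) (\<lambda>t. w (t - s))"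
    "control_length b (d + s) (\<lambda>t. w (t - s)) = k"
    using horizontal_curve_shift[OF 2(2), of s] cs 2(5) by auto
  have eq: "\<gamma> b = \<eta> (b - s)" and bd: "b < d + s" using 1 2 by (auto simp: s_def)
  note j = horizontal_curve_join[OF 1(2) sh(1) eq 1(1) bd]
  have "\<exists>\<theta> v. horizontal_curve a (d + s) \<theta> v \<and> \<theta> a = p \<and> \<theta> (d + s) = r \<and>
      l + k = control_length a (d + s) v"
    using j 1 2(4) sh(2) bd
    by (intro exI[of _ "\<lambda>t. if t \<le> b then \<gamma> t else \<eta> (t - s)"]
        exI[of _ "\<lambda>t. if t \<le> b then u t else w (t - s)"]) auto
  moreover have "a < d + s" using 1(1) bd by simp
  ultimately show ?thesis unfolding reaches_def by blast
qed

lemma reaches_straight: "reaches p (heis_mult p (\<zeta>, 0)) (norm \<zeta>)"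
proof -
  define \<gamma> where "\<gamma> t = p + t *\<^sub>R (\<zeta>, symp (fst p) \<zeta>)" for t :: real
  have "abs_continuous_curve 0 1 \<gamma>"
  proof (rule abs_continuous_curve_lipschitz)
    fix s t :: real assume "s \<le> t"
    have "\<gamma> t - \<gamma> s = (t - s) *\<^sub>R (\<zeta>, symp (fst p) \<zeta>)"
      by (simp add: \<gamma>_def algebra_simps)
    then show "norm (\<gamma> t - \<gamma> s) \<le> norm (\<zeta>, symp (fst p) \<zeta>) * (t - s)"
      using \<open>s \<le> t\<close> by (simp del: scaleR_Pair add: mult.commute)
  qed
  moreover have "(\<gamma> has_vector_derivative (\<zeta>, symp (fst (\<gamma> t)) \<zeta>)) (at t within {0..1})" for t
  proof -
    have "(\<gamma> has_vector_derivative (\<zeta>, symp (fst p) \<zeta>)) (at t within {0..1})"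
      unfolding \<gamma>_def by (auto intro!: derivative_eq_intros simp del: scaleR_Pair)
    then show ?thesis by (simp add: \<gamma>_def symp_simps)
  qed
  ultimately have h: "horizontal_curve 0 1 \<gamma> (\<lambda>_. \<zeta>)"
    unfolding horizontal_curve_iff
    by (auto intro!: exI[of _ "{}"] absolutely_integrable_onI integrable_const_ivl)
  show ?thesis unfolding reaches_def
    by (intro exI[of _ 0] exI[of _ 1] exI[of _ \<gamma>] exI[of _ "\<lambda>_. \<zeta>"])
       (use h in \<open>auto simp: \<gamma>_def control_length_def heis_mult_def prod_eq_iff\<close>)
qed

text \<open>A vertical displacement is the commutator of two horizontal ones: a square of side
  \<open>sqrt (\<bar>\<sigma>\<bar> / 2)\<close> in the plane of a conjugate pair of coordinates lifts to a curve that ends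
  at height \<open>\<sigma>\<close>.\<close>

lemma reaches_vertical: "reaches p (heis_mult p (0, \<sigma>)) (4 * sqrt (\<bar>\<sigma>\<bar> / 2))"
proof -
  fix i :: 'a
  define \<beta> where "\<beta> = sqrt (\<bar>\<sigma>\<bar> / 2)"
  define \<alpha> where "\<alpha> = - sgn \<sigma> * \<beta>"
  define e where "e = ((\<alpha> *\<^sub>R axis i 1, 0) :: 'a plane)"
  define f where "f = ((0, \<beta> *\<^sub>R axis i 1) :: 'a plane)"
  have "\<beta> \<ge> 0" by (simp add: \<beta>_def)
  have "\<alpha> * \<beta> = - sgn \<sigma> * (\<beta> * \<beta>)" by (simp add: \<alpha>_def)
  also have "\<dots> = - \<sigma> / 2" by (simp add: \<beta>_def sgn_if)
  finally have ab: "\<alpha> * \<beta> = - \<sigma> / 2" .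
  have ef: "symp e f = - (\<alpha> * \<beta>)"
    by (simp add: symp_def e_def f_def inner_axis_axis)
  have norms: "norm e \<le> \<beta>" "norm f = \<beta>"
    using \<open>\<beta> \<ge> 0\<close> by (auto simp: e_def f_def norm_Pair norm_axis_1 \<alpha>_def sgn_if)
  have n0: "norm e = \<beta>"
    using \<open>\<beta> \<ge> 0\<close> by (cases "\<sigma> = 0") (auto simp: e_def norm_Pair norm_axis_1 \<alpha>_def sgn_if \<beta>_def)
  have "heis_mult (heis_mult (heis_mult (heis_mult p (e, 0)) (f, 0)) (- e, 0)) (- f, 0) = heis_mult p (0, \<sigma>)"
    using ab ef symp_flip[of f e] by (simp add: heis_mult_def symp_simps)
  moreover have "reaches p (heis_mult (heis_mult (heis_mult (heis_mult p (e, 0)) (f, 0)) (- e, 0)) (- f, 0))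
      (norm e + norm f + norm (- e) + norm (- f))"
    by (intro reaches_trans[OF _ reaches_straight] reaches_straight)
  ultimately show ?thesis
    using n0 norms by (simp add: \<beta>_def)
qed

text \<open>The length of an explicit curve from \<open>p\<close> to \<open>q\<close>: a horizontal segment over the planar
  displacement, followed by a square loop that corrects the height.\<close>

definition heis_bound :: "'d::finite heis \<Rightarrow> 'd heis \<Rightarrow> real" where
  "heis_bound p q = norm (fst q - fst p) + 4 * sqrt (\<bar>snd q - snd p - symp (fst p) (fst q)\<bar> / 2)"

lemma reaches_bound: "reaches p q (heis_bound p q)"
proof -
  have "heis_mult (heis_mult p (fst q - fst p, 0)) (0, snd q - snd p - symp (fst p) (fst q)) = q"
    by (simp add: heis_mult_def symp_simps)
  then show ?thesis
    using reaches_trans[OF reaches_straight reaches_vertical,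
        of p "fst q - fst p" "snd q - snd p - symp (fst p) (fst q)"]
    by (simp add: heis_bound_def)
qed

text \<open>Along a horizontal curve that starts at the origin the planar part stays within the
  length \<open>l\<close>, and the height is the integral of \<open>symp z u\<close>, at most \<open>l\<close> times the speed.\<close>

lemma reaches_zero_lower:
  assumes "reaches 0 g l" shows "norm (fst g) \<le> l" "\<bar>snd g\<bar> \<le> l\<^sup>2"
proof -
  obtain a b \<gamma> u where 1: "a < b" "horizontal_curve a b \<gamma> u" "\<gamma> a = 0" "\<gamma> b = g" "l = control_length a b u"
    using assms by (auto simp: reaches_def)
  have int: "((\<lambda>s. (u s, symp (fst (\<gamma> s)) (u s))) has_integral \<gamma> t) {a..t}" if "a < t" "t \<le> b" for t
  proof -
    have "horizontal_curve a t \<gamma> u" using horizontal_curve_subinterval[OF 1(2)] that by simp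
    then obtain E where "abs_continuous_curve a t \<gamma>" "negligible E" "\<And>s. s \<in> {a..t} - E \<Longrightarrow>
      (\<gamma> has_vector_derivative (u s, symp (fst (\<gamma> s)) (u s))) (at s within {a..t})"
      by (auto simp: horizontal_curve_iff)
    from abs_continuous_curve_has_integral[OF this(1) that(1) this(2,3)]
    show ?thesis using 1(3) by simp
  qed
  have nu: "(\<lambda>s. norm (u s)) integrable_on {a..t}" if "t \<le> b" for t
    using horizontal_curve_subinterval[OF 1(2) _ that, of a]
    by (simp add: horizontal_curve_iff absolutely_integrable_on_def)
  have planar: "norm (fst (\<gamma> t)) \<le> l" if "a \<le> t" "t \<le> b" for t
  proof (cases "a = t")
    case True
    then show ?thesis using 1 control_length_nonneg[of a b u] by auto
  next
    case False
    then have "a < t" using that by simp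
    have ui: "(u has_integral fst (\<gamma> t)) {a..t}"
      using has_integral_linear[OF int[OF \<open>a < t\<close> that(2)] bounded_linear_fst] by (simp add: o_def)
    then have "fst (\<gamma> t) = integral {a..t} u" by (simp add: integral_unique)
    also have "norm \<dots> \<le> control_length a t u"
      unfolding control_length_def using ui nu[OF that(2)]
      by (intro integral_norm_bound_integral) auto
    also have "\<dots> \<le> l" using control_length_subinterval[OF 1(2) _ that(2), of a] 1(5) by simp
    finally show ?thesis .
  qed
  show "norm (fst g) \<le> l" using planar[of b] 1 by simp
  have si: "((\<lambda>s. symp (fst (\<gamma> s)) (u s)) has_integral snd g) {a..b}"
    using has_integral_linear[OF int[OF \<open>a < b\<close> order_refl] bounded_linear_snd] 1 by (simp add: o_def)
  have "norm (integral {a..b} (\<lambda>s. symp (fst (\<gamma> s)) (u s))) \<le> integral {a..b} (\<lambda>s. l * norm (u s))"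
  proof (rule integral_norm_bound_integral)
    show "(\<lambda>s. l * norm (u s)) integrable_on {a..b}" using integrable_cmul[OF nu[of b], of l] by simp
    show "norm (symp (fst (\<gamma> s)) (u s)) \<le> l * norm (u s)" if "s \<in> {a..b}" for s
      using planar[of s] that
      by (auto intro!: order_trans[OF abs_symp_le] mult_right_mono)
  qed (use si in auto)
  also have "\<dots> = l\<^sup>2" using 1(5) by (simp add: control_length_def power2_eq_square)
  finally show "\<bar>snd g\<bar> \<le> l\<^sup>2" using si by (simp add: integral_unique)
qed

lemma reaches_nonneg: "reaches p q l \<Longrightarrow> 0 \<le> l"
  by (auto simp: reaches_def control_length_nonneg)

lemma cc_dist_le: "reaches p q l \<Longrightarrow> cc_dist p q \<le> l"
  unfolding cc_dist_eq by (rule cInf_lower) (auto intro: bdd_belowI[of _ 0] reaches_nonneg)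

lemma cc_dist_ge: "(\<And>l. reaches p q l \<Longrightarrow> c \<le> l) \<Longrightarrow> c \<le> cc_dist p q"
  unfolding cc_dist_eq using reaches_bound[of p q] by (intro cInf_greatest) auto

lemma cc_dist_nonneg [simp]: "0 \<le> cc_dist p q"
  by (rule cc_dist_ge) (rule reaches_nonneg)

lemma cc_dist_commute: "cc_dist p q = cc_dist q p"
  unfolding cc_dist_eq by (rule arg_cong[of _ _ Inf]) (auto intro: reaches_sym)

lemma cc_dist_left_mult [simp]: "cc_dist (heis_mult g p) (heis_mult g q) = cc_dist p q"
proof -
  have "reaches (heis_mult g p) (heis_mult g q) l \<longleftrightarrow> reaches p q l" for l
    using reaches_left_mult[of "heis_mult g p" "heis_mult g q" l "- g"] reaches_left_mult[of p q l g] by auto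
  then show ?thesis by (simp add: cc_dist_eq)
qed

lemma cc_dist_zero_left: "cc_dist p q = cc_dist 0 (heis_mult (- p) q)"
  using cc_dist_left_mult[of "- p" p q] by simp

lemma cc_dist_triangle: "cc_dist p r \<le> cc_dist p q + cc_dist q r"
proof -
  have "cc_dist p r - l \<le> cc_dist q r" if "reaches p q l" for l
  proof (rule cc_dist_ge)
    fix k assume "reaches q r k"
    then show "cc_dist p r - l \<le> k" using cc_dist_le[OF reaches_trans[OF that]] by fastforce
  qed
  then have "cc_dist p r - cc_dist q r \<le> cc_dist p q"
    by (intro cc_dist_ge) fastforce
  then show ?thesis by simp
qed

lemma cc_dist_le_bound: "cc_dist p q \<le> heis_bound p q"
  by (rule cc_dist_le[OF reaches_bound])

lemma cc_dist_zero_lower: "norm (fst g) \<le> cc_dist 0 g" "\<bar>snd g\<bar> \<le> (cc_dist 0 g)\<^sup>2"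
proof -
  show "norm (fst g) \<le> cc_dist 0 g" by (rule cc_dist_ge) (rule reaches_zero_lower)
  have "sqrt \<bar>snd g\<bar> \<le> cc_dist 0 g"
  proof (rule cc_dist_ge)
    fix l assume "reaches 0 g l"
    from reaches_zero_lower(2)[OF this] reaches_nonneg[OF this]
    show "sqrt \<bar>snd g\<bar> \<le> l" by (intro real_le_lsqrt) auto
  qed
  then show "\<bar>snd g\<bar> \<le> (cc_dist 0 g)\<^sup>2"
    by (rule sqrt_le_D)
qed

lemma cc_dist_same [simp]: "cc_dist p p = 0"
proof -
  have "heis_bound p p = 0" by (simp add: heis_bound_def)
  then show ?thesis using cc_dist_le_bound[of p p] cc_dist_nonneg[of p p] by linarith
qed

lemma cc_dist_eq_0_iff [simp]: "cc_dist p q = 0 \<longleftrightarrow> p = q"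
proof
  assume "cc_dist p q = 0"
  then have "cc_dist 0 (heis_mult (- p) q) = 0" by (simp add: cc_dist_zero_left[symmetric])
  then have "heis_mult (- p) q = 0" using cc_dist_zero_lower[of "heis_mult (- p) q"] by (simp add: prod_eq_iff)
  then have "heis_mult p (heis_mult (- p) q) = p" by simp
  then show "p = q" by simp
qed simp

lemma Metric_space_cc_dist: "Metric_space UNIV cc_dist"
  by unfold_locales (auto simp: cc_dist_commute cc_dist_triangle)

lemma mspace_heis_metric [simp]: "mspace heis_metric = UNIV"
  and mdist_heis_metric [simp]: "mdist heis_metric = cc_dist"
  unfolding heis_metric_def
  using Metric_space.mspace_metric[OF Metric_space_cc_dist] Metric_space.mdist_metric[OF Metric_space_cc_dist]
  by auto

lemma heis_bound_same [simp]: "heis_bound p p = 0"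
  by (simp add: heis_bound_def)

lemma tendsto_heis_bound:
  assumes "(f \<longlongrightarrow> p) F" "(g \<longlongrightarrow> q) F"
  shows "((\<lambda>x. heis_bound (f x) (g x)) \<longlongrightarrow> heis_bound p q) F"
  unfolding heis_bound_def symp_def using assms by (auto intro!: tendsto_intros)

text \<open>The explicit bound vanishes continuously on the diagonal, so the distance is continuous for the
  Euclidean topology.\<close>

lemma tendsto_cc_dist:
  assumes "(f \<longlongrightarrow> p) F" "(g \<longlongrightarrow> q) F"
  shows "((\<lambda>x. cc_dist (f x) (g x)) \<longlongrightarrow> cc_dist p q) F"
proof -
  have "((\<lambda>x. heis_bound p (f x) + heis_bound q (g x)) \<longlongrightarrow> heis_bound p p + heis_bound q q) F"
    by (intro tendsto_add tendsto_heis_bound tendsto_const assms)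
  then have "((\<lambda>x. heis_bound p (f x) + heis_bound q (g x)) \<longlongrightarrow> 0) F" by simp
  then have "((\<lambda>x. cc_dist (f x) (g x) - cc_dist p q) \<longlongrightarrow> 0) F"
  proof (rule Lim_null_comparison[rotated], intro always_eventually allI)
    fix x
    have "cc_dist (f x) (g x) \<le> cc_dist (f x) p + cc_dist p q + cc_dist q (g x)"
      "cc_dist p q \<le> cc_dist p (f x) + cc_dist (f x) (g x) + cc_dist (g x) q"
      using cc_dist_triangle[of "f x" "g x" p] cc_dist_triangle[of p "g x" q]
        cc_dist_triangle[of p q "f x"] cc_dist_triangle[of "f x" q "g x"] by linarith+
    then show "norm (cc_dist (f x) (g x) - cc_dist p q) \<le> heis_bound p (f x) + heis_bound q (g x)"
      using cc_dist_le_bound[of p "f x"] cc_dist_le_bound[of q "g x"]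
        cc_dist_commute[of p "f x"] cc_dist_commute[of q "g x"] by simp
  qed
  then show ?thesis by (simp add: LIM_zero_iff)
qed

lemma continuous_on_cc_dist [continuous_intros]:
  "continuous_on S f \<Longrightarrow> continuous_on S g \<Longrightarrow> continuous_on S (\<lambda>x. cc_dist (f x) (g x))"
  unfolding continuous_on_def by (auto intro: tendsto_cc_dist)

lemma open_heis_metric:
  assumes "openin (mtopology_of heis_metric) U" shows "open U"
proof (rule openI)
  interpret H: Metric_space UNIV "cc_dist :: 'a heis \<Rightarrow> _" by (rule Metric_space_cc_dist)
  have U: "openin H.mtopology U" using assms by (simp add: mtopology_of_def)
  fix x assume "x \<in> U"
  then obtain r where r: "r > 0" "H.mball x r \<subseteq> U" using U unfolding H.openin_mtopology by blast
  have "open {y. cc_dist x y < r}"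
    by (intro open_Collect_less continuous_intros)
  then obtain e where "e > 0" "ball x e \<subseteq> {y. cc_dist x y < r}"
    using r(1) cc_dist_same[of x] unfolding open_contains_ball by (metis mem_Collect_eq)
  then show "\<exists>e>0. ball x e \<subseteq> U" using r(2) by (auto simp: H.mball_def)
qed

lemma continuous_map_heis_metric:
  assumes "continuous_on S f"
  shows "continuous_map (top_of_set S) (mtopology_of heis_metric) f"
proof -
  have "continuous_map (top_of_set S) euclidean f" using assms by simp
  then show ?thesis
    using open_heis_metric unfolding continuous_map_def by (auto simp: openin_open)
qed

text \<open>An initial piece of a shortest curve is at most as long as the whole curve.\<close>

lemma shortest_geodesic_dist_le:
  assumes "shortest_geodesic 0 h p q \<gamma>" "0 \<le> t" "t \<le> h"
  shows "cc_dist p (\<gamma> t) \<le> cc_dist p q"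
proof (cases "t = 0")
  case True
  then show ?thesis using assms by (simp add: shortest_geodesic_def)
next
  case False
  obtain u where u: "horizontal_curve 0 h \<gamma> u" "control_length 0 h u = cc_dist p q" "\<gamma> 0 = p"
    using assms by (auto simp: shortest_geodesic_def)
  have "reaches p (\<gamma> t) (control_length 0 t u)"
    unfolding reaches_def using horizontal_curve_subinterval[OF u(1), of 0 t] assms False u(3)
    by (intro exI[of _ 0] exI[of _ t] exI[of _ \<gamma>] exI[of _ u]) auto
  then show ?thesis
    using cc_dist_le[of p "\<gamma> t"] control_length_subinterval[OF u(1), of 0 t] assms(3) u(2) by force
qed

section \<open>Weak convergence and measurability in metric spaces\<close>

lemma space_borel_of_topology [simp]: "space (borel_of_topology S) = topspace S"
  unfolding borel_of_topology_def by (rule space_measure_of) (auto dest: openin_subset)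

lemma openin_borel_of_topology: "openin S U \<Longrightarrow> U \<in> sets (borel_of_topology S)"
  unfolding borel_of_topology_def by (subst sets_measure_of) (auto dest: openin_subset)

lemma measurable_borel_of_topologyI:
  assumes "f \<in> space M \<rightarrow> topspace S" "\<And>U. openin S U \<Longrightarrow> f -` U \<inter> space M \<in> sets M"
  shows "f \<in> measurable M (borel_of_topology S)"
  unfolding borel_of_topology_def
  by (rule measurable_measure_of) (use assms in \<open>auto dest: openin_subset\<close>)

lemma continuous_map_borel_measurable:
  fixes f :: "'a \<Rightarrow> real"
  assumes "continuous_map S euclidean f"
  shows "f \<in> borel_measurable (borel_of_topology S)"
proof (rule borel_measurableI)
  fix U :: "real set" assume "open U"
  then have "openin S {x \<in> topspace S. f x \<in> U}"
    using assms by (auto simp: continuous_map_def)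
  moreover have "f -` U \<inter> space (borel_of_topology S) = {x \<in> topspace S. f x \<in> U}" by auto
  ultimately show "f -` U \<inter> space (borel_of_topology S) \<in> sets (borel_of_topology S)"
    using openin_borel_of_topology by metis
qed

text \<open>A pointwise limit of measurable maps into a metric space is measurable: an open set \<open>U\<close>
  contains the limit iff for some \<open>j\<close> the maps are eventually in the open set of points whose
  ball of some radius above \<open>1 / (j + 1)\<close> lies in \<open>U\<close>.\<close>

lemma measurable_metric_limit:
  fixes m :: "'a metric"
  assumes f: "\<And>k. f k \<in> measurable M (borel_of_topology (mtopology_of m))"
    and g: "\<And>\<omega>. \<omega> \<in> space M \<Longrightarrow> g \<omega> \<in> mspace m"
    and lim: "\<And>\<omega>. \<omega> \<in> space M \<Longrightarrow> (\<lambda>k. mdist m (f k \<omega>) (g \<omega>)) \<longlonglongrightarrow> 0"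
  shows "g \<in> measurable M (borel_of_topology (mtopology_of m))"
proof (rule measurable_borel_of_topologyI)
  interpret m: Metric_space "mspace m" "mdist m" by (rule Metric_space_mspace_mdist)
  show "g \<in> space M \<rightarrow> topspace (mtopology_of m)" using g by auto
  fix U assume U: "openin (mtopology_of m) U"
  then have U': "U \<subseteq> mspace m" "\<And>x. x \<in> U \<Longrightarrow> \<exists>r>0. m.mball x r \<subseteq> U"
    unfolding mtopology_of_def m.openin_mtopology by auto
  define V where "V j = {x \<in> mspace m. \<exists>\<epsilon>>1 / real (Suc j). m.mball x \<epsilon> \<subseteq> U}" for j
  have V: "openin (mtopology_of m) (V j)" for j
    unfolding mtopology_of_def m.openin_mtopology
  proof (intro conjI allI impI)
    fix x assume "x \<in> V j"
    then obtain \<epsilon> where x: "x \<in> mspace m" "\<epsilon> > 1 / real (Suc j)" "m.mball x \<epsilon> \<subseteq> U"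
      by (auto simp: V_def)
    have "y \<in> V j" if y: "y \<in> m.mball x (\<epsilon> - 1 / real (Suc j))" for y
    proof -
      have "m.mball y (\<epsilon> - mdist m x y) \<subseteq> m.mball x \<epsilon>"
        using y by (intro m.mball_subset) (auto simp: m.commute)
      then show ?thesis using x y by (auto simp: V_def intro!: exI[of _ "\<epsilon> - mdist m x y"])
    qed
    then show "\<exists>r>0. m.mball x r \<subseteq> V j" using x by (intro exI[of _ "\<epsilon> - 1 / real (Suc j)"]) auto
  qed (auto simp: V_def)
  have fin: "f k \<omega> \<in> mspace m" if "\<omega> \<in> space M" for k \<omega>
    using measurable_space[OF f that] by simp
  have "g \<omega> \<in> U \<longleftrightarrow> (\<exists>j K. \<forall>k\<ge>K. f k \<omega> \<in> V j)" if \<omega>: "\<omega> \<in> space M" for \<omega>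
  proof
    assume "g \<omega> \<in> U"
    then obtain r where r: "r > 0" "m.mball (g \<omega>) r \<subseteq> U" using U' by blast
    obtain j where j: "1 / real (Suc j) < r / 2" using r(1) by (metis half_gt_zero nat_approx_posE)
    obtain K where K: "\<And>k. k \<ge> K \<Longrightarrow> mdist m (f k \<omega>) (g \<omega>) < r / 2"
      using LIMSEQ_D[OF lim[OF \<omega>], of "r / 2"] r(1) by auto
    have "f k \<omega> \<in> V j" if "k \<ge> K" for k
    proof -
      have "m.mball (f k \<omega>) (r / 2) \<subseteq> m.mball (g \<omega>) r"
        using K[OF that] fin[OF \<omega>] g[OF \<omega>] by (intro m.mball_subset) (auto simp: m.commute)
      then show ?thesis using j r fin[OF \<omega>] by (auto simp: V_def intro!: exI[of _ "r / 2"])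
    qed
    then show "\<exists>j K. \<forall>k\<ge>K. f k \<omega> \<in> V j" by blast
  next
    assume "\<exists>j K. \<forall>k\<ge>K. f k \<omega> \<in> V j"
    then obtain j K where jK: "\<And>k. k \<ge> K \<Longrightarrow> f k \<omega> \<in> V j" by blast
    obtain K' where K': "\<And>k. k \<ge> K' \<Longrightarrow> mdist m (f k \<omega>) (g \<omega>) < 1 / real (Suc j)"
      using LIMSEQ_D[OF lim[OF \<omega>], of "1 / real (Suc j)"] by auto
    obtain \<epsilon> where e: "\<epsilon> > 1 / real (Suc j)" "m.mball (f (max K K') \<omega>) \<epsilon> \<subseteq> U"
      using jK[of "max K K'"] by (auto simp: V_def)
    have "g \<omega> \<in> m.mball (f (max K K') \<omega>) \<epsilon>"
      using K'[of "max K K'"] e(1) fin[OF \<omega>] g[OF \<omega>] by simp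
    then show "g \<omega> \<in> U" using e(2) by blast
  qed
  then have "g -` U \<inter> space M = {\<omega> \<in> space M. \<exists>j K. \<forall>k\<ge>K. f k \<omega> \<in> V j}"
    by blast
  moreover have [measurable]: "Measurable.pred M (\<lambda>\<omega>. f k \<omega> \<in> V j)" for k j
    using measurable_sets[OF f openin_borel_of_topology[OF V]] by (simp add: pred_def vimage_def Int_def conj_commute)
  have "{\<omega> \<in> space M. \<exists>j K. \<forall>k\<ge>K. f k \<omega> \<in> V j} \<in> sets M"
    by measurable
  ultimately show "g -` U \<inter> space M \<in> sets M" by simp
qed

text \<open>Lipschitz functions determine weak convergence: a bounded continuous \<open>f\<close> is the increasing
  limit of its Lipschitz inf-convolutions \<open>\<lambda>x. INF y. f y + k * d x y\<close>; this bounds the limit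
  inferior of the integrals from below, and the same argument applies to \<open>- f\<close>.\<close>

lemma weakly_convergent_to_lipschitzI:
  fixes m :: "'a metric" and \<mu> :: "nat \<Rightarrow> 'a measure"
  assumes pr: "\<And>n. n \<ge> 1 \<Longrightarrow> prob_space (\<mu> n)" "prob_space \<nu>"
    and sets: "\<And>n. sets (\<mu> n) = sets (borel_of_topology (mtopology_of m))"
      "sets \<nu> = sets (borel_of_topology (mtopology_of m))"
    and lip: "\<And>f K C. (\<And>x y. x \<in> mspace m \<Longrightarrow> y \<in> mspace m \<Longrightarrow> \<bar>f x - f y\<bar> \<le> K * mdist m x y) \<Longrightarrow>
      (\<And>x. x \<in> mspace m \<Longrightarrow> \<bar>f x\<bar> \<le> C) \<Longrightarrow> 0 \<le> K \<Longrightarrow>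
      f \<in> borel_measurable (borel_of_topology (mtopology_of m)) \<Longrightarrow>
      (\<lambda>n. \<integral>x. f x \<partial>\<mu> n) \<longlonglongrightarrow> (\<integral>x. f x \<partial>\<nu>)"
  shows "weakly_convergent_to (mtopology_of m) \<mu> \<nu>"
proof -
  interpret m: Metric_space "mspace m" "mdist m" by (rule Metric_space_mspace_mdist)
  have spaces: "space (\<mu> n) = mspace m" "space \<nu> = mspace m" for n
    using sets_eq_imp_space_eq[OF sets(1)] sets_eq_imp_space_eq[OF sets(2)] by auto
  have m\<nu>: "h \<in> borel_measurable \<nu>" and m\<mu>: "h \<in> borel_measurable (\<mu> n)"
    if "h \<in> borel_measurable (borel_of_topology (mtopology_of m))" for h :: "'a \<Rightarrow> real" and n
    using that measurable_cong_sets[OF sets(1) refl] measurable_cong_sets[OF sets(2) refl] by blast+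
  have ne: "mspace m \<noteq> {}" using prob_space.not_empty[OF pr(2)] spaces by simp
  have cm: "continuous_map (mtopology_of m) euclidean h"
    if "\<And>x y. x \<in> mspace m \<Longrightarrow> y \<in> mspace m \<Longrightarrow> \<bar>h x - h y\<bar> \<le> K * mdist m x y" "0 \<le> K" for h :: "'a \<Rightarrow> real" and K
  proof -
    have "openin m.mtopology {x \<in> mspace m. h x \<in> U}" if "open U" for U
      unfolding m.openin_mtopology
    proof (intro conjI allI impI)
      fix x assume x: "x \<in> {x \<in> mspace m. h x \<in> U}"
      then obtain e where e: "e > 0" "\<And>z. \<bar>z - h x\<bar> < e \<Longrightarrow> z \<in> U"
        using \<open>open U\<close> by (auto simp: open_dist dist_real_def)
      have "h y \<in> U" if "y \<in> m.mball x (e / (K + 1))" for y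
      proof -
        have "\<bar>h y - h x\<bar> \<le> K * mdist m y x" using that x \<open>\<And>x y. _ \<Longrightarrow> _ \<Longrightarrow> \<bar>h x - h y\<bar> \<le> _\<close> by auto
        also have "\<dots> \<le> (K + 1) * mdist m y x" by (intro mult_right_mono) auto
        also have "\<dots> < e" using that \<open>0 \<le> K\<close> by (simp add: m.commute field_simps)
        finally show ?thesis using e by blast
      qed
      then show "\<exists>r>0. m.mball x r \<subseteq> {x \<in> mspace m. h x \<in> U}"
        using e(1) \<open>0 \<le> K\<close> by (intro exI[of _ "e / (K + 1)"]) auto
    qed auto
    then show ?thesis by (auto simp: continuous_map_def mtopology_of_def)
  qed
  have lower: "\<forall>\<^sub>F n in sequentially. (\<integral>x. f x \<partial>\<nu>) - e < (\<integral>x. f x \<partial>\<mu> n)"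
    if f: "continuous_map (mtopology_of m) euclidean f" and C: "\<And>x. x \<in> mspace m \<Longrightarrow> \<bar>f x\<bar> \<le> C" and "0 < e"
    for f :: "'a \<Rightarrow> real" and C e
  proof -
    define F where "F k x = (INF y\<in>mspace m. f y + real k * mdist m x y)" for k :: nat and x
    have "C \<ge> 0" using ne C by (metis abs_ge_zero ex_in_conv order_trans)
    have bdd: "bdd_below ((\<lambda>y. f y + real k * mdist m x y) ` mspace m)" for k x
    proof (rule bdd_belowI2[of _ "-C"])
      fix y assume "y \<in> mspace m"
      then have "- C \<le> f y" using C[of y] by linarith
      moreover have "0 \<le> real k * mdist m x y" by simp
      ultimately show "- C \<le> f y + real k * mdist m x y" by linarith
    qed
    have Fle: "F k x \<le> f y + real k * mdist m x y" if "y \<in> mspace m" for k x y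
      unfolding F_def using that by (intro cINF_lower bdd)
    have Fge: "c \<le> F k x" if "\<And>y. y \<in> mspace m \<Longrightarrow> c \<le> f y + real k * mdist m x y" for c k x
      unfolding F_def using that ne by (intro cINF_greatest)
    have Ff: "F k x \<le> f x" if "x \<in> mspace m" for k x
      using Fle[OF that, of k x] that by simp
    have FC: "\<bar>F k x\<bar> \<le> C" if x: "x \<in> mspace m" for k x
    proof -
      have "- C \<le> F k x"
      proof (rule Fge)
        fix y assume "y \<in> mspace m"
        then have "- C \<le> f y" using C[of y] by linarith
        moreover have "0 \<le> real k * mdist m x y" by simp
        ultimately show "- C \<le> f y + real k * mdist m x y" by linarith
      qed
      then show ?thesis using Ff[OF x, of k] C[OF x] by linarith
    qed
    have lip1: "F k x - F k y \<le> real k * mdist m x y" if "x \<in> mspace m" "y \<in> mspace m" for k x y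
    proof -
      have "F k x - real k * mdist m x y \<le> F k y"
      proof (rule Fge)
        fix z assume z: "z \<in> mspace m"
        have "real k * mdist m x z \<le> real k * (mdist m x y + mdist m y z)"
          using m.triangle[of x y z] that z by (intro mult_left_mono) auto
        then show "F k x - real k * mdist m x y \<le> f z + real k * mdist m y z"
          using Fle[OF z, of k x] by (simp add: distrib_left)
      qed
      then show ?thesis by simp
    qed
    have Flip: "\<bar>F k x - F k y\<bar> \<le> real k * mdist m x y" if "x \<in> mspace m" "y \<in> mspace m" for k x y
      using lip1[of x y k] lip1[of y x k] that by (simp add: m.commute abs_le_iff)
    have meas: "F k \<in> borel_measurable (borel_of_topology (mtopology_of m))" for k
      by (rule continuous_map_borel_measurable[OF cm[OF Flip]]) auto
    have fmeas: "f \<in> borel_measurable (borel_of_topology (mtopology_of m))"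
      by (rule continuous_map_borel_measurable[OF f])
    have Flim: "(\<lambda>k. F k x) \<longlonglongrightarrow> f x" if x: "x \<in> mspace m" for x
    proof (rule LIMSEQ_I)
      fix \<delta> :: real assume "0 < \<delta>"
      have "openin m.mtopology {y \<in> mspace m. f y \<in> {f x - \<delta> / 2<..}}"
        using f unfolding continuous_map_def mtopology_of_def by (simp del: greaterThan_iff)
      then obtain r where r: "r > 0" "m.mball x r \<subseteq> {y \<in> mspace m. f y \<in> {f x - \<delta> / 2<..}}"
        using x \<open>0 < \<delta>\<close> unfolding m.openin_mtopology by force
      obtain k0 where k0: "2 * C / r < real k0" using reals_Archimedean2 by blast
      have "norm (F k x - f x) < \<delta>" if "k \<ge> k0" for k
      proof -
        have "f x - \<delta> / 2 \<le> F k x"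
        proof (rule Fge)
          fix y assume y: "y \<in> mspace m"
          show "f x - \<delta> / 2 \<le> f y + real k * mdist m x y"
          proof (cases "mdist m x y < r")
            case True
            then have "f x - \<delta> / 2 \<le> f y" using r(2) x y by (auto simp: subset_iff less_imp_le)
            moreover have "0 \<le> real k * mdist m x y" by simp
            ultimately show ?thesis by linarith
          next
            case False
            have "2 * C \<le> real k0 * r" using k0 r(1) by (simp add: field_simps)
            also have "\<dots> \<le> real k * mdist m x y" using False r(1) that by (intro mult_mono) auto
            finally show ?thesis using C[OF x] C[OF y] \<open>0 < \<delta>\<close> by linarith
          qed
        qed
        then show ?thesis using Ff[OF x, of k] \<open>0 < \<delta>\<close> by auto
      qed
      then show "\<exists>no. \<forall>n\<ge>no. norm (F n x - f x) < \<delta>" by blast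
    qed
    have "(\<lambda>k. \<integral>x. F k x \<partial>\<nu>) \<longlonglongrightarrow> (\<integral>x. f x \<partial>\<nu>)"
    proof (rule integral_dominated_convergence[where w = "\<lambda>_. C"])
      interpret prob_space \<nu> by fact
      show "integrable \<nu> (\<lambda>_. C)" by simp
    qed (use m\<nu>[OF meas] m\<nu>[OF fmeas] FC Flim in \<open>auto simp: spaces\<close>)
    then have "\<forall>\<^sub>F k in sequentially. (\<integral>x. f x \<partial>\<nu>) - e < (\<integral>x. F k x \<partial>\<nu>)"
      using \<open>0 < e\<close> by (intro order_tendstoD(1)) auto
    then obtain k where k: "(\<integral>x. f x \<partial>\<nu>) - e < (\<integral>x. F k x \<partial>\<nu>)"
      by (auto simp: eventually_sequentially)
    have "(\<lambda>n. \<integral>x. F k x \<partial>\<mu> n) \<longlonglongrightarrow> (\<integral>x. F k x \<partial>\<nu>)"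
      by (rule lip[OF Flip FC _ meas]) auto
    then have "\<forall>\<^sub>F n in sequentially. (\<integral>x. f x \<partial>\<nu>) - e < (\<integral>x. F k x \<partial>\<mu> n)"
      using k by (rule order_tendstoD(1))
    then show ?thesis
    proof (rule eventually_elim2[OF _ eventually_ge_at_top[of 1]])
      fix n :: nat assume *: "(\<integral>x. f x \<partial>\<nu>) - e < (\<integral>x. F k x \<partial>\<mu> n)" and "1 \<le> n"
      interpret prob_space "\<mu> n" using pr \<open>1 \<le> n\<close> by blast
      have "integrable (\<mu> n) (F k)" "integrable (\<mu> n) f"
        using m\<mu>[OF meas] m\<mu>[OF fmeas] C FC
        by (auto simp: spaces intro!: integrable_const_bound[where B = C])
      then have "(\<integral>x. F k x \<partial>\<mu> n) \<le> (\<integral>x. f x \<partial>\<mu> n)"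
        using Ff by (intro integral_mono) (auto simp: spaces)
      with * show "(\<integral>x. f x \<partial>\<nu>) - e < (\<integral>x. f x \<partial>\<mu> n)" by simp
    qed
  qed
  show ?thesis unfolding weakly_convergent_to_def
  proof (intro allI impI, elim conjE)
    fix f :: "'a \<Rightarrow> real" assume f: "continuous_map (mtopology_of m) euclidean f"
      and "bounded (f ` topspace (mtopology_of m))"
    then obtain C where C: "\<And>x. x \<in> mspace m \<Longrightarrow> \<bar>f x\<bar> \<le> C" by (auto simp: bounded_iff)
    show "(\<lambda>n. \<integral>x. f x \<partial>\<mu> n) \<longlonglongrightarrow> (\<integral>x. f x \<partial>\<nu>)"
    proof (rule order_tendstoI)
      fix a assume "a < (\<integral>x. f x \<partial>\<nu>)"
      then show "\<forall>\<^sub>F n in sequentially. a < (\<integral>x. f x \<partial>\<mu> n)"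
        using lower[OF f C, of "(\<integral>x. f x \<partial>\<nu>) - a"] by simp
    next
      fix a assume "(\<integral>x. f x \<partial>\<nu>) < a"
      moreover have "continuous_map (mtopology_of m) euclidean (\<lambda>x. - f x)"
        using f by (rule continuous_map_minus)
      ultimately show "\<forall>\<^sub>F n in sequentially. (\<integral>x. f x \<partial>\<mu> n) < a"
        using lower[of "\<lambda>x. - f x" C "a - (\<integral>x. f x \<partial>\<nu>)"] C by simp
    qed
  qed
qed

section \<open>The path space and piecewise linear paths\<close>

text \<open>On bounded sets the distance has a Euclidean modulus of continuity; the square root comes from
  vertical displacements.\<close>

lemma cc_dist_modulus:
  assumes "norm p \<le> R" "norm (q - p) \<le> a"
  shows "cc_dist p q \<le> a + 4 * sqrt ((1 + R) * a / 2)"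
proof -
  have 1: "norm (fst q - fst p) \<le> a" "\<bar>snd q - snd p\<bar> \<le> a"
    using norm_fst_le[of "fst q - fst p" "snd q - snd p"] norm_snd_le[of "snd q - snd p" "fst q - fst p"]
      assms(2) prod.collapse[of "q - p", symmetric] by (auto simp del: prod.collapse)
  have "norm (fst p) \<le> R" using norm_fst_le[of "fst p" "snd p"] assms(1) by simp
  then have "R \<ge> 0" using norm_ge_zero order_trans by blast
  have "\<bar>symp (fst p) (fst q - fst p)\<bar> \<le> norm (fst p) * norm (fst q - fst p)" by (rule abs_symp_le)
  also have "\<dots> \<le> R * a" using 1 \<open>norm (fst p) \<le> R\<close> \<open>R \<ge> 0\<close> by (intro mult_mono) auto
  finally have "\<bar>snd q - snd p - symp (fst p) (fst q)\<bar> \<le> (1 + R) * a"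
    using 1(2) by (simp add: symp_simps distrib_right)
  then have "4 * sqrt (\<bar>snd q - snd p - symp (fst p) (fst q)\<bar> / 2) \<le> 4 * sqrt ((1 + R) * a / 2)"
    by simp
  then show ?thesis using cc_dist_le_bound[of p q] 1(1) unfolding heis_bound_def by linarith
qed

text \<open>Linear interpolation in the coordinates is linear interpolation in the group, since
  \<open>symp z (\<theta> (z' - z)) = \<theta> symp z z'\<close>; hence it moves by at most a fixed multiple of the distance.\<close>

lemma cc_dist_interpolate:
  assumes "0 \<le> \<theta>" "\<theta> \<le> 1"
  shows "cc_dist p (p + \<theta> *\<^sub>R (q - p)) \<le> 4 * cc_dist p q"
proof -
  define d where "d = cc_dist p q"
  have d: "cc_dist 0 (heis_mult (- p) q) = d" by (simp add: d_def cc_dist_zero_left[symmetric])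
  have 1: "norm (fst q - fst p) \<le> d" "\<bar>snd q - snd p - symp (fst p) (fst q)\<bar> \<le> d\<^sup>2"
    using cc_dist_zero_lower[of "heis_mult (- p) q", unfolded d] by (simp_all add: heis_mult_def symp_simps)
  have "d \<ge> 0" by (simp add: d_def)
  have "cc_dist p (p + \<theta> *\<^sub>R (q - p)) \<le> heis_bound p (p + \<theta> *\<^sub>R (q - p))" by (rule cc_dist_le_bound)
  also have "\<dots> = \<theta> * norm (fst q - fst p) + 4 * sqrt (\<bar>\<theta> * (snd q - snd p - symp (fst p) (fst q))\<bar> / 2)"
    using assms(1) by (simp add: heis_bound_def symp_simps algebra_simps flip: scaleR_diff_right)
  also have "\<dots> \<le> 1 * d + 4 * sqrt (1 * d\<^sup>2 / 2)"
    unfolding abs_mult using 1 assms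
    by (intro add_mono mult_mono mult_left_mono divide_right_mono real_sqrt_le_mono) auto
  also have "\<dots> \<le> 4 * d"
  proof -
    have "sqrt (d\<^sup>2 / 2) \<le> sqrt ((3 / 4 * d)\<^sup>2)"
      by (rule real_sqrt_le_mono) (simp add: power_mult_distrib power2_eq_square field_simps)
    also have "\<dots> = 3 / 4 * d" using \<open>d \<ge> 0\<close> by simp
    finally show ?thesis by simp
  qed
  finally show ?thesis by (simp add: d_def)
qed

definition clamp01 :: "real \<Rightarrow> real" where "clamp01 x = max 0 (min 1 x)"

text \<open>The path through \<open>y 0, \<dots>, y k\<close> at the times \<open>i T / k\<close>, linear in between; written as a sum
  of ramps it is visibly continuous in \<open>t\<close> and in \<open>y\<close>.\<close>

definition linear_path :: "real \<Rightarrow> nat \<Rightarrow> (nat \<Rightarrow> 'a::real_normed_vector) \<Rightarrow> real \<Rightarrow> 'a" where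
  "linear_path T k y t = y 0 + (\<Sum>i<k. clamp01 (real k * t / T - real i) *\<^sub>R (y (Suc i) - y i))"

lemma clamp01_range: "0 \<le> clamp01 x" "clamp01 x \<le> 1"
  by (auto simp: clamp01_def)

lemma continuous_on_linear_path: "continuous_on S (linear_path T k y)"
  unfolding linear_path_def clamp01_def divide_inverse by (intro continuous_intros)

lemma linear_path_segment:
  assumes "j < k" "0 \<le> \<theta>" "\<theta> \<le> 1" "T > 0"
  shows "linear_path T k y ((real j + \<theta>) * T / real k) = y j + \<theta> *\<^sub>R (y (Suc j) - y j)"
proof -
  have [simp]: "real k * ((real j + \<theta>) * T / real k) / T = real j + \<theta>" using assms by simp
  have "(\<Sum>i<k. clamp01 (real j + \<theta> - real i) *\<^sub>R (y (Suc i) - y i)) =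
    (\<Sum>i\<in>{..j}. clamp01 (real j + \<theta> - real i) *\<^sub>R (y (Suc i) - y i))"
  proof (rule sum.mono_neutral_right)
    show "\<forall>i\<in>{..<k} - {..j}. clamp01 (real j + \<theta> - real i) *\<^sub>R (y (Suc i) - y i) = 0"
      using assms by (auto simp: clamp01_def)
  qed (use assms in auto)
  also have "{..j} = insert j {..<j}" by auto
  also have "(\<Sum>i\<in>insert j {..<j}. clamp01 (real j + \<theta> - real i) *\<^sub>R (y (Suc i) - y i)) =
      \<theta> *\<^sub>R (y (Suc j) - y j) + (\<Sum>i<j. clamp01 (real j + \<theta> - real i) *\<^sub>R (y (Suc i) - y i))"
    using assms by (subst sum.insert) (auto simp: clamp01_def)
  also have "(\<Sum>i<j. clamp01 (real j + \<theta> - real i) *\<^sub>R (y (Suc i) - y i)) = (\<Sum>i<j. y (Suc i) - y i)"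
  proof (rule sum.cong[OF refl])
    fix i assume "i \<in> {..<j}"
    then have "real i + 1 \<le> real j" by auto
    then have "clamp01 (real j + \<theta> - real i) = 1" using assms(2) by (auto simp: clamp01_def)
    then show "clamp01 (real j + \<theta> - real i) *\<^sub>R (y (Suc i) - y i) = y (Suc i) - y i" by simp
  qed
  also have "\<dots> = y j - y 0" by (simp add: sum_lessThan_telescope)
  finally show ?thesis using \<open>T > 0\<close> by (simp add: linear_path_def)
qed

lemma grid_segment:
  assumes "0 \<le> t" "t \<le> T" "T > 0" "k > 0"
  obtains j \<theta> where "j < k" "0 \<le> \<theta>" "\<theta> \<le> 1" "t = (real j + \<theta>) * T / real k"
proof (cases "t = T")
  case True
  show ?thesis
    by (rule that[of "k - 1" 1]) (use True assms in \<open>auto simp: of_nat_diff\<close>)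
next
  case False
  define x where "x = real k * t / T"
  have x: "0 \<le> x" "x < real k" using assms False by (auto simp: x_def field_simps)
  show ?thesis
  proof (rule that[of "nat \<lfloor>x\<rfloor>" "x - real (nat \<lfloor>x\<rfloor>)"])
    show "nat \<lfloor>x\<rfloor> < k" using x by (simp add: nat_less_iff floor_less_iff)
    show "0 \<le> x - real (nat \<lfloor>x\<rfloor>)" using x(1) by (simp add: of_nat_floor)
    show "x - real (nat \<lfloor>x\<rfloor>) \<le> 1" using x(1) by linarith
    show "t = (real (nat \<lfloor>x\<rfloor>) + (x - real (nat \<lfloor>x\<rfloor>))) * T / real k" using assms by (simp add: x_def)
  qed
qed

lemma heis_paths_iff:
  "f \<in> mspace (heis_paths T) \<longleftrightarrow>
    f \<in> extensional {0..T} \<and> continuous_map (top_of_set {0..T}) (mtopology_of heis_metric) f"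
  unfolding heis_paths_def by (subst compactin_mspace_cfunspace) (auto simp: compactin_subtopology)

lemma restrict_in_heis_paths:
  assumes "continuous_on {0..T} f"
  shows "restrict f {0..T} \<in> mspace (heis_paths T)"
proof -
  have "continuous_on {0..T} (restrict f {0..T})" by (rule continuous_on_eq[OF assms]) simp
  then show ?thesis
    unfolding heis_paths_iff by (intro conjI restrict_extensional continuous_map_heis_metric)
qed

lemma heis_paths_dist_le:
  assumes "\<And>t. 0 \<le> t \<Longrightarrow> t \<le> T \<Longrightarrow> cc_dist (f t) (g t) \<le> c" "0 \<le> c"
  shows "mdist (heis_paths T) f g \<le> c"
  unfolding heis_paths_def using assms by (intro mdist_cfunspace_le) auto

definition interpolate :: "real \<Rightarrow> nat \<Rightarrow> (nat \<Rightarrow> 'd::finite heis) \<Rightarrow> real \<Rightarrow> 'd heis" where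
  "interpolate T k y = restrict (linear_path T k y) {0..T}"

lemma interpolate_in_heis_paths: "interpolate T k y \<in> mspace (heis_paths T)"
  unfolding interpolate_def by (intro restrict_in_heis_paths continuous_on_linear_path)

text \<open>A path and its Euclidean distance to a nearby one are bounded, uniformly in time, in terms of the
  vertices; the modulus \<open>cc_dist_modulus\<close> then bounds the supremum distance.\<close>

lemma continuous_map_interpolate:
  "continuous_map euclidean (mtopology_of (heis_paths T)) (interpolate T k :: (nat \<Rightarrow> 'd::finite heis) \<Rightarrow> _)"
proof -
  interpret m: Metric_space "mspace (heis_paths T :: (real \<Rightarrow> 'd heis) metric)" "mdist (heis_paths T)"
    by (rule Metric_space_mspace_mdist)
  have "open (interpolate T k -` U)" if U: "openin m.mtopology U" for U
  proof (subst open_subopen, rule ballI)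
    fix x assume "x \<in> interpolate T k -` U"
    then obtain r where r: "r > 0" "m.mball (interpolate T k x) r \<subseteq> U"
      using U unfolding m.openin_mtopology by auto
    define R where "R = norm (x 0) + (\<Sum>i<k. norm (x (Suc i) - x i))"
    define a where "a y = norm (y 0 - x 0) + (\<Sum>i<k. norm ((y (Suc i) - y i) - (x (Suc i) - x i)))"
      for y :: "nat \<Rightarrow> 'd heis"
    define b where "b y = a y + 4 * sqrt ((1 + R) * a y / 2)" for y :: "nat \<Rightarrow> 'd heis"
    have "R \<ge> 0" by (simp add: R_def sum_nonneg)
    have a0: "a y \<ge> 0" for y by (simp add: a_def sum_nonneg)
    have "continuous_on UNIV b"
      unfolding b_def a_def by (intro continuous_intros) auto
    then have "open {y. b y < r}" by (intro open_Collect_less continuous_intros)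
    moreover have "x \<in> {y. b y < r}" using r(1) by (simp add: b_def a_def)
    moreover have "{y. b y < r} \<subseteq> interpolate T k -` U"
    proof
      fix y assume "y \<in> {y. b y < r}"
      have nR: "norm (linear_path T k x t) \<le> R" for t
        unfolding linear_path_def R_def
        by (intro norm_triangle_le add_mono order_refl sum_norm_le)
           (auto simp: clamp01_range intro: mult_left_le_one_le)
      have na: "norm (linear_path T k y t - linear_path T k x t) \<le> a y" for t
      proof -
        have "linear_path T k y t - linear_path T k x t = (y 0 - x 0) +
          (\<Sum>i<k. clamp01 (real k * t / T - real i) *\<^sub>R ((y (Suc i) - y i) - (x (Suc i) - x i)))"
          by (simp add: linear_path_def scaleR_diff_right sum_subtractf)
        also have "norm \<dots> \<le> a y"
          unfolding a_def
          by (intro norm_triangle_le add_mono order_refl sum_norm_le)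
             (auto simp: clamp01_range intro: mult_left_le_one_le)
        finally show ?thesis .
      qed
      have "mdist (heis_paths T) (interpolate T k x) (interpolate T k y) \<le> b y"
        unfolding b_def using a0[of y] \<open>R \<ge> 0\<close>
        by (intro heis_paths_dist_le) (auto simp: interpolate_def intro!: cc_dist_modulus[OF nR na])
      then have "interpolate T k y \<in> m.mball (interpolate T k x) r"
        using \<open>y \<in> {y. b y < r}\<close> by (simp add: interpolate_in_heis_paths)
      then show "y \<in> interpolate T k -` U" using r(2) by auto
    qed
    ultimately show "\<exists>V. open V \<and> x \<in> V \<and> V \<subseteq> interpolate T k -` U" by blast
  qed
  then show ?thesis
    by (auto simp: continuous_map_def mtopology_of_def interpolate_in_heis_paths vimage_def)
qed

text \<open>Uniform continuity makes the Euclidean distance uniformly small, and the range of the path is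
  bounded, so that \<open>cc_dist_modulus\<close> applies.\<close>

lemma interpolate_tendsto:
  fixes x :: "real \<Rightarrow> 'd::finite heis"
  assumes x: "continuous_on {0..T} x" and "T > 0"
  shows "(\<lambda>k. mdist (heis_paths T) (interpolate T k (\<lambda>i. x (real i * T / real k))) (restrict x {0..T})) \<longlonglongrightarrow> 0"
proof (rule LIMSEQ_I)
  fix e :: real assume "e > 0"
  have "bounded (x ` {0..T})" by (intro compact_imp_bounded compact_continuous_image x) simp
  then obtain R where R: "\<And>t. t \<in> {0..T} \<Longrightarrow> norm (x t) \<le> R" unfolding bounded_iff by blast
  have "R \<ge> 0" using R[of 0] \<open>T > 0\<close> order_trans[OF norm_ge_zero, of "x 0" R] by simp
  have "((\<lambda>a. a + 4 * sqrt ((1 + R) * a / 2)) \<longlongrightarrow> 0 + 4 * sqrt ((1 + R) * 0 / 2)) (at_right 0)"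
    by (intro tendsto_intros) auto
  then have "\<forall>\<^sub>F a in at_right 0. a + 4 * sqrt ((1 + R) * a / 2) < e"
    using \<open>e > 0\<close> by (intro order_tendstoD(2)) auto
  then obtain a where a: "a > 0" "a + 4 * sqrt ((1 + R) * a / 2) < e"
    unfolding eventually_at_right_field by (metis dense)
  have "uniformly_continuous_on {0..T} x"
    by (intro compact_uniformly_continuous x) simp
  then obtain \<delta> where \<delta>: "\<delta> > 0" "\<And>s t. s \<in> {0..T} \<Longrightarrow> t \<in> {0..T} \<Longrightarrow> \<bar>s - t\<bar> < \<delta> \<Longrightarrow> norm (x s - x t) < a"
    using a(1) unfolding uniformly_continuous_on_def dist_norm real_norm_def by metis
  obtain K where K: "T / \<delta> < real K" using reals_Archimedean2 by blast
  have "norm (mdist (heis_paths T) (interpolate T k (\<lambda>i. x (real i * T / real k))) (restrict x {0..T}) - 0) < e"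
    if "k \<ge> K" for k
  proof -
    have "0 < T / \<delta>" using \<open>T > 0\<close> \<delta>(1) by simp
    then have "k > 0" "T / \<delta> < real k" using K that by (auto intro: ccontr)
    then have Tk: "T / real k < \<delta>" using \<delta>(1) by (simp add: field_simps)
    have near: "norm (linear_path T k (\<lambda>i. x (real i * T / real k)) t - x t) \<le> a" if t: "0 \<le> t" "t \<le> T" for t
    proof -
      obtain j \<theta> where j: "j < k" "0 \<le> \<theta>" "\<theta> \<le> 1" "t = (real j + \<theta>) * T / real k"
        using grid_segment[OF t \<open>T > 0\<close> \<open>k > 0\<close>] by metis
      define u v where "u = real j * T / real k" and "v = real (Suc j) * T / real k"
      have tu: "t - u = \<theta> * (T / real k)" "v - t = (1 - \<theta>) * (T / real k)"
        using \<open>k > 0\<close> by (auto simp: j(4) u_def v_def field_simps)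
      have "0 \<le> t - u" "t - u \<le> T / real k" "0 \<le> v - t" "v - t \<le> T / real k"
        unfolding tu using j \<open>T > 0\<close> mult_right_mono[of _ 1 "T / real k"] by auto
      moreover have "0 \<le> u" using \<open>T > 0\<close> by (simp add: u_def)
      moreover have "v \<le> T"
      proof -
        have "real (Suc j) * T \<le> real k * T" using j(1) \<open>T > 0\<close> by (intro mult_right_mono) auto
        then show ?thesis using \<open>k > 0\<close> by (simp add: v_def field_simps)
      qed
      ultimately have "norm (x u - x t) < a" "norm (x v - x t) < a"
        using Tk t by (auto intro!: \<delta>(2))
      have "linear_path T k (\<lambda>i. x (real i * T / real k)) t - x t = (1 - \<theta>) *\<^sub>R (x u - x t) + \<theta> *\<^sub>R (x v - x t)"
        unfolding j(4) linear_path_segment[OF j(1-3) \<open>T > 0\<close>] by (simp add: u_def v_def algebra_simps)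
      also have "norm \<dots> \<le> (1 - \<theta>) * norm (x u - x t) + \<theta> * norm (x v - x t)"
        using j(2,3) by (intro norm_triangle_le) simp
      also have "\<dots> \<le> (1 - \<theta>) * a + \<theta> * a"
        using \<open>norm (x u - x t) < a\<close> \<open>norm (x v - x t) < a\<close> j(2,3) by (intro add_mono mult_left_mono) auto
      finally show ?thesis by (simp add: algebra_simps)
    qed
    have "mdist (heis_paths T) (interpolate T k (\<lambda>i. x (real i * T / real k))) (restrict x {0..T})
        \<le> a + 4 * sqrt ((1 + R) * a / 2)"
    proof (rule heis_paths_dist_le)
      fix t assume t: "0 \<le> t" "t \<le> T"
      show "cc_dist (interpolate T k (\<lambda>i. x (real i * T / real k)) t) (restrict x {0..T} t)
          \<le> a + 4 * sqrt ((1 + R) * a / 2)"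
        using cc_dist_modulus[OF R near[OF t]] t by (simp add: interpolate_def cc_dist_commute)
    qed (use a \<open>R \<ge> 0\<close> in auto)
    moreover have "0 \<le> mdist (heis_paths T) (interpolate T k (\<lambda>i. x (real i * T / real k))) (restrict x {0..T})"
      by (rule Metric_space.nonneg[OF Metric_space_mspace_mdist])
    ultimately show ?thesis using a(2) by simp
  qed
  then show "\<exists>K. \<forall>k\<ge>K. norm (mdist (heis_paths T) (interpolate T k (\<lambda>i. x (real i * T / real k)))
      (restrict x {0..T}) - 0) < e" by blast
qed

lemma measurable_interpolate:
  fixes Y :: "nat \<Rightarrow> 'w \<Rightarrow> 'd::finite heis"
  assumes "\<And>i. Y i \<in> borel_measurable M"
  shows "(\<lambda>\<omega>. interpolate T k (\<lambda>i. Y i \<omega>)) \<in> measurable M (path_borel T)"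
  unfolding path_borel_def
proof (rule measurable_borel_of_topologyI)
  have Y: "(\<lambda>\<omega> i. Y i \<omega>) \<in> borel_measurable M"
    using assms unfolding measurable_cong_sets[OF refl sets_PiM_equal_borel[symmetric]]
    by (intro measurable_PiM_single') auto
  fix U :: "(real \<Rightarrow> 'd heis) set" assume "openin (mtopology_of (heis_paths T)) U"
  then have "open (interpolate T k -` U)"
    using continuous_map_interpolate[of T k] by (auto simp: continuous_map_def vimage_def)
  then have "(\<lambda>\<omega> i. Y i \<omega>) -` (interpolate T k -` U) \<inter> space M \<in> sets M"
    using Y by (intro measurable_sets[OF Y]) auto
  then show "(\<lambda>\<omega>. interpolate T k (\<lambda>i. Y i \<omega>)) -` U \<inter> space M \<in> sets M"
    by (simp add: vimage_def)
qed (simp add: interpolate_in_heis_paths)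

text \<open>The random path is the limit of its piecewise linear interpolations, which are measurable because
  they are continuous functions of countably many random positions.\<close>

lemma measurable_path_of:
  assumes "T > 0" and X: "\<And>t. 0 \<le> t \<Longrightarrow> X t \<in> borel_measurable M"
    and cont: "\<And>\<omega>. \<omega> \<in> space M \<Longrightarrow> continuous_on {0..} (\<lambda>t. X t \<omega>)"
  shows "path_of T X \<in> measurable M (path_borel T)"
  unfolding path_borel_def
proof (rule measurable_metric_limit)
  have cont': "continuous_on {0..T} (\<lambda>t. X t \<omega>)" if "\<omega> \<in> space M" for \<omega>
    using continuous_on_subset[OF cont[OF that]] by auto
  show "(\<lambda>\<omega>. interpolate T k (\<lambda>i. X (real i * T / real k) \<omega>))
      \<in> measurable M (borel_of_topology (mtopology_of (heis_paths T)))" for k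
    using measurable_interpolate[of "\<lambda>i. X (real i * T / real k)" M T k] X \<open>T > 0\<close>
    by (simp add: path_borel_def)
  show "path_of T X \<omega> \<in> mspace (heis_paths T)" if "\<omega> \<in> space M" for \<omega>
    unfolding path_of_def using cont'[OF that] by (rule restrict_in_heis_paths)
  show "(\<lambda>k. mdist (heis_paths T) (interpolate T k (\<lambda>i. X (real i * T / real k) \<omega>)) (path_of T X \<omega>)) \<longlonglongrightarrow> 0"
    if "\<omega> \<in> space M" for \<omega>
    unfolding path_of_def using interpolate_tendsto[OF cont'[OF that] \<open>T > 0\<close>] .
qed

section \<open>Variables independent of a sub-sigma-algebra\<close>

lemma space_natural_filtration [simp]: "space (natural_filtration M X t) = space M"
  unfolding natural_filtration_def by (rule space_measure_of) auto

lemma sets_natural_filtration: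
  "sets (natural_filtration M X t) =
    sigma_sets (space M) {X r -` A \<inter> space M | r A. r \<in> {0..t} \<and> A \<in> sets borel}"
  unfolding natural_filtration_def by (rule sets_measure_of) auto

lemma subalgebra_natural_filtration:
  assumes "\<And>r. 0 \<le> r \<Longrightarrow> X r \<in> borel_measurable M"
  shows "subalgebra M (natural_filtration M X t)"
  unfolding subalgebra_def sets_natural_filtration
  using assms by (auto intro!: sets.sigma_sets_subset measurable_sets)

lemma natural_filtration_mono:
  "s \<le> t \<Longrightarrow> sets (natural_filtration M X s) \<subseteq> sets (natural_filtration M X t)"
  unfolding sets_natural_filtration
  by (intro sigma_sets_mono' subsetI) (clarsimp, metis order_trans)

lemma measurable_natural_filtration:
  fixes X :: "'t::{linorder, zero} \<Rightarrow> 'w \<Rightarrow> 'a::topological_space"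
  assumes "0 \<le> r" "r \<le> t"
  shows "X r \<in> borel_measurable (natural_filtration M X t)"
proof (rule measurableI)
  fix A :: "'a set" assume "A \<in> sets borel"
  then show "X r -` A \<inter> space (natural_filtration M X t) \<in> sets (natural_filtration M X t)"
    unfolding sets_natural_filtration using assms by (auto intro!: sigma_sets.Basic)
qed simp

definition indep_law :: "'w measure \<Rightarrow> 'w measure \<Rightarrow> ('w \<Rightarrow> 'b) \<Rightarrow> 'b measure \<Rightarrow> bool" where
  "indep_law M F V \<mu> \<longleftrightarrow> prob_space M \<and> subalgebra M F \<and> V \<in> measurable M \<mu> \<and> prob_space \<mu> \<and>
    (\<forall>D\<in>sets F. \<forall>C\<in>sets \<mu>. measure M (D \<inter> (V -` C \<inter> space M)) = measure M D * measure \<mu> C)"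

lemma indep_lawD:
  assumes "indep_law M F V \<mu>"
  shows "prob_space M" "subalgebra M F" "V \<in> measurable M \<mu>" "prob_space \<mu>"
    "\<And>D C. D \<in> sets F \<Longrightarrow> C \<in> sets \<mu> \<Longrightarrow> measure M (D \<inter> (V -` C \<inter> space M)) = measure M D * measure \<mu> C"
  using assms by (auto simp: indep_law_def)

lemma indep_law_distr:
  assumes "indep_law M F V \<mu>" shows "distr M \<mu> V = \<mu>"
proof (rule measure_eqI)
  interpret prob_space M using assms by (rule indep_lawD)
  interpret \<mu>: prob_space \<mu> using assms by (rule indep_lawD)
  fix C assume "C \<in> sets (distr M \<mu> V)"
  then have C: "C \<in> sets \<mu>" by simp
  have "space M \<in> sets F" using indep_lawD(2)[OF assms] by (metis sets.top subalgebra_def)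
  then have "measure M (V -` C \<inter> space M) = measure \<mu> C"
    using indep_lawD(5)[OF assms _ C, of "space M"] prob_space Int_absorb1[of "V -` C \<inter> space M" "space M"] by simp
  then show "emeasure (distr M \<mu> V) C = emeasure \<mu> C"
    using C indep_lawD(3)[OF assms] by (simp add: emeasure_distr emeasure_eq_measure \<mu>.emeasure_eq_measure)
qed simp

text \<open>It suffices to test independence on generators that are closed under intersection, of the
  target here and of the sub-sigma-algebra in the next lemma.\<close>

lemma indep_lawI_generator:
  assumes M: "prob_space M" and F: "subalgebra M F" and V: "V \<in> measurable M \<mu>" and \<mu>: "prob_space \<mu>"
    and G: "Int_stable G" "G \<subseteq> Pow (space \<mu>)" "sets \<mu> = sigma_sets (space \<mu>) G"
    and eq: "\<And>D C. D \<in> sets F \<Longrightarrow> C \<in> G \<Longrightarrow> measure M (D \<inter> (V -` C \<inter> space M)) = measure M D * measure \<mu> C"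
  shows "indep_law M F V \<mu>"
  unfolding indep_law_def
proof (intro conjI ballI M F V \<mu>)
  interpret prob_space M by fact
  interpret \<mu>: prob_space \<mu> by fact
  fix D C assume D: "D \<in> sets F" and C: "C \<in> sets \<mu>"
  have DM: "D \<in> sets M" using D F by (auto simp: subalgebra_def)
  note [measurable] = V DM
  have sG: "A \<in> sigma_sets (space \<mu>) G \<Longrightarrow> A \<in> sets \<mu>" for A using G by simp
  show "measure M (D \<inter> (V -` C \<inter> space M)) = measure M D * measure \<mu> C"
    using C unfolding G(3)
  proof (induction rule: sigma_sets_induct_disjoint[OF G(1,2), consumes 1, case_names basic empty compl union])
    case (basic A) then show ?case using eq D by simp
  next
    case empty show ?case by simp
  next
    case (compl A)
    from compl(1) have A: "A \<in> sets \<mu>" by (rule sG)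
    have "D \<inter> (V -` (space \<mu> - A) \<inter> space M) = D - D \<inter> (V -` A \<inter> space M)"
      using measurable_space[OF V] sets.sets_into_space[OF DM] by auto
    then have "measure M (D \<inter> (V -` (space \<mu> - A) \<inter> space M)) = measure M D - measure M (D \<inter> (V -` A \<inter> space M))"
      using A by (simp add: finite_measure_Diff)
    also have "\<dots> = measure M D * measure \<mu> (space \<mu> - A)"
      using compl A by (simp add: \<mu>.prob_compl algebra_simps)
    finally show ?case .
  next
    case (union A)
    then have A: "\<And>i. A i \<in> sets \<mu>" by (intro sG) auto
    have "(\<lambda>i. measure M (D \<inter> (V -` A i \<inter> space M))) sums measure M (\<Union>i. D \<inter> (V -` A i \<inter> space M))"
      using A union(1) by (intro finite_measure_UNION) (auto simp: disjoint_family_on_def)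
    moreover have "(\<Union>i. D \<inter> (V -` A i \<inter> space M)) = D \<inter> (V -` (\<Union>i. A i) \<inter> space M)" by auto
    moreover have "(\<lambda>i. measure M D * measure \<mu> (A i)) sums (measure M D * measure \<mu> (\<Union>i. A i))"
      using A union(1) by (intro sums_mult \<mu>.finite_measure_UNION) auto
    ultimately show ?case using union(3) by (simp add: sums_unique2)
  qed
qed

lemma (in prob_space) indep_event_generator:
  assumes G: "Int_stable G" "G \<subseteq> Pow (space M)" "G \<subseteq> sets M" and E: "E \<in> sets M"
    and eq: "\<And>D. D \<in> G \<Longrightarrow> prob (D \<inter> E) = prob D * prob E"
    and D: "D \<in> sigma_sets (space M) G"
  shows "prob (D \<inter> E) = prob D * prob E"
proof -
  have sG: "A \<in> sigma_sets (space M) G \<Longrightarrow> A \<in> sets M" for A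
    using G sets.sigma_sets_subset[of G M] by auto
  show ?thesis using D
  proof (induction rule: sigma_sets_induct_disjoint[OF G(1,2), consumes 1, case_names basic empty compl union])
    case (basic A) then show ?case by (rule eq)
  next
    case empty show ?case by simp
  next
    case (compl A)
    from compl(1) have A: "A \<in> sets M" by (rule sG)
    have "(space M - A) \<inter> E = E - A \<inter> E" using sets.sets_into_space[OF E] by auto
    then have "prob ((space M - A) \<inter> E) = prob E - prob (A \<inter> E)"
      using A E by (simp add: finite_measure_Diff)
    also have "\<dots> = prob (space M - A) * prob E"
      using compl A by (simp add: prob_compl algebra_simps)
    finally show ?case .
  next
    case (union A)
    then have A: "\<And>i. A i \<in> sets M" by (intro sG) auto
    have "(\<lambda>i. prob (A i \<inter> E)) sums prob (\<Union>i. A i \<inter> E)"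
      using A E union(1) by (intro finite_measure_UNION) (auto simp: disjoint_family_on_def)
    moreover have "(\<Union>i. A i \<inter> E) = (\<Union>i. A i) \<inter> E" by auto
    moreover have "(\<lambda>i. prob (A i) * prob E) sums (prob (\<Union>i. A i) * prob E)"
      using A union(1) by (intro sums_mult2 finite_measure_UNION) auto
    ultimately show ?case using union(3) by (simp add: sums_unique2)
  qed
qed

lemma indep_law_compose:
  assumes "indep_law M F V \<mu>" "f \<in> measurable \<mu> \<nu>"
  shows "indep_law M F (\<lambda>\<omega>. f (V \<omega>)) (distr \<mu> \<nu> f)"
proof -
  note * = indep_lawD[OF assms(1)]
  have "measure M (D \<inter> ((\<lambda>\<omega>. f (V \<omega>)) -` C \<inter> space M)) = measure M D * measure (distr \<mu> \<nu> f) C"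
    if "D \<in> sets F" "C \<in> sets \<nu>" for D C
  proof -
    have eq: "(\<lambda>\<omega>. f (V \<omega>)) -` C \<inter> space M = V -` (f -` C \<inter> space \<mu>) \<inter> space M"
      using measurable_space[OF *(3)] by auto
    have "f -` C \<inter> space \<mu> \<in> sets \<mu>" using assms(2) that(2) by (rule measurable_sets)
    then show ?thesis
      unfolding eq measure_distr[OF assms(2) that(2)] by (rule *(5)[OF that(1)])
  qed
  moreover have "(\<lambda>\<omega>. f (V \<omega>)) \<in> measurable M \<nu>" using *(3) assms(2) by simp
  ultimately show ?thesis
    using * assms(2) by (simp add: indep_law_def prob_space.prob_space_distr)
qed

text \<open>Two independent steps one after the other: \<open>V\<close> is independent of \<open>F'\<close>, which contains both
  the past \<open>F\<close> and the events of \<open>U\<close>.\<close>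

lemma indep_law_pair:
  assumes U: "indep_law M F U \<mu>" and V: "indep_law M F' V \<nu>" and sub: "sets F \<subseteq> sets F'"
    and UF: "U \<in> measurable F' \<mu>"
  shows "indep_law M F (\<lambda>\<omega>. (U \<omega>, V \<omega>)) (\<mu> \<Otimes>\<^sub>M \<nu>)"
proof -
  interpret \<mu>: prob_space \<mu> by (rule indep_lawD(4)[OF U])
  interpret \<nu>: prob_space \<nu> by (rule indep_lawD(4)[OF V])
  interpret pair_prob_space \<mu> \<nu> ..
  have sp: "space F' = space M" "space F = space M"
    using indep_lawD(2)[OF V] indep_lawD(2)[OF U] by (auto simp: subalgebra_def)
  show ?thesis
  proof (rule indep_lawI_generator[where G = "{a \<times> b | a b. a \<in> sets \<mu> \<and> b \<in> sets \<nu>}"])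
    show "prob_space M" "subalgebra M F" using indep_lawD[OF U] by auto
    show "(\<lambda>\<omega>. (U \<omega>, V \<omega>)) \<in> measurable M (\<mu> \<Otimes>\<^sub>M \<nu>)" using indep_lawD(3)[OF U] indep_lawD(3)[OF V] by simp
    show "Int_stable {a \<times> b | a b. a \<in> sets \<mu> \<and> b \<in> sets \<nu>}" by (rule Int_stable_pair_measure_generator)
    show "sets (\<mu> \<Otimes>\<^sub>M \<nu>) = sigma_sets (space (\<mu> \<Otimes>\<^sub>M \<nu>)) {a \<times> b | a b. a \<in> sets \<mu> \<and> b \<in> sets \<nu>}"
      by (simp add: sets_pair_measure space_pair_measure)
    fix D C assume D: "D \<in> sets F" and "C \<in> {a \<times> b | a b. a \<in> sets \<mu> \<and> b \<in> sets \<nu>}"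
    then obtain a b where C: "C = a \<times> b" "a \<in> sets \<mu>" "b \<in> sets \<nu>" by auto
    have "D \<inter> (U -` a \<inter> space M) \<in> sets F'"
      using measurable_sets[OF UF C(2)] D sub sp by auto
    then have "measure M ((D \<inter> (U -` a \<inter> space M)) \<inter> (V -` b \<inter> space M)) = measure M (D \<inter> (U -` a \<inter> space M)) * measure \<nu> b"
      by (rule indep_lawD(5)[OF V _ C(3)])
    also have "\<dots> = measure M D * measure (\<mu> \<Otimes>\<^sub>M \<nu>) C"
      unfolding indep_lawD(5)[OF U D C(2)] C(1)
      using C by (simp add: measure_def \<nu>.emeasure_pair_measure_Times enn2real_mult)
    also have "D \<inter> (U -` a \<inter> space M) \<inter> (V -` b \<inter> space M) = D \<inter> ((\<lambda>\<omega>. (U \<omega>, V \<omega>)) -` C \<inter> space M)"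
      by (auto simp: C(1))
    finally show "measure M (D \<inter> ((\<lambda>\<omega>. (U \<omega>, V \<omega>)) -` C \<inter> space M)) = measure M D * measure (\<mu> \<Otimes>\<^sub>M \<nu>) C" .
  qed (auto simp: space_pair_measure dest: sets.sets_into_space intro: prob_space_axioms)
qed

lemma indep_law_joint_distr:
  assumes V: "indep_law M F V \<nu>" and U: "U \<in> measurable F K"
  shows "distr M (K \<Otimes>\<^sub>M \<nu>) (\<lambda>\<omega>. (U \<omega>, V \<omega>)) = distr M K U \<Otimes>\<^sub>M \<nu>"
proof -
  interpret prob_space M by (rule indep_lawD(1)[OF V])
  interpret \<nu>: prob_space \<nu> by (rule indep_lawD(4)[OF V])
  have UM: "U \<in> measurable M K" using U indep_lawD(2)[OF V] by (rule measurable_from_subalg[rotated])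
  interpret d: prob_space "distr M K U" using UM by (rule prob_space_distr)
  have sp: "space F = space M" using indep_lawD(2)[OF V] by (auto simp: subalgebra_def)
  note VM = indep_lawD(3)[OF V]
  have "distr M K U \<Otimes>\<^sub>M \<nu> = distr M (K \<Otimes>\<^sub>M \<nu>) (\<lambda>\<omega>. (U \<omega>, V \<omega>))"
  proof (rule pair_measure_eqI)
    show "sigma_finite_measure (distr M K U)" "sigma_finite_measure \<nu>" by unfold_locales
    show "sets (distr M K U \<Otimes>\<^sub>M \<nu>) = sets (distr M (K \<Otimes>\<^sub>M \<nu>) (\<lambda>\<omega>. (U \<omega>, V \<omega>)))"
      by (simp cong: sets_pair_measure_cong)
    fix A B assume "A \<in> sets (distr M K U)" and B: "B \<in> sets \<nu>"
    then have A: "A \<in> sets K" by simp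
    have "(\<lambda>\<omega>. (U \<omega>, V \<omega>)) -` (A \<times> B) \<inter> space M = (U -` A \<inter> space M) \<inter> (V -` B \<inter> space M)" by auto
    moreover have "measure M ((U -` A \<inter> space M) \<inter> (V -` B \<inter> space M)) = measure M (U -` A \<inter> space M) * measure \<nu> B"
      using indep_lawD(5)[OF V _ B] measurable_sets[OF U A] sp by simp
    ultimately show "emeasure (distr M K U) A * emeasure \<nu> B = emeasure (distr M (K \<Otimes>\<^sub>M \<nu>) (\<lambda>\<omega>. (U \<omega>, V \<omega>))) (A \<times> B)"
      using A B UM VM
      by (simp add: emeasure_distr emeasure_eq_measure \<nu>.emeasure_eq_measure ennreal_mult'')
  qed
  then show ?thesis ..
qed

text \<open>If each variable of a sequence is independent of the past, the joint law is the product.\<close>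

lemma indep_law_sequence:
  fixes F :: "nat \<Rightarrow> 'w measure" and U :: "nat \<Rightarrow> 'w \<Rightarrow> 'b" and \<mu> :: "nat \<Rightarrow> 'b measure"
  assumes U: "\<And>i. indep_law M (F i) (U i) (\<mu> i)"
    and UF: "\<And>i. U i \<in> measurable (F (Suc i)) (\<mu> i)"
    and mono: "\<And>i. sets (F i) \<subseteq> sets (F (Suc i))"
  shows "distr M (PiM UNIV \<mu>) (\<lambda>\<omega> i. U i \<omega>) = PiM UNIV \<mu>"
proof -
  interpret M: prob_space M by (rule indep_lawD(1)[OF U])
  interpret \<mu>: prob_space "\<mu> i" for i by (rule indep_lawD(4)[OF U])
  interpret product_prob_space \<mu> UNIV ..
  have sp: "space (F i) = space M" for i using indep_lawD(2)[OF U] by (auto simp: subalgebra_def)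
  have [measurable]: "U i \<in> measurable M (\<mu> i)" for i by (rule indep_lawD(3)[OF U])
  have meas: "(\<lambda>\<omega> i. U i \<omega>) \<in> measurable M (PiM UNIV \<mu>)"
    by (rule measurable_PiM_single') (auto simp: measurable_space[OF indep_lawD(3)[OF U]])
  have step: "(\<Inter>i\<in>{..<n}. U i -` X i \<inter> space M) \<inter> space M \<in> sets (F n) \<and>
      measure M ((\<Inter>i\<in>{..<n}. U i -` X i \<inter> space M) \<inter> space M) = (\<Prod>i<n. measure (\<mu> i) (X i))"
    if X: "\<And>i. X i \<in> sets (\<mu> i)" for X n
  proof (induction n)
    case 0
    then show ?case using sets.top[of "F 0"] sp by (simp add: M.prob_space)
  next
    case (Suc n)
    let ?D = "(\<Inter>i\<in>{..<n}. U i -` X i \<inter> space M) \<inter> space M"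
    have eq: "(\<Inter>i\<in>{..<Suc n}. U i -` X i \<inter> space M) \<inter> space M = ?D \<inter> (U n -` X n \<inter> space M)"
      by (auto simp: less_Suc_eq)
    have "?D \<in> sets (F (Suc n))" using Suc mono by blast
    moreover have "U n -` X n \<inter> space M \<in> sets (F (Suc n))"
      using measurable_sets[OF UF[of n] X[of n]] sp by simp
    ultimately show ?case
      unfolding eq using Suc indep_lawD(5)[OF U[of n] _ X[of n], of ?D] by simp
  qed
  show ?thesis
  proof (rule PiM_eq)
    fix J :: "nat set" and X assume J: "finite J" "J \<subseteq> UNIV" and X: "\<And>j. j \<in> J \<Longrightarrow> X j \<in> sets (\<mu> j)"
    define X' where "X' i = (if i \<in> J then X i else space (\<mu> i))" for i
    obtain n where n: "J \<subseteq> {..<n}" using J(1) by (meson finite_nat_iff_bounded)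
    have X': "X' i \<in> sets (\<mu> i)" for i using X by (simp add: X'_def)
    have "emeasure (distr M (PiM UNIV \<mu>) (\<lambda>\<omega> i. U i \<omega>)) (prod_emb UNIV \<mu> J (Pi\<^sub>E J X))
        = emeasure M ((\<lambda>\<omega> i. U i \<omega>) -` prod_emb UNIV \<mu> J (Pi\<^sub>E J X) \<inter> space M)"
      using X J by (intro emeasure_distr meas sets_PiM_I) auto
    also have "(\<lambda>\<omega> i. U i \<omega>) -` prod_emb UNIV \<mu> J (Pi\<^sub>E J X) \<inter> space M
        = (\<Inter>i\<in>{..<n}. U i -` X' i \<inter> space M) \<inter> space M"
    proof -
      have "(\<lambda>i. U i \<omega>) \<in> prod_emb UNIV \<mu> J (Pi\<^sub>E J X) \<longleftrightarrow> (\<forall>i<n. U i \<omega> \<in> X' i)"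
        if "\<omega> \<in> space M" for \<omega>
      proof -
        have "U i \<omega> \<in> space (\<mu> i)" for i using measurable_space[OF indep_lawD(3)[OF U] that] .
        then have "(\<lambda>i. U i \<omega>) \<in> prod_emb UNIV \<mu> J (Pi\<^sub>E J X) \<longleftrightarrow> (\<forall>i\<in>J. U i \<omega> \<in> X i)"
          by (simp add: prod_emb_iff restrict_PiE_iff Pi_iff)
        also have "\<dots> \<longleftrightarrow> (\<forall>i<n. U i \<omega> \<in> X' i)"
          using n \<open>\<And>i. U i \<omega> \<in> space (\<mu> i)\<close> by (auto simp: X'_def subset_iff)
        finally show ?thesis .
      qed
      then show ?thesis by (intro set_eqI) (simp add: vimage_def Ball_def, blast)
    qed
    also have "emeasure M \<dots> = ennreal (\<Prod>i<n. measure (\<mu> i) (X' i))"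
      using step[OF X', of n] by (simp add: M.emeasure_eq_measure)
    also have "(\<Prod>i<n. measure (\<mu> i) (X' i)) = (\<Prod>i\<in>J. measure (\<mu> i) (X' i))"
      using n by (intro prod.mono_neutral_right) (auto simp: X'_def \<mu>.prob_space)
    also have "ennreal \<dots> = (\<Prod>i\<in>J. emeasure (\<mu> i) (X i))"
      by (simp add: X'_def \<mu>.emeasure_eq_measure prod_ennreal measure_nonneg)
    finally show "emeasure (distr M (PiM UNIV \<mu>) (\<lambda>\<omega> i. U i \<omega>)) (prod_emb UNIV \<mu> J (Pi\<^sub>E J X))
        = (\<Prod>j\<in>J. emeasure (\<mu> j) (X j))" .
  qed simp
qed

section \<open>Gaussian measures\<close>

text \<open>The centred normal law whose covariance is \<open>v\<close> times the identity.\<close>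

definition gauss :: "real \<Rightarrow> 'a::euclidean_space measure" where
  "gauss v = density lborel
    (\<lambda>x. ennreal (exp (- (norm x)\<^sup>2 / (2 * v)) / sqrt (2 * pi * v) ^ DIM('a)))"

lemma sets_gauss [simp, measurable_cong]: "sets (gauss v) = sets borel"
  and space_gauss [simp]: "space (gauss v) = UNIV"
  by (simp_all add: gauss_def)

lemma gauss_density_prod:
  fixes x :: "'a::euclidean_space"
  assumes "v > 0"
  shows "exp (- (norm x)\<^sup>2 / (2 * v)) / sqrt (2 * pi * v) ^ DIM('a) =
    (\<Prod>b\<in>Basis. normal_density 0 (sqrt v) (x \<bullet> b))"
proof -
  have "(norm x)\<^sup>2 = (\<Sum>b\<in>Basis. (x \<bullet> b)\<^sup>2)"
    by (simp add: euclidean_inner[of x x] power2_norm_eq_inner flip: power2_eq_square)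
  then have "- (norm x)\<^sup>2 / (2 * v) = (\<Sum>b\<in>Basis. - (x \<bullet> b)\<^sup>2 / (2 * v))"
    by (simp add: sum_divide_distrib sum_negf)
  then show ?thesis
    using assms by (simp add: normal_density_def prod_dividef exp_sum mult.commute)
qed

lemma nn_integral_gauss_prod:
  fixes f :: "'a::euclidean_space \<Rightarrow> real \<Rightarrow> ennreal"
  assumes "v > 0" and [measurable]: "\<And>b. f b \<in> borel_measurable borel"
  shows "(\<integral>\<^sup>+x. (\<Prod>b\<in>Basis. f b (x \<bullet> b)) \<partial>gauss v) =
    (\<Prod>b\<in>Basis. \<integral>\<^sup>+y. ennreal (normal_density 0 (sqrt v) y) * f b y \<partial>lborel)"
proof -
  have "(\<integral>\<^sup>+x. (\<Prod>b\<in>Basis. f b (x \<bullet> b)) \<partial>gauss v) =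
      (\<integral>\<^sup>+(x::'a). (\<Prod>b\<in>Basis. ennreal (normal_density 0 (sqrt v) (x \<bullet> b)) * f b (x \<bullet> b)) \<partial>lborel)"
    unfolding gauss_def gauss_density_prod[OF \<open>v > 0\<close>]
    by (subst nn_integral_density) (auto simp: prod.distrib prod_ennreal)
  also have "\<dots> = (\<Prod>b\<in>Basis. \<integral>\<^sup>+y. ennreal (normal_density 0 (sqrt v) y) * f b y \<partial>lborel)"
    by (rule nn_integral_lborel_prod) auto
  finally show ?thesis .
qed

lemma nn_integral_normal_density_1:
  "v > 0 \<Longrightarrow> (\<integral>\<^sup>+y. ennreal (normal_density 0 (sqrt v) y) \<partial>lborel) = 1"
  using prob_space.emeasure_space_1[OF prob_space_normal_density, of "sqrt v" 0]
  by (simp add: emeasure_density)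

lemma prob_space_gauss: "v > 0 \<Longrightarrow> prob_space (gauss v :: 'a::euclidean_space measure)"
  using nn_integral_gauss_prod[of v "\<lambda>_ _. 1"] nn_integral_normal_density_1[of v]
  by (intro prob_spaceI) simp

lemma distr_gauss_component:
  fixes b :: "'a::euclidean_space"
  assumes "v > 0" "b \<in> Basis"
  shows "distr (gauss v) borel (\<lambda>x. x \<bullet> b) = density lborel (normal_density 0 (sqrt v))"
proof (rule measure_eqI)
  fix A assume "A \<in> sets (distr (gauss v) borel (\<lambda>x::'a. x \<bullet> b))"
  then have A [measurable]: "A \<in> sets borel" by simp
  have "emeasure (distr (gauss v) borel (\<lambda>x. x \<bullet> b)) A = (\<integral>\<^sup>+y. indicator A y \<partial>distr (gauss v) borel (\<lambda>x. x \<bullet> b))"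
    using A by (intro nn_integral_indicator[symmetric]) simp
  also have "\<dots> = (\<integral>\<^sup>+x. indicator A (x \<bullet> b) \<partial>gauss v)"
    by (rule nn_integral_distr) auto
  also have "\<dots> = (\<integral>\<^sup>+x. (\<Prod>c\<in>Basis. (if c = b then indicator A (x \<bullet> c) else 1)) \<partial>gauss v)"
    using assms(2) by (simp add: prod.delta)
  also have "\<dots> = (\<Prod>c\<in>Basis. \<integral>\<^sup>+y. ennreal (normal_density 0 (sqrt v) y) * (if c = b then indicator A y else 1) \<partial>lborel)"
    using nn_integral_gauss_prod[OF assms(1), of "\<lambda>c y. if c = b then indicator A y else 1"] by simp
  also have "\<dots> = (\<Prod>c\<in>(Basis :: 'a set). if c = b then (\<integral>\<^sup>+y. ennreal (normal_density 0 (sqrt v) y) * indicator A y \<partial>lborel) else 1)"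
    by (intro prod.cong refl) (auto simp: nn_integral_normal_density_1[OF assms(1)])
  also have "\<dots> = (\<integral>\<^sup>+y. ennreal (normal_density 0 (sqrt v) y) * indicator A y \<partial>lborel)"
    using assms(2) by (simp add: prod.delta)
  also have "\<dots> = emeasure (density lborel (normal_density 0 (sqrt v))) A"
    using A by (simp add: emeasure_density)
  finally show "emeasure (distr (gauss v) borel (\<lambda>x. x \<bullet> b)) A = emeasure (density lborel (normal_density 0 (sqrt v))) A" .
qed simp

lemma distr_gauss_scale:
  assumes "c > 0"
  shows "distr (gauss 1) borel (\<lambda>x::'a::euclidean_space. c *\<^sub>R x) = gauss (c\<^sup>2)"
proof (rule measure_eqI)
  let ?g = "\<lambda>v (x::'a). ennreal (exp (- (norm x)\<^sup>2 / (2 * v)) / sqrt (2 * pi * v) ^ DIM('a))"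
  fix A assume "A \<in> sets (distr (gauss 1) borel (\<lambda>x::'a. c *\<^sub>R x))"
  then have A [measurable]: "A \<in> sets borel" by simp
  have "emeasure (gauss (c\<^sup>2)) A = (\<integral>\<^sup>+x. ?g (c\<^sup>2) x * indicator A x \<partial>lborel)"
    unfolding gauss_def by (rule emeasure_density) auto
  also have "\<dots> = (\<integral>\<^sup>+x. ?g (c\<^sup>2) x * indicator A x
      \<partial>density (distr lborel borel (\<lambda>x::'a. 0 + c *\<^sub>R x)) (\<lambda>_. ennreal (\<bar>c\<bar> ^ DIM('a))))"
    by (subst lborel_affine[of c 0, symmetric]) (use assms in auto)
  also have "\<dots> = (\<integral>\<^sup>+x. ennreal (\<bar>c\<bar> ^ DIM('a)) * (?g (c\<^sup>2) (c *\<^sub>R x) * indicator A (c *\<^sub>R x)) \<partial>lborel)"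
    by (simp add: nn_integral_density nn_integral_distr)
  also have "\<dots> = (\<integral>\<^sup>+x. ?g 1 x * indicator A (c *\<^sub>R x) \<partial>lborel)"
  proof (intro nn_integral_cong)
    fix x :: 'a
    have "\<bar>c\<bar> ^ DIM('a) * (exp (- (norm (c *\<^sub>R x))\<^sup>2 / (2 * c\<^sup>2)) / sqrt (2 * pi * c\<^sup>2) ^ DIM('a))
        = exp (- (norm x)\<^sup>2 / (2 * 1)) / sqrt (2 * pi * 1) ^ DIM('a)"
      using assms by (simp add: power_mult_distrib real_sqrt_mult)
    then show "ennreal (\<bar>c\<bar> ^ DIM('a)) * (?g (c\<^sup>2) (c *\<^sub>R x) * indicator A (c *\<^sub>R x)) = ?g 1 x * indicator A (c *\<^sub>R x)"
      by (simp add: mult.assoc[symmetric] ennreal_mult'[symmetric])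
  qed
  also have "\<dots> = (\<integral>\<^sup>+x. ?g 1 x * indicator ((\<lambda>x. c *\<^sub>R x) -` A) x \<partial>lborel)"
    by (intro nn_integral_cong) (simp add: indicator_def)
  also have "\<dots> = emeasure (gauss 1) ((\<lambda>x. c *\<^sub>R x) -` A)"
    unfolding gauss_def by (rule emeasure_density[symmetric]) (auto intro!: measurable_sets_borel[OF _ A])
  also have "\<dots> = emeasure (distr (gauss 1) borel (\<lambda>x. c *\<^sub>R x)) A"
    by (simp add: emeasure_distr)
  finally show "emeasure (distr (gauss 1) borel (\<lambda>x. c *\<^sub>R x)) A = emeasure (gauss (c\<^sup>2)) A" ..
qed simp

lemma gauss_pair:
  assumes "v > 0"
  shows "(gauss v :: 'a::euclidean_space measure) \<Otimes>\<^sub>M (gauss v :: 'b::euclidean_space measure) = gauss v"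
proof -
  have "(gauss v :: 'a measure) \<Otimes>\<^sub>M (gauss v :: 'b measure) =
    density (lborel \<Otimes>\<^sub>M lborel) (\<lambda>(x, y).
      ennreal (exp (- (norm x)\<^sup>2 / (2 * v)) / sqrt (2 * pi * v) ^ DIM('a)) *
      ennreal (exp (- (norm y)\<^sup>2 / (2 * v)) / sqrt (2 * pi * v) ^ DIM('b)))"
    unfolding gauss_def using prob_space_gauss[OF assms, where ?'a = 'b]
    by (intro pair_measure_density) (auto simp: gauss_def prob_space_imp_sigma_finite sigma_finite_lborel)
  also have "\<dots> = gauss v"
    unfolding gauss_def lborel_prod
  proof (intro density_cong AE_I2)
    fix z :: "'a \<times> 'b"
    obtain x y where z: "z = (x, y)" by (cases z)
    have "exp (- (norm x)\<^sup>2 / (2 * v)) / sqrt (2 * pi * v) ^ DIM('a) *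
      (exp (- (norm y)\<^sup>2 / (2 * v)) / sqrt (2 * pi * v) ^ DIM('b)) =
      exp (- (norm z)\<^sup>2 / (2 * v)) / sqrt (2 * pi * v) ^ DIM('a \<times> 'b)"
      by (simp add: z norm_Pair power_add diff_divide_distrib exp_diff exp_minus field_simps
          flip: exp_add)
    then show "(case z of (x, y) \<Rightarrow> ennreal (exp (- (norm x)\<^sup>2 / (2 * v)) / sqrt (2 * pi * v) ^ DIM('a)) *
      ennreal (exp (- (norm y)\<^sup>2 / (2 * v)) / sqrt (2 * pi * v) ^ DIM('b))) =
      ennreal (exp (- (norm z)\<^sup>2 / (2 * v)) / sqrt (2 * pi * v) ^ DIM('a \<times> 'b))"
      using assms by (simp add: z ennreal_mult'[symmetric])
  qed (auto, simp flip: borel_prod)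
  finally show ?thesis .
qed

section \<open>Increments of Markov processes on the group\<close>

text \<open>The indicator of a box is the limit of the functions \<open>\<lambda>x. min 1 (k * infdist x (- box l u))\<close>,
  which are continuous with compact support.\<close>

lemma finite_measure_eqI_C0:
  fixes \<alpha> \<beta> :: "'a::euclidean_space measure"
  assumes "finite_measure \<alpha>" "finite_measure \<beta>" and [simp, measurable_cong]: "sets \<alpha> = sets borel" "sets \<beta> = sets borel"
    and eq: "\<And>f. f \<in> C0_functions \<Longrightarrow> (\<And>x. \<bar>f x\<bar> \<le> 1) \<Longrightarrow> (\<integral>x. f x \<partial>\<alpha>) = (\<integral>x. f x \<partial>\<beta>)"
  shows "\<alpha> = \<beta>"
proof -
  interpret a: finite_measure \<alpha> by fact
  interpret b: finite_measure \<beta> by fact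
  have spaces: "space \<alpha> = UNIV" "space \<beta> = UNIV"
    using sets_eq_imp_space_eq[OF assms(3)] sets_eq_imp_space_eq[OF assms(4)] by auto
  have box: "measure \<alpha> (box l u) = measure \<beta> (box l u)" for l u :: 'a
  proof -
    define S where "S = - box l u"
    define f where "f k x = min 1 (real k * infdist x S)" for k and x :: 'a
    have "\<not> bounded (UNIV :: 'a set)" by simp
    then have "box l u \<noteq> UNIV" using bounded_box[of l u] by metis
    then have ne: "S \<noteq> {}" unfolding S_def by (metis Compl_UNIV_eq double_complement)
    have S: "closed S" by (auto simp: S_def)
    have cont: "continuous_on UNIV (f k)" for k
      unfolding f_def by (intro continuous_intros)
    have zero: "f k x = 0" if "x \<notin> box l u" for k x
      using that by (simp add: f_def S_def)
    obtain R where R: "box l u \<subseteq> ball 0 R" using bounded_subset_ballD[OF bounded_box] by blast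
    have C0: "f k \<in> C0_functions" for k
      unfolding C0_functions_def
    proof (intro CollectI conjI cont)
      have "eventually (\<lambda>x. f k x = 0) at_infinity"
        unfolding eventually_at_infinity using R zero by (intro exI[of _ R]) force
      then show "(f k \<longlongrightarrow> 0) at_infinity" by (rule tendsto_eventually)
    qed
    have range: "0 \<le> f k x" "f k x \<le> 1" for k x by (auto simp: f_def infdist_nonneg)
    have lim: "(\<lambda>k. f k x) \<longlonglongrightarrow> indicator (box l u) x" for x
    proof (cases "x \<in> box l u")
      case False
      then show ?thesis by (simp add: zero)
    next
      case True
      then have "infdist x S \<noteq> 0" using in_closed_iff_infdist_zero[OF S ne] by (auto simp: S_def)
      then have pos: "infdist x S > 0" using infdist_nonneg[of x S] by linarith
      obtain K where K: "1 / infdist x S < real K" using reals_Archimedean2 by blast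
      have "f k x = 1" if "k \<ge> K" for k
      proof -
        have "1 / infdist x S < real k" using K that by linarith
        then have "1 \<le> real k * infdist x S" using pos by (simp add: field_simps)
        then show ?thesis by (simp add: f_def)
      qed
      then have "eventually (\<lambda>k. f k x = 1) sequentially" unfolding eventually_sequentially by blast
      then show ?thesis using True by (simp add: tendsto_eventually)
    qed
    have meas [measurable]: "f k \<in> borel_measurable borel" for k
      using cont by (rule borel_measurable_continuous_onI)
    have conv: "(\<lambda>k. \<integral>x. f k x \<partial>\<gamma>) \<longlonglongrightarrow> measure \<gamma> (box l u)"
      if "finite_measure \<gamma>" and [measurable_cong]: "sets \<gamma> = sets borel" for \<gamma> :: "'a measure"
    proof -
      interpret finite_measure \<gamma> by fact
      have "(\<lambda>k. \<integral>x. f k x \<partial>\<gamma>) \<longlonglongrightarrow> (\<integral>x. indicator (box l u) x \<partial>\<gamma>)"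
        by (rule integral_dominated_convergence[where w = "\<lambda>_. 1"]) (auto simp: lim range abs_le_iff intro: order_trans[OF _ range(1)])
      then show ?thesis using that(2) sets_eq_imp_space_eq[OF that(2)] by simp
    qed
    show ?thesis
      using conv[OF assms(1,3)] conv[OF assms(2,4)] eq[OF C0] range
      by (intro LIMSEQ_unique) (auto simp: abs_le_iff intro: order_trans[OF _ range(1)])
  qed
  show ?thesis
  proof (rule measure_eqI_generator_eq[where E = "range (\<lambda>(l, u). box l u)" and \<Omega> = UNIV and
        A = "\<lambda>n. box (- (real n *\<^sub>R One)) (real n *\<^sub>R One)"])
    show "Int_stable (range (\<lambda>(l, u). box l u :: 'a set))"
      by (auto simp: Int_stable_def box_Int_box)
    show "emeasure \<alpha> X = emeasure \<beta> X" if "X \<in> range (\<lambda>(l, u). box l u)" for X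
      using that box by (auto simp: a.emeasure_eq_measure b.emeasure_eq_measure)
    show "sets \<alpha> = sigma_sets UNIV (range (\<lambda>(l, u). box l u))" "sets \<beta> = sigma_sets UNIV (range (\<lambda>(l, u). box l u))"
      by (simp_all add: borel_eq_box)
    show "(\<Union>i. box (- (real i *\<^sub>R One)) (real i *\<^sub>R One)) = (UNIV :: 'a set)"
      by (rule UN_box_eq_UNIV)
  qed auto
qed

lemma borel_measurable_heis_mult [measurable (raw)]:
  fixes f g :: "'w \<Rightarrow> 'd::finite heis"
  assumes [measurable]: "f \<in> borel_measurable M" "g \<in> borel_measurable M"
  shows "(\<lambda>x. heis_mult (f x) (g x)) \<in> borel_measurable M"
proof -
  have "continuous_on UNIV (\<lambda>x :: 'd heis \<times> 'd heis. heis_mult (fst x) (snd x))"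
    by (intro continuous_intros)
  then have "(\<lambda>x :: 'd heis \<times> 'd heis. heis_mult (fst x) (snd x)) \<in> borel_measurable (borel \<Otimes>\<^sub>M borel)"
    unfolding borel_prod by (rule borel_measurable_continuous_onI)
  from measurable_compose[OF _ this, of "\<lambda>x. (f x, g x)" M] show ?thesis by simp
qed

lemma borel_measurable_cc_dist [measurable (raw)]:
  fixes f g :: "'w \<Rightarrow> 'd::finite heis"
  assumes [measurable]: "f \<in> borel_measurable M" "g \<in> borel_measurable M"
  shows "(\<lambda>x. cc_dist (f x) (g x)) \<in> borel_measurable M"
proof -
  have "continuous_on UNIV (\<lambda>x :: 'd heis \<times> 'd heis. cc_dist (fst x) (snd x))"
    by (intro continuous_intros)
  then have "(\<lambda>x :: 'd heis \<times> 'd heis. cc_dist (fst x) (snd x)) \<in> borel_measurable (borel \<Otimes>\<^sub>M borel)"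
    unfolding borel_prod by (rule borel_measurable_continuous_onI)
  from measurable_compose[OF _ this, of "\<lambda>x. (f x, g x)" M] show ?thesis by simp
qed

text \<open>If, on every event of the past, the next position is distributed like the present one
  multiplied by an independent \<open>\<mu>\<close>-variable, then the left increment is independent of the past.
  Since the present position belongs to the past, the assumption determines the joint law of the
  present and the next position first on rectangles, then on the events
  \<open>(- p) q \<in> C\<close>.\<close>

lemma markov_increment:
  fixes U V :: "'w \<Rightarrow> 'd::finite heis"
  assumes M: "prob_space M" and F: "subalgebra M F" and U: "U \<in> borel_measurable F"
    and V [measurable]: "V \<in> borel_measurable M"
    and \<mu>: "prob_space \<mu>" and \<mu>b [measurable_cong]: "sets \<mu> = sets borel"
    and eq: "\<And>D. D \<in> sets F \<Longrightarrow> distr (density M (indicator D)) borel V =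
      distr (density M (indicator D) \<Otimes>\<^sub>M \<mu>) borel (\<lambda>(\<omega>, w). heis_mult (U \<omega>) w)"
  shows "indep_law M F (\<lambda>\<omega>. heis_mult (- U \<omega>) (V \<omega>)) \<mu>"
  unfolding indep_law_def
proof (intro conjI ballI M F \<mu>)
  interpret prob_space M by fact
  interpret \<mu>: prob_space \<mu> by fact
  have UM [measurable]: "U \<in> borel_measurable M" using F U by (rule measurable_from_subalg)
  have sp: "space F = space M" "space \<mu> = UNIV"
    using F sets_eq_imp_space_eq[OF \<mu>b] by (auto simp: subalgebra_def)
  show inc: "(\<lambda>\<omega>. heis_mult (- U \<omega>) (V \<omega>)) \<in> measurable M \<mu>"
    by (simp add: measurable_cong_sets[OF refl \<mu>b])
  fix D C assume D: "D \<in> sets F" and C: "C \<in> sets \<mu>"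
  have FM: "A \<in> sets F \<Longrightarrow> A \<in> sets M" for A using F by (auto simp: subalgebra_def)
  note [measurable] = FM[OF D]
  have C' [measurable]: "C \<in> sets borel" using C \<mu>b by simp
  let ?MD = "density M (indicator D)"
  have em: "emeasure (density M (indicator A) \<Otimes>\<^sub>M \<mu>) S = (\<integral>\<^sup>+\<omega>. indicator A \<omega> * emeasure \<mu> (Pair \<omega> -` S) \<partial>M)"
    if "A \<in> sets M" "S \<in> sets (M \<Otimes>\<^sub>M \<mu>)" for A S
  proof -
    have S: "S \<in> sets (density M (indicator A) \<Otimes>\<^sub>M \<mu>)" using that(2) by (simp cong: sets_pair_measure_cong)
    show ?thesis
      unfolding \<mu>.emeasure_pair_measure_alt[OF S] using that
      by (subst nn_integral_density) (auto intro: \<mu>.measurable_emeasure_Pair)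
  qed
  define \<rho>1 where "\<rho>1 = distr ?MD (borel \<Otimes>\<^sub>M borel) (\<lambda>\<omega>. (U \<omega>, V \<omega>))"
  define \<rho>2 where "\<rho>2 = distr (?MD \<Otimes>\<^sub>M \<mu>) (borel \<Otimes>\<^sub>M borel) (\<lambda>(\<omega>, w). (U \<omega>, heis_mult (U \<omega>) w))"
  have m2: "(\<lambda>(\<omega>, w). (U \<omega>, heis_mult (U \<omega>) w)) \<in> measurable (M \<Otimes>\<^sub>M \<mu>) (borel \<Otimes>\<^sub>M borel)"
    by measurable
  then have m2': "(\<lambda>(\<omega>, w). (U \<omega>, heis_mult (U \<omega>) w)) \<in> measurable (?MD \<Otimes>\<^sub>M \<mu>) (borel \<Otimes>\<^sub>M borel)"
    by (simp cong: measurable_cong_sets sets_pair_measure_cong)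
  have m3: "(\<lambda>(\<omega>, w). heis_mult (U \<omega>) w) \<in> measurable (M \<Otimes>\<^sub>M \<mu>) borel" by measurable
  have e1: "emeasure \<rho>1 S = emeasure M (D \<inter> {\<omega> \<in> space M. (U \<omega>, V \<omega>) \<in> S})" if S [measurable]: "S \<in> sets (borel \<Otimes>\<^sub>M borel)" for S
  proof -
    have "emeasure \<rho>1 S = emeasure ?MD {\<omega> \<in> space M. (U \<omega>, V \<omega>) \<in> S}"
      unfolding \<rho>1_def by (subst emeasure_distr) (auto simp: vimage_def Int_def conj_commute)
    also have "\<dots> = (\<integral>\<^sup>+\<omega>. indicator D \<omega> * indicator {\<omega> \<in> space M. (U \<omega>, V \<omega>) \<in> S} \<omega> \<partial>M)"
      by (subst emeasure_density) auto
    also have "\<dots> = (\<integral>\<^sup>+\<omega>. indicator (D \<inter> {\<omega> \<in> space M. (U \<omega>, V \<omega>) \<in> S}) \<omega> \<partial>M)"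
      by (intro nn_integral_cong) (simp add: indicator_inter_arith)
    also have "\<dots> = emeasure M (D \<inter> {\<omega> \<in> space M. (U \<omega>, V \<omega>) \<in> S})"
      by (rule nn_integral_indicator) measurable
    finally show ?thesis .
  qed
  have e2: "emeasure \<rho>2 S = (\<integral>\<^sup>+\<omega>. indicator D \<omega> * emeasure \<mu> {w. (U \<omega>, heis_mult (U \<omega>) w) \<in> S} \<partial>M)"
    if S [measurable]: "S \<in> sets (borel \<Otimes>\<^sub>M borel)" for S
  proof -
    let ?S = "(\<lambda>(\<omega>, w). (U \<omega>, heis_mult (U \<omega>) w)) -` S \<inter> space (M \<Otimes>\<^sub>M \<mu>)"
    have S': "?S \<in> sets (M \<Otimes>\<^sub>M \<mu>)" using m2 S by (rule measurable_sets)
    have "emeasure \<rho>2 S = emeasure (?MD \<Otimes>\<^sub>M \<mu>) ?S"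
      unfolding \<rho>2_def by (subst emeasure_distr[OF m2' S]) (simp add: space_pair_measure)
    also have "\<dots> = (\<integral>\<^sup>+\<omega>. indicator D \<omega> * emeasure \<mu> (Pair \<omega> -` ?S) \<partial>M)"
      by (rule em[OF _ S']) measurable
    also have "\<dots> = (\<integral>\<^sup>+\<omega>. indicator D \<omega> * emeasure \<mu> {w. (U \<omega>, heis_mult (U \<omega>) w) \<in> S} \<partial>M)"
      by (intro nn_integral_cong arg_cong2[where f = "(*)"] refl arg_cong[where f = "emeasure \<mu>"])
         (auto simp: space_pair_measure sp)
    finally show ?thesis .
  qed
  have "\<rho>1 = \<rho>2"
  proof (rule measure_eqI_generator_eq[where E = "{a \<times> b | a b. a \<in> sets borel \<and> b \<in> sets borel}" and
        \<Omega> = UNIV and A = "\<lambda>_. UNIV"])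
    show "Int_stable {a \<times> b | a b. a \<in> sets (borel :: 'd heis measure) \<and> b \<in> sets (borel :: 'd heis measure)}"
      by (rule Int_stable_pair_measure_generator)
    show "emeasure \<rho>1 X = emeasure \<rho>2 X"
      if "X \<in> {a \<times> b | a b. a \<in> sets borel \<and> b \<in> sets borel}" for X
    proof -
      from that obtain A B where X: "X = A \<times> B" and [measurable]: "A \<in> sets borel" "B \<in> sets borel" by auto
      define D' where "D' = D \<inter> (U -` A \<inter> space M)"
      have D': "D' \<in> sets F" unfolding D'_def using D measurable_sets[OF U, of A] sp by auto
      note [measurable] = FM[OF D']
      let ?B = "(\<lambda>(\<omega>, w). heis_mult (U \<omega>) w) -` B \<inter> space (M \<Otimes>\<^sub>M \<mu>)"
      have B': "?B \<in> sets (M \<Otimes>\<^sub>M \<mu>)" using m3 by (rule measurable_sets) fact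
      have "emeasure \<rho>1 X = emeasure M (D' \<inter> {\<omega> \<in> space M. V \<omega> \<in> B})"
        by (subst e1) (auto simp: X D'_def intro!: arg_cong[where f = "emeasure M"])
      also have "\<dots> = (\<integral>\<^sup>+\<omega>. indicator (D' \<inter> {\<omega> \<in> space M. V \<omega> \<in> B}) \<omega> \<partial>M)"
        by (rule nn_integral_indicator[symmetric]) measurable
      also have "\<dots> = (\<integral>\<^sup>+\<omega>. indicator D' \<omega> * indicator {\<omega> \<in> space M. V \<omega> \<in> B} \<omega> \<partial>M)"
        by (intro nn_integral_cong) (simp add: indicator_inter_arith)
      also have "\<dots> = emeasure (density M (indicator D')) {\<omega> \<in> space M. V \<omega> \<in> B}"
        by (subst emeasure_density) auto
      also have "\<dots> = emeasure (distr (density M (indicator D')) borel V) B"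
        by (subst emeasure_distr) (auto simp: vimage_def Int_def conj_commute)
      also have "\<dots> = emeasure (density M (indicator D') \<Otimes>\<^sub>M \<mu>) ?B"
        unfolding eq[OF D'] using m3
        by (subst emeasure_distr) (auto simp: space_pair_measure cong: measurable_cong_sets sets_pair_measure_cong)
      also have "\<dots> = (\<integral>\<^sup>+\<omega>. indicator D' \<omega> * emeasure \<mu> (Pair \<omega> -` ?B) \<partial>M)"
        by (rule em[OF _ B']) measurable
      also have "\<dots> = (\<integral>\<^sup>+\<omega>. indicator D \<omega> * emeasure \<mu> {w. (U \<omega>, heis_mult (U \<omega>) w) \<in> X} \<partial>M)"
        by (intro nn_integral_cong)
           (auto simp: X D'_def indicator_def space_pair_measure sp intro!: arg_cong[where f = "emeasure \<mu>"])
      also have "\<dots> = emeasure \<rho>2 X" by (rule e2[symmetric]) (simp add: X)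
      finally show ?thesis .
    qed
    show "sets \<rho>1 = sigma_sets UNIV {a \<times> b | a b. a \<in> sets borel \<and> b \<in> sets borel}"
      "sets \<rho>2 = sigma_sets UNIV {a \<times> b | a b. a \<in> sets borel \<and> b \<in> sets borel}"
      by (simp_all add: \<rho>1_def \<rho>2_def sets_pair_measure)
    show "range (\<lambda>_. UNIV) \<subseteq> {a \<times> b | a b. a \<in> sets borel \<and> b \<in> sets borel}"
      by (auto intro!: exI[of _ UNIV])
    show "emeasure \<rho>1 UNIV \<noteq> \<infinity>" using e1[of UNIV] sets.top[of "borel \<Otimes>\<^sub>M borel :: ('d heis \<times> 'd heis) measure"]
      by (simp add: space_pair_measure emeasure_eq_measure)
  qed auto
  define E where "E = {pq :: 'd heis \<times> 'd heis. heis_mult (- fst pq) (snd pq) \<in> C}"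
  have E [measurable]: "E \<in> sets (borel \<Otimes>\<^sub>M borel)"
  proof -
    have "(\<lambda>pq :: 'd heis \<times> 'd heis. heis_mult (- fst pq) (snd pq)) \<in> borel_measurable (borel \<Otimes>\<^sub>M borel)"
      by measurable
    from measurable_sets[OF this C'] show ?thesis by (simp add: E_def vimage_def space_pair_measure)
  qed
  have "D \<inter> ((\<lambda>\<omega>. heis_mult (- U \<omega>) (V \<omega>)) -` C \<inter> space M) = D \<inter> {\<omega> \<in> space M. (U \<omega>, V \<omega>) \<in> E}"
    by (auto simp: E_def)
  then have "emeasure M (D \<inter> ((\<lambda>\<omega>. heis_mult (- U \<omega>) (V \<omega>)) -` C \<inter> space M)) = emeasure \<rho>2 E"
    using e1[OF E] \<open>\<rho>1 = \<rho>2\<close> by simp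
  also have "\<dots> = (\<integral>\<^sup>+\<omega>. indicator D \<omega> * emeasure \<mu> C \<partial>M)"
    unfolding e2[OF E] by (simp add: E_def)
  also have "\<dots> = emeasure M D * emeasure \<mu> C"
    by (simp add: nn_integral_multc)
  finally show "measure M (D \<inter> ((\<lambda>\<omega>. heis_mult (- U \<omega>) (V \<omega>)) -` C \<inter> space M)) = measure M D * measure \<mu> C"
    by (simp add: measure_def enn2real_mult)
qed

section \<open>Increments of Brownian motion\<close>

lemma brownian_motionD:
  assumes "brownian_motion M (B :: real \<Rightarrow> 'w \<Rightarrow> 'a::euclidean_space)"
  shows "prob_space M" "\<And>t. 0 \<le> t \<Longrightarrow> B t \<in> borel_measurable M" "AE \<omega> in M. B 0 \<omega> = 0"
    "AE \<omega> in M. continuous_on {0..} (\<lambda>t. B t \<omega>)"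
    "\<And>s t. 0 \<le> s \<Longrightarrow> s < t \<Longrightarrow> distr M borel (\<lambda>\<omega>. B t \<omega> - B s \<omega>) = gauss (t - s)"
    "\<And>(\<tau> :: nat \<Rightarrow> real) n. 0 \<le> \<tau> 0 \<Longrightarrow> mono \<tau> \<Longrightarrow>
      prob_space.indep_vars M (\<lambda>_. borel) (\<lambda>i \<omega>. B (\<tau> (Suc i)) \<omega> - B (\<tau> i) \<omega>) {..<n}"
proof -
  show "distr M borel (\<lambda>\<omega>. B t \<omega> - B s \<omega>) = gauss (t - s)" if "0 \<le> s" "s < t" for s t
  proof -
    have "distributed M lborel (\<lambda>\<omega>. B t \<omega> - B s \<omega>)
        (\<lambda>x. ennreal (exp (- (norm x)\<^sup>2 / (2 * (t - s))) / sqrt (2 * pi * (t - s)) ^ DIM('a)))"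
      using assms that unfolding brownian_motion_def by blast
    from distributed_distr_eq_density[OF this]
    show ?thesis by (simp add: gauss_def cong: distr_cong)
  qed
qed (use assms in \<open>unfold brownian_motion_def, blast+\<close>)

text \<open>The times in \<open>J\<close>, together with \<open>0\<close> and \<open>s\<close>, form an increasing grid that ends at \<open>s\<close>.
  The positions at the times in \<open>J\<close> are partial sums of the increments over this grid, and the
  increment from \<open>s\<close> to \<open>t\<close> is independent of them.\<close>

lemma brownian_increment_cylinder:
  fixes B :: "real \<Rightarrow> 'w \<Rightarrow> 'a::euclidean_space"
  assumes bm: "brownian_motion M B" and st: "0 \<le> s" "s < t"
    and J: "finite J" "J \<subseteq> {0..s}" and A: "\<And>r. A r \<in> sets borel" and C: "C \<in> sets borel"
  shows "measure M ({\<omega> \<in> space M. \<forall>r\<in>J. B r \<omega> \<in> A r} \<inter> {\<omega> \<in> space M. B t \<omega> - B s \<omega> \<in> C}) =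
    measure M {\<omega> \<in> space M. \<forall>r\<in>J. B r \<omega> \<in> A r} * measure (gauss (t - s)) C"
proof -
  interpret prob_space M using bm by (rule brownian_motionD)
  note meas = brownian_motionD(2)[OF bm]
  note [measurable] = A C
  define K where "K = insert 0 (insert s J)"
  define L where "L = sorted_list_of_set K"
  define m where "m = length L - 1"
  define \<tau> where "\<tau> i = (if i \<le> m then L ! i else t)" for i
  have K: "finite K" "K \<subseteq> {0..s}" using J st by (auto simp: K_def)
  have L: "set L = K" "sorted L" using K by (auto simp: L_def)
  have "L \<noteq> []" using L by (auto simp: K_def)
  then have len: "length L = Suc m" by (simp add: m_def)
  have LK: "L ! i \<in> K" if "i \<le> m" for i using that len L(1) by (metis less_Suc_eq_le nth_mem)
  have mono: "mono \<tau>"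
  proof (rule monoI)
    fix i j :: nat assume "i \<le> j"
    then show "\<tau> i \<le> \<tau> j"
      using LK[of i] LK[of j] K(2) st sorted_nth_mono[OF L(2), of i j] len by (auto simp: \<tau>_def)
  qed
  have ex: "\<exists>i\<le>m. \<tau> i = r" if "r \<in> K" for r
    using that L(1) len unfolding in_set_conv_nth[of r L, unfolded L(1)] by (auto simp: \<tau>_def less_Suc_eq_le)
  then obtain idx where idx: "\<And>r. r \<in> K \<Longrightarrow> idx r \<le> m \<and> \<tau> (idx r) = r" by metis
  have \<tau>0: "\<tau> 0 = 0"
  proof -
    have "\<tau> 0 \<le> \<tau> (idx 0)" by (rule monoD[OF mono]) simp
    moreover have "0 \<le> \<tau> 0" using LK[of 0] K(2) by (auto simp: \<tau>_def)
    ultimately show ?thesis using idx[of 0] by (simp add: K_def)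
  qed
  have \<tau>m: "\<tau> m = s"
  proof -
    have "\<tau> (idx s) \<le> \<tau> m" using idx[of s] by (intro monoD[OF mono]) (auto simp: K_def)
    moreover have "\<tau> m \<le> s" using LK[of m] K(2) by (auto simp: \<tau>_def)
    ultimately show ?thesis using idx[of s] by (simp add: K_def)
  qed
  have \<tau>Suc: "\<tau> (Suc m) = t" by (simp add: \<tau>_def)
  have \<tau>nn: "0 \<le> \<tau> i" for i using monoD[OF mono, of 0 i] \<tau>0 by simp
  define X where "X i \<omega> = B (\<tau> (Suc i)) \<omega> - B (\<tau> i) \<omega>" for i \<omega>
  have [measurable]: "X i \<in> borel_measurable M" for i
    unfolding X_def using meas \<tau>nn by (intro borel_measurable_diff) auto
  have "indep_vars (\<lambda>_. borel) X {..<Suc m}"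
    using brownian_motionD(6)[OF bm, of \<tau> "Suc m"] \<tau>0 mono by (simp add: X_def[abs_def])
  then have ind: "indep_var (PiM {..<m} (\<lambda>_. borel)) (\<lambda>\<omega>. restrict (\<lambda>i. X i \<omega>) {..<m})
      (PiM {m} (\<lambda>_. borel)) (\<lambda>\<omega>. restrict (\<lambda>i. X i \<omega>) {m})"
    by (rule indep_var_restrict) auto
  define E1 where "E1 = {x \<in> space (PiM {..<m} (\<lambda>_. borel :: 'a measure)). \<forall>r\<in>J. (\<Sum>i<idx r. x i) \<in> A r}"
  define E2 where "E2 = {x \<in> space (PiM {m} (\<lambda>_. borel :: 'a measure)). x m \<in> C}"
  have E1: "E1 \<in> sets (PiM {..<m} (\<lambda>_. borel))"
  proof -
    have [measurable]: "(\<lambda>x. \<Sum>i<idx r. x i) \<in> measurable (PiM {..<m} (\<lambda>_. borel :: 'a measure)) borel" if "r \<in> J" for r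
      using idx[of r] that by (intro borel_measurable_sum measurable_component_singleton) (auto simp: K_def)
    show ?thesis unfolding E1_def using J(1) by (intro sets.sets_Collect_finite_All) measurable
  qed
  have E2: "E2 \<in> sets (PiM {m} (\<lambda>_. borel))" unfolding E2_def by measurable
  have F1: "(\<lambda>\<omega>. restrict (\<lambda>i. X i \<omega>) {..<m}) -` E1 \<inter> space M = {\<omega> \<in> space M. \<forall>r\<in>J. (\<Sum>i<idx r. X i \<omega>) \<in> A r}"
  proof -
    have "(\<Sum>i<idx r. restrict (\<lambda>i. X i \<omega>) {..<m} i) = (\<Sum>i<idx r. X i \<omega>)" if "r \<in> J" for r \<omega>
      using idx[of r] that by (intro sum.cong) (auto simp: K_def)
    then show ?thesis by (auto simp: E1_def space_PiM)
  qed
  have F2: "(\<lambda>\<omega>. restrict (\<lambda>i. X i \<omega>) {m}) -` E2 \<inter> space M = {\<omega> \<in> space M. B t \<omega> - B s \<omega> \<in> C}"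
    by (auto simp: E2_def space_PiM X_def \<tau>m \<tau>Suc)
  have Bt [measurable]: "B t \<in> borel_measurable M" "B s \<in> borel_measurable M" using meas st by auto
  have tele: "(\<Sum>i<k. X i \<omega>) = B (\<tau> k) \<omega> - B 0 \<omega>" for k \<omega>
    unfolding X_def using sum_lessThan_telescope[of "\<lambda>i. B (\<tau> i) \<omega>" k] by (simp add: \<tau>0)
  have ae: "AE \<omega> in M. (\<forall>r\<in>J. B r \<omega> \<in> A r) \<longleftrightarrow> (\<forall>r\<in>J. (\<Sum>i<idx r. X i \<omega>) \<in> A r)"
    using brownian_motionD(3)[OF bm]
  proof eventually_elim
    case (elim \<omega>)
    have "(\<Sum>i<idx r. X i \<omega>) = B r \<omega>" if "r \<in> J" for r using idx[of r] that by (simp add: tele elim K_def)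
    then show ?case by simp
  qed
  have D2 [measurable]: "{\<omega> \<in> space M. \<forall>r\<in>J. (\<Sum>i<idx r. X i \<omega>) \<in> A r} \<in> sets M"
    using J(1) by (intro sets.sets_Collect_finite_All) measurable
  have D1 [measurable]: "{\<omega> \<in> space M. \<forall>r\<in>J. B r \<omega> \<in> A r} \<in> sets M"
  proof (rule sets.sets_Collect_finite_All[OF _ J(1)])
    fix r assume "r \<in> J"
    then have [measurable]: "B r \<in> borel_measurable M" using J by (intro meas) auto
    show "{\<omega> \<in> space M. B r \<omega> \<in> A r} \<in> sets M" by measurable
  qed
  have "prob ({\<omega> \<in> space M. \<forall>r\<in>J. B r \<omega> \<in> A r} \<inter> {\<omega> \<in> space M. B t \<omega> - B s \<omega> \<in> C}) =
    prob ({\<omega> \<in> space M. \<forall>r\<in>J. (\<Sum>i<idx r. X i \<omega>) \<in> A r} \<inter> {\<omega> \<in> space M. B t \<omega> - B s \<omega> \<in> C})"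
    using ae by (intro finite_measure_eq_AE) auto
  also have "\<dots> = prob {\<omega> \<in> space M. \<forall>r\<in>J. (\<Sum>i<idx r. X i \<omega>) \<in> A r} * prob {\<omega> \<in> space M. B t \<omega> - B s \<omega> \<in> C}"
  proof -
    have "(\<lambda>x. (restrict (\<lambda>i. X i x) {..<m}, restrict (\<lambda>i. X i x) {m})) -` (E1 \<times> E2) \<inter> space M =
      ((\<lambda>\<omega>. restrict (\<lambda>i. X i \<omega>) {..<m}) -` E1 \<inter> space M) \<inter> ((\<lambda>\<omega>. restrict (\<lambda>i. X i \<omega>) {m}) -` E2 \<inter> space M)"
      by auto
    with indep_varD[OF ind E1 E2] show ?thesis unfolding F1 F2 by simp
  qed
  also have "prob {\<omega> \<in> space M. \<forall>r\<in>J. (\<Sum>i<idx r. X i \<omega>) \<in> A r} = prob {\<omega> \<in> space M. \<forall>r\<in>J. B r \<omega> \<in> A r}"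
    using ae by (intro finite_measure_eq_AE) auto
  also have "prob {\<omega> \<in> space M. B t \<omega> - B s \<omega> \<in> C} = measure (gauss (t - s)) C"
    unfolding brownian_motionD(5)[OF bm st, symmetric]
    by (subst measure_distr) (auto simp: vimage_def Int_def conj_commute)
  finally show ?thesis .
qed

text \<open>For the pair of two independent Brownian motions, cylinder events of the past and
  rectangles of the target factor over the two components.\<close>

lemma brownian_pair_increment:
  fixes B1 B2 :: "real \<Rightarrow> 'w \<Rightarrow> 'a::euclidean_space"
  assumes bm1: "brownian_motion M B1" and bm2: "brownian_motion M B2"
    and ind: "prob_space.indep_var M
        (PiM {0..} (\<lambda>_. borel)) (\<lambda>\<omega>. \<lambda>t\<in>{0..}. B1 t \<omega>)
        (PiM {0..} (\<lambda>_. borel)) (\<lambda>\<omega>. \<lambda>t\<in>{0..}. B2 t \<omega>)"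
    and st: "0 \<le> s" "s < t"
  defines "B \<equiv> \<lambda>r \<omega>. (B1 r \<omega>, B2 r \<omega>)"
  shows "indep_law M (natural_filtration M B s) (\<lambda>\<omega>. B t \<omega> - B s \<omega>) (gauss (t - s))"
proof -
  interpret prob_space M using bm1 by (rule brownian_motionD)
  note meas1 = brownian_motionD(2)[OF bm1] and meas2 = brownian_motionD(2)[OF bm2]
  have measB: "B r \<in> borel_measurable M" if "0 \<le> r" for r
    unfolding B_def borel_prod[symmetric] using meas1[OF that] meas2[OF that] by (rule measurable_Pair)
  have diffB: "B t \<omega> - B s \<omega> = (B1 t \<omega> - B1 s \<omega>, B2 t \<omega> - B2 s \<omega>)" for \<omega> by (simp add: B_def)
  let ?g = "gauss (t - s) :: 'a measure"
  have v: "t - s > 0" using st by simp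
  interpret g2: prob_space ?g by (rule prob_space_gauss[OF v])
  have prod: "prob (D1 \<inter> D2) = prob D1 * prob D2"
    if D1: "D1 = {\<omega> \<in> space M. (\<forall>r\<in>J. B1 r \<omega> \<in> A1 r) \<and> B1 t \<omega> - B1 s \<omega> \<in> C1}"
    and D2: "D2 = {\<omega> \<in> space M. (\<forall>r\<in>J. B2 r \<omega> \<in> A2 r) \<and> B2 t \<omega> - B2 s \<omega> \<in> C2}"
    and J: "finite J" "J \<subseteq> {0..s}" and A: "\<And>r. A1 r \<in> sets borel" "\<And>r. A2 r \<in> sets borel"
    and C: "C1 \<in> sets borel" "C2 \<in> sets borel" for D1 D2 J A1 A2 C1 C2
  proof -
    note [measurable] = A C
    define S1 where "S1 = {x \<in> space (PiM {0..} (\<lambda>_. borel :: 'a measure)). (\<forall>r\<in>J. x r \<in> A1 r) \<and> x t - x s \<in> C1}"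
    define S2 where "S2 = {x \<in> space (PiM {0..} (\<lambda>_. borel :: 'a measure)). (\<forall>r\<in>J. x r \<in> A2 r) \<and> x t - x s \<in> C2}"
    have c1 [measurable]: "(\<lambda>x. x r) \<in> measurable (PiM {0..} (\<lambda>_. borel :: 'a measure)) borel" if "0 \<le> r" for r
      using that by (intro measurable_component_singleton) auto
    have c2 [measurable]: "(\<lambda>x. x r) \<in> measurable (PiM {0..} (\<lambda>_. borel :: 'a measure)) borel" if "0 \<le> r" for r
      using that by (intro measurable_component_singleton) auto
    have tnn: "0 \<le> t" using st by simp
    have S1: "S1 \<in> sets (PiM {0..} (\<lambda>_. borel))"
    proof -
      have [measurable]: "Measurable.pred (PiM {0..} (\<lambda>_. borel :: 'a measure)) (\<lambda>x. \<forall>r\<in>J. x r \<in> A1 r)"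
        using J c1 A(1) by (intro pred_intros_finite pred_sets2[of _ borel]) auto
      have [measurable]: "(\<lambda>x. x t - x s) \<in> measurable (PiM {0..} (\<lambda>_. borel :: 'a measure)) borel"
        using c1[OF tnn] c1[OF st(1)] by (rule borel_measurable_diff)
      show ?thesis unfolding S1_def by measurable
    qed
    have S2: "S2 \<in> sets (PiM {0..} (\<lambda>_. borel))"
    proof -
      have [measurable]: "Measurable.pred (PiM {0..} (\<lambda>_. borel :: 'a measure)) (\<lambda>x. \<forall>r\<in>J. x r \<in> A2 r)"
        using J c2 A(2) by (intro pred_intros_finite pred_sets2[of _ borel]) auto
      have [measurable]: "(\<lambda>x. x t - x s) \<in> measurable (PiM {0..} (\<lambda>_. borel :: 'a measure)) borel"
        using c2[OF tnn] c2[OF st(1)] by (rule borel_measurable_diff)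
      show ?thesis unfolding S2_def by measurable
    qed
    have Jr: "r \<in> {0..}" if "r \<in> J" for r using J that by auto
    have "(\<lambda>\<omega>. \<lambda>t\<in>{0..}. B1 t \<omega>) -` S1 \<inter> space M = D1" "(\<lambda>\<omega>. \<lambda>t\<in>{0..}. B2 t \<omega>) -` S2 \<inter> space M = D2"
      unfolding S1_def S2_def D1 D2 using Jr st tnn by (auto simp: space_PiM)
    moreover have "(\<lambda>x. (\<lambda>t\<in>{0..}. B1 t x, \<lambda>t\<in>{0..}. B2 t x)) -` (S1 \<times> S2) \<inter> space M =
      ((\<lambda>\<omega>. \<lambda>t\<in>{0..}. B1 t \<omega>) -` S1 \<inter> space M) \<inter> ((\<lambda>\<omega>. \<lambda>t\<in>{0..}. B2 t \<omega>) -` S2 \<inter> space M)" by auto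
    ultimately show ?thesis using indep_varD[OF ind S1 S2] by simp
  qed
  define G where "G = {{\<omega> \<in> space M. \<forall>r\<in>J. B1 r \<omega> \<in> A1 r \<and> B2 r \<omega> \<in> A2 r} | J A1 A2.
      finite J \<and> J \<subseteq> {0..s} \<and> (\<forall>r. A1 r \<in> sets borel) \<and> (\<forall>r. A2 r \<in> sets borel)}"
  have cyl: "prob (D \<inter> {\<omega> \<in> space M. B1 t \<omega> - B1 s \<omega> \<in> C1 \<and> B2 t \<omega> - B2 s \<omega> \<in> C2}) =
      prob D * (measure ?g C1 * measure ?g C2)"
    if "D \<in> G" and C: "C1 \<in> sets borel" "C2 \<in> sets borel" for D C1 C2
  proof -
    obtain J A1 A2 where D: "D = {\<omega> \<in> space M. \<forall>r\<in>J. B1 r \<omega> \<in> A1 r \<and> B2 r \<omega> \<in> A2 r}"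
      and J: "finite J" "J \<subseteq> {0..s}" and A: "\<And>r. A1 r \<in> sets borel" "\<And>r. A2 r \<in> sets borel"
      using \<open>D \<in> G\<close> by (auto simp: G_def)
    let ?D1 = "\<lambda>C. {\<omega> \<in> space M. (\<forall>r\<in>J. B1 r \<omega> \<in> A1 r) \<and> B1 t \<omega> - B1 s \<omega> \<in> C}"
    let ?D2 = "\<lambda>C. {\<omega> \<in> space M. (\<forall>r\<in>J. B2 r \<omega> \<in> A2 r) \<and> B2 t \<omega> - B2 s \<omega> \<in> C}"
    have "D = ?D1 UNIV \<inter> ?D2 UNIV" by (auto simp: D)
    then have PD: "prob D = prob (?D1 UNIV) * prob (?D2 UNIV)"
      using prod[OF refl refl J A, of UNIV UNIV] by simp
    have "D \<inter> {\<omega> \<in> space M. B1 t \<omega> - B1 s \<omega> \<in> C1 \<and> B2 t \<omega> - B2 s \<omega> \<in> C2} = ?D1 C1 \<inter> ?D2 C2"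
      by (auto simp: D)
    then have "prob (D \<inter> {\<omega> \<in> space M. B1 t \<omega> - B1 s \<omega> \<in> C1 \<and> B2 t \<omega> - B2 s \<omega> \<in> C2}) = prob (?D1 C1) * prob (?D2 C2)"
      using prod[OF refl refl J A C] by simp
    also have "prob (?D1 C1) = prob (?D1 UNIV) * measure ?g C1"
      using brownian_increment_cylinder[OF bm1 st J, of A1 C1] A C by (simp add: Int_def conj_ac)
    also have "prob (?D2 C2) = prob (?D2 UNIV) * measure ?g C2"
      using brownian_increment_cylinder[OF bm2 st J, of A2 C2] A C by (simp add: Int_def conj_ac)
    finally show ?thesis by (simp add: PD)
  qed
  have GM: "G \<subseteq> sets M"
  proof
    fix D assume "D \<in> G"
    then obtain J A1 A2 where D: "D = {\<omega> \<in> space M. \<forall>r\<in>J. B1 r \<omega> \<in> A1 r \<and> B2 r \<omega> \<in> A2 r}"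
      and J: "finite J" "J \<subseteq> {0..s}" and A [measurable]: "\<And>r. A1 r \<in> sets borel" "\<And>r. A2 r \<in> sets borel"
      by (auto simp: G_def)
    show "D \<in> sets M" unfolding D
    proof (rule sets.sets_Collect_finite_All[OF _ J(1)])
      fix r assume "r \<in> J"
      then have "0 \<le> r" using J by auto
      note [measurable] = meas1[OF this] meas2[OF this]
      show "{\<omega> \<in> space M. B1 r \<omega> \<in> A1 r \<and> B2 r \<omega> \<in> A2 r} \<in> sets M" by measurable
    qed
  qed
  have Gint: "Int_stable G"
    unfolding Int_stable_def
  proof (intro ballI)
    fix D D' assume "D \<in> G" "D' \<in> G"
    then obtain J A1 A2 J' A1' A2' where
      D: "D = {\<omega> \<in> space M. \<forall>r\<in>J. B1 r \<omega> \<in> A1 r \<and> B2 r \<omega> \<in> A2 r}"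
         "finite J" "J \<subseteq> {0..s}" "\<And>r. A1 r \<in> sets borel" "\<And>r. A2 r \<in> sets borel" and
      D': "D' = {\<omega> \<in> space M. \<forall>r\<in>J'. B1 r \<omega> \<in> A1' r \<and> B2 r \<omega> \<in> A2' r}"
         "finite J'" "J' \<subseteq> {0..s}" "\<And>r. A1' r \<in> sets borel" "\<And>r. A2' r \<in> sets borel"
      unfolding G_def by auto
    define E1 where "E1 r = (if r \<in> J then A1 r else UNIV) \<inter> (if r \<in> J' then A1' r else UNIV)" for r
    define E2 where "E2 r = (if r \<in> J then A2 r else UNIV) \<inter> (if r \<in> J' then A2' r else UNIV)" for r
    have "D \<inter> D' = {\<omega> \<in> space M. \<forall>r\<in>J \<union> J'. B1 r \<omega> \<in> E1 r \<and> B2 r \<omega> \<in> E2 r}"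
      unfolding D(1) D'(1) E1_def E2_def by auto
    moreover have "E1 r \<in> sets borel" "E2 r \<in> sets borel" for r using D D' by (auto simp: E1_def E2_def)
    ultimately show "D \<inter> D' \<in> G" unfolding G_def using D(2,3) D'(2,3)
      by (intro CollectI exI[of _ "J \<union> J'"] exI[of _ E1] exI[of _ E2]) auto
  qed
  have spaceG: "space M \<in> G"
    unfolding G_def by (intro CollectI exI[of _ "{}"] exI[of _ "\<lambda>_. UNIV"]) auto
  have FG: "sets (natural_filtration M B s) \<subseteq> sigma_sets (space M) G"
    unfolding sets_natural_filtration
  proof (rule sigma_sets_mono, rule subsetI)
    fix D assume "D \<in> {B r -` A \<inter> space M | r A. r \<in> {0..s} \<and> A \<in> sets borel}"
    then obtain r A where D: "D = B r -` A \<inter> space M" "r \<in> {0..s}" "A \<in> sets borel" by auto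
    let ?S = "sigma (space M) G"
    have sS: "space ?S = space M" "sets ?S = sigma_sets (space M) G"
      using GM sets.sets_into_space by (auto intro!: space_measure_of sets_measure_of simp: subset_eq)
    have "B1 r \<in> measurable ?S borel"
    proof (rule measurableI)
      fix A :: "'a set" assume "A \<in> sets borel"
      then have "B1 r -` A \<inter> space M \<in> G" unfolding G_def using D(2)
        by (intro CollectI exI[of _ "{r}"] exI[of _ "\<lambda>_. A"] exI[of _ "\<lambda>_. UNIV"]) auto
      then show "B1 r -` A \<inter> space ?S \<in> sets ?S" unfolding sS by (rule sigma_sets.Basic)
    qed simp
    moreover have "B2 r \<in> measurable ?S borel"
    proof (rule measurableI)
      fix A :: "'a set" assume "A \<in> sets borel"
      then have "B2 r -` A \<inter> space M \<in> G" unfolding G_def using D(2)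
        by (intro CollectI exI[of _ "{r}"] exI[of _ "\<lambda>_. UNIV"] exI[of _ "\<lambda>_. A"]) auto
      then show "B2 r -` A \<inter> space ?S \<in> sets ?S" unfolding sS by (rule sigma_sets.Basic)
    qed simp
    ultimately have "B r \<in> measurable ?S borel"
      unfolding B_def borel_prod[symmetric] by (rule measurable_Pair)
    from measurable_sets[OF this D(3)] show "D \<in> sigma_sets (space M) G" unfolding sS D(1) .
  qed
  show ?thesis
  proof (rule indep_lawI_generator[where G = "{a \<times> b | a b. a \<in> sets borel \<and> b \<in> sets borel}"])
    show "subalgebra M (natural_filtration M B s)" by (rule subalgebra_natural_filtration) (rule measB)
    show "(\<lambda>\<omega>. B t \<omega> - B s \<omega>) \<in> measurable M (gauss (t - s))"
      using measB st by (simp add: measurable_cong_sets[OF refl sets_gauss] borel_measurable_diff)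
    show "prob_space (gauss (t - s) :: ('a \<times> 'a) measure)" by (rule prob_space_gauss[OF v])
    show "Int_stable {a \<times> b | a b. a \<in> sets (borel :: 'a measure) \<and> b \<in> sets (borel :: 'a measure)}"
      by (rule Int_stable_pair_measure_generator)
    show "sets (gauss (t - s)) = sigma_sets (space (gauss (t - s))) {a \<times> b | a b. a \<in> sets (borel :: 'a measure) \<and> b \<in> sets (borel :: 'a measure)}"
      by (simp add: borel_prod[symmetric] sets_pair_measure)
    fix D C assume D: "D \<in> sets (natural_filtration M B s)"
      and "C \<in> {a \<times> b | a b. a \<in> sets (borel :: 'a measure) \<and> b \<in> sets (borel :: 'a measure)}"
    then obtain C1 C2 where C: "C = C1 \<times> C2" "C1 \<in> sets borel" "C2 \<in> sets borel" by auto
    define E where "E = {\<omega> \<in> space M. B1 t \<omega> - B1 s \<omega> \<in> C1 \<and> B2 t \<omega> - B2 s \<omega> \<in> C2}"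
    have E: "(\<lambda>\<omega>. B t \<omega> - B s \<omega>) -` C \<inter> space M = E" by (auto simp: E_def C(1) diffB)
    have "C \<in> sets (borel :: ('a \<times> 'a) measure)"
      unfolding C(1) borel_prod[symmetric] using C by simp
    then have EM: "E \<in> sets M"
      unfolding E[symmetric] using measB st by (intro measurable_sets[OF borel_measurable_diff]) auto
    have PE: "prob E = measure ?g C1 * measure ?g C2"
      using cyl[OF spaceG C(2,3)] sets.sets_into_space[OF EM] by (simp add: prob_space Int_absorb1 flip: E_def)
    have "prob (D \<inter> E) = prob D * prob E"
    proof (rule indep_event_generator[OF Gint _ GM EM])
      show "G \<subseteq> Pow (space M)" using GM sets.sets_into_space by blast
      show "D \<in> sigma_sets (space M) G" using D FG by blast
      show "prob (D \<inter> E) = prob D * prob E" if "D \<in> G" for D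
        unfolding PE using cyl[OF that C(2,3)] by (simp add: E_def)
    qed
    also have "prob E = measure (gauss (t - s)) C"
      unfolding PE C(1) gauss_pair[OF v, symmetric]
      using C by (simp add: measure_def g2.emeasure_pair_measure_Times enn2real_mult)
    finally show "prob (D \<inter> ((\<lambda>\<omega>. B t \<omega> - B s \<omega>) -` C \<inter> space M)) = prob D * measure (gauss (t - s)) C"
      by (simp only: E)
  qed (auto intro: prob_space_axioms)
qed

section \<open>The Ito isometry and Riemann sums\<close>

lemma indep_law_integral_mult:
  fixes f :: "'w \<Rightarrow> real" and g :: "'b \<Rightarrow> real"
  assumes V: "indep_law M F V \<mu>" and f: "f \<in> borel_measurable F" and g: "g \<in> borel_measurable \<mu>"
    and int: "integrable M f" "integrable M (\<lambda>\<omega>. g (V \<omega>))"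
  shows "integrable M (\<lambda>\<omega>. f \<omega> * g (V \<omega>))"
    "(\<integral>\<omega>. f \<omega> * g (V \<omega>) \<partial>M) = (\<integral>\<omega>. f \<omega> \<partial>M) * (\<integral>\<omega>. g (V \<omega>) \<partial>M)"
proof -
  interpret prob_space M using V by (rule indep_lawD)
  have gV: "indep_law M F (\<lambda>\<omega>. g (V \<omega>)) (distr \<mu> borel g)" by (rule indep_law_compose[OF V g])
  have fM: "f \<in> borel_measurable M" using f indep_lawD(2)[OF V] by (rule measurable_from_subalg[rotated])
  have gM: "(\<lambda>\<omega>. g (V \<omega>)) \<in> borel_measurable M"
    using indep_lawD(3)[OF gV] by (simp cong: measurable_cong_sets)
  have law: "distr \<mu> borel g = distr M borel (\<lambda>\<omega>. g (V \<omega>))"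
    using indep_law_distr[OF gV] by (simp cong: distr_cong)
  have "distr M (borel \<Otimes>\<^sub>M distr \<mu> borel g) (\<lambda>\<omega>. (f \<omega>, g (V \<omega>))) = distr M borel f \<Otimes>\<^sub>M distr \<mu> borel g"
    by (rule indep_law_joint_distr[OF gV f])
  moreover have "distr M (borel \<Otimes>\<^sub>M distr \<mu> borel g) (\<lambda>\<omega>. (f \<omega>, g (V \<omega>))) = distr M (borel \<Otimes>\<^sub>M borel) (\<lambda>\<omega>. (f \<omega>, g (V \<omega>)))"
    by (intro distr_cong refl sets_pair_measure_cong) simp_all
  ultimately have "indep_var borel f borel (\<lambda>\<omega>. g (V \<omega>))"
    unfolding indep_var_distribution_eq using fM gM by (simp add: law)
  then show "integrable M (\<lambda>\<omega>. f \<omega> * g (V \<omega>))"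
    "(\<integral>\<omega>. f \<omega> * g (V \<omega>) \<partial>M) = (\<integral>\<omega>. f \<omega> \<partial>M) * (\<integral>\<omega>. g (V \<omega>) \<partial>M)"
    using int by (auto intro: indep_var_integrable indep_var_lebesgue_integral)
qed

lemma normal_law_moments:
  assumes V: "V \<in> borel_measurable M" and law: "distr M borel V = density lborel (normal_density 0 \<sigma>)" and "\<sigma> > 0"
  shows "integrable M (\<lambda>\<omega>. V \<omega> ^ k)"
    "(\<integral>\<omega>. V \<omega> \<partial>M) = 0" "(\<integral>\<omega>. (V \<omega>)\<^sup>2 \<partial>M) = \<sigma>\<^sup>2" "(\<integral>\<omega>. (V \<omega>) ^ 4 \<partial>M) = 3 * \<sigma> ^ 4"
proof -
  have tr: "integrable M (\<lambda>\<omega>. V \<omega> ^ k) \<longleftrightarrow> integrable lborel (\<lambda>x. normal_density 0 \<sigma> x * x ^ k)"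
    "(\<integral>\<omega>. V \<omega> ^ k \<partial>M) = (\<integral>x. normal_density 0 \<sigma> x * x ^ k \<partial>lborel)" for k
  proof -
    have "integrable M (\<lambda>\<omega>. V \<omega> ^ k) \<longleftrightarrow> integrable (distr M borel V) (\<lambda>x. x ^ k)"
      using V by (simp add: integrable_distr_eq)
    then show "integrable M (\<lambda>\<omega>. V \<omega> ^ k) \<longleftrightarrow> integrable lborel (\<lambda>x. normal_density 0 \<sigma> x * x ^ k)"
      by (simp add: law integrable_density)
    have "(\<integral>\<omega>. V \<omega> ^ k \<partial>M) = (\<integral>x. x ^ k \<partial>distr M borel V)"
      using V by (simp add: integral_distr)
    then show "(\<integral>\<omega>. V \<omega> ^ k \<partial>M) = (\<integral>x. normal_density 0 \<sigma> x * x ^ k \<partial>lborel)"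
      by (simp add: law integral_density)
  qed
  have even: "has_bochner_integral lborel (\<lambda>x. normal_density 0 \<sigma> x * x ^ (2 * j)) (fact (2 * j) / ((2 / \<sigma>\<^sup>2)^j * fact j))" for j
    using normal_moment_even[OF \<open>\<sigma> > 0\<close>, of 0 j] by simp
  have odd: "has_bochner_integral lborel (\<lambda>x. normal_density 0 \<sigma> x * x ^ (2 * j + 1)) 0" for j
    using normal_moment_odd[OF \<open>\<sigma> > 0\<close>, of 0 j] by simp
  show "integrable M (\<lambda>\<omega>. V \<omega> ^ k)"
  proof (cases "even k")
    case True
    then obtain j where "k = 2 * j" by (auto elim: evenE)
    then show ?thesis using even[of j] by (simp add: tr(1) has_bochner_integral_iff)
  next
    case False
    then obtain j where "k = 2 * j + 1" by (auto elim: oddE)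
    then show ?thesis using odd[of j] unfolding tr(1) by (simp add: has_bochner_integral_iff)
  qed
  show "(\<integral>\<omega>. V \<omega> \<partial>M) = 0" using odd[of 0] tr(2)[of 1] by (simp add: has_bochner_integral_iff)
  show "(\<integral>\<omega>. (V \<omega>)\<^sup>2 \<partial>M) = \<sigma>\<^sup>2" using even[of 1] tr(2)[of 2] by (simp add: has_bochner_integral_iff)
  show "(\<integral>\<omega>. (V \<omega>) ^ 4 \<partial>M) = 3 * \<sigma> ^ 4"
    using even[of 2] tr(2)[of 4] by (simp add: has_bochner_integral_iff fact_numeral power_divide power_mult[symmetric])
qed

lemma integrable_mult_L2:
  fixes f g :: "'w \<Rightarrow> real"
  assumes [measurable]: "f \<in> borel_measurable M" "g \<in> borel_measurable M"
    and int: "integrable M (\<lambda>\<omega>. (f \<omega>)\<^sup>2)" "integrable M (\<lambda>\<omega>. (g \<omega>)\<^sup>2)"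
  shows "integrable M (\<lambda>\<omega>. f \<omega> * g \<omega>)"
proof (rule Bochner_Integration.integrable_bound[OF Bochner_Integration.integrable_add[OF int]])
  have "\<bar>a * b\<bar> \<le> a\<^sup>2 + b\<^sup>2" for a b :: real
    using sum_squares_bound[of "\<bar>a\<bar>" "\<bar>b\<bar>"] mult_nonneg_nonneg[of "\<bar>a\<bar>" "\<bar>b\<bar>"]
    unfolding abs_mult power2_abs by linarith
  then show "AE \<omega> in M. norm (f \<omega> * g \<omega>) \<le> norm ((f \<omega>)\<^sup>2 + (g \<omega>)\<^sup>2)" by (simp add: abs_mult)
qed measurable

text \<open>A scalar Brownian motion relative to a filtration: adapted, with centred normal increments
  independent of the past. The coordinates of a Brownian motion are of this kind for the natural
  filtration of the whole.\<close>

locale scalar_brownian = prob_space M for M :: "'w measure" +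
  fixes F :: "real \<Rightarrow> 'w measure" and \<beta> :: "real \<Rightarrow> 'w \<Rightarrow> real"
  assumes sub: "\<And>t. subalgebra M (F t)"
    and mono: "\<And>s t. s \<le> t \<Longrightarrow> sets (F s) \<subseteq> sets (F t)"
    and adapted: "\<And>r t. 0 \<le> r \<Longrightarrow> r \<le> t \<Longrightarrow> \<beta> r \<in> borel_measurable (F t)"
    and increment: "\<And>s t. 0 \<le> s \<Longrightarrow> s < t \<Longrightarrow>
      indep_law M (F s) (\<lambda>\<omega>. \<beta> t \<omega> - \<beta> s \<omega>) (density lborel (normal_density 0 (sqrt (t - s))))"
begin

lemma F_mono:
  assumes "f \<in> borel_measurable (F s)" "s \<le> t" shows "f \<in> borel_measurable (F t)"
proof -
  have "space (F s) = space (F t)" using sub[of s] sub[of t] by (simp add: subalgebra_def)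
  then have "subalgebra (F t) (F s)" using mono[OF assms(2)] by (simp add: subalgebra_def)
  then show ?thesis using assms(1) by (rule measurable_from_subalg)
qed

lemma F_M: "f \<in> borel_measurable (F s) \<Longrightarrow> f \<in> borel_measurable M"
  using sub by (rule measurable_from_subalg)

lemma \<beta>_M [measurable]: "0 \<le> r \<Longrightarrow> \<beta> r \<in> borel_measurable M"
  using adapted[of r r] F_M by auto

lemma increment_moments:
  assumes "0 \<le> s" "s \<le> t"
  shows "integrable M (\<lambda>\<omega>. (\<beta> t \<omega> - \<beta> s \<omega>) ^ k)" "(\<integral>\<omega>. \<beta> t \<omega> - \<beta> s \<omega> \<partial>M) = 0"
    "(\<integral>\<omega>. (\<beta> t \<omega> - \<beta> s \<omega>)\<^sup>2 \<partial>M) = t - s" "(\<integral>\<omega>. (\<beta> t \<omega> - \<beta> s \<omega>) ^ 4 \<partial>M) = 3 * (t - s)\<^sup>2"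
proof -
  have "integrable M (\<lambda>\<omega>. (\<beta> t \<omega> - \<beta> s \<omega>) ^ k) \<and> (\<integral>\<omega>. \<beta> t \<omega> - \<beta> s \<omega> \<partial>M) = 0 \<and>
    (\<integral>\<omega>. (\<beta> t \<omega> - \<beta> s \<omega>)\<^sup>2 \<partial>M) = t - s \<and> (\<integral>\<omega>. (\<beta> t \<omega> - \<beta> s \<omega>) ^ 4 \<partial>M) = 3 * (t - s)\<^sup>2"
  proof (cases "s = t")
    case True
    then show ?thesis by (cases k) auto
  next
    case False
    then have "s < t" using assms by simp
    have m: "(\<lambda>\<omega>. \<beta> t \<omega> - \<beta> s \<omega>) \<in> borel_measurable M" using assms by (intro borel_measurable_diff \<beta>_M) auto
    have law: "distr M borel (\<lambda>\<omega>. \<beta> t \<omega> - \<beta> s \<omega>) = density lborel (normal_density 0 (sqrt (t - s)))"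
      using indep_law_distr[OF increment[OF assms(1) \<open>s < t\<close>]] by (simp cong: distr_cong)
    have p4: "(sqrt (t - s)) ^ 4 = (t - s)\<^sup>2"
      using \<open>s < t\<close> power_mult[of "sqrt (t - s)" 2 2] by simp
    show ?thesis using normal_law_moments[OF m law] \<open>s < t\<close> p4 by simp
  qed
  then show "integrable M (\<lambda>\<omega>. (\<beta> t \<omega> - \<beta> s \<omega>) ^ k)" "(\<integral>\<omega>. \<beta> t \<omega> - \<beta> s \<omega> \<partial>M) = 0"
    "(\<integral>\<omega>. (\<beta> t \<omega> - \<beta> s \<omega>)\<^sup>2 \<partial>M) = t - s" "(\<integral>\<omega>. (\<beta> t \<omega> - \<beta> s \<omega>) ^ 4 \<partial>M) = 3 * (t - s)\<^sup>2" by auto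
qed

lemma integral_mult_increment:
  assumes "0 \<le> s" "s \<le> t" and g: "g \<in> borel_measurable (F s)" "integrable M g"
  shows "integrable M (\<lambda>\<omega>. g \<omega> * (\<beta> t \<omega> - \<beta> s \<omega>))" "(\<integral>\<omega>. g \<omega> * (\<beta> t \<omega> - \<beta> s \<omega>) \<partial>M) = 0"
    "integrable M (\<lambda>\<omega>. g \<omega> * (\<beta> t \<omega> - \<beta> s \<omega>)\<^sup>2)" "(\<integral>\<omega>. g \<omega> * (\<beta> t \<omega> - \<beta> s \<omega>)\<^sup>2 \<partial>M) = (\<integral>\<omega>. g \<omega> \<partial>M) * (t - s)"
proof -
  have "integrable M (\<lambda>\<omega>. g \<omega> * (\<beta> t \<omega> - \<beta> s \<omega>)) \<and> (\<integral>\<omega>. g \<omega> * (\<beta> t \<omega> - \<beta> s \<omega>) \<partial>M) = 0 \<and>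
    integrable M (\<lambda>\<omega>. g \<omega> * (\<beta> t \<omega> - \<beta> s \<omega>)\<^sup>2) \<and> (\<integral>\<omega>. g \<omega> * (\<beta> t \<omega> - \<beta> s \<omega>)\<^sup>2 \<partial>M) = (\<integral>\<omega>. g \<omega> \<partial>M) * (t - s)"
  proof (cases "s = t")
    case True
    then show ?thesis by simp
  next
    case False
    then have "s < t" using assms by simp
    note mom = increment_moments[OF assms(1,2)]
    have "integrable M (\<lambda>\<omega>. \<beta> t \<omega> - \<beta> s \<omega>)" using mom(1)[of 1] by simp
    then show ?thesis
      using indep_law_integral_mult[OF increment[OF assms(1) \<open>s < t\<close>] g(1), of "\<lambda>x. x"]
        indep_law_integral_mult[OF increment[OF assms(1) \<open>s < t\<close>] g(1), of "\<lambda>x. x\<^sup>2"] g(2) mom by simp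
  qed
  then show "integrable M (\<lambda>\<omega>. g \<omega> * (\<beta> t \<omega> - \<beta> s \<omega>))" "(\<integral>\<omega>. g \<omega> * (\<beta> t \<omega> - \<beta> s \<omega>) \<partial>M) = 0"
    "integrable M (\<lambda>\<omega>. g \<omega> * (\<beta> t \<omega> - \<beta> s \<omega>)\<^sup>2)" "(\<integral>\<omega>. g \<omega> * (\<beta> t \<omega> - \<beta> s \<omega>)\<^sup>2 \<partial>M) = (\<integral>\<omega>. g \<omega> \<partial>M) * (t - s)" by auto
qed

lemma elementary_L2:
  assumes "0 \<le> s" "s \<le> t" and a: "a \<in> borel_measurable (F s)" "integrable M (\<lambda>\<omega>. (a \<omega>)\<^sup>2)"
  shows "integrable M (\<lambda>\<omega>. (a \<omega> * (\<beta> t \<omega> - \<beta> s \<omega>))\<^sup>2)"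
  using integral_mult_increment(3)[OF assms(1,2), of "\<lambda>\<omega>. (a \<omega>)\<^sup>2"] a by (simp add: power_mult_distrib)

text \<open>The inner product of two elementary stochastic integrals. With \<open>s \<le> s'\<close>, split the first
  increment at \<open>s'\<close>: its part before \<open>s'\<close> is known when the second increment starts, and of the part
  after \<open>s'\<close> only the overlap with the second increment contributes.\<close>

lemma elementary_inner_ordered:
  assumes st: "0 \<le> s" "s \<le> t" "s' \<le> t'" and ss: "s \<le> s'"
    and a: "a \<in> borel_measurable (F s)" "integrable M (\<lambda>\<omega>. (a \<omega>)\<^sup>2)"
    and b: "b \<in> borel_measurable (F s')" "integrable M (\<lambda>\<omega>. (b \<omega>)\<^sup>2)"
  shows "(\<integral>\<omega>. (a \<omega> * (\<beta> t \<omega> - \<beta> s \<omega>)) * (b \<omega> * (\<beta> t' \<omega> - \<beta> s' \<omega>)) \<partial>M)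
    = (\<integral>\<omega>. a \<omega> * b \<omega> \<partial>M) * max 0 (min t t' - max s s')"
proof (cases "t \<le> s'")
  case True
  have aM: "(\<lambda>\<omega>. a \<omega> * (\<beta> t \<omega> - \<beta> s \<omega>)) \<in> borel_measurable (F s')"
    using F_mono[OF a(1) ss] adapted[of t s'] adapted[of s s'] st True by (intro borel_measurable_times borel_measurable_diff) auto
  have int: "integrable M (\<lambda>\<omega>. (a \<omega> * (\<beta> t \<omega> - \<beta> s \<omega>)) * b \<omega>)"
    using F_M[OF aM] F_M[OF b(1)] elementary_L2[OF st(1,2) a] b(2) by (rule integrable_mult_L2)
  have "(\<integral>\<omega>. ((a \<omega> * (\<beta> t \<omega> - \<beta> s \<omega>)) * b \<omega>) * (\<beta> t' \<omega> - \<beta> s' \<omega>) \<partial>M) = 0"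
    using st ss aM b(1) int by (intro integral_mult_increment(2)) auto
  then show ?thesis using True st ss by (simp add: mult.assoc max_def min_def)
next
  case False
  define u w where "u = min t t'" and "w = max t t'"
  have o: "0 \<le> s'" "s' \<le> u" "u \<le> w" "s' \<le> w" using False st ss by (auto simp: u_def w_def)
  define g where "g \<omega> = a \<omega> * b \<omega>" for \<omega>
  have gF: "g \<in> borel_measurable (F s')" unfolding g_def using F_mono[OF a(1) ss] b(1) by (rule borel_measurable_times)
  have gint: "integrable M g" unfolding g_def
    using F_M[OF a(1)] F_M[OF b(1)] a(2) b(2) by (rule integrable_mult_L2)
  have hF: "(\<lambda>\<omega>. (a \<omega> * (\<beta> s' \<omega> - \<beta> s \<omega>)) * b \<omega>) \<in> borel_measurable (F s')"
    using F_mono[OF a(1) ss] adapted[of s' s'] adapted[of s s'] st o ss b(1)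
    by (intro borel_measurable_times borel_measurable_diff) auto
  have hint: "integrable M (\<lambda>\<omega>. (a \<omega> * (\<beta> s' \<omega> - \<beta> s \<omega>)) * b \<omega>)"
  proof (rule integrable_mult_L2)
    show "(\<lambda>\<omega>. a \<omega> * (\<beta> s' \<omega> - \<beta> s \<omega>)) \<in> borel_measurable M"
      using F_M[OF a(1)] o st by (intro borel_measurable_times borel_measurable_diff \<beta>_M) auto
  qed (use F_M[OF b(1)] elementary_L2[OF st(1) ss a] b(2) in auto)
  have kF: "(\<lambda>\<omega>. g \<omega> * (\<beta> u \<omega> - \<beta> s' \<omega>)) \<in> borel_measurable (F u)"
    using F_mono[OF gF o(2)] adapted[of u u] adapted[of s' u] o
    by (intro borel_measurable_times borel_measurable_diff) auto
  note i1 = integral_mult_increment[OF o(1) st(3) hF hint]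
  note i2 = integral_mult_increment[OF o(1,2) gF gint]
  have u0: "0 \<le> u" using o by simp
  note i3 = integral_mult_increment[OF u0 o(3) kF i2(1)]
  have split: "(a \<omega> * (\<beta> t \<omega> - \<beta> s \<omega>)) * (b \<omega> * (\<beta> t' \<omega> - \<beta> s' \<omega>)) =
      (a \<omega> * (\<beta> s' \<omega> - \<beta> s \<omega>)) * b \<omega> * (\<beta> t' \<omega> - \<beta> s' \<omega>) +
      (g \<omega> * (\<beta> u \<omega> - \<beta> s' \<omega>)\<^sup>2 + g \<omega> * (\<beta> u \<omega> - \<beta> s' \<omega>) * (\<beta> w \<omega> - \<beta> u \<omega>))" for \<omega>
  proof -
    have "(\<beta> t \<omega> - \<beta> s' \<omega>) * (\<beta> t' \<omega> - \<beta> s' \<omega>) = (\<beta> u \<omega> - \<beta> s' \<omega>) * (\<beta> w \<omega> - \<beta> s' \<omega>)"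
      by (auto simp: u_def w_def min_def max_def)
    also have "\<dots> = (\<beta> u \<omega> - \<beta> s' \<omega>)\<^sup>2 + (\<beta> u \<omega> - \<beta> s' \<omega>) * (\<beta> w \<omega> - \<beta> u \<omega>)"
      by (simp add: power2_eq_square algebra_simps)
    finally have e: "(\<beta> t \<omega> - \<beta> s' \<omega>) * (\<beta> t' \<omega> - \<beta> s' \<omega>) =
      (\<beta> u \<omega> - \<beta> s' \<omega>)\<^sup>2 + (\<beta> u \<omega> - \<beta> s' \<omega>) * (\<beta> w \<omega> - \<beta> u \<omega>)" .
    have "(a \<omega> * (\<beta> t \<omega> - \<beta> s \<omega>)) * (b \<omega> * (\<beta> t' \<omega> - \<beta> s' \<omega>)) =
      (a \<omega> * (\<beta> s' \<omega> - \<beta> s \<omega>)) * b \<omega> * (\<beta> t' \<omega> - \<beta> s' \<omega>) +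
      g \<omega> * ((\<beta> t \<omega> - \<beta> s' \<omega>) * (\<beta> t' \<omega> - \<beta> s' \<omega>))" by (simp add: g_def algebra_simps)
    then show ?thesis unfolding e by (simp add: distrib_left mult.assoc)
  qed
  have "(\<integral>\<omega>. (a \<omega> * (\<beta> t \<omega> - \<beta> s \<omega>)) * (b \<omega> * (\<beta> t' \<omega> - \<beta> s' \<omega>)) \<partial>M) = (\<integral>\<omega>. g \<omega> \<partial>M) * (u - s')"
    unfolding split using i1(1,2) i2(3,4) i3(1,2) by simp
  then show ?thesis using o ss by (simp add: u_def g_def max_def)
qed

lemma elementary_inner:
  assumes st: "0 \<le> s" "s \<le> t" "0 \<le> s'" "s' \<le> t'"
    and a: "a \<in> borel_measurable (F s)" "integrable M (\<lambda>\<omega>. (a \<omega>)\<^sup>2)"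
    and b: "b \<in> borel_measurable (F s')" "integrable M (\<lambda>\<omega>. (b \<omega>)\<^sup>2)"
  shows "(\<integral>\<omega>. (a \<omega> * (\<beta> t \<omega> - \<beta> s \<omega>)) * (b \<omega> * (\<beta> t' \<omega> - \<beta> s' \<omega>)) \<partial>M)
    = (\<integral>\<omega>. a \<omega> * b \<omega> \<partial>M) * max 0 (min t t' - max s s')"
proof (cases "s \<le> s'")
  case True
  then show ?thesis using elementary_inner_ordered[OF st(1,2,4) True a b] by simp
next
  case False
  then have "s' \<le> s" by simp
  from elementary_inner_ordered[OF st(3,4,2) this b a] show ?thesis
    by (simp add: mult.commute min.commute max.commute)
qed

text \<open>Both sides expand into double sums that agree term by term. The intervals may overlap: the
  isometry can then be applied to the difference of two simple integrals over different grids.\<close>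

lemma ito_isometry:
  assumes I: "finite I" and st: "\<And>i. i \<in> I \<Longrightarrow> 0 \<le> s i \<and> s i \<le> t i"
    and a: "\<And>i. i \<in> I \<Longrightarrow> a i \<in> borel_measurable (F (s i))" "\<And>i. i \<in> I \<Longrightarrow> integrable M (\<lambda>\<omega>. (a i \<omega>)\<^sup>2)"
  shows "(\<integral>\<^sup>+\<omega>. ennreal ((\<Sum>i\<in>I. a i \<omega> * (\<beta> (t i) \<omega> - \<beta> (s i) \<omega>))\<^sup>2) \<partial>M) =
    (\<integral>\<^sup>+\<omega>. (\<integral>\<^sup>+r. ennreal ((\<Sum>i\<in>I. a i \<omega> * indicator {s i<..t i} r)\<^sup>2) \<partial>lborel) \<partial>M)"
proof -
  define l where "l i j = max 0 (min (t i) (t j) - max (s i) (s j))" for i j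
  have sq: "(\<Sum>i\<in>I. f i)\<^sup>2 = (\<Sum>i\<in>I. \<Sum>j\<in>I. f i * f j)" for f :: "_ \<Rightarrow> real"
    by (simp add: power2_eq_square sum_product)
  have elM: "(\<lambda>\<omega>. a i \<omega> * (\<beta> (t i) \<omega> - \<beta> (s i) \<omega>)) \<in> borel_measurable M" if "i \<in> I" for i
    using F_M[OF a(1)[OF that]] st[OF that] by (intro borel_measurable_times borel_measurable_diff \<beta>_M) auto
  have el2: "integrable M (\<lambda>\<omega>. (a i \<omega> * (\<beta> (t i) \<omega> - \<beta> (s i) \<omega>)) * (a j \<omega> * (\<beta> (t j) \<omega> - \<beta> (s j) \<omega>)))"
    if "i \<in> I" "j \<in> I" for i j
    using elM that elementary_L2 a st by (intro integrable_mult_L2) auto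
  have aa: "integrable M (\<lambda>\<omega>. a i \<omega> * a j \<omega>)" if "i \<in> I" "j \<in> I" for i j
    using that F_M a by (intro integrable_mult_L2) auto
  have "(\<integral>\<^sup>+\<omega>. ennreal ((\<Sum>i\<in>I. a i \<omega> * (\<beta> (t i) \<omega> - \<beta> (s i) \<omega>))\<^sup>2) \<partial>M) =
    ennreal (\<integral>\<omega>. (\<Sum>i\<in>I. a i \<omega> * (\<beta> (t i) \<omega> - \<beta> (s i) \<omega>))\<^sup>2 \<partial>M)"
  proof (rule nn_integral_eq_integral)
    show "integrable M (\<lambda>\<omega>. (\<Sum>i\<in>I. a i \<omega> * (\<beta> (t i) \<omega> - \<beta> (s i) \<omega>))\<^sup>2)"
      unfolding sq using el2 by (intro Bochner_Integration.integrable_sum) auto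
  qed simp
  also have "(\<integral>\<omega>. (\<Sum>i\<in>I. a i \<omega> * (\<beta> (t i) \<omega> - \<beta> (s i) \<omega>))\<^sup>2 \<partial>M) = (\<Sum>i\<in>I. \<Sum>j\<in>I. (\<integral>\<omega>. a i \<omega> * a j \<omega> \<partial>M) * l i j)"
    unfolding sq using el2 st a
    by (simp add: elementary_inner l_def cong: sum.cong)
  also have "\<dots> = (\<integral>\<omega>. (\<Sum>i\<in>I. \<Sum>j\<in>I. a i \<omega> * a j \<omega> * l i j) \<partial>M)"
    using aa by simp
  also have "ennreal \<dots> = (\<integral>\<^sup>+\<omega>. (\<integral>\<^sup>+r. ennreal ((\<Sum>i\<in>I. a i \<omega> * indicator {s i<..t i} r)\<^sup>2) \<partial>lborel) \<partial>M)"
  proof -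
    have inner: "(\<integral>\<^sup>+r. ennreal ((\<Sum>i\<in>I. a i \<omega> * indicator {s i<..t i} r)\<^sup>2) \<partial>lborel) =
        ennreal (\<Sum>i\<in>I. \<Sum>j\<in>I. a i \<omega> * a j \<omega> * l i j) \<and> 0 \<le> (\<Sum>i\<in>I. \<Sum>j\<in>I. a i \<omega> * a j \<omega> * l i j)" for \<omega>
    proof -
      have prod: "a i \<omega> * indicator {s i<..t i} r * (a j \<omega> * indicator {s j<..t j} r) =
        a i \<omega> * a j \<omega> * indicator {max (s i) (s j)<..min (t i) (t j)} r" for i j r
        by (auto simp: indicator_def)
      have ind: "integrable lborel (\<lambda>r. a i \<omega> * a j \<omega> * indicator {max (s i) (s j)<..min (t i) (t j)} r)" for i j
      proof -
        have "emeasure lborel {x<..y :: real} < \<infinity>" for x y by (cases "x \<le> y") auto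
        then show ?thesis by (intro integrable_mult_right integrable_real_indicator) auto
      qed
      have val: "(\<integral>r. a i \<omega> * a j \<omega> * indicator {max (s i) (s j)<..min (t i) (t j)} r \<partial>lborel) = a i \<omega> * a j \<omega> * l i j" for i j
        by (auto simp: l_def max_def)
      have "(\<integral>\<^sup>+r. ennreal ((\<Sum>i\<in>I. a i \<omega> * indicator {s i<..t i} r)\<^sup>2) \<partial>lborel) =
        ennreal (\<integral>r. (\<Sum>i\<in>I. a i \<omega> * indicator {s i<..t i} r)\<^sup>2 \<partial>lborel)"
      proof (rule nn_integral_eq_integral)
        show "integrable lborel (\<lambda>r. (\<Sum>i\<in>I. a i \<omega> * indicator {s i<..t i} r)\<^sup>2)"
          unfolding sq prod using ind by (intro Bochner_Integration.integrable_sum) auto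
      qed simp
      moreover have "(\<integral>r. (\<Sum>i\<in>I. a i \<omega> * indicator {s i<..t i} r)\<^sup>2 \<partial>lborel) = (\<Sum>i\<in>I. \<Sum>j\<in>I. a i \<omega> * a j \<omega> * l i j)"
        unfolding sq prod
        by (simp only: Bochner_Integration.integral_sum Bochner_Integration.integrable_sum ind val)
      moreover have "0 \<le> (\<integral>r. (\<Sum>i\<in>I. a i \<omega> * indicator {s i<..t i} r)\<^sup>2 \<partial>lborel)" by simp
      ultimately show ?thesis by simp
    qed
    show ?thesis
      unfolding inner[THEN conjunct1] using aa inner[THEN conjunct2]
      by (intro nn_integral_eq_integral[symmetric]) auto
  qed
  finally show ?thesis .
qed

end

lemma tendsto_floor_grid:
  assumes "0 \<le> r"
  shows "(\<lambda>n. real (nat \<lfloor>real n * r\<rfloor>) / real n) \<longlonglongrightarrow> r"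
proof (rule real_tendsto_sandwich)
  have pos: "\<forall>\<^sub>F n :: nat in sequentially. n > 0" by (rule eventually_gt_at_top)
  show "\<forall>\<^sub>F n in sequentially. r - 1 / real n \<le> real (nat \<lfloor>real n * r\<rfloor>) / real n"
    using pos
  proof eventually_elim
    case (elim n)
    have "real n * r - 1 \<le> real (nat \<lfloor>real n * r\<rfloor>)" using assms by linarith
    then have "(real n * r - 1) / real n \<le> real (nat \<lfloor>real n * r\<rfloor>) / real n"
      by (rule divide_right_mono) simp
    then show ?case using elim by (simp add: diff_divide_distrib)
  qed
  show "\<forall>\<^sub>F n in sequentially. real (nat \<lfloor>real n * r\<rfloor>) / real n \<le> r"
    using pos
  proof eventually_elim
    case (elim n)
    have "real (nat \<lfloor>real n * r\<rfloor>) \<le> real n * r" using assms by (intro of_nat_floor) simp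
    then show ?case using elim by (simp add: field_simps)
  qed
  show "(\<lambda>n. r - 1 / real n) \<longlonglongrightarrow> r"
    using tendsto_diff[OF tendsto_const[of r] lim_1_over_n] by simp
qed (rule tendsto_const)

text \<open>Almost surely continuous paths have a jointly measurable modification, the limit of the step
  processes on the grids of mesh \<open>1 / n\<close>; joint measurability lets the expectation be exchanged with
  the time integral.\<close>

lemma (in scalar_brownian) jointly_measurable_version:
  assumes cont: "AE \<omega> in M. continuous_on {0..} (\<lambda>t. \<beta> t \<omega>)"
  obtains \<beta>' where "(\<lambda>(\<omega>, r). \<beta>' r \<omega>) \<in> borel_measurable (M \<Otimes>\<^sub>M (borel :: real measure))"
    "AE \<omega> in M. \<forall>r\<ge>0. \<beta>' r \<omega> = \<beta> r \<omega>"
proof -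
  define \<beta>' where "\<beta>' r \<omega> = lim (\<lambda>n. \<beta> (real (nat \<lfloor>real n * r\<rfloor>) / real n) \<omega>)" for r \<omega>
  have "(\<lambda>(\<omega>, r). \<beta> (real (nat \<lfloor>real n * r\<rfloor>) / real n) \<omega>) \<in> borel_measurable (M \<Otimes>\<^sub>M (borel :: real measure))" for n
  proof -
    have "(\<lambda>x. \<beta> (real (nat \<lfloor>real n * snd x\<rfloor>) / real n) (fst x))
      \<in> borel_measurable (M \<Otimes>\<^sub>M (borel :: real measure))"
    proof (rule measurable_compose_countable[where f = "\<lambda>i x. \<beta> (real i / real n) (fst x)"])
      show "(\<lambda>x. \<beta> (real i / real n) (fst x)) \<in> borel_measurable (M \<Otimes>\<^sub>M (borel :: real measure))" for i
        using \<beta>_M[of "real i / real n"] by measurable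
    qed measurable
    then show ?thesis by (simp add: split_beta')
  qed
  from borel_measurable_lim_metric[OF this]
  have "(\<lambda>(\<omega>, r). \<beta>' r \<omega>) \<in> borel_measurable (M \<Otimes>\<^sub>M (borel :: real measure))"
    by (simp add: \<beta>'_def split_beta')
  moreover have "AE \<omega> in M. \<forall>r\<ge>0. \<beta>' r \<omega> = \<beta> r \<omega>"
    using cont
  proof eventually_elim
    case (elim \<omega>)
    have "\<beta>' r \<omega> = \<beta> r \<omega>" if "0 \<le> r" for r
    proof -
      have "(\<lambda>n. \<beta> (real (nat \<lfloor>real n * r\<rfloor>) / real n) \<omega>) \<longlonglongrightarrow> \<beta> r \<omega>"
        by (rule continuous_on_tendsto_compose[OF elim tendsto_floor_grid[OF that]]) (use that in auto)
      then show ?thesis unfolding \<beta>'_def by (rule limI)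
    qed
    then show ?case by blast
  qed
  ultimately show ?thesis by (rule that)
qed

lemma simple_value_grid:
  assumes "n > 0"
  shows "i < m \<Longrightarrow> real i / real n < r \<Longrightarrow> r \<le> real (Suc i) / real n \<Longrightarrow>
      simple_value m (\<lambda>i. real i / real n) h r \<omega> = h i \<omega>"
    and "r \<le> 0 \<or> real m / real n < r \<Longrightarrow> simple_value m (\<lambda>i. real i / real n) h r \<omega> = 0"
    and "0 < r \<Longrightarrow> r \<le> real m / real n \<Longrightarrow> \<exists>i<m. real i / real n < r \<and> r \<le> real (Suc i) / real n"
proof -
  assume i: "i < m" "real i / real n < r" "r \<le> real (Suc i) / real n"
  have "h j \<omega> * indicator {real j / real n<..real (Suc j) / real n} r = (if j = i then h i \<omega> else 0)" for j
  proof (cases "j = i")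
    case False
    have "real (Suc i) / real n \<le> real j / real n \<or> real (Suc j) / real n \<le> real i / real n"
      using False by (intro disj_forward[OF _ divide_right_mono divide_right_mono, of "Suc i \<le> j" "Suc j \<le> i"]) auto
    then have "r \<notin> {real j / real n<..real (Suc j) / real n}" using i by auto
    then show ?thesis using False by simp
  qed (use i in auto)
  then show "simple_value m (\<lambda>i. real i / real n) h r \<omega> = h i \<omega>" using i(1) by (simp add: simple_value_def)
next
  assume r: "r \<le> 0 \<or> real m / real n < r"
  have "r \<notin> {real j / real n<..real (Suc j) / real n}" if "j < m" for j
  proof -
    have "real (Suc j) / real n \<le> real m / real n" using that by (intro divide_right_mono) auto
    moreover have "0 \<le> real j / real n" by simp
    ultimately show ?thesis using r unfolding greaterThanAtMost_iff by linarith
  qed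
  then show "simple_value m (\<lambda>i. real i / real n) h r \<omega> = 0" by (auto simp: simple_value_def intro!: sum.neutral)
next
  assume r: "0 < r" "r \<le> real m / real n"
  define i where "i = nat \<lceil>real n * r\<rceil> - 1"
  have p: "0 < real n * r" using r assms by simp
  then have c: "0 < \<lceil>real n * r\<rceil>" by simp
  have Si: "real (Suc i) = of_int \<lceil>real n * r\<rceil>" using c by (simp add: i_def of_nat_diff)
  have "real n * r \<le> real m" using r assms by (simp add: field_simps)
  then have "\<lceil>real n * r\<rceil> \<le> int m" by (simp add: ceiling_le_iff)
  then have "i < m" using Si by linarith
  moreover have "real i < real n * r" "real n * r \<le> real (Suc i)" using Si by linarith+
  ultimately show "\<exists>i<m. real i / real n < r \<and> r \<le> real (Suc i) / real n"
    using assms by (intro exI[of _ i]) (auto simp: field_simps)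
qed

lemma (in scalar_brownian) nn_integral_increment_sq:
  assumes "0 \<le> s" "s \<le> t"
  shows "(\<integral>\<^sup>+\<omega>. ennreal ((\<beta> t \<omega> - \<beta> s \<omega>)\<^sup>2) \<partial>M) = ennreal (t - s)"
  using increment_moments(1)[OF assms, of 2] increment_moments(3)[OF assms] by (simp add: nn_integral_eq_integral)

lemma (in scalar_brownian) nn_integral_value_sq:
  assumes "AE \<omega> in M. \<beta> 0 \<omega> = 0" "0 \<le> t"
  shows "(\<integral>\<^sup>+\<omega>. ennreal ((\<beta> t \<omega>)\<^sup>2) \<partial>M) = ennreal t"
proof -
  have "(\<integral>\<^sup>+\<omega>. ennreal ((\<beta> t \<omega>)\<^sup>2) \<partial>M) = (\<integral>\<^sup>+\<omega>. ennreal ((\<beta> t \<omega> - \<beta> 0 \<omega>)\<^sup>2) \<partial>M)"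
    by (rule nn_integral_cong_AE) (use assms(1) in \<open>eventually_elim, simp\<close>)
  then show ?thesis using nn_integral_increment_sq[of 0 t] assms(2) by simp
qed

lemma ennreal_square_add_le: "ennreal ((a + b)\<^sup>2) \<le> 2 * ennreal (a\<^sup>2) + 2 * ennreal (b\<^sup>2)"
proof -
  have "(a + b)\<^sup>2 \<le> 2 * a\<^sup>2 + 2 * b\<^sup>2"
    using zero_le_power2[of "a - b"] by (simp add: power2_sum power2_diff)
  then have "ennreal ((a + b)\<^sup>2) \<le> ennreal (2 * a\<^sup>2 + 2 * b\<^sup>2)" by (rule ennreal_leI)
  also have "\<dots> = 2 * ennreal (a\<^sup>2) + 2 * ennreal (b\<^sup>2)" by (simp add: ennreal_mult' ennreal_plus)
  finally show ?thesis .
qed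

text \<open>The Ito integral of a Brownian coordinate is the mean-square limit of its Riemann sums, with an
  explicit rate. By the isometry, the distance of the Riemann sum to the approximating simple
  integrals is the \<open>L\<^sup>2\<close> distance of the integrands, which is controlled by the modulus of continuity
  of \<open>\<eta>\<close> in mean square. The Riemann sum may stop before or after \<open>t\<close>.\<close>

lemma ito_integral_riemann_sum:
  assumes b: "scalar_brownian M F \<beta>" and e: "scalar_brownian M F \<eta>"
    and e0: "AE \<omega> in M. \<eta> 0 \<omega> = 0" and cont: "AE \<omega> in M. continuous_on {0..} (\<lambda>t. \<eta> t \<omega>)"
    and ito: "has_ito_integral M F \<beta> t \<eta> I" and t: "0 \<le> t" and n: "n > 0" and m: "\<bar>real m / real n - t\<bar> \<le> 1 / real n"
  shows "(\<integral>\<^sup>+\<omega>. ennreal ((I \<omega> - simple_integral \<beta> m (\<lambda>i. real i / real n) (\<lambda>i. \<eta> (real i / real n)) \<omega>)\<^sup>2) \<partial>M)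
    \<le> ennreal ((10 * t + 2) / real n)"
proof -
  interpret scalar_brownian M F \<beta> by fact
  interpret e: scalar_brownian M F \<eta> by fact
  obtain \<eta>' where \<eta>'m: "(\<lambda>(\<omega>, r). \<eta>' r \<omega>) \<in> borel_measurable (M \<Otimes>\<^sub>M (borel :: real measure))"
    and \<eta>': "AE \<omega> in M. \<forall>r\<ge>0. \<eta>' r \<omega> = \<eta> r \<omega>"
    using e.jointly_measurable_version[OF cont] by blast
  let ?g = "\<lambda>i. real i / real n"
  define h where "h r \<omega> = simple_value m ?g (\<lambda>i. \<eta> (?g i)) r \<omega>" for r \<omega>
  define R where "R \<omega> = simple_integral \<beta> m ?g (\<lambda>i. \<eta> (?g i)) \<omega>" for \<omega>
  obtain N \<tau> a where si: "\<And>k. simple_integrand M F t (N k) (\<tau> k) (a k)"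
    and lim1: "(\<lambda>k. \<integral>\<^sup>+\<omega>. (\<integral>\<^sup>+r\<in>{0..t}.
          ennreal ((\<eta> r \<omega> - simple_value (N k) (\<tau> k) (a k) r \<omega>)\<^sup>2) \<partial>lborel) \<partial>M) \<longlonglongrightarrow> 0"
    and lim2: "(\<lambda>k. \<integral>\<^sup>+\<omega>. ennreal ((I \<omega> - simple_integral \<beta> (N k) (\<tau> k) (a k) \<omega>)\<^sup>2) \<partial>M) \<longlonglongrightarrow> 0"
    and IM [measurable]: "I \<in> borel_measurable M"
    using ito unfolding has_ito_integral_def by blast
  define S where "S k \<omega> = simple_integral \<beta> (N k) (\<tau> k) (a k) \<omega>" for k \<omega>
  define v where "v k r \<omega> = simple_value (N k) (\<tau> k) (a k) r \<omega>" for k r \<omega>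
  have mn: "real m / real n \<le> t + 1 / real n" "t \<le> real m / real n + 1 / real n" using m by linarith+
  have n1: "1 / real n \<le> 1" using n by simp
  have [measurable]: "\<eta> (?g i) \<in> borel_measurable M" for i by (rule e.\<beta>_M) simp
  have [measurable]: "(\<lambda>(\<omega>, r). h r \<omega>) \<in> borel_measurable (M \<Otimes>\<^sub>M (borel :: real measure))"
    unfolding h_def simple_value_def by measurable
  have \<tau>: "0 \<le> \<tau> k i \<and> \<tau> k i \<le> \<tau> k (N k)" if "i \<le> N k" for k i
  proof -
    have st: "\<tau> k i \<le> \<tau> k j" if "i \<le> j" "j \<le> N k" for i j
      using that
    proof (induction j rule: dec_induct)
      case (step j)
      then show ?case using si[of k] unfolding simple_integrand_def by (meson Suc_le_lessD less_imp_le_nat order_trans)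
    qed simp
    have "0 \<le> \<tau> k 0" using si[of k] by (simp add: simple_integrand_def)
    then show ?thesis using st[of 0 i] st[of i "N k"] that by simp
  qed
  have aF: "a k i \<in> borel_measurable (F (\<tau> k i))" "integrable M (\<lambda>\<omega>. (a k i \<omega>)\<^sup>2)" "\<tau> k i \<le> \<tau> k (Suc i)" "\<tau> k (N k) \<le> t"
    if "i < N k" for k i using si[of k] that by (auto simp: simple_integrand_def)
  have aM [measurable]: "a k i \<in> borel_measurable M" if "i < N k" for k i using F_M[OF aF(1)[OF that]] .
  have vM [measurable]: "(\<lambda>(\<omega>, r). v k r \<omega>) \<in> borel_measurable (M \<Otimes>\<^sub>M (borel :: real measure))" for k
    unfolding v_def simple_value_def split_beta'
  proof (rule borel_measurable_sum)
    fix i assume "i \<in> {..<N k}"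
    then have [measurable]: "a k i \<in> borel_measurable M" using aM by simp
    show "(\<lambda>x. a k i (fst x) * indicator {\<tau> k i<..\<tau> k (Suc i)} (snd x)) \<in> borel_measurable (M \<Otimes>\<^sub>M (borel :: real measure))"
      by measurable
  qed
  have RM [measurable]: "R \<in> borel_measurable M"
    unfolding R_def simple_integral_def using n
    by (intro borel_measurable_sum borel_measurable_times borel_measurable_diff \<beta>_M) auto
  have SM [measurable]: "S k \<in> borel_measurable M" for k
    unfolding S_def simple_integral_def using \<tau>
    by (intro borel_measurable_sum borel_measurable_times borel_measurable_diff \<beta>_M aM) (auto simp: Suc_le_eq)
  have v0: "v k r \<omega> = 0" if "r \<le> 0 \<or> t < r" for k r \<omega>
  proof -
    have "r \<notin> {\<tau> k i<..\<tau> k (Suc i)}" if i: "i < N k" for i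
      using \<tau>[of i k] \<tau>[of "Suc i" k] aF(4)[OF i] i \<open>r \<le> 0 \<or> t < r\<close> by auto
    then show ?thesis by (auto simp: v_def simple_value_def intro!: sum.neutral)
  qed
  have h0: "h r \<omega> = 0" if "r \<le> 0 \<or> real m / real n < r" for r \<omega>
    unfolding h_def using simple_value_grid(2)[OF n that] .
  \<comment> \<open>the \<open>L\<^sup>2\<close> distance of the integrands: approximation error and discretization error on \<open>[0,t]\<close>,
    and the part of the Riemann sum beyond \<open>t\<close>\<close>
  define a1 where "a1 k = (\<integral>\<^sup>+\<omega>. (\<integral>\<^sup>+r\<in>{0..t}. ennreal ((\<eta> r \<omega> - v k r \<omega>)\<^sup>2) \<partial>lborel) \<partial>M)" for k
  define a2 where "a2 = (\<integral>\<^sup>+\<omega>. (\<integral>\<^sup>+r\<in>{0..t}. ennreal ((h r \<omega> - \<eta>' r \<omega>)\<^sup>2) \<partial>lborel) \<partial>M)"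
  define a3 where "a3 = (\<integral>\<^sup>+\<omega>. (\<integral>\<^sup>+r\<in>{t<..}. ennreal ((h r \<omega>)\<^sup>2) \<partial>lborel) \<partial>M)"
  have fubini: "(\<integral>\<^sup>+\<omega>. (\<integral>\<^sup>+r. f \<omega> r \<partial>lborel) \<partial>M) = (\<integral>\<^sup>+r. (\<integral>\<^sup>+\<omega>. f \<omega> r \<partial>M) \<partial>lborel)"
    if f: "(\<lambda>(\<omega>, r). f \<omega> r) \<in> borel_measurable (M \<Otimes>\<^sub>M (borel :: real measure))" for f
  proof -
    interpret pair_sigma_finite M "lborel :: real measure" ..
    have "(\<lambda>(\<omega>, r). f \<omega> r) \<in> borel_measurable (M \<Otimes>\<^sub>M (lborel :: real measure))"
      using f by (simp cong: measurable_cong_sets sets_pair_measure_cong)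
    from Fubini'[OF this] show ?thesis by simp
  qed
  have gridval: "h r \<omega> = \<eta> (?g i) \<omega>" if "i < m" "?g i < r" "r \<le> real (Suc i) / real n" for i r \<omega>
    unfolding h_def using simple_value_grid(1)[OF n that] .
  have a2_le: "a2 \<le> ennreal (2 * t / real n)"
  proof -
    have point: "(\<integral>\<^sup>+\<omega>. ennreal ((h r \<omega> - \<eta>' r \<omega>)\<^sup>2) \<partial>M) \<le>
        ennreal (1 / real n + t * indicator {real m / real n<..t} r)" if r: "r \<in> {0..t}" for r
    proof -
      have eq: "(\<integral>\<^sup>+\<omega>. ennreal ((h r \<omega> - \<eta>' r \<omega>)\<^sup>2) \<partial>M) = (\<integral>\<^sup>+\<omega>. ennreal ((\<eta> r \<omega> - h r \<omega>)\<^sup>2) \<partial>M)"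
        by (rule nn_integral_cong_AE) (use \<eta>' r in \<open>auto elim!: eventually_mono simp: power2_commute\<close>)
      show ?thesis
      proof (cases "0 < r \<and> r \<le> real m / real n")
        case True
        then obtain i where i: "i < m" "?g i < r" "r \<le> real (Suc i) / real n"
          using simple_value_grid(3)[OF n, of r m] by blast
        have "(\<integral>\<^sup>+\<omega>. ennreal ((\<eta> r \<omega> - h r \<omega>)\<^sup>2) \<partial>M) = ennreal (r - ?g i)"
          unfolding gridval[OF i] using i by (intro e.nn_integral_increment_sq) auto
        also have "r - ?g i \<le> 1 / real n" using i(3) by (simp add: add_divide_distrib)
        also have "1 / real n \<le> 1 / real n + t * indicator {real m / real n<..t} r" using t by simp
        finally show ?thesis unfolding eq by (simp add: ennreal_leI)
      next
        case False
        then have "r = 0 \<or> real m / real n < r" using r by auto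
        then have "(\<integral>\<^sup>+\<omega>. ennreal ((\<eta> r \<omega> - h r \<omega>)\<^sup>2) \<partial>M) = ennreal r"
          using h0[of r] r e.nn_integral_value_sq[OF e0, of r] by auto
        also have "r \<le> 1 / real n + t * indicator {real m / real n<..t} r"
        proof -
          have "r \<le> 1 / real n + t" using r by (simp add: add_increasing)
          then show ?thesis using \<open>r = 0 \<or> _\<close> r by (auto simp: indicator_def)
        qed
        finally show ?thesis unfolding eq by (simp add: ennreal_leI)
      qed
    qed
    have "a2 = (\<integral>\<^sup>+r. (\<integral>\<^sup>+\<omega>. ennreal ((h r \<omega> - \<eta>' r \<omega>)\<^sup>2) * indicator {0..t} r \<partial>M) \<partial>lborel)"
      unfolding a2_def by (rule fubini) (use \<eta>'m in measurable)
    also have "\<dots> = (\<integral>\<^sup>+r. (\<integral>\<^sup>+\<omega>. ennreal ((h r \<omega> - \<eta>' r \<omega>)\<^sup>2) \<partial>M) * indicator {0..t} r \<partial>lborel)"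
      by (intro nn_integral_cong) (auto simp: indicator_def)
    also have "\<dots> \<le> (\<integral>\<^sup>+r. ennreal (1 / real n) * indicator {0..t} r + ennreal t * indicator {real m / real n<..t} r \<partial>lborel)"
    proof (rule nn_integral_mono)
      fix r :: real
      have "0 \<le> real m / real n" by simp
      then show "(\<integral>\<^sup>+\<omega>. ennreal ((h r \<omega> - \<eta>' r \<omega>)\<^sup>2) \<partial>M) * indicator {0..t} r \<le>
          ennreal (1 / real n) * indicator {0..t} r + ennreal t * indicator {real m / real n<..t} r"
        using point[of r] t by (auto simp: indicator_def ennreal_plus[symmetric] simp del: ennreal_plus split: if_splits)
    qed
    also have "\<dots> = ennreal (1 / real n) * ennreal t + ennreal t * emeasure lborel {real m / real n<..t}"
      using t by (subst nn_integral_add) (auto simp: nn_integral_cmult_indicator)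
    also have "emeasure lborel {real m / real n<..t} \<le> ennreal (1 / real n)"
      using mn by (cases "real m / real n \<le> t") (auto intro!: ennreal_leI)
    also have "ennreal (1 / real n) * ennreal t + ennreal t * ennreal (1 / real n) = ennreal (2 * t / real n)"
      using t by (simp add: ennreal_mult''[symmetric] ennreal_plus[symmetric] del: ennreal_plus)
    finally show ?thesis by (simp add: mult_left_mono add_left_mono)
  qed
  have a3_le: "a3 \<le> ennreal ((t + 1) / real n)"
  proof -
    have point: "(\<integral>\<^sup>+\<omega>. ennreal ((h r \<omega>)\<^sup>2) \<partial>M) \<le> ennreal (t + 1) * indicator {t<..real m / real n} r" if r: "t < r" for r
    proof (cases "r \<le> real m / real n")
      case True
      then obtain i where i: "i < m" "?g i < r" "r \<le> real (Suc i) / real n"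
        using simple_value_grid(3)[OF n, of r m] t r by auto
      have "(\<integral>\<^sup>+\<omega>. ennreal ((h r \<omega>)\<^sup>2) \<partial>M) = ennreal (?g i)"
        unfolding gridval[OF i] by (intro e.nn_integral_value_sq[OF e0]) simp
      also have "?g i \<le> t + 1" using i(2) True mn n1 by linarith
      finally show ?thesis using True r by (simp add: ennreal_leI)
    next
      case False
      then show ?thesis using h0[of r] by simp
    qed
    have "a3 = (\<integral>\<^sup>+r. (\<integral>\<^sup>+\<omega>. ennreal ((h r \<omega>)\<^sup>2) * indicator {t<..} r \<partial>M) \<partial>lborel)"
      unfolding a3_def by (rule fubini) measurable
    also have "\<dots> \<le> (\<integral>\<^sup>+r. ennreal (t + 1) * indicator {t<..real m / real n} r \<partial>lborel)"
    proof (rule nn_integral_mono)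
      fix r :: real
      have "(\<integral>\<^sup>+\<omega>. ennreal ((h r \<omega>)\<^sup>2) * indicator {t<..} r \<partial>M) = (\<integral>\<^sup>+\<omega>. ennreal ((h r \<omega>)\<^sup>2) \<partial>M)" if "t < r"
        using that by simp
      then show "(\<integral>\<^sup>+\<omega>. ennreal ((h r \<omega>)\<^sup>2) * indicator {t<..} r \<partial>M) \<le>
          ennreal (t + 1) * indicator {t<..real m / real n} r"
        using point[of r] by (cases "t < r") auto
    qed
    also have "\<dots> = ennreal (t + 1) * emeasure lborel {t<..real m / real n}"
      by (rule nn_integral_cmult_indicator) simp
    also have "\<dots> \<le> ennreal (t + 1) * ennreal (1 / real n)"
      using mn by (intro mult_left_mono) (cases "t \<le> real m / real n"; auto intro!: ennreal_leI)+
    also have "\<dots> = ennreal ((t + 1) / real n)"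
      using t by (simp add: ennreal_mult''[symmetric] del: ennreal_plus)
    finally show ?thesis .
  qed
  have SR: "(\<integral>\<^sup>+\<omega>. ennreal ((S k \<omega> - R \<omega>)\<^sup>2) \<partial>M) \<le> 2 * a1 k + 2 * a2 + a3" for k
  proof -
    \<comment> \<open>the difference of the two integrals is a single sum over the disjoint union of both grids\<close>
    let ?I = "{..<N k} <+> {..<m}"
    define s where "s = case_sum (\<tau> k) ?g"
    define u where "u = case_sum (\<lambda>i. \<tau> k (Suc i)) (\<lambda>i. ?g (Suc i))"
    define c where "c = case_sum (a k) (\<lambda>i \<omega>. - \<eta> (?g i) \<omega>)"
    have "S k \<omega> - R \<omega> = (\<Sum>i\<in>?I. c i \<omega> * (\<beta> (u i) \<omega> - \<beta> (s i) \<omega>))" for \<omega>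
      by (subst sum.Plus) (auto simp: S_def R_def simple_integral_def c_def u_def s_def o_def sum_negf)
    then have "(\<integral>\<^sup>+\<omega>. ennreal ((S k \<omega> - R \<omega>)\<^sup>2) \<partial>M) = (\<integral>\<^sup>+\<omega>. (\<integral>\<^sup>+r. ennreal ((\<Sum>i\<in>?I. c i \<omega> * indicator {s i<..u i} r)\<^sup>2) \<partial>lborel) \<partial>M)"
    proof (simp only:, intro ito_isometry)
      fix i assume i: "i \<in> ?I"
      show "0 \<le> s i \<and> s i \<le> u i"
        using i \<tau> aF n by (auto simp: s_def u_def divide_right_mono)
      show "c i \<in> borel_measurable (F (s i))"
        using i aF e.adapted by (auto simp: c_def s_def)
      have "integrable M (\<lambda>\<omega>. (\<eta> r \<omega>)\<^sup>2)" if "0 \<le> r" for r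
        using e.nn_integral_value_sq[OF e0 that] e.\<beta>_M[OF that]
        by (intro integrableI_bounded) (auto simp: ennreal_power[symmetric])
      then show "integrable M (\<lambda>\<omega>. (c i \<omega>)\<^sup>2)"
        using i aF by (auto simp: c_def)
    qed simp
    also have "\<dots> = (\<integral>\<^sup>+\<omega>. (\<integral>\<^sup>+r. ennreal ((v k r \<omega> - h r \<omega>)\<^sup>2) \<partial>lborel) \<partial>M)"
    proof -
      have "(\<Sum>i\<in>?I. c i \<omega> * indicator {s i<..u i} r) = v k r \<omega> - h r \<omega>" for \<omega> r
        by (subst sum.Plus) (auto simp: v_def h_def simple_value_def c_def u_def s_def o_def sum_negf)
      then show ?thesis by simp
    qed
    also have "(\<integral>\<^sup>+\<omega>. (\<integral>\<^sup>+r. ennreal ((v k r \<omega> - h r \<omega>)\<^sup>2) \<partial>lborel) \<partial>M) \<le>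
      (\<integral>\<^sup>+\<omega>. (2 * (\<integral>\<^sup>+r\<in>{0..t}. ennreal ((\<eta>' r \<omega> - v k r \<omega>)\<^sup>2) \<partial>lborel) +
        2 * (\<integral>\<^sup>+r\<in>{0..t}. ennreal ((h r \<omega> - \<eta>' r \<omega>)\<^sup>2) \<partial>lborel)) + (\<integral>\<^sup>+r\<in>{t<..}. ennreal ((h r \<omega>)\<^sup>2) \<partial>lborel) \<partial>M)"
    proof (rule nn_integral_mono)
      fix \<omega> assume w: "\<omega> \<in> space M"
      have [measurable]: "(\<lambda>r. v k r \<omega>) \<in> borel_measurable borel" "(\<lambda>r. h r \<omega>) \<in> borel_measurable borel"
        "(\<lambda>r. \<eta>' r \<omega>) \<in> borel_measurable borel"
        using measurable_Pair2[OF vM w, of k] measurable_Pair2[OF _ w, of "\<lambda>(\<omega>, r). h r \<omega>"] measurable_Pair2[OF \<eta>'m w]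
        by auto
      have "(\<integral>\<^sup>+r. ennreal ((v k r \<omega> - h r \<omega>)\<^sup>2) \<partial>lborel) \<le>
        (\<integral>\<^sup>+r. (2 * (ennreal ((\<eta>' r \<omega> - v k r \<omega>)\<^sup>2) * indicator {0..t} r) +
          2 * (ennreal ((h r \<omega> - \<eta>' r \<omega>)\<^sup>2) * indicator {0..t} r)) + ennreal ((h r \<omega>)\<^sup>2) * indicator {t<..} r \<partial>lborel)"
      proof (rule nn_integral_mono)
        fix r :: real
        consider "r < 0" | "0 \<le> r" "r \<le> t" | "t < r" by linarith
        then show "ennreal ((v k r \<omega> - h r \<omega>)\<^sup>2) \<le> (2 * (ennreal ((\<eta>' r \<omega> - v k r \<omega>)\<^sup>2) * indicator {0..t} r) +
          2 * (ennreal ((h r \<omega> - \<eta>' r \<omega>)\<^sup>2) * indicator {0..t} r)) + ennreal ((h r \<omega>)\<^sup>2) * indicator {t<..} r"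
        proof cases
          case 1
          then show ?thesis using v0[of r k \<omega>] h0[of r \<omega>] by simp
        next
          case 2
          have "ennreal (((\<eta>' r \<omega> - v k r \<omega>) + (h r \<omega> - \<eta>' r \<omega>))\<^sup>2) \<le>
              2 * ennreal ((\<eta>' r \<omega> - v k r \<omega>)\<^sup>2) + 2 * ennreal ((h r \<omega> - \<eta>' r \<omega>)\<^sup>2)"
            by (rule ennreal_square_add_le)
          then show ?thesis using 2 by (simp add: power2_commute)
        next
          case 3
          then show ?thesis using v0[of r k \<omega>] t by simp
        qed
      qed
      also have "\<dots> = (2 * (\<integral>\<^sup>+r\<in>{0..t}. ennreal ((\<eta>' r \<omega> - v k r \<omega>)\<^sup>2) \<partial>lborel) +
        2 * (\<integral>\<^sup>+r\<in>{0..t}. ennreal ((h r \<omega> - \<eta>' r \<omega>)\<^sup>2) \<partial>lborel)) + (\<integral>\<^sup>+r\<in>{t<..}. ennreal ((h r \<omega>)\<^sup>2) \<partial>lborel)"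
        by (simp add: nn_integral_add nn_integral_cmult)
      finally show "(\<integral>\<^sup>+r. ennreal ((v k r \<omega> - h r \<omega>)\<^sup>2) \<partial>lborel) \<le> \<dots>" .
    qed
    also have "\<dots> = 2 * (\<integral>\<^sup>+\<omega>. (\<integral>\<^sup>+r\<in>{0..t}. ennreal ((\<eta>' r \<omega> - v k r \<omega>)\<^sup>2) \<partial>lborel) \<partial>M) + 2 * a2 + a3"
    proof -
      have lb: "(\<lambda>\<omega>. \<integral>\<^sup>+r. f \<omega> r \<partial>lborel) \<in> borel_measurable M"
        if "(\<lambda>(\<omega>, r). f \<omega> r) \<in> borel_measurable (M \<Otimes>\<^sub>M (borel :: real measure))" for f :: "'a \<Rightarrow> real \<Rightarrow> ennreal"
        by (rule sigma_finite_measure.borel_measurable_nn_integral[OF sigma_finite_lborel])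
           (use that in \<open>simp cong: measurable_cong_sets sets_pair_measure_cong\<close>)
      have [measurable]: "(\<lambda>\<omega>. (\<integral>\<^sup>+r\<in>{0..t}. ennreal ((\<eta>' r \<omega> - v k r \<omega>)\<^sup>2) \<partial>lborel)) \<in> borel_measurable M"
        by (rule lb) (use \<eta>'m in measurable)
      have [measurable]: "(\<lambda>\<omega>. (\<integral>\<^sup>+r\<in>{0..t}. ennreal ((h r \<omega> - \<eta>' r \<omega>)\<^sup>2) \<partial>lborel)) \<in> borel_measurable M"
        by (rule lb) (use \<eta>'m in measurable)
      have [measurable]: "(\<lambda>\<omega>. (\<integral>\<^sup>+r\<in>{t<..}. ennreal ((h r \<omega>)\<^sup>2) \<partial>lborel)) \<in> borel_measurable M"
        by (rule lb) measurable
      show ?thesis unfolding a2_def a3_def by (simp add: nn_integral_add nn_integral_cmult)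
    qed
    also have "(\<integral>\<^sup>+\<omega>. (\<integral>\<^sup>+r\<in>{0..t}. ennreal ((\<eta>' r \<omega> - v k r \<omega>)\<^sup>2) \<partial>lborel) \<partial>M) = a1 k"
      unfolding a1_def
    proof (rule nn_integral_cong_AE)
      show "AE \<omega> in M. (\<integral>\<^sup>+r\<in>{0..t}. ennreal ((\<eta>' r \<omega> - v k r \<omega>)\<^sup>2) \<partial>lborel) = (\<integral>\<^sup>+r\<in>{0..t}. ennreal ((\<eta> r \<omega> - v k r \<omega>)\<^sup>2) \<partial>lborel)"
        using \<eta>' by eventually_elim (auto intro!: nn_integral_cong simp: indicator_def)
    qed
    finally show ?thesis .
  qed
  define C where "C = 2 * (2 * a2 + a3)"
  have main: "(\<integral>\<^sup>+\<omega>. ennreal ((I \<omega> - R \<omega>)\<^sup>2) \<partial>M) \<le> 2 * (\<integral>\<^sup>+\<omega>. ennreal ((I \<omega> - S k \<omega>)\<^sup>2) \<partial>M) + 4 * a1 k + C" for k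
  proof -
    have "(\<integral>\<^sup>+\<omega>. ennreal ((I \<omega> - R \<omega>)\<^sup>2) \<partial>M) \<le> (\<integral>\<^sup>+\<omega>. 2 * ennreal ((I \<omega> - S k \<omega>)\<^sup>2) + 2 * ennreal ((S k \<omega> - R \<omega>)\<^sup>2) \<partial>M)"
    proof (rule nn_integral_mono)
      show "ennreal ((I \<omega> - R \<omega>)\<^sup>2) \<le> 2 * ennreal ((I \<omega> - S k \<omega>)\<^sup>2) + 2 * ennreal ((S k \<omega> - R \<omega>)\<^sup>2)" for \<omega>
        using ennreal_square_add_le[of "I \<omega> - S k \<omega>" "S k \<omega> - R \<omega>"] by simp
    qed
    also have "\<dots> = 2 * (\<integral>\<^sup>+\<omega>. ennreal ((I \<omega> - S k \<omega>)\<^sup>2) \<partial>M) + 2 * (\<integral>\<^sup>+\<omega>. ennreal ((S k \<omega> - R \<omega>)\<^sup>2) \<partial>M)"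
      by (simp add: nn_integral_add nn_integral_cmult)
    also have "\<dots> \<le> 2 * (\<integral>\<^sup>+\<omega>. ennreal ((I \<omega> - S k \<omega>)\<^sup>2) \<partial>M) + 2 * (2 * a1 k + 2 * a2 + a3)"
      by (intro add_left_mono mult_left_mono SR) simp
    also have "\<dots> = 2 * (\<integral>\<^sup>+\<omega>. ennreal ((I \<omega> - S k \<omega>)\<^sup>2) \<partial>M) + 4 * a1 k + C"
      by (simp add: C_def distrib_left mult.assoc[symmetric] add.assoc)
    finally show ?thesis .
  qed
  have "(\<lambda>k. 2 * (\<integral>\<^sup>+\<omega>. ennreal ((I \<omega> - S k \<omega>)\<^sup>2) \<partial>M) + 4 * a1 k + C) \<longlonglongrightarrow> 2 * 0 + 4 * 0 + C"
    using lim1 lim2 unfolding a1_def S_def v_def by (intro tendsto_add tendsto_const ennreal_tendsto_cmult) auto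
  then have "(\<integral>\<^sup>+\<omega>. ennreal ((I \<omega> - R \<omega>)\<^sup>2) \<partial>M) \<le> C"
    using main by (intro LIMSEQ_le_const[of _ C]) auto
  also have "C \<le> 2 * (2 * ennreal (2 * t / real n) + ennreal ((t + 1) / real n))"
    unfolding C_def by (intro mult_left_mono add_mono a2_le a3_le) auto
  also have "\<dots> = ennreal (2 * (2 * (2 * t / real n) + (t + 1) / real n))"
  proof -
    have "2 * (2 * ennreal x + ennreal y) = ennreal (2 * (2 * x + y))" if "0 \<le> x" "0 \<le> y" for x y
      using that by (simp add: ennreal_mult' ennreal_plus distrib_left)
    then show ?thesis using t by simp
  qed
  also have "2 * (2 * (2 * t / real n) + (t + 1) / real n) = (10 * t + 2) / real n"
    by (simp add: add_divide_distrib)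
  finally show ?thesis by (simp add: R_def)
qed

section \<open>The increments of the chain and of the Feller process\<close>

definition step_law :: "nat \<Rightarrow> 'd::finite heis measure" where
  "step_law n = distr (gauss (1 / real n)) borel (\<lambda>\<zeta>. (\<zeta>, 0))"

lemma measurable_horizontal [measurable]: "(\<lambda>\<zeta> :: 'd::finite plane. (\<zeta>, 0 :: real)) \<in> borel_measurable borel"
  by (intro borel_measurable_continuous_onI continuous_intros)

lemma sets_step_law [simp, measurable_cong]: "sets (step_law n) = sets borel"
  and space_step_law [simp]: "space (step_law n) = UNIV"
  by (simp_all add: step_law_def)

lemma prob_space_step_law: "n \<ge> 1 \<Longrightarrow> prob_space (step_law n)"
  unfolding step_law_def using prob_space_gauss[of "1 / real n"]
  by (intro prob_space.prob_space_distr) (auto simp: measurable_cong_sets[OF sets_gauss refl])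

text \<open>The \<open>m\<close>-fold convolution power of the law of a step.\<close>

fun walk_law :: "nat \<Rightarrow> nat \<Rightarrow> 'd::finite heis measure" where
  "walk_law n 0 = return borel 0"
| "walk_law n (Suc m) = distr (walk_law n m \<Otimes>\<^sub>M step_law n) borel (\<lambda>(g, h). heis_mult g h)"

lemma sets_walk_law [simp, measurable_cong]: "sets (walk_law n m) = sets borel"
  by (cases m) simp_all

lemma space_walk_law [simp]: "space (walk_law n m) = UNIV"
  using sets_eq_imp_space_eq[OF sets_walk_law] by simp

lemma measurable_heis_mult_left:
  fixes U :: "'w \<Rightarrow> 'd::finite heis"
  assumes [measurable]: "U \<in> borel_measurable M" and "sets A = sets M" "sets B = sets borel"
  shows "(\<lambda>(\<omega>, w). heis_mult (U \<omega>) w) \<in> borel_measurable (A \<Otimes>\<^sub>M B)"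
proof -
  have "sets (A \<Otimes>\<^sub>M B) = sets (M \<Otimes>\<^sub>M (borel :: 'd heis measure))"
    using assms(2,3) by (rule sets_pair_measure_cong)
  moreover have "(\<lambda>(\<omega>, w). heis_mult (U \<omega>) w) \<in> borel_measurable (M \<Otimes>\<^sub>M (borel :: 'd heis measure))"
    by measurable
  ultimately show ?thesis by (metis measurable_cong_sets)
qed

lemma measurable_heis_mult_pair:
  fixes \<mu> \<nu> :: "'d::finite heis measure"
  assumes "sets \<mu> = sets borel" "sets \<nu> = sets borel"
  shows "(\<lambda>(g, h). heis_mult g h) \<in> borel_measurable (\<mu> \<Otimes>\<^sub>M \<nu>)"
  using measurable_heis_mult_left[of "\<lambda>x. x" borel \<mu> \<nu>] assms by simp

lemma prob_space_walk_law: "n \<ge> 1 \<Longrightarrow> prob_space (walk_law n m :: 'd::finite heis measure)"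
proof (induction m)
  case 0
  then show ?case by (simp add: prob_space_return)
next
  case (Suc m)
  then interpret a: prob_space "walk_law n m :: 'd heis measure" by simp
  interpret b: prob_space "step_law n :: 'd heis measure" by (rule prob_space_step_law) fact
  interpret pair_prob_space "walk_law n m :: 'd heis measure" "step_law n :: 'd heis measure" ..
  show ?case unfolding walk_law.simps by (rule prob_space_distr) (rule measurable_heis_mult_pair; simp)
qed

lemma indep_law_const:
  assumes "prob_space M" "subalgebra M F" "c \<in> space K"
  shows "indep_law M F (\<lambda>_. c) (return K c)"
proof -
  interpret prob_space M by fact
  have "measure M (D \<inter> ((\<lambda>_. c) -` C \<inter> space M)) = measure M D * measure (return K c) C"
    if D: "D \<in> sets F" and C: "C \<in> sets K" for D C
  proof -
    have "D \<in> sets M" using D assms(2) by (auto simp: subalgebra_def)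
    then have "D \<inter> space M = D" using sets.sets_into_space by blast
    then show ?thesis using C by (cases "c \<in> C") (simp_all add: measure_return)
  qed
  then show ?thesis using assms by (auto simp: indep_law_def prob_space_return)
qed

text \<open>The transition function written with the group law: right multiplication by a horizontal step,
  after the substitution of \<open>\<zeta> / sqrt n\<close> for \<open>\<zeta>\<close>.\<close>

lemma heis_kernel_eq:
  assumes n: "n \<ge> 1" and B [measurable]: "B \<in> sets borel"
  shows "heis_kernel n p B = measure (step_law n) {w. heis_mult p w \<in> B}"
proof -
  let ?c = "1 / sqrt (real n)"
  have c: "?c > 0" "?c\<^sup>2 = 1 / real n" using n by (auto simp: power_divide)
  have [measurable]: "{w. heis_mult p w \<in> B} \<in> sets borel"
  proof -
    have "(\<lambda>w. heis_mult p w) \<in> borel_measurable borel" by measurable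
    from measurable_sets[OF this B] show ?thesis by (simp add: vimage_def)
  qed
  have m1: "(\<lambda>\<zeta> :: 'a plane. (?c *\<^sub>R \<zeta>, 0 :: real)) \<in> borel_measurable borel"
    by (intro borel_measurable_continuous_onI continuous_intros)
  have "measure (step_law n) {w. heis_mult p w \<in> B} =
      measure (gauss (1 / real n)) {\<zeta>. heis_mult p (\<zeta>, 0) \<in> B}"
    unfolding step_law_def by (subst measure_distr) (auto simp: vimage_def measurable_cong_sets[OF sets_gauss refl])
  also have "\<dots> = measure (distr (gauss 1) borel (\<lambda>\<zeta>. ?c *\<^sub>R \<zeta>)) {\<zeta>. heis_mult p (\<zeta>, 0) \<in> B}"
    using distr_gauss_scale[OF c(1), where ?'a = "'a plane"] c(2) by simp
  also have "\<dots> = measure (gauss 1) {\<zeta>. heis_mult p (?c *\<^sub>R \<zeta>, 0) \<in> B}"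
  proof (subst measure_distr)
    show "{\<zeta>. heis_mult p (\<zeta>, 0) \<in> B} \<in> sets borel"
      using measurable_sets[OF measurable_horizontal, of "{w. heis_mult p w \<in> B}"] by (simp add: vimage_def)
  qed (auto simp: vimage_def measurable_cong_sets[OF sets_gauss refl])
  also have "\<dots> = (\<integral>\<zeta>. indicator B (heis_mult p (?c *\<^sub>R \<zeta>, 0)) \<partial>gauss 1)"
  proof -
    have "{\<zeta>. heis_mult p (?c *\<^sub>R \<zeta>, 0) \<in> B} \<in> sets borel"
      using measurable_sets[OF m1, of "{w. heis_mult p w \<in> B}"] by (simp add: vimage_def)
    moreover have "(\<lambda>\<zeta>. indicator B (heis_mult p (?c *\<^sub>R \<zeta>, 0)) :: real) = indicator {\<zeta>. heis_mult p (?c *\<^sub>R \<zeta>, 0) \<in> B}"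
      by (auto simp: indicator_def)
    ultimately show ?thesis by simp
  qed
  also have "\<dots> = (\<integral>\<zeta>. (exp (- (norm \<zeta>)\<^sup>2 / (2 * 1)) / sqrt (2 * pi * 1) ^ DIM('a plane)) *
      indicator B (heis_mult p (?c *\<^sub>R \<zeta>, 0)) \<partial>lborel)"
  proof -
    have [measurable]: "(\<lambda>\<zeta>. indicator B (heis_mult p (?c *\<^sub>R \<zeta>, 0)) :: real) \<in> borel_measurable borel"
      using measurable_compose[OF m1, of "\<lambda>w. heis_mult p w" borel] by measurable
    show ?thesis unfolding gauss_def by (subst integral_density) auto
  qed
  also have "\<dots> = heis_kernel n p B"
  proof -
    have "sqrt (2 * pi * 1) ^ DIM('a plane) = (2 * pi) ^ CARD('a)"
    proof -
      have "DIM('a plane) = 2 * CARD('a)" by simp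
      moreover have "sqrt (2 * pi * 1) ^ (2 * CARD('a)) = ((sqrt (2 * pi * 1))\<^sup>2) ^ CARD('a)"
        by (rule power_mult)
      moreover have "(sqrt (2 * pi * 1))\<^sup>2 = 2 * pi" by simp
      ultimately show ?thesis by (simp only:)
    qed
    then have "(\<integral>\<zeta>. (exp (- (norm \<zeta>)\<^sup>2 / (2 * 1)) / sqrt (2 * pi * 1) ^ DIM('a plane)) *
      indicator B (heis_mult p (?c *\<^sub>R \<zeta>, 0)) \<partial>lborel) =
      (\<integral>\<zeta>. 1 / (2 * pi) ^ CARD('a) * (exp (- (norm \<zeta>)\<^sup>2 / 2) *
        indicator B (fst p + ?c *\<^sub>R \<zeta>, snd p + ?c * symp (fst p) \<zeta>)) \<partial>lborel)"
      by (intro Bochner_Integration.integral_cong[OF refl])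
         (simp only: heis_mult_def symp_scaleR_right fst_conv snd_conv add_0_right mult_1_right, simp)
    then show ?thesis unfolding heis_kernel_def by (simp only: integral_mult_right_zero)
  qed
  finally show ?thesis ..
qed

lemma markov_chain_increment:
  assumes mc: "markov_chain M Y (heis_kernel n)" and n: "n \<ge> 1"
  shows "indep_law M (natural_filtration M Y m) (\<lambda>\<omega>. heis_mult (- Y m \<omega>) (Y (Suc m) \<omega>)) (step_law n)"
proof (rule markov_increment)
  show "prob_space M" using mc by (simp add: markov_chain_def)
  then interpret prob_space M .
  interpret \<mu>: prob_space "step_law n" by (rule prob_space_step_law[OF n])
  have Y [measurable]: "Y m \<in> borel_measurable M" for m using mc by (simp add: markov_chain_def)
  let ?F = "natural_filtration M Y m"
  show F: "subalgebra M ?F" by (rule subalgebra_natural_filtration) (rule Y)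
  show "Y m \<in> borel_measurable ?F" by (rule measurable_natural_filtration) auto
  show "Y (Suc m) \<in> borel_measurable M" by (rule Y)
  show "prob_space (step_law n)" "sets (step_law n) = sets borel" by (auto intro: \<mu>.prob_space_axioms)
  fix D assume D: "D \<in> sets ?F"
  have DM [measurable]: "D \<in> sets M" using D F by (auto simp: subalgebra_def)
  interpret sub: finite_measure_subalgebra M ?F by unfold_locales (rule F)
  have m3: "(\<lambda>(\<omega>, w). heis_mult (Y m \<omega>) w) \<in> measurable (density M (indicator D) \<Otimes>\<^sub>M step_law n) borel"
    by (rule measurable_heis_mult_left[OF Y]) simp_all
  show "distr (density M (indicator D)) borel (Y (Suc m)) =
    distr (density M (indicator D) \<Otimes>\<^sub>M step_law n) borel (\<lambda>(\<omega>, w). heis_mult (Y m \<omega>) w)"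
  proof (rule measure_eqI)
    fix B assume "B \<in> sets (distr (density M (indicator D)) borel (Y (Suc m)))"
    then have B [measurable]: "B \<in> sets borel" by simp
    have kernel_range: "0 \<le> heis_kernel n p B" "heis_kernel n p B \<le> 1" for p
      unfolding heis_kernel_eq[OF n B] by auto
    have sect: "Pair \<omega> -` ((\<lambda>(\<omega>, w). heis_mult (Y m \<omega>) w) -` B \<inter> space (M \<Otimes>\<^sub>M step_law n)) = {w. heis_mult (Y m \<omega>) w \<in> B}"
      if "\<omega> \<in> space M" for \<omega>
      using that by (auto simp: space_pair_measure)
    have km: "(\<lambda>\<omega>. emeasure (step_law n) {w. heis_mult (Y m \<omega>) w \<in> B}) \<in> borel_measurable M"
    proof -
      have S: "(\<lambda>(\<omega>, w). heis_mult (Y m \<omega>) w) -` B \<inter> space (M \<Otimes>\<^sub>M step_law n) \<in> sets (M \<Otimes>\<^sub>M step_law n)"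
        by (rule measurable_sets[OF _ B]) measurable
      show ?thesis
        using \<mu>.measurable_emeasure_Pair[OF S] by (simp add: sect cong: measurable_cong)
    qed
    then have km': "(\<lambda>\<omega>. heis_kernel n (Y m \<omega>) B) \<in> borel_measurable M"
      unfolding heis_kernel_eq[OF n B] measure_def by measurable
    have ind: "integrable M (\<lambda>\<omega>. indicat_real B (Y (Suc m) \<omega>))"
      by (intro integrable_const_bound[where B = 1]) auto
    have ik: "integrable M (\<lambda>\<omega>. heis_kernel n (Y m \<omega>) B)"
      using kernel_range km' by (intro integrable_const_bound[where B = 1]) (auto simp: abs_le_iff intro: order_trans[OF _ kernel_range(1)])
    have im: "integrable M (\<lambda>\<omega>. indicat_real D \<omega> * f \<omega>)" if "integrable M f" for f
      using integrable_mult_indicator[OF DM that] by simp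
    have "emeasure (distr (density M (indicator D)) borel (Y (Suc m))) B
        = emeasure (density M (indicator D)) (Y (Suc m) -` B \<inter> space M)"
      by (subst emeasure_distr) auto
    also have "\<dots> = (\<integral>\<^sup>+\<omega>. indicator D \<omega> * indicator (Y (Suc m) -` B \<inter> space M) \<omega> \<partial>M)"
      by (subst emeasure_density) auto
    also have "\<dots> = (\<integral>\<^sup>+\<omega>. ennreal (indicator D \<omega> * indicator B (Y (Suc m) \<omega>)) \<partial>M)"
      by (intro nn_integral_cong) (auto simp: indicator_def)
    also have "\<dots> = ennreal (\<integral>\<omega>. indicator D \<omega> * indicator B (Y (Suc m) \<omega>) \<partial>M)"
      using ind by (intro nn_integral_eq_integral im) auto
    also have "(\<integral>\<omega>. indicator D \<omega> * indicator B (Y (Suc m) \<omega>) \<partial>M) =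
        (\<integral>\<omega>. indicator D \<omega> * real_cond_exp M ?F (\<lambda>\<omega>. indicator B (Y (Suc m) \<omega>)) \<omega> \<partial>M)"
      using sub.real_cond_exp_intA[OF ind D] by (simp add: set_lebesgue_integral_def)
    also have "\<dots> = (\<integral>\<omega>. indicator D \<omega> * heis_kernel n (Y m \<omega>) B \<partial>M)"
    proof (rule integral_cong_AE)
      show "(\<lambda>\<omega>. indicator D \<omega> * heis_kernel n (Y m \<omega>) B) \<in> borel_measurable M"
        using km' by measurable
      have "AE \<omega> in M. real_cond_exp M ?F (\<lambda>\<omega>. indicator B (Y (Suc m) \<omega>)) \<omega> = heis_kernel n (Y m \<omega>) B"
        using mc B unfolding markov_chain_def by blast
      then show "AE \<omega> in M. indicator D \<omega> * real_cond_exp M ?F (\<lambda>\<omega>. indicator B (Y (Suc m) \<omega>)) \<omega> =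
          indicator D \<omega> * heis_kernel n (Y m \<omega>) B" by eventually_elim simp
    qed measurable
    also have "ennreal \<dots> = (\<integral>\<^sup>+\<omega>. ennreal (indicator D \<omega> * heis_kernel n (Y m \<omega>) B) \<partial>M)"
      using ik kernel_range by (intro nn_integral_eq_integral[symmetric] im) auto
    also have "\<dots> = (\<integral>\<^sup>+\<omega>. indicator D \<omega> * emeasure (step_law n) {w. heis_mult (Y m \<omega>) w \<in> B} \<partial>M)"
      unfolding heis_kernel_eq[OF n B] by (intro nn_integral_cong) (auto simp: indicator_def \<mu>.emeasure_eq_measure)
    also have "\<dots> = emeasure (density M (indicator D) \<Otimes>\<^sub>M step_law n)
        ((\<lambda>(\<omega>, w). heis_mult (Y m \<omega>) w) -` B \<inter> space (density M (indicator D) \<Otimes>\<^sub>M step_law n))"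
    proof -
      let ?S = "(\<lambda>(\<omega>, w). heis_mult (Y m \<omega>) w) -` B \<inter> space (density M (indicator D) \<Otimes>\<^sub>M step_law n)"
      have "?S \<in> sets (density M (indicator D) \<Otimes>\<^sub>M step_law n)" by (rule measurable_sets[OF m3 B])
      then have "emeasure (density M (indicator D) \<Otimes>\<^sub>M step_law n) ?S =
          (\<integral>\<^sup>+\<omega>. emeasure (step_law n) (Pair \<omega> -` ?S) \<partial>density M (indicator D))"
        by (rule \<mu>.emeasure_pair_measure_alt)
      also have "\<dots> = (\<integral>\<^sup>+\<omega>. emeasure (step_law n) {w. heis_mult (Y m \<omega>) w \<in> B} \<partial>density M (indicator D))"
        by (intro nn_integral_cong arg_cong[where f = "emeasure (step_law n)"]) (auto simp: space_pair_measure)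
      also have "\<dots> = (\<integral>\<^sup>+\<omega>. indicator D \<omega> * emeasure (step_law n) {w. heis_mult (Y m \<omega>) w \<in> B} \<partial>M)"
        using km by (intro nn_integral_density) auto
      finally show ?thesis ..
    qed
    also have "\<dots> = emeasure (distr (density M (indicator D) \<Otimes>\<^sub>M step_law n) borel (\<lambda>(\<omega>, w). heis_mult (Y m \<omega>) w)) B"
      by (subst emeasure_distr[OF m3 B]) simp
    finally show "emeasure (distr (density M (indicator D)) borel (Y (Suc m))) B =
      emeasure (distr (density M (indicator D) \<Otimes>\<^sub>M step_law n) borel (\<lambda>(\<omega>, w). heis_mult (Y m \<omega>) w)) B" .
  qed simp
qed

text \<open>Left increments over adjacent periods multiply to the left increment over their union.\<close>

lemma markov_chain_increments:
  assumes mc: "markov_chain M Y (heis_kernel n)" and n: "n \<ge> 1"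
  shows "indep_law M (natural_filtration M Y m) (\<lambda>\<omega>. heis_mult (- Y m \<omega>) (Y (m + j) \<omega>)) (walk_law n j)"
proof (induction j)
  case 0
  interpret prob_space M using mc by (simp add: markov_chain_def)
  have "subalgebra M (natural_filtration M Y m)"
    using mc by (intro subalgebra_natural_filtration) (simp add: markov_chain_def)
  then show ?case by (simp add: indep_law_const prob_space_axioms)
next
  case (Suc j)
  let ?U = "\<lambda>\<omega>. heis_mult (- Y m \<omega>) (Y (m + j) \<omega>)"
  let ?V = "\<lambda>\<omega>. heis_mult (- Y (m + j) \<omega>) (Y (Suc (m + j)) \<omega>)"
  have "indep_law M (natural_filtration M Y m) (\<lambda>\<omega>. (?U \<omega>, ?V \<omega>)) (walk_law n j \<Otimes>\<^sub>M step_law n)"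
  proof (rule indep_law_pair[OF Suc markov_chain_increment[OF mc n]])
    show "sets (natural_filtration M Y m) \<subseteq> sets (natural_filtration M Y (m + j))"
      by (rule natural_filtration_mono) simp
    have "Y m \<in> borel_measurable (natural_filtration M Y (m + j))"
      "Y (m + j) \<in> borel_measurable (natural_filtration M Y (m + j))"
      by (auto intro: measurable_natural_filtration)
    then show "?U \<in> measurable (natural_filtration M Y (m + j)) (walk_law n j)"
      by (simp add: measurable_cong_sets[OF refl sets_walk_law])
  qed
  from indep_law_compose[OF this, of "\<lambda>(g, h). heis_mult g h" borel]
  have "indep_law M (natural_filtration M Y m) (\<lambda>\<omega>. heis_mult (?U \<omega>) (?V \<omega>)) (walk_law n (Suc j))"
    by (simp add: measurable_heis_mult_pair)
  then show ?case by (simp add: heis_mult_assoc)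
qed

text \<open>The semigroup acts by right multiplication with \<open>W t\<close>, and its values on \<open>C0_functions\<close>
  determine the conditional law of the next position.\<close>

lemma feller_increment:
  fixes X :: "real \<Rightarrow> 'u \<Rightarrow> 'd::finite heis"
  assumes feller: "feller_process Q X (heis_semigroup N W)" and N: "prob_space N"
    and W [measurable]: "W t \<in> borel_measurable N" and st: "0 \<le> s" "0 \<le> t"
  shows "indep_law Q (natural_filtration Q X s) (\<lambda>\<omega>. heis_mult (- X s \<omega>) (X (s + t) \<omega>)) (distr N borel (W t))"
proof (rule markov_increment)
  show "prob_space Q" using feller by (simp add: feller_process_def)
  then interpret prob_space Q .
  interpret N: prob_space N by fact
  let ?\<mu> = "distr N borel (W t)"
  show "prob_space ?\<mu>" by (rule N.prob_space_distr) measurable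
  then interpret \<mu>: prob_space ?\<mu> .
  have X: "X r \<in> borel_measurable Q" if "0 \<le> r" for r using feller that by (simp add: feller_process_def)
  have [measurable]: "X s \<in> borel_measurable Q" "X (s + t) \<in> borel_measurable Q" using X st by auto
  let ?F = "natural_filtration Q X s"
  show F: "subalgebra Q ?F" by (rule subalgebra_natural_filtration) (rule X)
  show "X s \<in> borel_measurable ?F" using st by (intro measurable_natural_filtration) auto
  show "X (s + t) \<in> borel_measurable Q" using X st by auto
  show "sets ?\<mu> = sets borel" by simp
  fix D assume D: "D \<in> sets ?F"
  have DM [measurable]: "D \<in> sets Q" using D F by (auto simp: subalgebra_def)
  interpret sub: finite_measure_subalgebra Q ?F by unfold_locales (rule F)
  let ?QD = "density Q (indicator D)"
  interpret QD: finite_measure ?QD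
    by (rule finite_measureI) (simp add: emeasure_density nn_integral_indicator emeasure_eq_measure cong: nn_integral_cong)
  interpret P: pair_sigma_finite ?QD ?\<mu> ..
  interpret P: finite_measure "?QD \<Otimes>\<^sub>M ?\<mu>"
    by (rule finite_measure_pair_measure) unfold_locales
  have m3: "(\<lambda>(\<omega>, w). heis_mult (X s \<omega>) w) \<in> measurable (?QD \<Otimes>\<^sub>M ?\<mu>) borel"
    by (rule measurable_heis_mult_left[of "X s" Q]) simp_all
  show "distr ?QD borel (X (s + t)) = distr (?QD \<Otimes>\<^sub>M ?\<mu>) borel (\<lambda>(\<omega>, w). heis_mult (X s \<omega>) w)"
  proof (rule finite_measure_eqI_C0)
    show "finite_measure (distr ?QD borel (X (s + t)))" by (rule QD.finite_measure_distr) simp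
    show "finite_measure (distr (?QD \<Otimes>\<^sub>M ?\<mu>) borel (\<lambda>(\<omega>, w). heis_mult (X s \<omega>) w))"
      by (rule P.finite_measure_distr[OF m3])
    fix f :: "'d heis \<Rightarrow> real" assume f: "f \<in> C0_functions" and f1: "\<And>x. \<bar>f x\<bar> \<le> 1"
    have [measurable]: "f \<in> borel_measurable borel"
      using f by (auto simp: C0_functions_def intro: borel_measurable_continuous_onI)
    have ind: "integrable Q (\<lambda>\<omega>. f (X (s + t) \<omega>))"
      using f1 by (intro integrable_const_bound[where B = 1]) auto
    have V: "heis_semigroup N W t f p = (\<integral>w. f (heis_mult p w) \<partial>?\<mu>)" for p
      unfolding heis_semigroup_def by (subst integral_distr) auto
    have Vm [measurable]: "(\<lambda>\<omega>. \<integral>w. f (heis_mult (X s \<omega>) w) \<partial>?\<mu>) \<in> borel_measurable Q"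
      by (rule \<mu>.borel_measurable_lebesgue_integral) measurable
    have "(\<integral>x. f x \<partial>distr ?QD borel (X (s + t))) = (\<integral>\<omega>. f (X (s + t) \<omega>) \<partial>?QD)"
      by (rule integral_distr) auto
    also have "\<dots> = (\<integral>\<omega>. indicator D \<omega> * f (X (s + t) \<omega>) \<partial>Q)"
      using integral_density[of "\<lambda>\<omega>. f (X (s + t) \<omega>)" Q "indicat_real D"] by (simp add: ennreal_indicator)
    also have "\<dots> = (\<integral>\<omega>. indicator D \<omega> * real_cond_exp Q ?F (\<lambda>\<omega>. f (X (s + t) \<omega>)) \<omega> \<partial>Q)"
      using sub.real_cond_exp_intA[OF ind D] by (simp add: set_lebesgue_integral_def)
    also have "\<dots> = (\<integral>\<omega>. indicator D \<omega> * (\<integral>w. f (heis_mult (X s \<omega>) w) \<partial>?\<mu>) \<partial>Q)"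
    proof (rule integral_cong_AE)
      have "AE \<omega> in Q. real_cond_exp Q ?F (\<lambda>\<omega>. f (X (s + t) \<omega>)) \<omega> = heis_semigroup N W t f (X s \<omega>)"
        using feller f st unfolding feller_process_def by blast
      then show "AE \<omega> in Q. indicator D \<omega> * real_cond_exp Q ?F (\<lambda>\<omega>. f (X (s + t) \<omega>)) \<omega> =
          indicator D \<omega> * (\<integral>w. f (heis_mult (X s \<omega>) w) \<partial>?\<mu>)" by eventually_elim (simp add: V)
    qed measurable
    also have "\<dots> = (\<integral>\<omega>. (\<integral>w. f (heis_mult (X s \<omega>) w) \<partial>?\<mu>) \<partial>?QD)"
      using integral_density[of "\<lambda>\<omega>. \<integral>w. f (heis_mult (X s \<omega>) w) \<partial>?\<mu>" Q "indicat_real D"] by (simp add: ennreal_indicator)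
    also have "\<dots> = (\<integral>z. f (case z of (\<omega>, w) \<Rightarrow> heis_mult (X s \<omega>) w) \<partial>(?QD \<Otimes>\<^sub>M ?\<mu>))"
    proof -
      have "integrable (?QD \<Otimes>\<^sub>M ?\<mu>) (\<lambda>z. f (case z of (\<omega>, w) \<Rightarrow> heis_mult (X s \<omega>) w))"
        using f1 measurable_compose[OF m3, of f borel] by (intro P.integrable_const_bound[where B = 1]) auto
      from P.integral_fst'[OF this] show ?thesis by simp
    qed
    also have "\<dots> = (\<integral>x. f x \<partial>distr (?QD \<Otimes>\<^sub>M ?\<mu>) borel (\<lambda>(\<omega>, w). heis_mult (X s \<omega>) w))"
      by (rule integral_distr[symmetric, OF m3]) simp
    finally show "(\<integral>x. f x \<partial>distr ?QD borel (X (s + t))) =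
      (\<integral>x. f x \<partial>distr (?QD \<Otimes>\<^sub>M ?\<mu>) borel (\<lambda>(\<omega>, w). heis_mult (X s \<omega>) w))" .
  qed simp_all
qed

section \<open>The random walk along Brownian increments\<close>

text \<open>The chain started at the origin, driven by the increments of a planar process instead of abstract
  Gaussian steps.\<close>

fun bm_walk :: "nat \<Rightarrow> (real \<Rightarrow> 'v \<Rightarrow> 'd::finite plane) \<Rightarrow> nat \<Rightarrow> 'v \<Rightarrow> 'd heis" where
  "bm_walk n B 0 \<omega> = 0"
| "bm_walk n B (Suc m) \<omega> =
    heis_mult (bm_walk n B m \<omega>) (B (real (Suc m) / real n) \<omega> - B (real m / real n) \<omega>, 0)"

lemma bm_walk_eq:
  "bm_walk n B m \<omega> = (B (real m / real n) \<omega> - B 0 \<omega>,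
    \<Sum>i<m. symp (B (real i / real n) \<omega> - B 0 \<omega>) (B (real (Suc i) / real n) \<omega> - B (real i / real n) \<omega>))"
proof (induction m)
  case (Suc m)
  then show ?case by (simp add: heis_mult_def del: of_nat_Suc)
qed (simp add: zero_prod_def)

lemma nn_integral_L1_from_L2:
  assumes "prob_space M" and [measurable]: "f \<in> borel_measurable M" and "n > 0" "K \<ge> 0"
    and L2: "(\<integral>\<^sup>+\<omega>. ennreal ((f \<omega>)\<^sup>2) \<partial>M) \<le> ennreal (K / real n)"
  shows "(\<integral>\<^sup>+\<omega>. ennreal \<bar>f \<omega>\<bar> \<partial>M) \<le> ennreal ((1 + K) / sqrt (real n))"
proof -
  interpret prob_space M by fact
  define d where "d = sqrt (real n)"
  have d: "d > 0" "d\<^sup>2 = real n" using assms by (auto simp: d_def)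
  \<comment> \<open>the weight \<open>d\<close> balances the two terms after integration\<close>
  have pt: "\<bar>x\<bar> \<le> 1 / d + d * x\<^sup>2" for x
  proof -
    have "0 \<le> (1 - d * \<bar>x\<bar>)\<^sup>2" by simp
    then have "2 * (d * \<bar>x\<bar>) \<le> 1 + d\<^sup>2 * x\<^sup>2" by (simp add: power2_diff power_mult_distrib)
    then have "d * \<bar>x\<bar> \<le> 1 + d * d * x\<^sup>2" using d(1) by (simp add: power2_eq_square) (smt (verit) mult_nonneg_nonneg abs_ge_zero)
    then have "d * \<bar>x\<bar> \<le> d * (1 / d + d * x\<^sup>2)" using d(1) by (simp add: distrib_left mult.assoc)
    then show ?thesis using d(1) by simp
  qed
  have "(\<integral>\<^sup>+\<omega>. ennreal \<bar>f \<omega>\<bar> \<partial>M) \<le> (\<integral>\<^sup>+\<omega>. ennreal (1 / d) + ennreal d * ennreal ((f \<omega>)\<^sup>2) \<partial>M)"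
  proof (rule nn_integral_mono)
    fix \<omega>
    have "ennreal \<bar>f \<omega>\<bar> \<le> ennreal (1 / d + d * (f \<omega>)\<^sup>2)" by (intro ennreal_leI pt)
    then show "ennreal \<bar>f \<omega>\<bar> \<le> ennreal (1 / d) + ennreal d * ennreal ((f \<omega>)\<^sup>2)"
      using d(1) by (simp add: ennreal_mult' ennreal_plus)
  qed
  also have "\<dots> = ennreal (1 / d) + ennreal d * (\<integral>\<^sup>+\<omega>. ennreal ((f \<omega>)\<^sup>2) \<partial>M)"
    by (simp add: nn_integral_add nn_integral_cmult emeasure_space_1)
  also have "\<dots> \<le> ennreal (1 / d) + ennreal d * ennreal (K / real n)"
    by (intro add_left_mono mult_left_mono L2) simp
  also have "\<dots> = ennreal (1 / d + d * (K / real n))"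
  proof -
    have "ennreal (1 / d) + ennreal d * ennreal k = ennreal (1 / d + d * k)" if "k \<ge> 0" for k
      using d(1) that by (simp add: ennreal_mult' ennreal_plus)
    then show ?thesis using \<open>K \<ge> 0\<close> by simp
  qed
  also have "1 / d + d * (K / real n) = (1 + K) / d"
    using d by (simp add: field_simps power2_eq_square flip: d(2))
  finally show ?thesis by (simp add: d_def)
qed

text \<open>By the isometry the second moment is the sum of \<open>(i / n) (1 / n)\<close> over \<open>i < m\<close>.\<close>

lemma riemann_sum_L2:
  assumes b: "scalar_brownian M F \<beta>" and e: "scalar_brownian M F \<eta>"
    and e0: "AE \<omega> in M. \<eta> 0 \<omega> = 0" and n: "n > 0"
  shows "(\<integral>\<^sup>+\<omega>. ennreal ((simple_integral \<beta> m (\<lambda>i. real i / real n) (\<lambda>i. \<eta> (real i / real n)) \<omega>)\<^sup>2) \<partial>M)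
    \<le> ennreal ((real m / real n)\<^sup>2)"
proof -
  interpret scalar_brownian M F \<beta> by fact
  interpret e: scalar_brownian M F \<eta> by fact
  let ?g = "\<lambda>i. real i / real n"
  have [measurable]: "\<eta> (?g i) \<in> borel_measurable M" for i by (rule e.\<beta>_M) simp
  have sq_int: "integrable M (\<lambda>\<omega>. (\<eta> r \<omega>)\<^sup>2)" if "0 \<le> r" for r
    using e.nn_integral_value_sq[OF e0 that] e.\<beta>_M[OF that]
    by (intro integrableI_bounded) (auto simp: ennreal_power[symmetric])
  have sq: "(simple_value m ?g (\<lambda>i. \<eta> (?g i)) r \<omega>)\<^sup>2 = simple_value m ?g (\<lambda>i \<omega>. (\<eta> (?g i) \<omega>)\<^sup>2) r \<omega>" for r \<omega>
  proof (cases "r \<le> 0 \<or> real m / real n < r")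
    case True
    then show ?thesis by (simp add: simple_value_grid(2)[OF n True])
  next
    case False
    then obtain i where "i < m" "?g i < r" "r \<le> real (Suc i) / real n"
      using simple_value_grid(3)[OF n, of r m] by auto
    then show ?thesis by (simp add: simple_value_grid(1)[OF n, of i])
  qed
  have len: "emeasure lborel {?g i<..?g (Suc i)} = ennreal (1 / real n)" for i
    by (simp add: add_divide_distrib divide_right_mono)
  have "(\<integral>\<^sup>+\<omega>. ennreal ((simple_integral \<beta> m ?g (\<lambda>i. \<eta> (?g i)) \<omega>)\<^sup>2) \<partial>M) =
    (\<integral>\<^sup>+\<omega>. (\<integral>\<^sup>+r. ennreal ((simple_value m ?g (\<lambda>i. \<eta> (?g i)) r \<omega>)\<^sup>2) \<partial>lborel) \<partial>M)"
    unfolding simple_integral_def simple_value_def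
    by (intro ito_isometry) (auto simp: e.adapted sq_int divide_right_mono)
  also have "\<dots> = (\<integral>\<^sup>+\<omega>. (\<Sum>i<m. ennreal ((\<eta> (?g i) \<omega>)\<^sup>2) * ennreal (1 / real n)) \<partial>M)"
  proof (rule nn_integral_cong)
    fix \<omega>
    have "(\<integral>\<^sup>+r. ennreal ((simple_value m ?g (\<lambda>i. \<eta> (?g i)) r \<omega>)\<^sup>2) \<partial>lborel) =
        (\<integral>\<^sup>+r. (\<Sum>i<m. ennreal ((\<eta> (?g i) \<omega>)\<^sup>2) * indicator {?g i<..?g (Suc i)} r) \<partial>lborel)"
    proof (rule nn_integral_cong)
      fix r
      have "ennreal (simple_value m ?g (\<lambda>i \<omega>. (\<eta> (?g i) \<omega>)\<^sup>2) r \<omega>) =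
        (\<Sum>i<m. ennreal ((\<eta> (?g i) \<omega>)\<^sup>2 * indicator {?g i<..?g (Suc i)} r))"
        unfolding simple_value_def by (rule sum_ennreal[symmetric]) simp
      also have "\<dots> = (\<Sum>i<m. ennreal ((\<eta> (?g i) \<omega>)\<^sup>2) * indicator {?g i<..?g (Suc i)} r)"
        by (intro sum.cong refl) (simp add: indicator_def)
      finally show "ennreal ((simple_value m ?g (\<lambda>i. \<eta> (?g i)) r \<omega>)\<^sup>2) =
          (\<Sum>i<m. ennreal ((\<eta> (?g i) \<omega>)\<^sup>2) * indicator {?g i<..?g (Suc i)} r)" unfolding sq .
    qed
    also have "\<dots> = (\<Sum>i<m. ennreal ((\<eta> (?g i) \<omega>)\<^sup>2) * emeasure lborel {?g i<..?g (Suc i)})"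
      by (subst nn_integral_sum) (auto intro!: sum.cong nn_integral_cmult_indicator)
    finally show "(\<integral>\<^sup>+r. ennreal ((simple_value m ?g (\<lambda>i. \<eta> (?g i)) r \<omega>)\<^sup>2) \<partial>lborel) =
      (\<Sum>i<m. ennreal ((\<eta> (?g i) \<omega>)\<^sup>2) * ennreal (1 / real n))" unfolding len .
  qed
  also have "\<dots> = (\<Sum>i<m. ennreal (?g i) * ennreal (1 / real n))"
    by (simp add: nn_integral_sum nn_integral_multc e.nn_integral_value_sq[OF e0])
  also have "\<dots> \<le> (\<Sum>i<m. ennreal (real m / real n) * ennreal (1 / real n))"
    by (intro sum_mono mult_right_mono ennreal_leI divide_right_mono) auto
  also have "\<dots> = ennreal ((real m / real n)\<^sup>2)"
    by (simp add: ennreal_mult''[symmetric] ennreal_of_nat_eq_real_of_nat power2_eq_square mult.commute)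
  finally show ?thesis .
qed

lemma square_sum_le_card:
  fixes f :: "'i \<Rightarrow> real"
  assumes "finite I"
  shows "(\<Sum>i\<in>I. f i)\<^sup>2 \<le> real (card I) * (\<Sum>i\<in>I. (f i)\<^sup>2)"
proof -
  have "(\<Sum>i\<in>I. 1 * f i)\<^sup>2 \<le> (\<Sum>i\<in>I. 1\<^sup>2) * (\<Sum>i\<in>I. (f i)\<^sup>2)" by (rule Cauchy_Schwarz_ineq_sum)
  then show ?thesis by simp
qed

lemma norm_power4_le: "norm z ^ 4 \<le> real (DIM('a)) * (\<Sum>b\<in>Basis. (z \<bullet> b) ^ 4)" for z :: "'a::euclidean_space"
proof -
  have "(norm z)\<^sup>2 = (\<Sum>b\<in>Basis. (z \<bullet> b)\<^sup>2)"
    by (simp add: euclidean_inner[of z z] power2_norm_eq_inner flip: power2_eq_square)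
  then have "norm z ^ 4 = (\<Sum>b\<in>Basis. (z \<bullet> b)\<^sup>2)\<^sup>2" using power_mult[of "norm z" 2 2] by simp
  also have "\<dots> \<le> real (card (Basis :: 'a set)) * (\<Sum>b\<in>Basis. ((z \<bullet> b)\<^sup>2)\<^sup>2)"
    by (rule square_sum_le_card) simp
  finally show ?thesis by (simp flip: power_mult)
qed

lemma ennreal_linear_sums:
  fixes f :: "'i \<Rightarrow> real" and g h :: "'j \<Rightarrow> real"
  assumes "0 \<le> c" "0 \<le> e" "\<And>i. 0 \<le> f i" "\<And>j. 0 \<le> g j" "\<And>j. 0 \<le> h j"
  shows "ennreal (c * (\<Sum>i\<in>S. f i) + e * (\<Sum>j\<in>J. g j + h j)) =
    ennreal c * (\<Sum>i\<in>S. ennreal (f i)) + ennreal e * (\<Sum>j\<in>J. ennreal (g j) + ennreal (h j))"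
proof -
  have "(\<Sum>i\<in>S. ennreal (f i)) = ennreal (\<Sum>i\<in>S. f i)"
    using assms by (intro sum_ennreal) auto
  moreover have "(\<Sum>j\<in>J. ennreal (g j) + ennreal (h j)) = ennreal (\<Sum>j\<in>J. g j + h j)"
    using assms by (simp add: ennreal_plus[symmetric] sum_ennreal del: ennreal_plus)
  ultimately show ?thesis
    using assms by (simp add: ennreal_mult'[symmetric] ennreal_plus[symmetric] sum_nonneg del: ennreal_plus)
qed

text \<open>Both sides are homogeneous of degree four under the dilations \<open>(z, s) \<mapsto> (\<lambda> z, \<lambda>\<^sup>2 s)\<close> of the
  group.\<close>

lemma cc_dist_power4_le: "cc_dist 0 g ^ 4 \<le> 8 * norm (fst g) ^ 4 + 512 * (snd g)\<^sup>2"
proof -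
  define a b where "a = norm (fst g)" and "b = 4 * sqrt (\<bar>snd g\<bar> / 2)"
  have "cc_dist 0 g \<le> a + b" using cc_dist_le_bound[of 0 g] by (simp add: heis_bound_def a_def b_def)
  then have "cc_dist 0 g ^ 4 \<le> (a + b) ^ 4" by (rule power_mono) simp
  also have "(a + b) ^ 4 = ((a + b)\<^sup>2)\<^sup>2" by simp
  also have "\<dots> \<le> (2 * a\<^sup>2 + 2 * b\<^sup>2)\<^sup>2"
  proof (rule power_mono)
    show "(a + b)\<^sup>2 \<le> 2 * a\<^sup>2 + 2 * b\<^sup>2"
      using zero_le_power2[of "a - b"] by (simp add: power2_sum power2_diff)
  qed simp
  also have "\<dots> \<le> 8 * a ^ 4 + 8 * b ^ 4"
  proof -
    have "(2 * a\<^sup>2 + 2 * b\<^sup>2)\<^sup>2 \<le> 2 * (2 * a\<^sup>2)\<^sup>2 + 2 * (2 * b\<^sup>2)\<^sup>2"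
      using zero_le_power2[of "2 * a\<^sup>2 - 2 * b\<^sup>2"] by (simp add: power2_sum power2_diff)
    then show ?thesis by (simp add: power_mult_distrib flip: power_mult)
  qed
  also have "b ^ 4 = 64 * (snd g)\<^sup>2"
  proof -
    have "b ^ 4 = (b\<^sup>2)\<^sup>2" by simp
    also have "b\<^sup>2 = 8 * \<bar>snd g\<bar>" by (simp add: b_def power_mult_distrib)
    finally show ?thesis by (simp add: power_mult_distrib)
  qed
  finally show ?thesis by (simp add: a_def)
qed

locale plane_brownian =
  fixes M :: "'v measure" and B1 B2 :: "real \<Rightarrow> 'v \<Rightarrow> real ^ 'd::finite"
  assumes bm1: "brownian_motion M B1" and bm2: "brownian_motion M B2"
    and ind: "prob_space.indep_var M
        (PiM {0..} (\<lambda>_. borel)) (\<lambda>\<omega>. \<lambda>t\<in>{0..}. B1 t \<omega>)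
        (PiM {0..} (\<lambda>_. borel)) (\<lambda>\<omega>. \<lambda>t\<in>{0..}. B2 t \<omega>)"
begin

definition B :: "real \<Rightarrow> 'v \<Rightarrow> 'd plane" where "B r \<omega> = (B1 r \<omega>, B2 r \<omega>)"

definition F :: "real \<Rightarrow> 'v measure" where "F = natural_filtration M (\<lambda>r \<omega>. (B1 r \<omega>, B2 r \<omega>))"

sublocale prob_space M using bm1 by (rule brownian_motionD)

lemma B_M: "0 \<le> r \<Longrightarrow> B r \<in> borel_measurable M"
  unfolding B_def[abs_def] borel_prod[symmetric]
  using brownian_motionD(2)[OF bm1] brownian_motionD(2)[OF bm2] by (intro measurable_Pair) auto

lemma sub_F: "subalgebra M (F t)"
  unfolding F_def using B_M by (intro subalgebra_natural_filtration) (simp add: B_def[abs_def])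

lemma F_mono: "s \<le> t \<Longrightarrow> sets (F s) \<subseteq> sets (F t)"
  unfolding F_def by (rule natural_filtration_mono)

lemma B_F: "0 \<le> r \<Longrightarrow> r \<le> t \<Longrightarrow> B r \<in> borel_measurable (F t)"
  unfolding F_def B_def[abs_def] by (rule measurable_natural_filtration)

lemma B_increment: "0 \<le> s \<Longrightarrow> s < t \<Longrightarrow> indep_law M (F s) (\<lambda>\<omega>. B t \<omega> - B s \<omega>) (gauss (t - s))"
  using brownian_pair_increment[OF bm1 bm2 ind] unfolding F_def B_def .

lemma B_zero: "AE \<omega> in M. B 0 \<omega> = 0"
  using brownian_motionD(3)[OF bm1] brownian_motionD(3)[OF bm2] by eventually_elim (simp add: B_def zero_prod_def)

lemma B_cont: "AE \<omega> in M. continuous_on {0..} (\<lambda>t. B t \<omega>)"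
  using brownian_motionD(4)[OF bm1] brownian_motionD(4)[OF bm2]
  by eventually_elim (simp add: B_def continuous_on_Pair)

lemma scalar: assumes b: "b \<in> Basis" shows "scalar_brownian M F (\<lambda>r \<omega>. B r \<omega> \<bullet> b)"
proof
  show "subalgebra M (F t)" for t by (rule sub_F)
  show "sets (F s) \<subseteq> sets (F t)" if "s \<le> t" for s t using that by (rule F_mono)
  show "(\<lambda>\<omega>. B r \<omega> \<bullet> b) \<in> borel_measurable (F t)" if "0 \<le> r" "r \<le> t" for r t
    using B_F[OF that] by measurable
  show "indep_law M (F s) (\<lambda>\<omega>. B t \<omega> \<bullet> b - B s \<omega> \<bullet> b) (density lborel (normal_density 0 (sqrt (t - s))))"
    if st: "0 \<le> s" "s < t" for s t
  proof -
    have "(\<lambda>x. x \<bullet> b) \<in> measurable (gauss (t - s)) borel"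
      by (simp add: measurable_cong_sets[OF sets_gauss refl])
    from indep_law_compose[OF B_increment[OF st] this]
    show ?thesis using st b by (simp add: distr_gauss_component inner_diff_left)
  qed
qed

lemma coordinate_zero: "AE \<omega> in M. B 0 \<omega> \<bullet> b = 0"
  using B_zero by eventually_elim simp

lemma coordinate_cont: "AE \<omega> in M. continuous_on {0..} (\<lambda>t. B t \<omega> \<bullet> b)"
  using B_cont by eventually_elim (intro continuous_intros)

lemma bm_walk_F: "bm_walk n B m \<in> borel_measurable (F (real m / real n))"
proof (induction m)
  case 0
  then show ?case by simp
next
  case (Suc m)
  have le: "real m / real n \<le> real (Suc m) / real n" by (intro divide_right_mono) auto
  have "subalgebra (F (real (Suc m) / real n)) (F (real m / real n))"
    using F_mono[OF le] sub_F[of "real m / real n"] sub_F[of "real (Suc m) / real n"] by (simp add: subalgebra_def)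
  then have [measurable]: "bm_walk n B m \<in> borel_measurable (F (real (Suc m) / real n))"
    using Suc by (rule measurable_from_subalg)
  have [measurable]: "B (real (Suc m) / real n) \<in> borel_measurable (F (real (Suc m) / real n))"
    "B (real m / real n) \<in> borel_measurable (F (real (Suc m) / real n))"
    using le by (auto intro!: B_F simp del: of_nat_Suc)
  have "(\<lambda>\<omega>. (B (real (Suc m) / real n) \<omega> - B (real m / real n) \<omega>, 0 :: real)) \<in> borel_measurable (F (real (Suc m) / real n))"
    by (rule measurable_compose[OF _ measurable_horizontal]) (intro borel_measurable_diff; measurable)
  then show ?case by (simp del: of_nat_Suc)
qed

lemma bm_walk_M: "bm_walk n B m \<in> borel_measurable M"
  using measurable_from_subalg[OF sub_F bm_walk_F] .

lemma distr_bm_walk: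
  assumes n: "n \<ge> 1" shows "distr M borel (bm_walk n B m) = walk_law n m"
proof (induction m)
  case 0
  have "distr M borel (\<lambda>_. 0 :: 'd heis) = return borel 0"
    by (rule measure_eqI) (auto simp: emeasure_distr emeasure_space_1 indicator_def vimage_def split: if_splits)
  then show ?case by simp
next
  case (Suc m)
  let ?r = "real m / real n" and ?t = "real (Suc m) / real n"
  let ?V = "\<lambda>\<omega>. (B ?t \<omega> - B ?r \<omega>, 0 :: real)"
  have rt: "0 \<le> ?r" "?r < ?t" "?t - ?r = 1 / real n" using n by (auto simp: divide_strict_right_mono add_divide_distrib)
  have V: "indep_law M (F ?r) ?V (step_law n)"
  proof -
    have "(\<lambda>\<zeta> :: 'd plane. (\<zeta>, 0 :: real)) \<in> measurable (gauss (1 / real n)) borel"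
      by (simp add: measurable_cong_sets[OF sets_gauss refl])
    from indep_law_compose[OF B_increment[OF rt(1,2), unfolded rt(3)] this]
    show ?thesis unfolding step_law_def .
  qed
  have "distr M (borel \<Otimes>\<^sub>M step_law n) (\<lambda>\<omega>. (bm_walk n B m \<omega>, ?V \<omega>)) = walk_law n m \<Otimes>\<^sub>M step_law n"
    using indep_law_joint_distr[OF V bm_walk_F] Suc by simp
  then have "walk_law n (Suc m) = distr (distr M (borel \<Otimes>\<^sub>M step_law n) (\<lambda>\<omega>. (bm_walk n B m \<omega>, ?V \<omega>))) borel (\<lambda>(g, h). heis_mult g h)"
    by simp
  also have "\<dots> = distr M borel (\<lambda>\<omega>. heis_mult (bm_walk n B m \<omega>) (?V \<omega>))"
    using bm_walk_M[of n m] indep_lawD(3)[OF V]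
    by (subst distr_distr) (auto simp: o_def measurable_heis_mult_pair simp del: of_nat_Suc)
  also have "(\<lambda>\<omega>. heis_mult (bm_walk n B m \<omega>) (?V \<omega>)) = bm_walk n B (Suc m)"
    by (rule ext) (rule bm_walk.simps(2)[symmetric])
  finally show ?case ..
qed

text \<open>The height of the walk is the Riemann sum of the area integral on the grid of mesh \<open>1 / n\<close>.\<close>

lemma snd_bm_walk_eq:
  assumes "B 0 \<omega> = 0"
  shows "snd (bm_walk n B m \<omega>) = (\<Sum>j\<in>UNIV.
      simple_integral (\<lambda>r \<omega>. B r \<omega> \<bullet> (axis j 1, 0)) m (\<lambda>i. real i / real n) (\<lambda>i \<omega>. B (real i / real n) \<omega> \<bullet> (0, axis j 1)) \<omega> -
      simple_integral (\<lambda>r \<omega>. B r \<omega> \<bullet> (0, axis j 1)) m (\<lambda>i. real i / real n) (\<lambda>i \<omega>. B (real i / real n) \<omega> \<bullet> (axis j 1, 0)) \<omega>)"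
proof -
  have "symp z w = (\<Sum>j\<in>UNIV. (z \<bullet> (0, axis j 1)) * (w \<bullet> (axis j 1, 0)) - (z \<bullet> (axis j 1, 0)) * (w \<bullet> (0, axis j 1)))"
    for z w :: "'d plane"
    by (simp add: symp_def inner_vec_def[of "fst w"] inner_vec_def[of "fst z"] inner_axis sum_subtractf inner_prod_def mult.commute)
  then show ?thesis
    unfolding bm_walk_eq simple_integral_def
    by (simp add: assms inner_diff_left sum_subtractf del: of_nat_Suc) (intro arg_cong2[where f = "(-)"] sum.swap)
qed

text \<open>Markov's inequality for the fourth power of the distance. In \<open>cc_dist_power4_le\<close> the \<open>2 d\<close> planar
  coordinates, with normal fourth moments \<open>3 (m / n)\<^sup>2\<close>, contribute \<open>8 * 2 d * 2 d * 3 = 96 d\<^sup>2\<close> times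
  \<open>(m / n)\<^sup>2\<close>, and the \<open>2 d\<close> Riemann sums of the height contribute \<open>512 * 2 d * 2 d = 2048 d\<^sup>2\<close> times
  \<open>(m / n)\<^sup>2\<close>.\<close>

lemma bm_walk_tail:
  assumes n: "n \<ge> 1" and \<epsilon>: "\<epsilon> > 0"
  shows "measure M {\<omega> \<in> space M. cc_dist 0 (bm_walk n B m \<omega>) > \<epsilon>} \<le> 2144 * (real CARD('d))\<^sup>2 * (real m / real n)\<^sup>2 / \<epsilon> ^ 4"
proof -
  define r where "r = real m / real n"
  let ?D = "real (DIM('d plane))"
  let ?R1 = "\<lambda>j \<omega>. simple_integral (\<lambda>r \<omega>. B r \<omega> \<bullet> (axis j 1, 0)) m (\<lambda>i. real i / real n) (\<lambda>i \<omega>. B (real i / real n) \<omega> \<bullet> (0, axis j 1)) \<omega>"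
  let ?R2 = "\<lambda>j \<omega>. simple_integral (\<lambda>r \<omega>. B r \<omega> \<bullet> (0, axis j 1)) m (\<lambda>i. real i / real n) (\<lambda>i \<omega>. B (real i / real n) \<omega> \<bullet> (axis j 1, 0)) \<omega>"
  have r0: "0 \<le> r" by (simp add: r_def)
  have basis: "((axis j 1, 0) :: 'd plane) \<in> Basis" "((0, axis j 1) :: 'd plane) \<in> Basis" for j
    by (auto simp: Basis_prod_def axis_in_Basis_iff)
  have [measurable]: "bm_walk n B m \<in> borel_measurable M" by (rule bm_walk_M)
  have Rm [measurable]: "?R1 j \<in> borel_measurable M" "?R2 j \<in> borel_measurable M" for j
    unfolding simple_integral_def
    by (intro borel_measurable_sum borel_measurable_times borel_measurable_diff borel_measurable_inner B_M; simp)+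
  have Bm [measurable]: "B r \<in> borel_measurable M" "B 0 \<in> borel_measurable M" using B_M r0 by auto
  have n': "n > 0" using n by simp
  have point: "AE \<omega> in M. ennreal (\<epsilon> ^ 4) * indicator {\<omega> \<in> space M. cc_dist 0 (bm_walk n B m \<omega>) > \<epsilon>} \<omega> \<le>
      ennreal (8 * ?D) * (\<Sum>b\<in>Basis. ennreal ((B r \<omega> \<bullet> b - B 0 \<omega> \<bullet> b) ^ 4)) +
      ennreal (1024 * real CARD('d)) * (\<Sum>j\<in>UNIV. ennreal ((?R1 j \<omega>)\<^sup>2) + ennreal ((?R2 j \<omega>)\<^sup>2))"
    using B_zero
  proof eventually_elim
    case (elim \<omega>)
    let ?g = "bm_walk n B m \<omega>"
    have f4: "norm (fst ?g) ^ 4 \<le> ?D * (\<Sum>b\<in>Basis. (B r \<omega> \<bullet> b - B 0 \<omega> \<bullet> b) ^ 4)"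
      using norm_power4_le[of "fst ?g"] by (simp add: bm_walk_eq r_def inner_diff_left)
    have s2: "(snd ?g)\<^sup>2 \<le> 2 * real CARD('d) * (\<Sum>j\<in>UNIV. (?R1 j \<omega>)\<^sup>2 + (?R2 j \<omega>)\<^sup>2)"
    proof -
      have "(snd ?g)\<^sup>2 \<le> real CARD('d) * (\<Sum>j\<in>UNIV. (?R1 j \<omega> - ?R2 j \<omega>)\<^sup>2)"
        unfolding snd_bm_walk_eq[OF elim] by (rule square_sum_le_card) simp
      also have "\<dots> \<le> real CARD('d) * (\<Sum>j\<in>UNIV. 2 * ((?R1 j \<omega>)\<^sup>2 + (?R2 j \<omega>)\<^sup>2))"
      proof (intro mult_left_mono sum_mono)
        have "(a - b)\<^sup>2 \<le> 2 * (a\<^sup>2 + b\<^sup>2)" for a b :: real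
          using zero_le_power2[of "a + b"] by (simp add: power2_sum power2_diff)
        then show "(?R1 j \<omega> - ?R2 j \<omega>)\<^sup>2 \<le> 2 * ((?R1 j \<omega>)\<^sup>2 + (?R2 j \<omega>)\<^sup>2)" for j .
      qed simp
      also have "\<dots> = 2 * real CARD('d) * (\<Sum>j\<in>UNIV. (?R1 j \<omega>)\<^sup>2 + (?R2 j \<omega>)\<^sup>2)"
        by (simp only: sum_distrib_left[symmetric] mult.assoc mult.left_commute[of 2])
      finally show ?thesis .
    qed
    have "\<epsilon> ^ 4 \<le> 8 * ?D * (\<Sum>b\<in>Basis. (B r \<omega> \<bullet> b - B 0 \<omega> \<bullet> b) ^ 4) +
        1024 * real CARD('d) * (\<Sum>j\<in>UNIV. (?R1 j \<omega>)\<^sup>2 + (?R2 j \<omega>)\<^sup>2)" if "cc_dist 0 ?g > \<epsilon>"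
    proof -
      have "\<epsilon> ^ 4 \<le> cc_dist 0 ?g ^ 4" using that \<epsilon> by (intro power_mono) auto
      then show ?thesis using cc_dist_power4_le[of ?g] f4 s2 by linarith
    qed
    then have "ennreal (\<epsilon> ^ 4) \<le> ennreal (8 * ?D * (\<Sum>b\<in>Basis. (B r \<omega> \<bullet> b - B 0 \<omega> \<bullet> b) ^ 4) +
        1024 * real CARD('d) * (\<Sum>j\<in>UNIV. (?R1 j \<omega>)\<^sup>2 + (?R2 j \<omega>)\<^sup>2))" if "cc_dist 0 ?g > \<epsilon>"
      using that by (intro ennreal_leI)
    also have "ennreal (8 * ?D * (\<Sum>b\<in>Basis. (B r \<omega> \<bullet> b - B 0 \<omega> \<bullet> b) ^ 4) +
        1024 * real CARD('d) * (\<Sum>j\<in>UNIV. (?R1 j \<omega>)\<^sup>2 + (?R2 j \<omega>)\<^sup>2)) =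
      ennreal (8 * ?D) * (\<Sum>b\<in>Basis. ennreal ((B r \<omega> \<bullet> b - B 0 \<omega> \<bullet> b) ^ 4)) +
      ennreal (1024 * real CARD('d)) * (\<Sum>j\<in>UNIV. ennreal ((?R1 j \<omega>)\<^sup>2) + ennreal ((?R2 j \<omega>)\<^sup>2))"
      by (rule ennreal_linear_sums) auto
    finally show ?case by (auto simp: indicator_def)
  qed
  have "ennreal (\<epsilon> ^ 4) * emeasure M {\<omega> \<in> space M. cc_dist 0 (bm_walk n B m \<omega>) > \<epsilon>} =
    (\<integral>\<^sup>+\<omega>. ennreal (\<epsilon> ^ 4) * indicator {\<omega> \<in> space M. cc_dist 0 (bm_walk n B m \<omega>) > \<epsilon>} \<omega> \<partial>M)"
    by (rule nn_integral_cmult_indicator[symmetric]) measurable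
  also have "\<dots> \<le> (\<integral>\<^sup>+\<omega>. ennreal (8 * ?D) * (\<Sum>b\<in>Basis. ennreal ((B r \<omega> \<bullet> b - B 0 \<omega> \<bullet> b) ^ 4)) +
      ennreal (1024 * real CARD('d)) * (\<Sum>j\<in>UNIV. ennreal ((?R1 j \<omega>)\<^sup>2) + ennreal ((?R2 j \<omega>)\<^sup>2)) \<partial>M)"
    by (rule nn_integral_mono_AE[OF point])
  also have "\<dots> = ennreal (8 * ?D) * (\<Sum>b\<in>Basis. \<integral>\<^sup>+\<omega>. ennreal ((B r \<omega> \<bullet> b - B 0 \<omega> \<bullet> b) ^ 4) \<partial>M) +
      ennreal (1024 * real CARD('d)) * (\<Sum>j\<in>UNIV. (\<integral>\<^sup>+\<omega>. ennreal ((?R1 j \<omega>)\<^sup>2) \<partial>M) + (\<integral>\<^sup>+\<omega>. ennreal ((?R2 j \<omega>)\<^sup>2) \<partial>M))"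
    by (simp add: nn_integral_add nn_integral_cmult nn_integral_sum del: sum_ennreal)
  also have "\<dots> \<le> ennreal (8 * ?D) * (\<Sum>b\<in>(Basis :: 'd plane set). ennreal (3 * r\<^sup>2)) +
      ennreal (1024 * real CARD('d)) * (\<Sum>j\<in>(UNIV :: 'd set). ennreal (r\<^sup>2) + ennreal (r\<^sup>2))"
  proof (intro add_mono mult_left_mono sum_mono)
    fix b :: "'d plane" assume "b \<in> Basis"
    then interpret s: scalar_brownian M F "\<lambda>r \<omega>. B r \<omega> \<bullet> b" by (rule scalar)
    show "(\<integral>\<^sup>+\<omega>. ennreal ((B r \<omega> \<bullet> b - B 0 \<omega> \<bullet> b) ^ 4) \<partial>M) \<le> ennreal (3 * r\<^sup>2)"
      using s.increment_moments(1)[of 0 r 4] s.increment_moments(4)[of 0 r] r0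
      by (subst nn_integral_eq_integral) auto
  next
    fix j :: 'd
    show "(\<integral>\<^sup>+\<omega>. ennreal ((?R1 j \<omega>)\<^sup>2) \<partial>M) \<le> ennreal (r\<^sup>2)"
      unfolding r_def by (rule riemann_sum_L2[OF scalar[OF basis(1)] scalar[OF basis(2)] coordinate_zero n'])
    show "(\<integral>\<^sup>+\<omega>. ennreal ((?R2 j \<omega>)\<^sup>2) \<partial>M) \<le> ennreal (r\<^sup>2)"
      unfolding r_def by (rule riemann_sum_L2[OF scalar[OF basis(2)] scalar[OF basis(1)] coordinate_zero n'])
  qed auto
  also have "\<dots> = ennreal (2144 * (real CARD('d))\<^sup>2 * r\<^sup>2)"
    by (subst ennreal_linear_sums[symmetric]) (auto simp: power2_eq_square algebra_simps)
  finally have "ennreal (\<epsilon> ^ 4 * measure M {\<omega> \<in> space M. cc_dist 0 (bm_walk n B m \<omega>) > \<epsilon>}) \<le> ennreal (2144 * (real CARD('d))\<^sup>2 * r\<^sup>2)"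
    by (simp add: emeasure_eq_measure ennreal_mult'')
  then have "\<epsilon> ^ 4 * measure M {\<omega> \<in> space M. cc_dist 0 (bm_walk n B m \<omega>) > \<epsilon>} \<le> 2144 * (real CARD('d))\<^sup>2 * r\<^sup>2"
    by (simp add: ennreal_le_iff)
  then show ?thesis using \<epsilon> by (simp add: r_def pos_le_divide_eq mult.commute)
qed

end

context plane_brownian
begin

text \<open>Both times differ by at most \<open>1 / n\<close>, so the planar parts differ by order \<open>1 / sqrt n\<close> in mean;
  the heights are compared by the rate of the Riemann sums.\<close>

lemma bm_walk_L1:
  assumes n: "n \<ge> 1" and t: "0 \<le> t" and m: "\<bar>real m / real n - t\<bar> \<le> 1 / real n"
    and I: "\<And>j. has_ito_integral M F (\<lambda>r \<omega>. B r \<omega> \<bullet> (axis j 1, 0)) t (\<lambda>r \<omega>. B r \<omega> \<bullet> (0, axis j 1)) (I j)"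
    and J: "\<And>j. has_ito_integral M F (\<lambda>r \<omega>. B r \<omega> \<bullet> (0, axis j 1)) t (\<lambda>r \<omega>. B r \<omega> \<bullet> (axis j 1, 0)) (J j)"
    and A: "AE \<omega> in M. A \<omega> = (\<Sum>j\<in>UNIV. I j \<omega> - J j \<omega>)"
  shows "(\<integral>\<^sup>+\<omega>. ennreal (norm (bm_walk n B m \<omega> - (B t \<omega>, A \<omega>))) \<partial>M)
    \<le> ennreal ((2 * real (DIM('d plane)) + 2 * real CARD('d) * (10 * t + 3)) / sqrt (real n))"
proof -
  define r where "r = real m / real n"
  have r0: "0 \<le> r" by (simp add: r_def)
  have n': "n > 0" using n by simp
  let ?g = "\<lambda>i. real i / real n"
  let ?R1 = "\<lambda>j \<omega>. simple_integral (\<lambda>r \<omega>. B r \<omega> \<bullet> (axis j 1, 0)) m ?g (\<lambda>i \<omega>. B (real i / real n) \<omega> \<bullet> (0, axis j 1)) \<omega>"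
  let ?R2 = "\<lambda>j \<omega>. simple_integral (\<lambda>r \<omega>. B r \<omega> \<bullet> (0, axis j 1)) m ?g (\<lambda>i \<omega>. B (real i / real n) \<omega> \<bullet> (axis j 1, 0)) \<omega>"
  have basis: "((axis j 1, 0) :: 'd plane) \<in> Basis" "((0, axis j 1) :: 'd plane) \<in> Basis" for j
    by (auto simp: Basis_prod_def axis_in_Basis_iff)
  have Rm [measurable]: "?R1 j \<in> borel_measurable M" "?R2 j \<in> borel_measurable M" for j
    unfolding simple_integral_def
    by (intro borel_measurable_sum borel_measurable_times borel_measurable_diff borel_measurable_inner B_M; simp)+
  have Im [measurable]: "I j \<in> borel_measurable M" "J j \<in> borel_measurable M" for j
    using I[of j] J[of j] by (auto simp: has_ito_integral_def)
  have [measurable]: "B r \<in> borel_measurable M" "B t \<in> borel_measurable M" using B_M r0 t by auto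
  have "(\<integral>\<^sup>+\<omega>. ennreal (norm (bm_walk n B m \<omega> - (B t \<omega>, A \<omega>))) \<partial>M) \<le>
    (\<integral>\<^sup>+\<omega>. (\<Sum>b\<in>Basis. ennreal \<bar>B r \<omega> \<bullet> b - B t \<omega> \<bullet> b\<bar>) +
      (\<Sum>j\<in>UNIV. ennreal \<bar>I j \<omega> - ?R1 j \<omega>\<bar> + ennreal \<bar>J j \<omega> - ?R2 j \<omega>\<bar>) \<partial>M)"
  proof (rule nn_integral_mono_AE)
    show "AE \<omega> in M. ennreal (norm (bm_walk n B m \<omega> - (B t \<omega>, A \<omega>))) \<le>
      (\<Sum>b\<in>Basis. ennreal \<bar>B r \<omega> \<bullet> b - B t \<omega> \<bullet> b\<bar>) +
      (\<Sum>j\<in>UNIV. ennreal \<bar>I j \<omega> - ?R1 j \<omega>\<bar> + ennreal \<bar>J j \<omega> - ?R2 j \<omega>\<bar>)"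
      using A B_zero
    proof eventually_elim
      case (elim \<omega>)
      have "norm (bm_walk n B m \<omega> - (B t \<omega>, A \<omega>)) \<le> norm (B r \<omega> - B t \<omega>) + \<bar>snd (bm_walk n B m \<omega>) - A \<omega>\<bar>"
        using norm_Pair_le[of "fst (bm_walk n B m \<omega>) - B t \<omega>" "snd (bm_walk n B m \<omega>) - A \<omega>"] elim(2)
        by (simp add: bm_walk_eq r_def del: of_nat_Suc)
      also have "norm (B r \<omega> - B t \<omega>) \<le> (\<Sum>b\<in>Basis. \<bar>B r \<omega> \<bullet> b - B t \<omega> \<bullet> b\<bar>)"
        using norm_le_l1[of "B r \<omega> - B t \<omega>"] by (simp add: inner_diff_left)
      also have "\<bar>snd (bm_walk n B m \<omega>) - A \<omega>\<bar> \<le> (\<Sum>j\<in>UNIV. \<bar>I j \<omega> - ?R1 j \<omega>\<bar> + \<bar>J j \<omega> - ?R2 j \<omega>\<bar>)"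
      proof -
        have "snd (bm_walk n B m \<omega>) - A \<omega> = (\<Sum>j\<in>UNIV. (?R1 j \<omega> - ?R2 j \<omega>) - (I j \<omega> - J j \<omega>))"
          unfolding snd_bm_walk_eq[OF elim(2)] elim(1) by (simp only: sum_subtractf)
        then have "\<bar>snd (bm_walk n B m \<omega>) - A \<omega>\<bar> \<le> (\<Sum>j\<in>UNIV. \<bar>(?R1 j \<omega> - ?R2 j \<omega>) - (I j \<omega> - J j \<omega>)\<bar>)"
          by (simp only: sum_abs)
        also have "\<dots> \<le> (\<Sum>j\<in>UNIV. \<bar>I j \<omega> - ?R1 j \<omega>\<bar> + \<bar>J j \<omega> - ?R2 j \<omega>\<bar>)"
        proof (rule sum_mono)
          have "\<bar>(a - b) - (c - d)\<bar> \<le> \<bar>c - a\<bar> + \<bar>d - b\<bar>" for a b c d :: real by linarith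
          then show "\<bar>(?R1 j \<omega> - ?R2 j \<omega>) - (I j \<omega> - J j \<omega>)\<bar> \<le> \<bar>I j \<omega> - ?R1 j \<omega>\<bar> + \<bar>J j \<omega> - ?R2 j \<omega>\<bar>" for j .
        qed
        finally show ?thesis .
      qed
      finally have "norm (bm_walk n B m \<omega> - (B t \<omega>, A \<omega>)) \<le>
        1 * (\<Sum>b\<in>Basis. \<bar>B r \<omega> \<bullet> b - B t \<omega> \<bullet> b\<bar>) + 1 * (\<Sum>j\<in>UNIV. \<bar>I j \<omega> - ?R1 j \<omega>\<bar> + \<bar>J j \<omega> - ?R2 j \<omega>\<bar>)"
        by simp
      then have "ennreal (norm (bm_walk n B m \<omega> - (B t \<omega>, A \<omega>))) \<le>
        ennreal (1 * (\<Sum>b\<in>Basis. \<bar>B r \<omega> \<bullet> b - B t \<omega> \<bullet> b\<bar>) + 1 * (\<Sum>j\<in>UNIV. \<bar>I j \<omega> - ?R1 j \<omega>\<bar> + \<bar>J j \<omega> - ?R2 j \<omega>\<bar>))"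
        by (rule ennreal_leI)
      then show ?case by (subst (asm) ennreal_linear_sums) (auto simp del: sum_ennreal)
    qed
  qed
  also have "\<dots> = (\<Sum>b\<in>Basis. \<integral>\<^sup>+\<omega>. ennreal \<bar>B r \<omega> \<bullet> b - B t \<omega> \<bullet> b\<bar> \<partial>M) +
      (\<Sum>j\<in>UNIV. (\<integral>\<^sup>+\<omega>. ennreal \<bar>I j \<omega> - ?R1 j \<omega>\<bar> \<partial>M) + (\<integral>\<^sup>+\<omega>. ennreal \<bar>J j \<omega> - ?R2 j \<omega>\<bar> \<partial>M))"
    by (simp add: nn_integral_add nn_integral_sum del: sum_ennreal)
  also have "\<dots> \<le> (\<Sum>b\<in>(Basis :: 'd plane set). ennreal ((1 + 1) / sqrt (real n))) +
      (\<Sum>j\<in>(UNIV :: 'd set). ennreal ((1 + (10 * t + 2)) / sqrt (real n)) + ennreal ((1 + (10 * t + 2)) / sqrt (real n)))"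
  proof (intro add_mono sum_mono)
    fix b :: "'d plane" assume "b \<in> Basis"
    then interpret s: scalar_brownian M F "\<lambda>r \<omega>. B r \<omega> \<bullet> b" by (rule scalar)
    have "(\<integral>\<^sup>+\<omega>. ennreal ((B r \<omega> \<bullet> b - B t \<omega> \<bullet> b)\<^sup>2) \<partial>M) = ennreal \<bar>r - t\<bar>"
    proof (cases "r \<le> t")
      case True
      then show ?thesis using s.nn_integral_increment_sq[OF r0 True] by (simp add: power2_commute)
    next
      case False
      then show ?thesis using s.nn_integral_increment_sq[OF t, of r] by simp
    qed
    also have "\<dots> \<le> ennreal (1 / real n)" using m by (intro ennreal_leI) (simp add: r_def)
    finally show "(\<integral>\<^sup>+\<omega>. ennreal \<bar>B r \<omega> \<bullet> b - B t \<omega> \<bullet> b\<bar> \<partial>M) \<le> ennreal ((1 + 1) / sqrt (real n))"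
      by (intro nn_integral_L1_from_L2[OF prob_space_axioms _ n']) auto
  next
    fix j :: 'd
    show "(\<integral>\<^sup>+\<omega>. ennreal \<bar>I j \<omega> - ?R1 j \<omega>\<bar> \<partial>M) \<le> ennreal ((1 + (10 * t + 2)) / sqrt (real n))"
      using ito_integral_riemann_sum[OF scalar[OF basis(1)] scalar[OF basis(2)] coordinate_zero coordinate_cont I t n' m] t
      by (intro nn_integral_L1_from_L2[OF prob_space_axioms _ n']) auto
    show "(\<integral>\<^sup>+\<omega>. ennreal \<bar>J j \<omega> - ?R2 j \<omega>\<bar> \<partial>M) \<le> ennreal ((1 + (10 * t + 2)) / sqrt (real n))"
      using ito_integral_riemann_sum[OF scalar[OF basis(2)] scalar[OF basis(1)] coordinate_zero coordinate_cont J t n' m] t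
      by (intro nn_integral_L1_from_L2[OF prob_space_axioms _ n']) auto
  qed
  also have "\<dots> = ennreal (real (DIM('d plane)) * ((1 + 1) / sqrt (real n)) +
      real CARD('d) * (2 * ((1 + (10 * t + 2)) / sqrt (real n))))"
  proof -
    have "(\<Sum>b\<in>(Basis :: 'd plane set). ennreal x) + (\<Sum>j\<in>(UNIV :: 'd set). ennreal y + ennreal y) =
      ennreal (real (DIM('d plane)) * x + real CARD('d) * (2 * y))" if "0 \<le> x" "0 \<le> y" for x y
      using that by (simp add: ennreal_plus[symmetric] ennreal_mult''[symmetric] ennreal_of_nat_eq_real_of_nat algebra_simps del: ennreal_plus)
    then show ?thesis using t by simp
  qed
  also have "real (DIM('d plane)) * ((1 + 1) / sqrt (real n)) + real CARD('d) * (2 * ((1 + (10 * t + 2)) / sqrt (real n))) =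
      (2 * real (DIM('d plane)) + 2 * real CARD('d) * (10 * t + 3)) / sqrt (real n)"
    by (simp add: add_divide_distrib algebra_simps)
  finally show ?thesis .
qed

end

text \<open>What the limit argument uses of horizontal Brownian motion: walks \<open>S n\<close> on its probability space
  that have the law of the chain, obey the fourth-moment bound and converge to \<open>W\<close> in mean.\<close>

lemma horizontal_brownian_motion_walks:
  fixes W :: "real \<Rightarrow> 'v \<Rightarrow> 'd::finite heis"
  assumes "horizontal_brownian_motion N W"
  obtains S :: "nat \<Rightarrow> nat \<Rightarrow> 'v \<Rightarrow> 'd heis" where
    "prob_space N" "\<And>t. 0 \<le> t \<Longrightarrow> W t \<in> borel_measurable N" "\<And>n m. S n m \<in> borel_measurable N"
    "\<And>n m. n \<ge> 1 \<Longrightarrow> distr N borel (S n m) = walk_law n m"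
    "\<And>n m \<epsilon>. n \<ge> 1 \<Longrightarrow> \<epsilon> > 0 \<Longrightarrow> measure (walk_law n m :: 'd heis measure) {g. cc_dist 0 g > \<epsilon>} \<le>
        2144 * (real CARD('d))\<^sup>2 * (real m / real n)\<^sup>2 / \<epsilon> ^ 4"
    "\<And>t. 0 \<le> t \<Longrightarrow> \<exists>C\<ge>0. \<forall>n\<ge>1. \<forall>m. \<bar>real m / real n - t\<bar> \<le> 1 / real n \<longrightarrow>
        (\<integral>\<^sup>+\<omega>. ennreal (norm (S n m \<omega> - W t \<omega>)) \<partial>N) \<le> ennreal (C / sqrt (real n))"
proof -
  obtain B1 B2 A where W: "W = (\<lambda>t \<omega>. ((B1 t \<omega>, B2 t \<omega>), A t \<omega>))"
    and bm: "brownian_motion N B1" "brownian_motion N B2"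
    and ind: "prob_space.indep_var N
        (PiM {0..} (\<lambda>_. borel)) (\<lambda>\<omega>. \<lambda>t\<in>{0..}. B1 t \<omega>)
        (PiM {0..} (\<lambda>_. borel)) (\<lambda>\<omega>. \<lambda>t\<in>{0..}. B2 t \<omega>)"
    and A: "\<And>t. 0 \<le> t \<Longrightarrow> A t \<in> borel_measurable N \<and>
        (\<exists>I J. (\<forall>j.
            has_ito_integral N (natural_filtration N (\<lambda>r \<omega>. (B1 r \<omega>, B2 r \<omega>)))
              (\<lambda>r \<omega>. B1 r \<omega> $ j) t (\<lambda>r \<omega>. B2 r \<omega> $ j) (I j) \<and>
            has_ito_integral N (natural_filtration N (\<lambda>r \<omega>. (B1 r \<omega>, B2 r \<omega>)))
              (\<lambda>r \<omega>. B2 r \<omega> $ j) t (\<lambda>r \<omega>. B1 r \<omega> $ j) (J j)) \<and>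
          (AE \<omega> in N. A t \<omega> = (\<Sum>j\<in>UNIV. I j \<omega> - J j \<omega>)))"
    using assms unfolding horizontal_brownian_motion_def by blast
  interpret P: plane_brownian N B1 B2 using bm ind by unfold_locales
  have coord: "(\<lambda>r \<omega>. B1 r \<omega> $ j) = (\<lambda>r \<omega>. P.B r \<omega> \<bullet> (axis j 1, 0))"
    "(\<lambda>r \<omega>. B2 r \<omega> $ j) = (\<lambda>r \<omega>. P.B r \<omega> \<bullet> (0, axis j 1))" for j
    by (simp_all add: P.B_def inner_axis fun_eq_iff)
  have WB: "W t \<omega> = (P.B t \<omega>, A t \<omega>)" for t \<omega> by (simp add: W P.B_def)
  show ?thesis
  proof (rule that[of "\<lambda>n m. bm_walk n P.B m"])
    show "prob_space N" by (rule P.prob_space_axioms)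
    show "W t \<in> borel_measurable N" if "0 \<le> t" for t
      unfolding WB[abs_def] borel_prod[symmetric] using P.B_M[OF that] A[OF that] by (intro measurable_Pair) (auto simp: borel_prod)
    show "bm_walk n P.B m \<in> borel_measurable N" for n m by (rule P.bm_walk_M)
    show "distr N borel (bm_walk n P.B m) = walk_law n m" if "n \<ge> 1" for n m by (rule P.distr_bm_walk[OF that])
    show "measure (walk_law n m :: 'd heis measure) {g. cc_dist 0 g > \<epsilon>} \<le>
        2144 * (real CARD('d))\<^sup>2 * (real m / real n)\<^sup>2 / \<epsilon> ^ 4" if "n \<ge> 1" "\<epsilon> > 0" for n m \<epsilon>
    proof -
      have "measure (walk_law n m :: 'd heis measure) {g. cc_dist 0 g > \<epsilon>} =
        measure N (bm_walk n P.B m -` {g. cc_dist 0 g > \<epsilon>} \<inter> space N)"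
        unfolding P.distr_bm_walk[OF that(1), symmetric] by (rule measure_distr) (use P.bm_walk_M in measurable)
      also have "bm_walk n P.B m -` {g. cc_dist 0 g > \<epsilon>} \<inter> space N = {\<omega> \<in> space N. cc_dist 0 (bm_walk n P.B m \<omega>) > \<epsilon>}"
        by auto
      finally show ?thesis using P.bm_walk_tail[OF that] by simp
    qed
    show "\<exists>C\<ge>0. \<forall>n\<ge>1. \<forall>m. \<bar>real m / real n - t\<bar> \<le> 1 / real n \<longrightarrow>
        (\<integral>\<^sup>+\<omega>. ennreal (norm (bm_walk n P.B m \<omega> - W t \<omega>)) \<partial>N) \<le> ennreal (C / sqrt (real n))" if t: "0 \<le> t" for t
    proof -
      obtain I J where IJ: "\<And>j. has_ito_integral N P.F (\<lambda>r \<omega>. P.B r \<omega> \<bullet> (axis j 1, 0)) t (\<lambda>r \<omega>. P.B r \<omega> \<bullet> (0, axis j 1)) (I j)"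
          "\<And>j. has_ito_integral N P.F (\<lambda>r \<omega>. P.B r \<omega> \<bullet> (0, axis j 1)) t (\<lambda>r \<omega>. P.B r \<omega> \<bullet> (axis j 1, 0)) (J j)"
          "AE \<omega> in N. A t \<omega> = (\<Sum>j\<in>UNIV. I j \<omega> - J j \<omega>)"
        using A[OF t] unfolding coord P.F_def[symmetric] by blast
      show ?thesis
        unfolding WB using P.bm_walk_L1[OF _ t _ IJ] t
        by (intro exI[of _ "2 * real (DIM('d plane)) + 2 * real CARD('d) * (10 * t + 3)"]) auto
    qed
  qed
qed

section \<open>Finite-dimensional distributions\<close>

fun path_prod :: "'d::finite heis \<Rightarrow> (nat \<Rightarrow> 'd heis) \<Rightarrow> nat \<Rightarrow> 'd heis" where
  "path_prod p u 0 = p"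
| "path_prod p u (Suc i) = heis_mult (path_prod p u i) (u i)"

lemma path_prod_increments:
  "path_prod (y 0) (\<lambda>i. heis_mult (- y i) (y (Suc i))) = y"
proof
  show "path_prod (y 0) (\<lambda>i. heis_mult (- y i) (y (Suc i))) i = y i" for i by (induction i) simp_all
qed

lemma path_prod_cong: "(\<And>j. j < i \<Longrightarrow> u j = v j) \<Longrightarrow> path_prod p u i = path_prod p v i"
  by (induction i) auto

lemma continuous_on_path_prod: "continuous_on UNIV (path_prod p)"
proof (rule continuous_on_coordinatewise_then_product)
  show "continuous_on UNIV (\<lambda>u. path_prod p u i)" for i
    by (induction i) (auto intro!: continuous_intros)
qed

lemma borel_measurable_sequence:
  fixes U :: "nat \<Rightarrow> 'w \<Rightarrow> 'b::second_countable_topology"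
  assumes "\<And>i. U i \<in> borel_measurable M"
  shows "(\<lambda>\<omega> i. U i \<omega>) \<in> borel_measurable M"
  unfolding measurable_cong_sets[OF refl sets_PiM_equal_borel[symmetric]]
  using assms by (intro measurable_PiM_single') auto

lemma sets_PiM_borel_cong:
  fixes \<mu> :: "nat \<Rightarrow> 'b::second_countable_topology measure"
  assumes "\<And>i. sets (\<mu> i) = sets borel"
  shows "sets (PiM UNIV \<mu>) = sets borel"
proof -
  have "sets (PiM UNIV \<mu>) = sets (PiM UNIV (\<lambda>_. borel :: 'b measure))" using assms by (intro sets_PiM_cong) auto
  then show ?thesis by (simp add: sets_PiM_equal_borel)
qed

text \<open>A process whose increments along a time grid are independent of the past is, along the grid,
  the running product of independent variables.\<close>

lemma integral_increment_process:
  fixes y :: "nat \<Rightarrow> 'w \<Rightarrow> 'd::finite heis" and \<mu> :: "nat \<Rightarrow> 'd heis measure"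
  assumes U: "\<And>i. indep_law M (G i) (\<lambda>\<omega>. heis_mult (- y i \<omega>) (y (Suc i) \<omega>)) (\<mu> i)"
    and y: "\<And>i j. i \<le> j \<Longrightarrow> y i \<in> borel_measurable (G j)"
    and mono: "\<And>i. sets (G i) \<subseteq> sets (G (Suc i))"
    and start: "AE \<omega> in M. y 0 \<omega> = p" and \<mu>: "\<And>i. sets (\<mu> i) = sets borel"
    and \<phi>: "\<phi> \<in> borel_measurable borel"
  shows "(\<integral>\<omega>. \<phi> (\<lambda>i. y i \<omega>) \<partial>M) = (\<integral>u. \<phi> (path_prod p u) \<partial>PiM UNIV \<mu> :: real)"
proof -
  let ?U = "\<lambda>\<omega> i. heis_mult (- y i \<omega>) (y (Suc i) \<omega>)"
  have sp: "subalgebra M (G i)" for i using indep_lawD(2)[OF U] .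
  have yM [measurable]: "y i \<in> borel_measurable M" for i
    using measurable_from_subalg[OF sp y[OF order_refl]] .
  have [measurable]: "(\<lambda>\<omega> i. y i \<omega>) \<in> borel_measurable M" "?U \<in> borel_measurable M"
    by (rule borel_measurable_sequence; measurable)+
  note sets_P = sets_PiM_borel_cong[OF \<mu>]
  have UP: "?U \<in> measurable M (PiM UNIV \<mu>)" using \<open>?U \<in> borel_measurable M\<close> by (simp add: measurable_cong_sets[OF refl sets_P])
  have pp: "(\<lambda>u. \<phi> (path_prod p u)) \<in> borel_measurable borel"
    using borel_measurable_continuous_onI[OF continuous_on_path_prod] \<phi> by (rule measurable_compose)
  have law: "distr M (PiM UNIV \<mu>) ?U = PiM UNIV \<mu>"
  proof (rule indep_law_sequence[where F = G and U = "\<lambda>i \<omega>. heis_mult (- y i \<omega>) (y (Suc i) \<omega>)"])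
    show "indep_law M (G i) (\<lambda>\<omega>. heis_mult (- y i \<omega>) (y (Suc i) \<omega>)) (\<mu> i)" for i by (rule U)
    show "sets (G i) \<subseteq> sets (G (Suc i))" for i by (rule mono)
    show "(\<lambda>\<omega>. heis_mult (- y i \<omega>) (y (Suc i) \<omega>)) \<in> measurable (G (Suc i)) (\<mu> i)" for i
    proof -
      have "y i \<in> borel_measurable (G (Suc i))" "y (Suc i) \<in> borel_measurable (G (Suc i))" by (auto intro: y)
      then show ?thesis by (simp add: measurable_cong_sets[OF refl \<mu>])
    qed
  qed
  have "(\<integral>u. \<phi> (path_prod p u) \<partial>PiM UNIV \<mu>) = (\<integral>u. \<phi> (path_prod p u) \<partial>distr M (PiM UNIV \<mu>) ?U)"
    unfolding law ..
  also have "\<dots> = (\<integral>\<omega>. \<phi> (path_prod p (?U \<omega>)) \<partial>M)"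
    by (rule integral_distr[OF UP]) (use pp in \<open>simp add: measurable_cong_sets[OF sets_P refl]\<close>)
  also have "\<dots> = (\<integral>\<omega>. \<phi> (\<lambda>i. y i \<omega>) \<partial>M)"
  proof (rule integral_cong_AE)
    show "(\<lambda>\<omega>. \<phi> (path_prod p (?U \<omega>))) \<in> borel_measurable M"
      by (rule measurable_compose[OF _ pp]) measurable
    show "(\<lambda>\<omega>. \<phi> (\<lambda>i. y i \<omega>)) \<in> borel_measurable M" by (rule measurable_compose[OF _ \<phi>]) measurable
    show "AE \<omega> in M. \<phi> (path_prod p (?U \<omega>)) = \<phi> (\<lambda>i. y i \<omega>)"
      using start
    proof eventually_elim
      case (elim \<omega>)
      show ?case using path_prod_increments[of "\<lambda>i. y i \<omega>"] elim by simp
    qed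
  qed
  finally show ?thesis ..
qed

text \<open>Independent variables with prescribed laws are functions of independent copies of one probability
  space. This couples the increments of the chain with those of the limit.\<close>

lemma PiM_distr_component:
  fixes f :: "nat \<Rightarrow> 'v \<Rightarrow> 'b::second_countable_topology"
  assumes N: "prob_space N" and f: "\<And>i. f i \<in> borel_measurable N"
  shows "PiM UNIV (\<lambda>i. distr N borel (f i)) = distr (PiM UNIV (\<lambda>_::nat. N)) borel (\<lambda>\<omega> i. f i (\<omega> i))"
proof -
  interpret N: prob_space N by fact
  interpret P: product_prob_space "\<lambda>_::nat. N" UNIV ..
  interpret D: prob_space "distr N borel (f i)" for i by (rule N.prob_space_distr[OF f])
  interpret Q: product_prob_space "\<lambda>i. distr N borel (f i)" UNIV ..
  let ?P = "PiM UNIV (\<lambda>_::nat. N)" and ?D = "PiM UNIV (\<lambda>i. distr N borel (f i))"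
  let ?F = "\<lambda>\<omega> i. f i (\<omega> i)"
  have sD: "sets ?D = sets borel" by (rule sets_PiM_borel_cong) simp
  have F: "?F \<in> measurable ?P borel"
  proof (rule borel_measurable_sequence)
    fix i :: nat
    have "(\<lambda>\<omega>. \<omega> i) \<in> measurable ?P N" by (rule measurable_component_singleton) simp
    then show "(\<lambda>\<omega>. f i (\<omega> i)) \<in> borel_measurable ?P" using f by (rule measurable_compose)
  qed
  then have FD: "?F \<in> measurable ?P ?D" by (simp add: measurable_cong_sets[OF refl sD])
  have "distr ?P borel ?F = ?D"
  proof (rule Q.PiM_eq)
    show "sets (distr ?P borel ?F) = sets ?D" by (simp add: sD)
    fix J :: "nat set" and X assume J: "finite J" "J \<subseteq> UNIV" and X: "\<And>j. j \<in> J \<Longrightarrow> X j \<in> sets (distr N borel (f j))"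
    let ?E = "prod_emb UNIV (\<lambda>i. distr N borel (f i)) J (Pi\<^sub>E J X)"
    have E: "?E \<in> sets borel" using sets_PiM_I[OF J, of X "\<lambda>i. distr N borel (f i)"] X by (simp add: sD)
    have pre: "?F -` ?E \<inter> space ?P = prod_emb UNIV (\<lambda>_. N) J (Pi\<^sub>E J (\<lambda>j. f j -` X j \<inter> space N))"
      by (auto simp: prod_emb_iff restrict_PiE_iff space_PiM PiE_iff)
    have "emeasure (distr ?P borel ?F) ?E = emeasure ?P (?F -` ?E \<inter> space ?P)" by (rule emeasure_distr[OF F E])
    also have "\<dots> = (\<Prod>j\<in>J. emeasure N (f j -` X j \<inter> space N))"
      unfolding pre using J X f by (intro P.emeasure_PiM_emb) (auto intro: measurable_sets)
    also have "\<dots> = (\<Prod>j\<in>J. emeasure (distr N borel (f j)) (X j))"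
      using X f by (intro prod.cong refl) (simp add: emeasure_distr)
    finally show "emeasure (distr ?P borel ?F) ?E = (\<Prod>j\<in>J. emeasure (distr N borel (f j)) (X j))" .
  qed
  then show ?thesis ..
qed

text \<open>Convergence in mean of finitely many coordinates gives convergence of the expectations of
  bounded continuous functions: every subsequence has a further one along which the
  coordinates converge almost surely.\<close>

lemma integral_tendsto_of_L1:
  fixes V :: "nat \<Rightarrow> 'w \<Rightarrow> nat \<Rightarrow> 'b::{real_normed_vector, second_countable_topology}" and \<phi> :: "(nat \<Rightarrow> 'b) \<Rightarrow> real"
  assumes P: "prob_space P" and V [measurable]: "\<And>n i. (\<lambda>\<omega>. V n \<omega> i) \<in> borel_measurable P"
    and V' [measurable]: "\<And>i. (\<lambda>\<omega>. V' \<omega> i) \<in> borel_measurable P"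
    and L1: "\<And>n i. (\<integral>\<^sup>+\<omega>. ennreal (norm (V n \<omega> i - V' \<omega> i)) \<partial>P) \<le> ennreal (c n)" and c: "c \<longlonglongrightarrow> 0" "\<And>n. 0 \<le> c n"
    and \<phi>: "continuous_on UNIV \<phi>" "\<And>u. \<bar>\<phi> u\<bar> \<le> C"
    and dep: "\<And>u v. (\<And>i. i < k \<Longrightarrow> u i = v i) \<Longrightarrow> \<phi> u = \<phi> v"
  shows "(\<lambda>n. \<integral>\<omega>. \<phi> (V n \<omega>) \<partial>P) \<longlonglongrightarrow> (\<integral>\<omega>. \<phi> (V' \<omega>) \<partial>P)"
proof (rule ccontr)
  interpret prob_space P by fact
  assume "\<not> ?thesis"
  then obtain e where e: "e > 0" "\<And>N. \<exists>n\<ge>N. \<not> dist (\<integral>\<omega>. \<phi> (V n \<omega>) \<partial>P) (\<integral>\<omega>. \<phi> (V' \<omega>) \<partial>P) < e"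
    unfolding lim_sequentially by blast
  then have "\<exists>r :: nat \<Rightarrow> nat. strict_mono r \<and> (\<forall>n. \<not> dist (\<integral>\<omega>. \<phi> (V (r n) \<omega>) \<partial>P) (\<integral>\<omega>. \<phi> (V' \<omega>) \<partial>P) < e)"
    using infinite_enumerate[of "{n. \<not> dist (\<integral>\<omega>. \<phi> (V n \<omega>) \<partial>P) (\<integral>\<omega>. \<phi> (V' \<omega>) \<partial>P) < e}"]
    by (auto simp: infinite_nat_iff_unbounded_le)
  then obtain r :: "nat \<Rightarrow> nat" where r: "strict_mono r"
    "\<And>n. \<not> dist (\<integral>\<omega>. \<phi> (V (r n) \<omega>) \<partial>P) (\<integral>\<omega>. \<phi> (V' \<omega>) \<partial>P) < e" by blast
  define g where "g n \<omega> = (\<Sum>i<k. norm (V (r n) \<omega> i - V' \<omega> i))" for n \<omega>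
  have gi: "integrable P (\<lambda>\<omega>. norm (V (r n) \<omega> i - V' \<omega> i))" for n i
  proof (rule integrableI_bounded)
    show "(\<integral>\<^sup>+\<omega>. ennreal (norm (norm (V (r n) \<omega> i - V' \<omega> i))) \<partial>P) < \<infinity>"
      using order_le_less_trans[OF L1[of "r n" i] ennreal_less_top] by simp
  qed measurable
  have gint: "integrable P (g n)" for n unfolding g_def using gi by (intro Bochner_Integration.integrable_sum) auto
  have bound: "(\<integral>\<omega>. norm (g n \<omega>) \<partial>P) \<le> real k * c (r n)" for n
  proof -
    have "(\<integral>\<omega>. norm (g n \<omega>) \<partial>P) = (\<integral>\<omega>. g n \<omega> \<partial>P)" by (simp add: g_def sum_nonneg)
    also have "\<dots> = (\<Sum>i<k. \<integral>\<omega>. norm (V (r n) \<omega> i - V' \<omega> i) \<partial>P)"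
      unfolding g_def using gi by (intro Bochner_Integration.integral_sum) auto
    also have "\<dots> \<le> (\<Sum>i<k. c (r n))"
    proof (rule sum_mono)
      fix i
      have "ennreal (\<integral>\<omega>. norm (V (r n) \<omega> i - V' \<omega> i) \<partial>P) \<le> ennreal (c (r n))"
        using L1[of "r n" i] gi by (subst nn_integral_eq_integral[symmetric]) auto
      then show "(\<integral>\<omega>. norm (V (r n) \<omega> i - V' \<omega> i) \<partial>P) \<le> c (r n)" using c(2) by (simp add: ennreal_le_iff)
    qed
    finally show ?thesis by simp
  qed
  have "(\<lambda>n. \<integral>\<omega>. norm (g n \<omega>) \<partial>P) \<longlonglongrightarrow> 0"
  proof (rule tendsto_sandwich[of "\<lambda>_. 0" _ _ "\<lambda>n. real k * c (r n)"])
    show "(\<lambda>n. real k * c (r n)) \<longlonglongrightarrow> 0"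
      using tendsto_mult_left[OF LIMSEQ_subseq_LIMSEQ[OF c(1) r(1)], of "real k"] by (simp add: o_def)
  qed (use bound in auto)
  from tendsto_L1_AE_subseq[OF gint this] obtain q where q: "strict_mono q" "AE \<omega> in P. (\<lambda>n. g (q n) \<omega>) \<longlonglongrightarrow> 0" by blast
  define tr where "tr u i = (if i < k then u i else 0)" for u :: "nat \<Rightarrow> 'b" and i
  have tr: "\<phi> (tr u) = \<phi> u" for u by (rule dep) (simp add: tr_def)
  have "(\<lambda>n. \<integral>\<omega>. \<phi> (V (r (q n)) \<omega>) \<partial>P) \<longlonglongrightarrow> (\<integral>\<omega>. \<phi> (V' \<omega>) \<partial>P)"
  proof (rule integral_dominated_convergence[where w = "\<lambda>_. C"])
    have \<phi>m: "\<phi> \<in> borel_measurable borel" using \<phi>(1) by (rule borel_measurable_continuous_onI)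
    show "(\<lambda>\<omega>. \<phi> (V' \<omega>)) \<in> borel_measurable P"
      using measurable_compose[OF borel_measurable_sequence[of "\<lambda>i \<omega>. V' \<omega> i" P] \<phi>m] by simp
    show "(\<lambda>\<omega>. \<phi> (V (r (q n)) \<omega>)) \<in> borel_measurable P" for n
      using measurable_compose[OF borel_measurable_sequence[of "\<lambda>i \<omega>. V (r (q n)) \<omega> i" P] \<phi>m] by simp
    show "AE \<omega> in P. (\<lambda>n. \<phi> (V (r (q n)) \<omega>)) \<longlonglongrightarrow> \<phi> (V' \<omega>)"
      using q(2)
    proof eventually_elim
      case (elim \<omega>)
      have coord: "(\<lambda>n. tr (V (r (q n)) \<omega>) i) \<longlonglongrightarrow> tr (V' \<omega>) i" for i
      proof (cases "i < k")
        case True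
        have "(\<lambda>n. V (r (q n)) \<omega> i - V' \<omega> i) \<longlonglongrightarrow> 0"
        proof (rule Lim_null_comparison[OF _ elim], intro always_eventually allI)
          show "norm (V (r (q n)) \<omega> i - V' \<omega> i) \<le> g (q n) \<omega>" for n
            unfolding g_def using True by (intro member_le_sum[of i "{..<k}" "\<lambda>i. norm (V (r (q n)) \<omega> i - V' \<omega> i)"]) auto
        qed
        then show ?thesis using True by (simp add: tr_def LIM_zero_iff)
      qed (simp add: tr_def)
      then have "(\<lambda>n. tr (V (r (q n)) \<omega>)) \<longlonglongrightarrow> tr (V' \<omega>)"
        by (simp add: limitin_componentwise flip: limitin_canonical_iff euclidean_product_topology)
      then have "(\<lambda>n. \<phi> (tr (V (r (q n)) \<omega>))) \<longlonglongrightarrow> \<phi> (tr (V' \<omega>))"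
        using continuous_on_tendsto_compose[OF \<phi>(1)] by auto
      then show ?case by (simp add: tr)
    qed
  qed (use \<phi>(2) in auto)
  then obtain n where "dist (\<integral>\<omega>. \<phi> (V (r (q n)) \<omega>) \<partial>P) (\<integral>\<omega>. \<phi> (V' \<omega>) \<partial>P) < e"
    using e(1) unfolding lim_sequentially by blast
  then show False using r(2)[of "q n"] by simp
qed

section \<open>A maximal inequality\<close>

text \<open>Ottaviani's inequality. At the first time the chain is further than \<open>2 \<epsilon>\<close> from its starting
  point, the remaining increment is independent of the past and at most \<open>\<epsilon>\<close> with probability at
  least one half; by the triangle inequality the chain then ends further than \<open>\<epsilon>\<close> from the start.\<close>

lemma markov_chain_maximal:
  fixes Y :: "nat \<Rightarrow> 'w \<Rightarrow> 'd::finite heis"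
  assumes mc: "markov_chain M Y (heis_kernel n)" and n: "n \<ge> 1" and \<epsilon>: "\<epsilon> > 0"
    and tail: "\<And>j. j \<le> L \<Longrightarrow> measure (walk_law n j :: 'd heis measure) {g. cc_dist 0 g > \<epsilon>} \<le> \<tau>" and \<tau>: "\<tau> \<le> 1 / 2"
  shows "measure M {\<omega> \<in> space M. \<exists>j\<le>L. cc_dist (Y m \<omega>) (Y (m + j) \<omega>) > 2 * \<epsilon>} \<le> 2 * \<tau>"
proof -
  interpret prob_space M using mc by (simp add: markov_chain_def)
  have Y [measurable]: "Y i \<in> borel_measurable M" for i using mc by (simp add: markov_chain_def)
  let ?F = "\<lambda>m. natural_filtration M Y m"
  let ?d = "\<lambda>j \<omega>. cc_dist (Y m \<omega>) (Y (m + j) \<omega>)"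
  define E where "E j = {\<omega> \<in> space M. (\<forall>i<j. ?d i \<omega> \<le> 2 * \<epsilon>) \<and> ?d j \<omega> > 2 * \<epsilon>}" for j
  define H where "H j = {\<omega> \<in> space M. cc_dist 0 (heis_mult (- Y (m + j) \<omega>) (Y (m + j + (L - j)) \<omega>)) \<le> \<epsilon>}" for j
  have EF: "E j \<in> sets (?F (m + j))" for j
  proof -
    have [measurable]: "Y (m + i) \<in> borel_measurable (?F (m + j))" if "i \<le> j" for i
      using that by (intro measurable_natural_filtration) auto
    have "Y m \<in> borel_measurable (?F (m + j))" by (intro measurable_natural_filtration) auto
    note [measurable] = this
    have d [measurable]: "?d i \<in> borel_measurable (?F (m + j))" if "i \<le> j" for i
      using that by measurable
    have "(\<Inter>i\<in>{..<j}. {\<omega> \<in> space (?F (m + j)). ?d i \<omega> \<le> 2 * \<epsilon>} ) \<inter> space (?F (m + j)) \<in> sets (?F (m + j))"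
    proof (cases "j = 0")
      case False
      have "{\<omega> \<in> space (?F (m + j)). ?d i \<omega> \<le> 2 * \<epsilon>} \<in> sets (?F (m + j))" if "i < j" for i
        using borel_measurable_le[OF d borel_measurable_const] that by simp
      then show ?thesis using False by (intro sets.Int sets.finite_INT sets.top) auto
    qed (simp add: sets.top del: space_natural_filtration)
    moreover have "{\<omega> \<in> space (?F (m + j)). ?d j \<omega> > 2 * \<epsilon>} \<in> sets (?F (m + j))"
      using borel_measurable_less[OF borel_measurable_const d] by simp
    moreover have "E j = ((\<Inter>i\<in>{..<j}. {\<omega> \<in> space (?F (m + j)). ?d i \<omega> \<le> 2 * \<epsilon>}) \<inter> space (?F (m + j))) \<inter>
        {\<omega> \<in> space (?F (m + j)). ?d j \<omega> > 2 * \<epsilon>}"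
      unfolding E_def space_natural_filtration by blast
    ultimately show ?thesis by (simp only: sets.Int)
  qed
  have EM [measurable]: "E j \<in> sets M" for j unfolding E_def by measurable
  have HM [measurable]: "H j \<in> sets M" for j unfolding H_def by measurable
  have ball: "{g :: 'd heis. cc_dist 0 g \<le> \<epsilon>} \<in> sets borel" by measurable
  have half: "prob (E j) / 2 \<le> prob (E j \<inter> H j)" if "j \<le> L" for j
  proof -
    interpret W: prob_space "walk_law n (L - j) :: 'd heis measure" by (rule prob_space_walk_law[OF n])
    have "H j = (\<lambda>\<omega>. heis_mult (- Y (m + j) \<omega>) (Y (m + j + (L - j)) \<omega>)) -` {g. cc_dist 0 g \<le> \<epsilon>} \<inter> space M"
      by (auto simp: H_def)
    then have "prob (E j \<inter> H j) = prob (E j) * measure (walk_law n (L - j) :: 'd heis measure) {g. cc_dist 0 g \<le> \<epsilon>}"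
      using indep_lawD(5)[OF markov_chain_increments[OF mc n, of "m + j" "L - j"] EF, of "{g. cc_dist 0 g \<le> \<epsilon>}"] ball by simp
    moreover have "measure (walk_law n (L - j) :: 'd heis measure) {g. cc_dist 0 g \<le> \<epsilon>} =
        1 - measure (walk_law n (L - j) :: 'd heis measure) {g. cc_dist 0 g > \<epsilon>}"
    proof -
      have "{g :: 'd heis. cc_dist 0 g > \<epsilon>} = space (walk_law n (L - j)) - {g. cc_dist 0 g \<le> \<epsilon>}" by auto
      then show ?thesis using W.prob_compl[of "{g. cc_dist 0 g \<le> \<epsilon>}"] ball by simp
    qed
    moreover have "\<dots> \<ge> 1 / 2" using tail[of "L - j"] \<tau> by simp
    ultimately show ?thesis using mult_left_mono[of "1/2" "measure (walk_law n (L - j) :: 'd heis measure) {g. cc_dist 0 g \<le> \<epsilon>}" "prob (E j)"]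
      by simp
  qed
  have disj: "disjoint_family_on E {..L}"
    unfolding disjoint_family_on_def
  proof (intro ballI impI)
    fix i j :: nat assume "i \<noteq> j"
    then consider "i < j" | "j < i" by linarith
    then show "E i \<inter> E j = {}"
    proof cases
      case 1
      then have "?d i \<omega> \<le> 2 * \<epsilon>" if "\<omega> \<in> E j" for \<omega> using that unfolding E_def by blast
      then show ?thesis unfolding E_def using not_le by blast
    next
      case 2
      then have "?d j \<omega> \<le> 2 * \<epsilon>" if "\<omega> \<in> E i" for \<omega> using that unfolding E_def by blast
      then show ?thesis unfolding E_def using not_le by blast
    qed
  qed
  have cover: "{\<omega> \<in> space M. \<exists>j\<le>L. ?d j \<omega> > 2 * \<epsilon>} = (\<Union>j\<in>{..L}. E j)"
  proof (intro set_eqI iffI)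
    fix \<omega> assume "\<omega> \<in> {\<omega> \<in> space M. \<exists>j\<le>L. ?d j \<omega> > 2 * \<epsilon>}"
    then obtain j where j: "j \<le> L" "?d j \<omega> > 2 * \<epsilon>" "\<omega> \<in> space M" by auto
    define i where "i = (LEAST j. ?d j \<omega> > 2 * \<epsilon>)"
    have "?d i \<omega> > 2 * \<epsilon>" unfolding i_def using j(2) by (rule LeastI)
    moreover have "?d k \<omega> \<le> 2 * \<epsilon>" if "k < i" for k using not_less_Least[of k "\<lambda>j. ?d j \<omega> > 2 * \<epsilon>"] that by (simp add: i_def)
    moreover have "i \<le> j" unfolding i_def using j(2) by (rule Least_le)
    ultimately show "\<omega> \<in> (\<Union>j\<in>{..L}. E j)" using j by (auto simp: E_def intro!: bexI[of _ i])
  qed (auto simp: E_def)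
  have "prob {\<omega> \<in> space M. \<exists>j\<le>L. ?d j \<omega> > 2 * \<epsilon>} = (\<Sum>j\<le>L. prob (E j))"
    unfolding cover using disj by (intro finite_measure_finite_Union) auto
  also have "\<dots> \<le> (\<Sum>j\<le>L. 2 * prob (E j \<inter> H j))"
  proof (rule sum_mono)
    fix j assume "j \<in> {..L}"
    then show "prob (E j) \<le> 2 * prob (E j \<inter> H j)" using half[of j] by simp
  qed
  also have "\<dots> = 2 * prob (\<Union>j\<in>{..L}. E j \<inter> H j)"
  proof -
    have "disjoint_family_on (\<lambda>j. E j \<inter> H j) {..L}" using disj by (auto simp: disjoint_family_on_def)
    then show ?thesis by (subst finite_measure_finite_Union) (auto simp: sum_distrib_left)
  qed
  also have "prob (\<Union>j\<in>{..L}. E j \<inter> H j) \<le> prob {\<omega> \<in> space M. ?d L \<omega> > \<epsilon>}"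
  proof (rule finite_measure_mono)
    show "(\<Union>j\<in>{..L}. E j \<inter> H j) \<subseteq> {\<omega> \<in> space M. ?d L \<omega> > \<epsilon>}"
    proof
      fix \<omega> assume "\<omega> \<in> (\<Union>j\<in>{..L}. E j \<inter> H j)"
      then obtain j where j: "j \<le> L" "\<omega> \<in> E j" "\<omega> \<in> H j" by auto
      then have "cc_dist (Y (m + j) \<omega>) (Y (m + L) \<omega>) \<le> \<epsilon>"
        by (simp add: H_def cc_dist_zero_left[symmetric])
      moreover have "?d j \<omega> \<le> ?d L \<omega> + cc_dist (Y (m + L) \<omega>) (Y (m + j) \<omega>)" by (rule cc_dist_triangle)
      ultimately show "\<omega> \<in> {\<omega> \<in> space M. ?d L \<omega> > \<epsilon>}"
        using j(2) by (simp add: E_def cc_dist_commute[of "Y (m + L) \<omega>"])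
    qed
  qed measurable
  also have "prob {\<omega> \<in> space M. ?d L \<omega> > \<epsilon>} \<le> \<tau>"
  proof -
    have b: "{g :: 'd heis. cc_dist 0 g > \<epsilon>} \<in> sets borel" by measurable
    have eq: "{\<omega> \<in> space M. ?d L \<omega> > \<epsilon>} =
        space M \<inter> ((\<lambda>\<omega>. heis_mult (- Y m \<omega>) (Y (m + L) \<omega>)) -` {g. cc_dist 0 g > \<epsilon>} \<inter> space M)"
      by (auto simp: cc_dist_zero_left[symmetric])
    have "space M \<in> sets (?F m)" using sets.top[of "?F m"] by simp
    then have "prob {\<omega> \<in> space M. ?d L \<omega> > \<epsilon>} = measure (walk_law n L :: 'd heis measure) {g. cc_dist 0 g > \<epsilon>}"
      unfolding eq using indep_lawD(5)[OF markov_chain_increments[OF mc n, of m L], of "space M" "{g. cc_dist 0 g > \<epsilon>}"] b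
      by (simp add: prob_space)
    then show ?thesis using tail[of L] by simp
  qed
  finally show ?thesis by simp
qed

section \<open>Interpolated paths\<close>

lemma geodesic_interpolation_near:
  assumes gi: "geodesic_interpolation n (\<lambda>t. rescaled_chain n Y t \<omega>) z" and n: "n \<ge> 1" and t: "0 \<le> t"
  defines "p \<equiv> nat \<lfloor>real n * t\<rfloor>"
  shows "cc_dist (Y p \<omega>) (z t) \<le> cc_dist (Y p \<omega>) (Y (Suc p) \<omega>)"
proof -
  have rc: "rescaled_chain n Y (real i / real n) = Y i" for i using n by (simp add: rescaled_chain_def)
  have p: "real p \<le> real n * t" "real n * t \<le> real (Suc p)" using t by (auto simp: p_def of_nat_floor) linarith
  have pt: "real p / real n \<le> t" "t \<le> real (Suc p) / real n" using p n by (auto simp: field_simps)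
  obtain \<gamma> where \<gamma>: "shortest_geodesic 0 (1 / real n) (Y p \<omega>) (Y (Suc p) \<omega>) \<gamma>"
    "\<forall>t\<in>{real p / real n..real (Suc p) / real n}. z t = \<gamma> (t - real p / real n)"
    using gi unfolding geodesic_interpolation_def rc by blast
  have "z t = \<gamma> (t - real p / real n)" using \<gamma>(2) pt by simp
  moreover have "t - real p / real n \<le> 1 / real n" using pt(2) by (simp add: add_divide_distrib)
  ultimately show ?thesis using shortest_geodesic_dist_le[OF \<gamma>(1), of "t - real p / real n"] pt(1) by simp
qed

text \<open>The number of steps that the chain with \<open>n\<close> steps per unit of time has made at time \<open>i * h\<close>.\<close>

definition grid_time :: "nat \<Rightarrow> real \<Rightarrow> nat \<Rightarrow> nat" where
  "grid_time n h i = nat \<lfloor>real n * (real i * h)\<rfloor>"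

lemma grid_time_0 [simp]: "grid_time n h 0 = 0"
  by (simp add: grid_time_def)

lemma grid_time_mono: "0 \<le> h \<Longrightarrow> i \<le> j \<Longrightarrow> grid_time n h i \<le> grid_time n h j"
  unfolding grid_time_def by (intro nat_mono floor_mono mult_left_mono mult_right_mono) auto

lemma grid_time_step:
  assumes "0 \<le> h" "n \<ge> 1"
  shows "\<bar>real (grid_time n h (Suc i) - grid_time n h i) / real n - h\<bar> \<le> 1 / real n"
proof -
  have le: "grid_time n h i \<le> grid_time n h (Suc i)" using assms by (intro grid_time_mono) auto
  have nn: "0 \<le> real n * (real j * h)" for j using assms by simp
  have f: "real (grid_time n h j) \<le> real n * (real j * h)" "real n * (real j * h) < real (grid_time n h j) + 1" for j
    unfolding grid_time_def using nn[of j] by (auto simp: of_nat_floor)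
  have "real n * (real (Suc i) * h) = real n * (real i * h) + real n * h" by (simp add: algebra_simps)
  then have "\<bar>real (grid_time n h (Suc i)) - real (grid_time n h i) - real n * h\<bar> \<le> 1"
    using f[of i] f[of "Suc i"] by linarith
  moreover have "real (grid_time n h (Suc i) - grid_time n h i) = real (grid_time n h (Suc i)) - real (grid_time n h i)"
    using le by (simp add: of_nat_diff)
  moreover have "\<bar>x / real n - h\<bar> = \<bar>x - real n * h\<bar> / real n" for x
  proof -
    have "x / real n - h = (x - real n * h) / real n" using assms(2) by (simp add: diff_divide_distrib)
    then show ?thesis by simp
  qed
  ultimately show ?thesis by (simp add: divide_right_mono)
qed

text \<open>If within each block of length \<open>T / k\<close> the chain stays close to its position at the start of
  the block, the geodesic interpolation is uniformly close to the piecewise linear path. Both are compared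
  with the position at the start of the block: the geodesic arc stays within \<open>3 \<epsilon>\<close> of it, the linear
  segment within \<open>4 \<epsilon>\<close>. The last arc of a block may end one step after the block.\<close>

lemma path_distance:
  fixes Y :: "nat \<Rightarrow> 'w \<Rightarrow> 'd::finite heis"
  assumes gi: "geodesic_interpolation n (\<lambda>t. rescaled_chain n Y t \<omega>) (\<lambda>t. Z t \<omega>)" and n: "n \<ge> 1"
    and T: "T > 0" and k: "k > 0" and \<epsilon>: "\<epsilon> \<ge> 0"
  defines "m \<equiv> grid_time n (T / real k)"
  assumes near: "\<And>i j. i < k \<Longrightarrow> j \<le> Suc (m (Suc i)) - m i \<Longrightarrow> cc_dist (Y (m i) \<omega>) (Y (m i + j) \<omega>) \<le> \<epsilon>"
  shows "mdist (heis_paths T) (path_of T Z \<omega>) (interpolate T k (\<lambda>i. Y (m i) \<omega>)) \<le> 7 * \<epsilon>"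
proof (rule heis_paths_dist_le)
  fix t assume t: "0 \<le> t" "t \<le> T"
  obtain j \<theta> where j: "j < k" "0 \<le> \<theta>" "\<theta> \<le> 1" "t = (real j + \<theta>) * T / real k"
    using grid_segment[OF t T k] by metis
  define p where "p = nat \<lfloor>real n * t\<rfloor>"
  have h: "0 \<le> T / real k" using T by simp
  have mp: "m j \<le> p" "p \<le> m (Suc j)"
  proof -
    have jt: "real j * (T / real k) \<le> t" "t \<le> real (Suc j) * (T / real k)"
      using mult_right_mono[of "real j" "real j + \<theta>" "T / real k"] mult_right_mono[of "real j + \<theta>" "real (Suc j)" "T / real k"] j h
      by (simp_all add: j(4))
    show "m j \<le> p" "p \<le> m (Suc j)"
      unfolding m_def grid_time_def p_def by (intro nat_mono floor_mono mult_left_mono jt of_nat_0_le_iff)+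
  qed
  let ?y = "Y (m j) \<omega>"
  have d: "cc_dist ?y (Y q \<omega>) \<le> \<epsilon>" if "m j \<le> q" "q \<le> Suc (m (Suc j))" for q
    using near[OF j(1), of "q - m j"] that by simp
  have 1: "cc_dist (Y p \<omega>) (Z t \<omega>) \<le> cc_dist (Y p \<omega>) (Y (Suc p) \<omega>)"
    unfolding p_def by (rule geodesic_interpolation_near[OF gi n t(1)])
  have 2: "cc_dist (Y p \<omega>) (Y (Suc p) \<omega>) \<le> 2 * \<epsilon>"
    using cc_dist_triangle[of "Y p \<omega>" "Y (Suc p) \<omega>" ?y] d[of p] d[of "Suc p"] mp cc_dist_commute[of "Y p \<omega>" ?y] by simp
  have 3: "cc_dist ?y (Z t \<omega>) \<le> 3 * \<epsilon>"
    using cc_dist_triangle[of ?y "Z t \<omega>" "Y p \<omega>"] 1 2 d[of p] mp by simp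
  have eq: "interpolate T k (\<lambda>i. Y (m i) \<omega>) t = ?y + \<theta> *\<^sub>R (Y (m (Suc j)) \<omega> - ?y)"
    using t linear_path_segment[OF j(1-3) T, of "\<lambda>i. Y (m i) \<omega>"] by (simp add: interpolate_def j(4)[symmetric])
  have "m j \<le> m (Suc j)" using mp by simp
  then have 4: "cc_dist ?y (interpolate T k (\<lambda>i. Y (m i) \<omega>) t) \<le> 4 * \<epsilon>"
    unfolding eq using cc_dist_interpolate[OF j(2,3), of ?y "Y (m (Suc j)) \<omega>"] d[of "m (Suc j)"] by simp
  show "cc_dist (path_of T Z \<omega> t) (interpolate T k (\<lambda>i. Y (m i) \<omega>) t) \<le> 7 * \<epsilon>"
    using cc_dist_triangle[of "Z t \<omega>" "interpolate T k (\<lambda>i. Y (m i) \<omega>) t" ?y] 3 4 t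
    by (simp add: path_of_def cc_dist_commute[of "Z t \<omega>"])
qed (use \<epsilon> in simp)

section \<open>Convergence of the path distributions\<close>

text \<open>On the probability space of the horizontal Brownian motion, the increments of the chain over
  one block of time converge in mean to \<open>W h\<close>; independent copies of these increments carry the
  convergence to the positions at all grid times.\<close>

lemma grid_positions_converge:
  fixes p0 :: "'d::finite heis" and W :: "real \<Rightarrow> 'v \<Rightarrow> 'd heis" and X :: "real \<Rightarrow> 'u \<Rightarrow> 'd heis"
    and Y :: "nat \<Rightarrow> nat \<Rightarrow> 'w \<Rightarrow> 'd heis" and \<phi> :: "(nat \<Rightarrow> 'd heis) \<Rightarrow> real"
  assumes chain: "\<And>n. n \<ge> 1 \<Longrightarrow> markov_chain (M n) (Y n) (heis_kernel n)"
    and chain_start: "\<And>n. n \<ge> 1 \<Longrightarrow> AE \<omega> in M n. Y n 0 \<omega> = p0"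
    and hbm: "horizontal_brownian_motion N W"
    and feller: "feller_process Q X (heis_semigroup N W)" and X_start: "AE \<omega> in Q. X 0 \<omega> = p0"
    and h: "0 \<le> h" and \<phi>: "continuous_on UNIV \<phi>" "\<And>y. \<bar>\<phi> y\<bar> \<le> C"
    and dep: "\<And>y y'. (\<And>i. i \<le> k \<Longrightarrow> y i = y' i) \<Longrightarrow> \<phi> y = \<phi> y'"
  shows "(\<lambda>n. \<integral>\<omega>. \<phi> (\<lambda>i. Y n (grid_time n h i) \<omega>) \<partial>M n) \<longlonglongrightarrow> (\<integral>\<omega>. \<phi> (\<lambda>i. X (real i * h) \<omega>) \<partial>Q)"
proof -
  obtain S :: "nat \<Rightarrow> nat \<Rightarrow> 'v \<Rightarrow> 'd heis" where N: "prob_space N"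
    and W: "\<And>t. 0 \<le> t \<Longrightarrow> W t \<in> borel_measurable N" and S: "\<And>n m. S n m \<in> borel_measurable N"
    and S_law: "\<And>n m. n \<ge> 1 \<Longrightarrow> distr N borel (S n m) = walk_law n m"
    and L1: "\<And>t. 0 \<le> t \<Longrightarrow> \<exists>C\<ge>0. \<forall>n\<ge>1. \<forall>m. \<bar>real m / real n - t\<bar> \<le> 1 / real n \<longrightarrow>
        (\<integral>\<^sup>+\<omega>. ennreal (norm (S n m \<omega> - W t \<omega>)) \<partial>N) \<le> ennreal (C / sqrt (real n))"
    by (rule horizontal_brownian_motion_walks[OF hbm]) blast
  interpret N: prob_space N by (rule N)
  let ?P = "PiM UNIV (\<lambda>_::nat. N)"
  interpret P: product_prob_space "\<lambda>_::nat. N" UNIV ..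
  have comp: "(\<lambda>\<omega>. \<omega> i) \<in> measurable ?P N" for i by (rule measurable_component_singleton) simp
  define \<Delta> where "\<Delta> n i = grid_time n h (Suc i) - grid_time n h i" for n i
  define V where "V n \<omega> i = S n (\<Delta> n i) (\<omega> i)" for n i and \<omega> :: "nat \<Rightarrow> 'v"
  define V' where "V' \<omega> i = W h (\<omega> i)" for i :: nat and \<omega> :: "nat \<Rightarrow> 'v"
  have V: "(\<lambda>\<omega>. V n \<omega> i) \<in> borel_measurable ?P" for n i unfolding V_def using comp S by (rule measurable_compose)
  have V': "(\<lambda>\<omega>. V' \<omega> i) \<in> borel_measurable ?P" for i unfolding V'_def using comp W[OF h] by (rule measurable_compose)
  have \<phi>m: "\<phi> \<in> borel_measurable borel" using \<phi>(1) by (rule borel_measurable_continuous_onI)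
  have pm: "(\<lambda>u. \<phi> (path_prod p0 u)) \<in> borel_measurable borel"
    using borel_measurable_continuous_onI[OF continuous_on_path_prod] \<phi>m by (rule measurable_compose)
  have eqY: "(\<integral>\<omega>. \<phi> (\<lambda>i. Y n (grid_time n h i) \<omega>) \<partial>M n) = (\<integral>\<omega>. \<phi> (path_prod p0 (V n \<omega>)) \<partial>?P)" if n: "n \<ge> 1" for n
  proof -
    have "(\<integral>\<omega>. \<phi> (\<lambda>i. Y n (grid_time n h i) \<omega>) \<partial>M n) = (\<integral>u. \<phi> (path_prod p0 u) \<partial>PiM UNIV (\<lambda>i. walk_law n (\<Delta> n i)))"
    proof (rule integral_increment_process[where G = "\<lambda>i. natural_filtration (M n) (Y n) (grid_time n h i)"
          and y = "\<lambda>i. Y n (grid_time n h i)"])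
      fix i
      have "grid_time n h i + \<Delta> n i = grid_time n h (Suc i)" using grid_time_mono[OF h, of i "Suc i" n] by (simp add: \<Delta>_def)
      then show "indep_law (M n) (natural_filtration (M n) (Y n) (grid_time n h i))
          (\<lambda>\<omega>. heis_mult (- Y n (grid_time n h i) \<omega>) (Y n (grid_time n h (Suc i)) \<omega>)) (walk_law n (\<Delta> n i))"
        using markov_chain_increments[OF chain[OF n] n, of "grid_time n h i" "\<Delta> n i"] by simp
      show "sets (natural_filtration (M n) (Y n) (grid_time n h i)) \<subseteq> sets (natural_filtration (M n) (Y n) (grid_time n h (Suc i)))"
        by (intro natural_filtration_mono grid_time_mono h) simp
      show "Y n (grid_time n h i) \<in> borel_measurable (natural_filtration (M n) (Y n) (grid_time n h j))" if "i \<le> j" for j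
        by (intro measurable_natural_filtration grid_time_mono h that) simp
    qed (use chain_start[OF n] \<phi>m in simp_all)
    also have "(\<lambda>i. walk_law n (\<Delta> n i)) = (\<lambda>i. distr N borel (S n (\<Delta> n i)))" using S_law[OF n] by simp
    also have "PiM UNIV \<dots> = distr ?P borel (V n)"
      unfolding V_def[abs_def] using N S by (rule PiM_distr_component)
    also have "(\<integral>u. \<phi> (path_prod p0 u) \<partial>distr ?P borel (V n)) = (\<integral>\<omega>. \<phi> (path_prod p0 (V n \<omega>)) \<partial>?P)"
      using borel_measurable_sequence[OF V] pm by (rule integral_distr)
    finally show ?thesis .
  qed
  have eqX: "(\<integral>\<omega>. \<phi> (\<lambda>i. X (real i * h) \<omega>) \<partial>Q) = (\<integral>\<omega>. \<phi> (path_prod p0 (V' \<omega>)) \<partial>?P)"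
  proof -
    have "(\<integral>\<omega>. \<phi> (\<lambda>i. X (real i * h) \<omega>) \<partial>Q) = (\<integral>u. \<phi> (path_prod p0 u) \<partial>PiM UNIV (\<lambda>i. distr N borel (W h)))"
    proof (rule integral_increment_process[where G = "\<lambda>i. natural_filtration Q X (real i * h)" and y = "\<lambda>i. X (real i * h)"])
      fix i :: nat
      have "real i * h + h = real (Suc i) * h" by (simp add: algebra_simps)
      then show "indep_law Q (natural_filtration Q X (real i * h))
          (\<lambda>\<omega>. heis_mult (- X (real i * h) \<omega>) (X (real (Suc i) * h) \<omega>)) (distr N borel (W h))"
        using feller_increment[OF feller N W[OF h] _ h, of "real i * h"] h by simp
      show "sets (natural_filtration Q X (real i * h)) \<subseteq> sets (natural_filtration Q X (real (Suc i) * h))"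
        by (intro natural_filtration_mono mult_right_mono h) simp
      show "X (real i * h) \<in> borel_measurable (natural_filtration Q X (real j * h))" if "i \<le> j" for j
        using h that by (intro measurable_natural_filtration mult_right_mono) auto
    qed (use X_start \<phi>m in simp_all)
    also have "PiM UNIV (\<lambda>i. distr N borel (W h)) = distr ?P borel V'"
      unfolding V'_def[abs_def] using N W[OF h] by (rule PiM_distr_component)
    also have "(\<integral>u. \<phi> (path_prod p0 u) \<partial>distr ?P borel V') = (\<integral>\<omega>. \<phi> (path_prod p0 (V' \<omega>)) \<partial>?P)"
      using borel_measurable_sequence[OF V'] pm by (rule integral_distr)
    finally show ?thesis .
  qed
  obtain c where c: "c \<ge> 0" "\<And>n m. n \<ge> 1 \<Longrightarrow> \<bar>real m / real n - h\<bar> \<le> 1 / real n \<Longrightarrow>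
        (\<integral>\<^sup>+\<omega>. ennreal (norm (S n m \<omega> - W h \<omega>)) \<partial>N) \<le> ennreal (c / sqrt (real n))"
    using L1[OF h] by blast
  have "(\<lambda>n. \<integral>\<omega>. \<phi> (path_prod p0 (V (Suc n) \<omega>)) \<partial>?P) \<longlonglongrightarrow> (\<integral>\<omega>. \<phi> (path_prod p0 (V' \<omega>)) \<partial>?P)"
  proof (rule integral_tendsto_of_L1[where V = "\<lambda>n. V (Suc n)" and \<phi> = "\<lambda>u. \<phi> (path_prod p0 u)" and V' = V' and c = "\<lambda>n. c / sqrt (real (Suc n))" and C = C and k = k])
    show "prob_space ?P" by (rule P.P.prob_space_axioms)
    show "(\<integral>\<^sup>+\<omega>. ennreal (norm (V (Suc n) \<omega> i - V' \<omega> i)) \<partial>?P) \<le> ennreal (c / sqrt (real (Suc n)))" for n i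
    proof -
      have [measurable]: "S (Suc n) (\<Delta> (Suc n) i) \<in> borel_measurable N" "W h \<in> borel_measurable N" using S W[OF h] by auto
      have "(\<integral>\<^sup>+\<omega>. ennreal (norm (V (Suc n) \<omega> i - V' \<omega> i)) \<partial>?P) =
          (\<integral>\<^sup>+\<omega>. ennreal (norm (S (Suc n) (\<Delta> (Suc n) i) \<omega> - W h \<omega>)) \<partial>distr ?P N (\<lambda>\<omega>. \<omega> i))"
        unfolding V_def V'_def using comp by (intro nn_integral_distr[symmetric]) auto
      also have "distr ?P N (\<lambda>\<omega>. \<omega> i) = N" by (rule P.PiM_component) simp
      also have "(\<integral>\<^sup>+\<omega>. ennreal (norm (S (Suc n) (\<Delta> (Suc n) i) \<omega> - W h \<omega>)) \<partial>N) \<le> ennreal (c / sqrt (real (Suc n)))"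
          unfolding \<Delta>_def by (intro c(2) grid_time_step h) simp_all
      finally show ?thesis .
    qed
    show "(\<lambda>n. c / sqrt (real (Suc n))) \<longlonglongrightarrow> 0"
      by (intro tendsto_divide_0[OF tendsto_const] filterlim_at_top_imp_at_infinity
        filterlim_compose[OF sqrt_at_top] filterlim_compose[OF filterlim_real_sequentially] filterlim_Suc)
    show "continuous_on UNIV (\<lambda>u. \<phi> (path_prod p0 u))"
      using continuous_on_compose2[OF \<phi>(1) continuous_on_path_prod] by auto
    show "\<phi> (path_prod p0 u) = \<phi> (path_prod p0 v)" if "\<And>i. i < k \<Longrightarrow> u i = v i" for u v
      using that by (intro dep path_prod_cong) auto
  qed (use V V' c(1) \<phi>(2) in auto)
  then have "(\<lambda>n. \<integral>\<omega>. \<phi> (\<lambda>i. Y (Suc n) (grid_time (Suc n) h i) \<omega>) \<partial>M (Suc n)) \<longlonglongrightarrow> (\<integral>\<omega>. \<phi> (\<lambda>i. X (real i * h) \<omega>) \<partial>Q)"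
    unfolding eqX by (subst eqY) auto
  then show ?thesis by (subst (asm) filterlim_sequentially_Suc)
qed

text \<open>Replacing the geodesic interpolation by the piecewise linear one through the grid positions
  costs little where the chain oscillates little within the blocks, and the other event is
  controlled by the maximal inequality in each block.\<close>

lemma linear_interpolation_error:
  fixes Y :: "nat \<Rightarrow> 'w \<Rightarrow> 'd::finite heis" and f :: "(real \<Rightarrow> 'd heis) \<Rightarrow> real" and T :: real
  defines "paths \<equiv> heis_paths T :: (real \<Rightarrow> 'd heis) metric"
  assumes mc: "markov_chain M Y (heis_kernel n)" and n: "n \<ge> 1"
    and gi: "\<And>\<omega>. \<omega> \<in> space M \<Longrightarrow> geodesic_interpolation n (\<lambda>t. rescaled_chain n Y t \<omega>) (\<lambda>t. Z t \<omega>)"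
    and Z: "path_of T Z \<in> measurable M (path_borel T)"
    and T: "T > 0" and k: "k > 0" and \<epsilon>: "\<epsilon> > 0"
    and tail: "\<And>i j. i < k \<Longrightarrow> j \<le> Suc (grid_time n (T / real k) (Suc i)) - grid_time n (T / real k) i \<Longrightarrow>
      measure (walk_law n j :: 'd heis measure) {g. cc_dist 0 g > \<epsilon>} \<le> \<tau>" and \<tau>: "\<tau> \<le> 1 / 2"
    and lip: "\<And>x y. x \<in> mspace paths \<Longrightarrow> y \<in> mspace paths \<Longrightarrow> \<bar>f x - f y\<bar> \<le> K * mdist paths x y"
    and bd: "\<And>x. x \<in> mspace paths \<Longrightarrow> \<bar>f x\<bar> \<le> C" and K: "0 \<le> K"
    and f: "f \<in> borel_measurable (path_borel T)"
  shows "\<bar>(\<integral>\<omega>. f (path_of T Z \<omega>) \<partial>M) - (\<integral>\<omega>. f (interpolate T k (\<lambda>i. Y (grid_time n (T / real k) i) \<omega>)) \<partial>M)\<bar>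
    \<le> 14 * K * \<epsilon> + 4 * C * (real k * \<tau>)"
proof -
  interpret prob_space M using mc by (simp add: markov_chain_def)
  have Y [measurable]: "Y i \<in> borel_measurable M" for i using mc by (simp add: markov_chain_def)
  define m where "m = grid_time n (T / real k)"
  let ?L = "\<lambda>i. Suc (m (Suc i)) - m i"
  define B where "B i = {\<omega> \<in> space M. \<exists>j\<le>?L i. cc_dist (Y (m i) \<omega>) (Y (m i + j) \<omega>) > 2 * \<epsilon>}" for i
  let ?bad = "\<Union>i<k. B i"
  let ?l = "\<lambda>\<omega>. interpolate T k (\<lambda>i. Y (m i) \<omega>)"
  have B [measurable]: "B i \<in> sets M" for i unfolding B_def by measurable
  have "prob ?bad \<le> (\<Sum>i<k. prob (B i))" by (rule finite_measure_subadditive_finite) auto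
  also have "\<dots> \<le> (\<Sum>i<k. 2 * \<tau>)"
    unfolding B_def using tail by (intro sum_mono markov_chain_maximal[OF mc n \<epsilon> _ \<tau>]) (auto simp: m_def)
  finally have bad: "prob ?bad \<le> 2 * (real k * \<tau>)" by simp
  have sp: "space (path_borel T :: (real \<Rightarrow> 'd heis) measure) = mspace paths" by (simp add: path_borel_def paths_def)
  have Zs: "path_of T Z \<omega> \<in> mspace paths" if "\<omega> \<in> space M" for \<omega> using measurable_space[OF Z that] sp by simp
  have ls: "?l \<omega> \<in> mspace paths" for \<omega> unfolding paths_def by (rule interpolate_in_heis_paths)
  have [measurable]: "(\<lambda>\<omega>. f (path_of T Z \<omega>)) \<in> borel_measurable M" "(\<lambda>\<omega>. f (?l \<omega>)) \<in> borel_measurable M"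
    using measurable_compose[OF Z f] measurable_compose[OF measurable_interpolate[of "\<lambda>i. Y (m i)"] f] by auto
  have int: "integrable M (\<lambda>\<omega>. f (path_of T Z \<omega>))" "integrable M (\<lambda>\<omega>. f (?l \<omega>))"
    using bd Zs ls by (auto intro!: integrable_const_bound[where B = C] AE_I2)
  have C: "C \<ge> 0" using bd[OF ls] abs_ge_zero order_trans by blast
  have pt: "\<bar>f (path_of T Z \<omega>) - f (?l \<omega>)\<bar> \<le> 14 * K * \<epsilon> + 2 * C * indicator ?bad \<omega>" if \<omega>: "\<omega> \<in> space M" for \<omega>
  proof (cases "\<omega> \<in> ?bad")
    case True
    have "0 \<le> 14 * K * \<epsilon>" using K \<epsilon> by simp
    then show ?thesis using bd[OF Zs[OF \<omega>]] bd[OF ls[of \<omega>]] True by simp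
  next
    case False
    have "mdist (heis_paths T) (path_of T Z \<omega>) (?l \<omega>) \<le> 7 * (2 * \<epsilon>)"
      unfolding m_def
    proof (rule path_distance[where Y = Y and Z = Z and \<omega> = \<omega>, OF gi[OF \<omega>] n T k])
      show "cc_dist (Y (grid_time n (T / real k) i) \<omega>) (Y (grid_time n (T / real k) i + j) \<omega>) \<le> 2 * \<epsilon>"
        if "i < k" "j \<le> Suc (grid_time n (T / real k) (Suc i)) - grid_time n (T / real k) i" for i j
        using False \<omega> that unfolding B_def m_def by (fastforce simp: not_less)
    qed (use \<epsilon> in simp)
    then have "K * mdist paths (path_of T Z \<omega>) (?l \<omega>) \<le> K * (7 * (2 * \<epsilon>))"
      unfolding paths_def using K by (rule mult_left_mono)
    then show ?thesis using lip[OF Zs[OF \<omega>] ls[of \<omega>]] False by simp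
  qed
  have "\<bar>(\<integral>\<omega>. f (path_of T Z \<omega>) \<partial>M) - (\<integral>\<omega>. f (?l \<omega>) \<partial>M)\<bar> = \<bar>\<integral>\<omega>. f (path_of T Z \<omega>) - f (?l \<omega>) \<partial>M\<bar>"
    using int by simp
  also have "\<dots> \<le> (\<integral>\<omega>. \<bar>f (path_of T Z \<omega>) - f (?l \<omega>)\<bar> \<partial>M)" by (rule integral_abs_bound)
  also have "\<dots> \<le> (\<integral>\<omega>. 14 * K * \<epsilon> + 2 * C * indicator ?bad \<omega> \<partial>M)"
    using int pt by (intro integral_mono) (auto simp: emeasure_eq_measure)
  also have "\<dots> = 14 * K * \<epsilon> + 2 * C * prob ?bad"
    by (subst Bochner_Integration.integral_add) (auto simp: prob_space emeasure_eq_measure)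
  also have "\<dots> \<le> 14 * K * \<epsilon> + 2 * C * (2 * (real k * \<tau>))"
    using bad C by (intro add_left_mono mult_left_mono) auto
  finally show ?thesis by (simp add: m_def)
qed

text \<open>With blocks of length \<open>h = T / k\<close> the maximal inequality bounds the probability of a large
  oscillation in some block by a multiple of \<open>k h\<^sup>2 = T\<^sup>2 / k\<close>: the fourth moment of the distance
  makes this small for large \<open>k\<close>, uniformly in \<open>n\<close>.\<close>

lemma lipschitz_integrals_converge:
  fixes p0 :: "'d::finite heis" and W :: "real \<Rightarrow> 'v \<Rightarrow> 'd heis" and X :: "real \<Rightarrow> 'u \<Rightarrow> 'd heis"
    and Y :: "nat \<Rightarrow> nat \<Rightarrow> 'w \<Rightarrow> 'd heis" and f :: "(real \<Rightarrow> 'd heis) \<Rightarrow> real" and T :: real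
  defines "paths \<equiv> heis_paths T :: (real \<Rightarrow> 'd heis) metric"
  assumes T: "T > 0"
    and chain: "\<And>n. n \<ge> 1 \<Longrightarrow> markov_chain (M n) (Y n) (heis_kernel n)"
    and chain_start: "\<And>n. n \<ge> 1 \<Longrightarrow> AE \<omega> in M n. Y n 0 \<omega> = p0"
    and interpolation: "\<And>n \<omega>. n \<ge> 1 \<Longrightarrow> \<omega> \<in> space (M n) \<Longrightarrow>
          geodesic_interpolation n (\<lambda>t. rescaled_chain n (Y n) t \<omega>) (\<lambda>t. Z n t \<omega>)"
    and Z: "\<And>n. n \<ge> 1 \<Longrightarrow> path_of T (Z n) \<in> measurable (M n) (path_borel T)"
    and hbm: "horizontal_brownian_motion N W"
    and feller: "feller_process Q X (heis_semigroup N W)"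
    and X_start: "AE \<omega> in Q. X 0 \<omega> = p0"
    and X_continuous: "\<And>\<omega>. \<omega> \<in> space Q \<Longrightarrow> continuous_on {0..} (\<lambda>t. X t \<omega>)"
    and lip: "\<And>x y. x \<in> mspace paths \<Longrightarrow> y \<in> mspace paths \<Longrightarrow> \<bar>f x - f y\<bar> \<le> K * mdist paths x y"
    and bd: "\<And>x. x \<in> mspace paths \<Longrightarrow> \<bar>f x\<bar> \<le> C" and K: "0 \<le> K"
    and f: "f \<in> borel_measurable (path_borel T)"
  shows "(\<lambda>n. \<integral>\<omega>. f (path_of T (Z n) \<omega>) \<partial>M n) \<longlonglongrightarrow> (\<integral>\<omega>. f (path_of T X \<omega>) \<partial>Q)"
proof (rule LIMSEQ_I)
  fix r :: real assume "r > 0"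
  define \<delta> where "\<delta> = r / 4"
  have \<delta>: "\<delta> > 0" using \<open>r > 0\<close> by (simp add: \<delta>_def)
  interpret Q: prob_space Q using feller by (simp add: feller_process_def)
  have X: "X t \<in> borel_measurable Q" if "0 \<le> t" for t using feller that by (simp add: feller_process_def)
  have X_path: "path_of T X \<in> measurable Q (path_borel T)" using T X X_continuous by (rule measurable_path_of)
  have sp: "space (path_borel T :: (real \<Rightarrow> 'd heis) measure) = mspace paths" by (simp add: path_borel_def paths_def)
  have Xs: "path_of T X \<omega> \<in> mspace paths" if "\<omega> \<in> space Q" for \<omega> using measurable_space[OF X_path that] sp by simp
  have ls: "interpolate T k y \<in> mspace paths" for k y unfolding paths_def by (rule interpolate_in_heis_paths)
  have C: "C \<ge> 0" using bd[OF ls] abs_ge_zero order_trans by blast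
  let ?lX = "\<lambda>k \<omega>. interpolate T k (\<lambda>i. X (real i * (T / real k)) \<omega>)"
  \<comment> \<open>\<open>14\<close> is the factor in \<open>linear_interpolation_error\<close>; \<open>K\<close> may vanish\<close>
  define \<epsilon> where "\<epsilon> = \<delta> / (14 * (K + 1))"
  have \<epsilon>: "\<epsilon> > 0" "14 * K * \<epsilon> \<le> \<delta>" using \<delta> K by (simp_all add: \<epsilon>_def field_simps)
  define A where "A = 2144 * (real CARD('d))\<^sup>2 * (T + 2)\<^sup>2 / \<epsilon> ^ 4"
  have limX: "(\<lambda>k. \<integral>\<omega>. f (?lX k \<omega>) \<partial>Q) \<longlonglongrightarrow> (\<integral>\<omega>. f (path_of T X \<omega>) \<partial>Q)"
  proof (rule integral_dominated_convergence[where w = "\<lambda>_. C"])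
    show "(\<lambda>\<omega>. f (path_of T X \<omega>)) \<in> borel_measurable Q" using X_path f by (rule measurable_compose)
    show "(\<lambda>\<omega>. f (?lX k \<omega>)) \<in> borel_measurable Q" for k
      using T by (intro measurable_compose[OF measurable_interpolate f] X) simp
    show "AE \<omega> in Q. (\<lambda>k. f (?lX k \<omega>)) \<longlonglongrightarrow> f (path_of T X \<omega>)"
    proof (rule AE_I2)
      fix \<omega> assume \<omega>: "\<omega> \<in> space Q"
      have "continuous_on {0..T} (\<lambda>t. X t \<omega>)" by (rule continuous_on_subset[OF X_continuous[OF \<omega>]]) auto
      then have "(\<lambda>k. mdist paths (?lX k \<omega>) (path_of T X \<omega>)) \<longlonglongrightarrow> 0"
        unfolding path_of_def paths_def using interpolate_tendsto[OF _ T, of "\<lambda>t. X t \<omega>"] by simp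
      then have "(\<lambda>k. K * mdist paths (?lX k \<omega>) (path_of T X \<omega>)) \<longlonglongrightarrow> 0"
        using tendsto_mult_left[of _ 0 sequentially K] by fastforce
      then have "(\<lambda>k. f (?lX k \<omega>) - f (path_of T X \<omega>)) \<longlonglongrightarrow> 0"
        by (rule Lim_null_comparison[rotated]) (use lip[OF ls Xs[OF \<omega>]] in simp)
      then show "(\<lambda>k. f (?lX k \<omega>)) \<longlonglongrightarrow> f (path_of T X \<omega>)" by (simp add: LIM_zero_iff)
    qed
    show "AE \<omega> in Q. norm (f (?lX k \<omega>)) \<le> C" for k using bd[OF ls] by simp
  qed simp
  have ev: "\<forall>\<^sub>F k in sequentially. A / (real k)\<^sup>2 < 1 / 2 \<and> 4 * C * (A / real k) < \<delta> \<and>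
      dist (\<integral>\<omega>. f (?lX k \<omega>) \<partial>Q) (\<integral>\<omega>. f (path_of T X \<omega>) \<partial>Q) < \<delta> \<and> k > 0"
  proof (intro eventually_conj)
    have 1: "(\<lambda>k. A / real k) \<longlonglongrightarrow> 0" by (rule lim_const_over_n)
    have "(\<lambda>k. 4 * C * (A / real k)) \<longlonglongrightarrow> 4 * C * 0" by (intro tendsto_mult_left 1)
    then show "\<forall>\<^sub>F k in sequentially. 4 * C * (A / real k) < \<delta>" using \<delta> by (intro order_tendstoD(2)) auto
    have "(\<lambda>k. A / real k * (1 / real k)) \<longlonglongrightarrow> 0 * 0" by (intro tendsto_mult 1 lim_const_over_n)
    then have "(\<lambda>k. A / (real k)\<^sup>2) \<longlonglongrightarrow> 0" by (simp add: power2_eq_square)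
    then show "\<forall>\<^sub>F k in sequentially. A / (real k)\<^sup>2 < 1 / 2" by (intro order_tendstoD(2)) auto
    show "\<forall>\<^sub>F k in sequentially. dist (\<integral>\<omega>. f (?lX k \<omega>) \<partial>Q) (\<integral>\<omega>. f (path_of T X \<omega>) \<partial>Q) < \<delta>"
      using limX \<delta> by (rule tendstoD)
  qed (rule eventually_gt_at_top)
  then obtain k where k: "A / (real k)\<^sup>2 < 1 / 2" "4 * C * (A / real k) < \<delta>"
    "dist (\<integral>\<omega>. f (?lX k \<omega>) \<partial>Q) (\<integral>\<omega>. f (path_of T X \<omega>) \<partial>Q) < \<delta>" "k > 0"
    using eventually_happens'[OF sequentially_bot ev] by blast
  define h where "h = T / real k"
  have h: "0 \<le> h" using T by (simp add: h_def)
  let ?lY = "\<lambda>n \<omega>. interpolate T k (\<lambda>i. Y n (grid_time n h i) \<omega>)"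
  have "(\<lambda>n. \<integral>\<omega>. f (?lY n \<omega>) \<partial>M n) \<longlonglongrightarrow> (\<integral>\<omega>. f (?lX k \<omega>) \<partial>Q)"
    unfolding h_def[symmetric]
  proof (rule grid_positions_converge[where \<phi> = "\<lambda>y. f (interpolate T k y)" and k = k, OF chain chain_start hbm feller X_start h])
    interpret m: Metric_space "mspace paths" "mdist paths" by (rule Metric_space_mspace_mdist)
    show "continuous_on UNIV (\<lambda>y. f (interpolate T k y))"
      unfolding continuous_on_def
    proof
      fix y :: "nat \<Rightarrow> 'd heis"
      have at: "atin euclidean y = at y" by (auto simp: filter_eq_iff eventually_atin eventually_at_topological)
      have "limitin (mtopology_of paths) (interpolate T k) (interpolate T k y) (atin euclidean y)"
        using continuous_map_interpolate[of T k, where 'd = 'd] unfolding paths_def continuous_map_atin by simp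
      then have "((\<lambda>z. mdist paths (interpolate T k z) (interpolate T k y)) \<longlongrightarrow> 0) (at y)"
        unfolding mtopology_of_def m.limitin_metric_dist_null at by simp
      then have "((\<lambda>z. K * mdist paths (interpolate T k z) (interpolate T k y)) \<longlongrightarrow> 0) (at y)"
        using tendsto_mult_left[of _ 0 "at y" K] by fastforce
      then have "((\<lambda>z. f (interpolate T k z) - f (interpolate T k y)) \<longlongrightarrow> 0) (at y)"
        by (rule Lim_null_comparison[rotated]) (use lip[OF ls ls] in simp)
      then show "((\<lambda>z. f (interpolate T k z)) \<longlongrightarrow> f (interpolate T k y)) (at y within UNIV)" by (simp add: LIM_zero_iff)
    qed
    show "\<bar>f (interpolate T k y)\<bar> \<le> C" for y by (rule bd[OF ls])
    show "f (interpolate T k y) = f (interpolate T k y')" if "\<And>i. i \<le> k \<Longrightarrow> y i = y' i" for y y'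
    proof -
      have "linear_path T k y = linear_path T k y'" unfolding linear_path_def using that by (intro ext) simp
      then show ?thesis by (simp add: interpolate_def)
    qed
  qed assumption+
  then obtain n0 where n0: "\<And>n. n \<ge> n0 \<Longrightarrow> dist (\<integral>\<omega>. f (?lY n \<omega>) \<partial>M n) (\<integral>\<omega>. f (?lX k \<omega>) \<partial>Q) < \<delta>"
    using \<delta> unfolding lim_sequentially by blast
  have "norm ((\<integral>\<omega>. f (path_of T (Z n) \<omega>) \<partial>M n) - (\<integral>\<omega>. f (path_of T X \<omega>) \<partial>Q)) < r" if n: "n \<ge> max n0 k" for n
  proof -
    have n1: "n \<ge> 1" "n \<ge> n0" "n \<ge> k" using n k(4) by auto
    obtain S :: "nat \<Rightarrow> nat \<Rightarrow> 'v \<Rightarrow> 'd heis" where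
      tail: "\<And>m. measure (walk_law n m :: 'd heis measure) {g. cc_dist 0 g > \<epsilon>} \<le>
        2144 * (real CARD('d))\<^sup>2 * (real m / real n)\<^sup>2 / \<epsilon> ^ 4"
      using n1(1) \<epsilon>(1) by (rule_tac horizontal_brownian_motion_walks[OF hbm]) blast
    have "\<bar>(\<integral>\<omega>. f (path_of T (Z n) \<omega>) \<partial>M n) - (\<integral>\<omega>. f (?lY n \<omega>) \<partial>M n)\<bar> \<le> 14 * K * \<epsilon> + 4 * C * (real k * (A / (real k)\<^sup>2))"
      unfolding h_def
    proof (rule linear_interpolation_error[OF chain[OF n1(1)] n1(1) interpolation[OF n1(1)] Z[OF n1(1)] T k(4) \<epsilon>(1)])
      \<comment> \<open>a block has at most \<open>n h + 1\<close> steps, and one step more for the arc across its end; \<open>n \<ge> k\<close> absorbs both\<close>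
      fix i j assume ij: "i < k" "j \<le> Suc (grid_time n (T / real k) (Suc i)) - grid_time n (T / real k) i"
      have "grid_time n h i \<le> grid_time n h (Suc i)" using h by (intro grid_time_mono) auto
      then have "real j \<le> real (grid_time n h (Suc i) - grid_time n h i) + 1"
        using ij(2) unfolding h_def by linarith
      then have "real j / real n \<le> real (grid_time n h (Suc i) - grid_time n h i) / real n + 1 / real n"
        using divide_right_mono[of "real j" "real (grid_time n h (Suc i) - grid_time n h i) + 1" "real n"]
        by (simp add: add_divide_distrib)
      also have "\<dots> \<le> h + 2 / real n" using grid_time_step[OF h n1(1), of i] by simp
      also have "\<dots> \<le> h + 2 / real k" using n1(3) k(4) by (intro add_left_mono divide_left_mono) auto
      finally have "real j / real n \<le> (T + 2) / real k" by (simp add: h_def add_divide_distrib)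
      then have "(real j / real n)\<^sup>2 \<le> ((T + 2) / real k)\<^sup>2" by (rule power_mono) simp
      then have "2144 * (real CARD('d))\<^sup>2 * (real j / real n)\<^sup>2 / \<epsilon> ^ 4 \<le> 2144 * (real CARD('d))\<^sup>2 * ((T + 2) / real k)\<^sup>2 / \<epsilon> ^ 4"
        by (intro divide_right_mono mult_left_mono) auto
      also have "\<dots> = A / (real k)\<^sup>2" by (simp add: A_def power_divide)
      finally show "measure (walk_law n j :: 'd heis measure) {g. cc_dist 0 g > \<epsilon>} \<le> A / (real k)\<^sup>2"
        using tail[of j] by linarith
    qed (use k(1) lip bd K f in \<open>auto simp: paths_def\<close>)
    also have "real k * (A / (real k)\<^sup>2) = A / real k" using k(4) by (simp add: power2_eq_square)
    finally have "\<bar>(\<integral>\<omega>. f (path_of T (Z n) \<omega>) \<partial>M n) - (\<integral>\<omega>. f (?lY n \<omega>) \<partial>M n)\<bar> < 2 * \<delta>"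
      using \<epsilon>(2) k(2) by linarith
    then show ?thesis using n0[OF n1(2)] k(3) unfolding dist_real_def real_norm_def \<delta>_def by linarith
  qed
  then show "\<exists>n0. \<forall>n\<ge>n0. norm ((\<integral>\<omega>. f (path_of T (Z n) \<omega>) \<partial>M n) - (\<integral>\<omega>. f (path_of T X \<omega>) \<partial>Q)) < r" by blast
qed

theorem theorem17:
  fixes T :: real and p0 :: "'d::finite heis"
    and M :: "nat \<Rightarrow> 'w measure"
    and Y :: "nat \<Rightarrow> nat \<Rightarrow> 'w \<Rightarrow> 'd heis"
    and Z :: "nat \<Rightarrow> real \<Rightarrow> 'w \<Rightarrow> 'd heis"
    and N :: "'v measure" and W :: "real \<Rightarrow> 'v \<Rightarrow> 'd heis"
    and Q :: "'u measure" and X :: "real \<Rightarrow> 'u \<Rightarrow> 'd heis"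
  assumes "T > 0"
    and chain: "\<And>n. n \<ge> 1 \<Longrightarrow> markov_chain (M n) (Y n) (heis_kernel n)"
    and chain_start: "\<And>n. n \<ge> 1 \<Longrightarrow> AE \<omega> in M n. Y n 0 \<omega> = p0"
    and interpolation: "\<And>n \<omega>. n \<ge> 1 \<Longrightarrow> \<omega> \<in> space (M n) \<Longrightarrow>
          geodesic_interpolation n (\<lambda>t. rescaled_chain n (Y n) t \<omega>) (\<lambda>t. Z n t \<omega>)"
    and Z_random_path: "\<And>n. n \<ge> 1 \<Longrightarrow> path_of T (Z n) \<in> measurable (M n) (path_borel T)"
    and horizontal_bm: "horizontal_brownian_motion N W"
    and feller: "feller_process Q X (heis_semigroup N W)"
    and X_start: "AE \<omega> in Q. X 0 \<omega> = p0"
    and X_continuous: "\<And>\<omega>. \<omega> \<in> space Q \<Longrightarrow> continuous_on {0..} (\<lambda>t. X t \<omega>)"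
  shows "weakly_convergent_to (mtopology_of (heis_paths T))
           (\<lambda>n. distr (M n) (path_borel T) (path_of T (Z n)))
           (distr Q (path_borel T) (path_of T X))"
proof (rule weakly_convergent_to_lipschitzI)
  have Q: "prob_space Q" and X: "\<And>t. 0 \<le> t \<Longrightarrow> X t \<in> borel_measurable Q"
    using feller by (auto simp: feller_process_def)
  have X_path: "path_of T X \<in> measurable Q (path_borel T)" using \<open>T > 0\<close> X X_continuous by (rule measurable_path_of)
  show "prob_space (distr (M n) (path_borel T) (path_of T (Z n)))" if "n \<ge> 1" for n
    using chain[OF that] Z_random_path[OF that] by (intro prob_space.prob_space_distr) (simp_all add: markov_chain_def)
  show "prob_space (distr Q (path_borel T) (path_of T X))" using Q X_path by (rule prob_space.prob_space_distr)
  fix f :: "(real \<Rightarrow> 'd heis) \<Rightarrow> real" and K C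
  assume lip: "\<And>x y. x \<in> mspace (heis_paths T) \<Longrightarrow> y \<in> mspace (heis_paths T) \<Longrightarrow> \<bar>f x - f y\<bar> \<le> K * mdist (heis_paths T) x y"
    "\<And>x. x \<in> mspace (heis_paths T) \<Longrightarrow> \<bar>f x\<bar> \<le> C" "0 \<le> K"
    and f': "f \<in> borel_measurable (borel_of_topology (mtopology_of (heis_paths T)))"
  have f: "f \<in> borel_measurable (path_borel T)" using f' by (simp add: path_borel_def)
  have "(\<lambda>n. \<integral>\<omega>. f (path_of T (Z n) \<omega>) \<partial>M n) \<longlonglongrightarrow> (\<integral>\<omega>. f (path_of T X \<omega>) \<partial>Q)"
    by (rule lipschitz_integrals_converge[OF \<open>T > 0\<close> chain chain_start interpolation Z_random_path
          horizontal_bm feller X_start X_continuous lip f])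
  moreover have "(\<integral>x. f x \<partial>distr Q (path_borel T) (path_of T X)) = (\<integral>\<omega>. f (path_of T X \<omega>) \<partial>Q)"
    using X_path f by (rule integral_distr)
  moreover have "(\<integral>x. f x \<partial>distr (M n) (path_borel T) (path_of T (Z n))) = (\<integral>\<omega>. f (path_of T (Z n) \<omega>) \<partial>M n)" if "n \<ge> 1" for n
    using Z_random_path[OF that] f by (rule integral_distr)
  ultimately show "(\<lambda>n. \<integral>x. f x \<partial>distr (M n) (path_borel T) (path_of T (Z n))) \<longlonglongrightarrow> (\<integral>x. f x \<partial>distr Q (path_borel T) (path_of T X))"
    by (auto elim!: Lim_transform_eventually simp: eventually_sequentially intro!: exI[of _ 1])
qed (simp_all add: path_borel_def)

end
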